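(* Let $A$ be an elliptic self-adjoint first order classical pseudodifferential operator acting on columns of $m$ complex-valued half-densities over a connected compact $n$-dimensional manifold $M$ without boundary, $m,n\ge2$, whose principal symbol has nonzero simple eigenvalues, at least one of them positive. Then the densities $$a(x)=\sum_{j=1}^{m^+}\int_{h^{(j)}(x,\xi)<1}(2\pi)^{-n}d\xi,$$ $$b(x)=-n\sum_{j=1}^{m^+}\int_{h^{(j)}(x,\xi)<1}\Bigl([v^{(j)}]^*A_{\mathrm{sub}}v^{(j)}-\frac i2\{[v^{(j)}]^*,A_1-h^{(j)},v^{(j)}\}+\frac i{n-1}h^{(j)}\{[v^{(j)}]^*,v^{(j)}\}\Bigr)(x,\xi)\,(2\pi)^{-n}d\xi$$ are unitarily invariant: for every smooth unitary matrix-function $R:M\to\mathrm U(m)$, the densities $a(x)$ and $b(x)$ computed for the operator $RAR^*$ coincide at every $x\in M$ with those computed for $A$.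
   Context: Setting. $A$ has infinitely smooth coefficients and is formally self-adjoint: $\int_M w^*Av\,dx=\int_M(Aw)^*v\,dx$ for smooth columns of half-densities ($^*$ is Hermitian conjugation). $T'M$ is the cotangent bundle with zero section removed. $A_1(x,\xi)$ is the principal symbol (Hermitian $m\times m$ matrix-function on $T'M$, positively homogeneous of degree 1 in $\xi$). Its eigenvalues are assumed nonzero and simple for all $(x,\xi)\in T'M$; they are denoted $h^{(j)}(x,\xi)$ and enumerated in increasing order, with $j=1,\dots,m^+$ for positive ones and $j=-1,\dots,-m^-$ for negative ones, $m^+>0$. $v^{(j)}(x,\xi)$ is a (locally smooth) normalised eigenvector of $A_1(x,\xi)$ for $h^{(j)}(x,\xi)$; it is defined up to a phase, and the formulae do not depend on that choice. The subprincipal symbol is $A_{\mathrm{sub}}:=A_0+\frac i2(A_1)_{x^\alpha\xi_\alpha}$, where $A_0$ is the degree 0 homogeneous component of the full symbol in local coordinates (subscripts denote partial derivatives, summation over repeated indices). Brackets: $\{P,R\}:=P_{x^\alpha}R_{\xi_\alpha}-P_{\xi_\alpha}R_{x^\alpha}$, $\{P,Q,R\}:=P_{x^\alpha}QR_{\xi_\alpha}-P_{\xi_\alpha}QR_{x^\alpha}$. $RAR^*$ is the composition of $A$ with the operators of multiplication by $R(x)$ and $R(x)^*$. *)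

theory Defs
  imports "HOL-Analysis.Analysis" "HOL-Computational_Algebra.Polynomial"
begin

section \<open>Smooth functions and partial derivatives\<close>

text \<open>Meant for open \<open>S\<close> in a finite-dimensional space, where it is the usual class \<open>C\<^sup>k(S)\<close>.\<close>

primrec Ck_on :: "nat \<Rightarrow> 'a set \<Rightarrow> ('a::real_normed_vector \<Rightarrow> 'b::real_normed_vector) \<Rightarrow> bool" where
  "Ck_on 0 S f \<longleftrightarrow> continuous_on S f"
| "Ck_on (Suc k) S f \<longleftrightarrow>
     (\<forall>x\<in>S. f differentiable (at x)) \<and> (\<forall>v. Ck_on k S (\<lambda>x. frechet_derivative f (at x) v))"

definition smooth_on :: "'a set \<Rightarrow> ('a::real_normed_vector \<Rightarrow> 'b::real_normed_vector) \<Rightarrow> bool" where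
  "smooth_on S f \<longleftrightarrow> (\<forall>k. Ck_on k S f)"

text \<open>Functions on (subsets of) the cotangent bundle of a coordinate domain are curried, \<open>f x \<xi>\<close>;
  \<open>dx \<alpha>\<close> and \<open>d\<xi> \<alpha>\<close> are the partial derivatives with respect to
  \<open>x\<^sup>\<alpha>\<close> and \<open>\<xi>\<^sub>\<alpha>\<close>.\<close>

definition dx :: "'n::finite \<Rightarrow> (real^'n \<Rightarrow> real^'n \<Rightarrow> 'b::real_normed_vector) \<Rightarrow> real^'n \<Rightarrow> real^'n \<Rightarrow> 'b" where
  "dx \<alpha> f x \<xi> = vector_derivative (\<lambda>t. f (x + t *\<^sub>R axis \<alpha> 1) \<xi>) (at 0)"

definition d\<xi> :: "'n::finite \<Rightarrow> (real^'n \<Rightarrow> real^'n \<Rightarrow> 'b::real_normed_vector) \<Rightarrow> real^'n \<Rightarrow> real^'n \<Rightarrow> 'b" where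
  "d\<xi> \<alpha> f x \<xi> = vector_derivative (\<lambda>t. f x (\<xi> + t *\<^sub>R axis \<alpha> 1)) (at 0)"

definition supp :: "('a::topological_space \<Rightarrow> 'b::zero) \<Rightarrow> 'a set" where
  "supp f = closure {x. f x \<noteq> 0}"

definition test_function :: "'a set \<Rightarrow> ('a::real_normed_vector \<Rightarrow> 'b::real_normed_vector) \<Rightarrow> bool" where
  "test_function S f \<longleftrightarrow> smooth_on UNIV f \<and> compact (supp f) \<and> supp f \<subseteq> S"


section \<open>Complex matrices\<close>

definition hconj :: "complex^'m^'m \<Rightarrow> complex^'m^'m" where
  "hconj B = (\<chi> i j. cnj (B $ j $ i))"

text \<open>The scalar \<open>v\<^sup>* w\<close>.\<close>

definition cdot :: "complex^'m \<Rightarrow> complex^'m \<Rightarrow> complex" where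
  "cdot v w = (\<Sum>i\<in>UNIV. cnj (v $ i) * w $ i)"

definition cscale :: "complex \<Rightarrow> complex^'m^'m \<Rightarrow> complex^'m^'m" where
  "cscale c B = (\<chi> i j. c * B $ i $ j)"

definition is_eigenvalue :: "complex^'m^'m \<Rightarrow> complex \<Rightarrow> bool" where
  "is_eigenvalue B h \<longleftrightarrow> (\<exists>v. v \<noteq> 0 \<and> B *v v = h *s v)"

definition charpoly :: "complex^'m^'m \<Rightarrow> complex poly" where
  "charpoly B = det (\<chi> i j. (if i = j then [:0, 1:] else 0) - [:B $ i $ j:])"

definition simple_spectrum :: "complex^'m^'m \<Rightarrow> bool" where
  "simple_spectrum B \<longleftrightarrow> (\<forall>h. is_eigenvalue B h \<longrightarrow> order h (charpoly B) = 1)"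

definition positive_eigenvalues :: "complex^'m^'m \<Rightarrow> real set" where
  "positive_eigenvalues B = {h. 0 < h \<and> is_eigenvalue B (of_real h)}"

text \<open>\<open>h\<^sup>(\<^sup>j\<^sup>)\<close> for \<open>j = 1, 2, \<dots>\<close>: the \<open>j\<close>-th positive eigenvalue in increasing order.\<close>

definition eigenvalue_no :: "nat \<Rightarrow> complex^'m^'m \<Rightarrow> real" where
  "eigenvalue_no j B = sorted_list_of_set (positive_eigenvalues B) ! (j - 1)"


section \<open>Smooth manifolds\<close>

text \<open>A chart is an open set of points together with its coordinate map; the values of the map outside
  this set are irrelevant. Chart domains need not be connected.\<close>

type_synonym ('p, 'n) chart = "'p set \<times> ('p \<Rightarrow> real^'n)"

definition coords :: "('p, 'n::finite) chart \<Rightarrow> (real^'n) set" where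
  "coords \<kappa> = snd \<kappa> ` fst \<kappa>"

definition point :: "('p, 'n::finite) chart \<Rightarrow> real^'n \<Rightarrow> 'p" where
  "point \<kappa> = inv_into (fst \<kappa>) (snd \<kappa>)"

definition is_chart :: "('p::topological_space, 'n::finite) chart \<Rightarrow> bool" where
  "is_chart \<kappa> \<longleftrightarrow> open (fst \<kappa>) \<and> open (coords \<kappa>) \<and>
     homeomorphism (fst \<kappa>) (coords \<kappa>) (snd \<kappa>) (point \<kappa>)"

text \<open>The coordinates of \<open>\<kappa>\<close> as functions of those of \<open>\<kappa>'\<close>.\<close>

definition transition :: "('p, 'n::finite) chart \<Rightarrow> ('p, 'n) chart \<Rightarrow> real^'n \<Rightarrow> real^'n" where
  "transition \<kappa> \<kappa>' = snd \<kappa> \<circ> point \<kappa>'"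

definition compatible :: "('p, 'n::finite) chart \<Rightarrow> ('p, 'n) chart \<Rightarrow> bool" where
  "compatible \<kappa> \<kappa>' \<longleftrightarrow>
     smooth_on (snd \<kappa>' ` (fst \<kappa> \<inter> fst \<kappa>')) (transition \<kappa> \<kappa>') \<and>
     smooth_on (snd \<kappa> ` (fst \<kappa> \<inter> fst \<kappa>')) (transition \<kappa>' \<kappa>)"

text \<open>A maximal smooth atlas on the whole type \<open>'p\<close>.\<close>

definition smooth_structure :: "('p::topological_space, 'n::finite) chart set \<Rightarrow> bool" where
  "smooth_structure atl \<longleftrightarrow>
     (\<Union>\<kappa>\<in>atl. fst \<kappa>) = UNIV \<and>
     (\<forall>\<kappa>. \<kappa> \<in> atl \<longleftrightarrow> is_chart \<kappa> \<and> (\<forall>\<kappa>'\<in>atl. compatible \<kappa> \<kappa>'))"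

definition smooth_on_manifold ::
    "('p, 'n::finite) chart set \<Rightarrow> ('p \<Rightarrow> 'b::real_normed_vector) \<Rightarrow> bool" where
  "smooth_on_manifold atl f \<longleftrightarrow> (\<forall>\<kappa>\<in>atl. smooth_on (coords \<kappa>) (f \<circ> point \<kappa>))"


section \<open>Half-densities and densities\<close>

text \<open>\<open>jac \<kappa> \<kappa>' p\<close> is \<open>|det (\<partial>x/\<partial>x')|\<close> at \<open>p\<close>,
  with \<open>x\<close>, \<open>x'\<close> the coordinates of \<open>\<kappa>\<close>, \<open>\<kappa>'\<close>.\<close>

definition jac :: "('p, 'n::finite) chart \<Rightarrow> ('p, 'n) chart \<Rightarrow> 'p \<Rightarrow> real" where
  "jac \<kappa> \<kappa>' p = \<bar>det (matrix (frechet_derivative (transition \<kappa> \<kappa>') (at (snd \<kappa>' p))))\<bar>"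

text \<open>\<open>u \<kappa> p\<close> is the value at the point \<open>p\<close> of the coordinate representation of \<open>u\<close> in the
  chart \<open>\<kappa>\<close>. It is set to zero where it has no meaning, so that equal half-densities are equal
  functions.\<close>

type_synonym ('p, 'n, 'm) column = "('p, 'n) chart \<Rightarrow> 'p \<Rightarrow> complex^'m"

definition half_density ::
    "('p, 'n::finite) chart set \<Rightarrow> ('p, 'n, 'm::finite) column \<Rightarrow> bool" where
  "half_density atl u \<longleftrightarrow>
     (\<forall>\<kappa>\<in>atl. \<forall>\<kappa>'\<in>atl. \<forall>p\<in>fst \<kappa> \<inter> fst \<kappa>'. u \<kappa>' p = sqrt (jac \<kappa> \<kappa>' p) *\<^sub>R u \<kappa> p) \<and>
     (\<forall>\<kappa> p. \<kappa> \<notin> atl \<or> p \<notin> fst \<kappa> \<longrightarrow> u \<kappa> p = 0)"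

definition smooth_half_density ::
    "('p, 'n::finite) chart set \<Rightarrow> ('p, 'n, 'm::finite) column \<Rightarrow> bool" where
  "smooth_half_density atl u \<longleftrightarrow>
     half_density atl u \<and> (\<forall>\<kappa>\<in>atl. smooth_on (coords \<kappa>) (u \<kappa> \<circ> point \<kappa>))"

text \<open>The half-density, supported in the domain of \<open>\<kappa>\<close>, whose representation in \<open>\<kappa>\<close> is \<open>f\<close>.\<close>

definition from_chart ::
    "('p, 'n::finite) chart set \<Rightarrow> ('p, 'n) chart \<Rightarrow> (real^'n \<Rightarrow> complex^'m) \<Rightarrow> ('p, 'n, 'm::finite) column" where
  "from_chart atl \<kappa> f = (\<lambda>\<kappa>' p. if \<kappa>' \<in> atl \<and> p \<in> fst \<kappa> \<inter> fst \<kappa>'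
     then sqrt (jac \<kappa> \<kappa>' p) *\<^sub>R f (snd \<kappa> p) else 0)"

text \<open>Integral over the compact manifold of a density given by its coordinate representations.
  A finite cover \<open>cs\<close> by chart domains is cut into disjoint pieces; the result does not depend on the cover.\<close>

definition integral_density ::
    "('p::topological_space, 'n::finite) chart set \<Rightarrow> (('p, 'n) chart \<Rightarrow> 'p \<Rightarrow> complex) \<Rightarrow> complex" where
  "integral_density atl f =
     (let cs = (SOME cs. set cs \<subseteq> atl \<and> (\<Union>\<kappa>\<in>set cs. fst \<kappa>) = UNIV) in
      \<Sum>i<length cs. LINT x : snd (cs ! i) ` (fst (cs ! i) - (\<Union>j<i. fst (cs ! j))) | lborel.
         f (cs ! i) (point (cs ! i) x))"

definition formally_self_adjoint ::
    "('p::topological_space, 'n::finite) chart set \<Rightarrow>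
     (('p, 'n, 'm::finite) column \<Rightarrow> ('p, 'n, 'm) column) \<Rightarrow> bool" where
  "formally_self_adjoint atl A \<longleftrightarrow>
     (\<forall>v w. smooth_half_density atl v \<and> smooth_half_density atl w \<longrightarrow>
        integral_density atl (\<lambda>\<kappa> p. cdot (w \<kappa> p) (A v \<kappa> p)) =
        integral_density atl (\<lambda>\<kappa> p. cdot (A w \<kappa> p) (v \<kappa> p)))"


section \<open>Classical pseudodifferential operators of order one\<close>

type_synonym ('n, 'm) symb = "real^'n \<Rightarrow> real^'n \<Rightarrow> complex^'m^'m"

definition symbol_bound :: "real \<Rightarrow> (real^'n) set \<Rightarrow> ('n::finite, 'm::finite) symb \<Rightarrow> bool" where
  "symbol_bound d S a \<longleftrightarrow>
     (\<forall>\<alpha> \<beta>. \<exists>C. \<forall>x. \<forall>\<xi>\<in>S.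
        norm (foldr dx \<beta> (foldr d\<xi> \<alpha> a) x \<xi>) \<le> C * (1 + norm \<xi>) powr (d - real (length \<alpha>)))"

text \<open>The class \<open>S\<^sup>d\<close> on \<open>\<real>\<^sup>n \<times> \<real>\<^sup>n\<close>, with bounds uniform in \<open>x\<close>.\<close>

definition symbol_class :: "real \<Rightarrow> ('n::finite, 'm::finite) symb set" where
  "symbol_class d = {a. smooth_on UNIV (\<lambda>(x, \<xi>). a x \<xi>) \<and> symbol_bound d UNIV a}"

definition fourier :: "(real^'n \<Rightarrow> complex^'m) \<Rightarrow> real^'n \<Rightarrow> complex^'m" where
  "fourier u \<xi> = (LINT y|lborel. cis (- (y \<bullet> \<xi>)) *s u y)"

definition Op :: "('n::finite, 'm::finite) symb \<Rightarrow> (real^'n \<Rightarrow> complex^'m) \<Rightarrow> real^'n \<Rightarrow> complex^'m" where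
  "Op a u x = (1 / (2 * pi) ^ CARD('n)) *\<^sub>R
     (LINT \<xi>|lborel. cis (x \<bullet> \<xi>) *s (a x \<xi> *v fourier u \<xi>))"

text \<open>The operator \<open>\<phi> A \<psi>\<close> in the coordinates of \<open>\<kappa>\<close>, for cut-offs supported in \<open>coords \<kappa>\<close>.\<close>

definition localised ::
    "('p, 'n::finite) chart set \<Rightarrow> (('p, 'n, 'm::finite) column \<Rightarrow> ('p, 'n, 'm) column) \<Rightarrow> ('p, 'n) chart \<Rightarrow>
     (real^'n \<Rightarrow> complex) \<Rightarrow> (real^'n \<Rightarrow> complex) \<Rightarrow> (real^'n \<Rightarrow> complex^'m) \<Rightarrow> real^'n \<Rightarrow> complex^'m" where
  "localised atl A \<kappa> \<phi> \<psi> u x =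
     (if x \<in> coords \<kappa> then \<phi> x *s A (from_chart atl \<kappa> (\<lambda>y. \<psi> y *s u y)) \<kappa> (point \<kappa> x) else 0)"

text \<open>\<open>\<Sum>\<^sub>k p k\<close>, with \<open>p k\<close> positively homogeneous of degree \<open>1 - k\<close>, is the full symbol of \<open>A\<close> in
  the coordinates of \<open>\<kappa>\<close>. All cut-off operators \<open>\<phi> A \<psi>\<close> are pseudodifferential operators on
  \<open>\<real>\<^sup>n\<close> with symbols in \<open>S\<^sup>1\<close> (as chart domains may be disconnected, this includes the condition away
  from the diagonal), and the symbol is asymptotic to \<open>\<Sum>\<^sub>k \<phi> (p k)\<close> when \<open>\<psi> = 1\<close> near the support of
  \<open>\<phi>\<close>. The remainders are estimated for \<open>|\<xi>| \<ge> 1\<close>, in place of cutting the \<open>p k\<close> off near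
  \<open>\<xi> = 0\<close>.\<close>

definition has_full_symbol ::
    "('p, 'n::finite) chart set \<Rightarrow> (('p, 'n, 'm::finite) column \<Rightarrow> ('p, 'n, 'm) column) \<Rightarrow>
     ('p, 'n) chart \<Rightarrow> (nat \<Rightarrow> ('n, 'm) symb) \<Rightarrow> bool" where
  "has_full_symbol atl A \<kappa> p \<longleftrightarrow>
     (\<forall>k. smooth_on (coords \<kappa> \<times> (- {0})) (\<lambda>(x, \<xi>). p k x \<xi>)) \<and>
     (\<forall>k. \<forall>x\<in>coords \<kappa>. \<forall>\<xi>. \<forall>t>0. \<xi> \<noteq> 0 \<longrightarrow> p k x (t *\<^sub>R \<xi>) = (t powi (1 - int k)) *\<^sub>R p k x \<xi>) \<and>
     (\<forall>\<phi> \<psi>. test_function (coords \<kappa>) \<phi> \<and> test_function (coords \<kappa>) \<psi> \<longrightarrow>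
        (\<exists>a\<in>symbol_class 1.
           (\<forall>u. test_function UNIV u \<longrightarrow> localised atl A \<kappa> \<phi> \<psi> u = Op a u) \<and>
           (supp \<phi> \<subseteq> interior {x. \<psi> x = 1} \<longrightarrow>
              (\<forall>N. symbol_bound (1 - real N) {\<xi>. 1 \<le> norm \<xi>}
                     (\<lambda>x \<xi>. a x \<xi> - (\<Sum>k<N. cscale (\<phi> x) (p k x \<xi>)))))))"

definition classical_psido ::
    "('p, 'n::finite) chart set \<Rightarrow> (('p, 'n, 'm::finite) column \<Rightarrow> ('p, 'n, 'm) column) \<Rightarrow> bool" where
  "classical_psido atl A \<longleftrightarrow>
     (\<forall>u. smooth_half_density atl u \<longrightarrow> smooth_half_density atl (A u)) \<and>
     (\<forall>u w. smooth_half_density atl u \<and> smooth_half_density atl w \<longrightarrow>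
        A (\<lambda>\<kappa> p. u \<kappa> p + w \<kappa> p) = (\<lambda>\<kappa> p. A u \<kappa> p + A w \<kappa> p)) \<and>
     (\<forall>c u. smooth_half_density atl u \<longrightarrow> A (\<lambda>\<kappa> p. c *s u \<kappa> p) = (\<lambda>\<kappa> p. c *s A u \<kappa> p)) \<and>
     (\<forall>\<kappa>\<in>atl. \<exists>p. has_full_symbol atl A \<kappa> p)"

text \<open>The components are uniquely determined on \<open>coords \<kappa> \<times> (- {0})\<close>, and only their values there are used.\<close>

definition symbol_component ::
    "('p, 'n::finite) chart set \<Rightarrow> (('p, 'n, 'm::finite) column \<Rightarrow> ('p, 'n, 'm) column) \<Rightarrow>
     ('p, 'n) chart \<Rightarrow> nat \<Rightarrow> ('n, 'm) symb" where
  "symbol_component atl A \<kappa> = (SOME p. has_full_symbol atl A \<kappa> p)"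

definition principal_symbol ::
    "('p, 'n::finite) chart set \<Rightarrow> (('p, 'n, 'm::finite) column \<Rightarrow> ('p, 'n, 'm) column) \<Rightarrow>
     ('p, 'n) chart \<Rightarrow> ('n, 'm) symb" where
  "principal_symbol atl A \<kappa> = symbol_component atl A \<kappa> 0"

definition subprincipal_symbol ::
    "('p, 'n::finite) chart set \<Rightarrow> (('p, 'n, 'm::finite) column \<Rightarrow> ('p, 'n, 'm) column) \<Rightarrow>
     ('p, 'n) chart \<Rightarrow> ('n, 'm) symb" where
  "subprincipal_symbol atl A \<kappa> x \<xi> =
     symbol_component atl A \<kappa> 1 x \<xi> +
     cscale (\<i> / 2) (\<Sum>\<alpha>\<in>UNIV. d\<xi> \<alpha> (dx \<alpha> (principal_symbol atl A \<kappa>)) x \<xi>)"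

definition elliptic ::
    "('p, 'n::finite) chart set \<Rightarrow> (('p, 'n, 'm::finite) column \<Rightarrow> ('p, 'n, 'm) column) \<Rightarrow> bool" where
  "elliptic atl A \<longleftrightarrow>
     (\<forall>\<kappa>\<in>atl. \<forall>x\<in>coords \<kappa>. \<forall>\<xi>. \<xi> \<noteq> 0 \<longrightarrow> invertible (principal_symbol atl A \<kappa> x \<xi>))"


section \<open>The densities\<close>

text \<open>The number \<open>m\<^sup>+\<close> does not depend on the point of the (connected) manifold; it is read off at the
  point with coordinates \<open>x\<close>, from the fibre without zero, which is connected since \<open>n \<ge> 2\<close>.\<close>

definition m_plus :: "('n::finite, 'm::finite) symb \<Rightarrow> real^'n \<Rightarrow> nat" where
  "m_plus A1 x = (THE k. \<forall>\<xi>. \<xi> \<noteq> 0 \<longrightarrow> card (positive_eigenvalues (A1 x \<xi>)) = k)"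

definition local_eigenvector ::
    "('n::finite, 'm::finite) symb \<Rightarrow> nat \<Rightarrow> ((real^'n) \<times> (real^'n)) set \<Rightarrow> (real^'n \<Rightarrow> real^'n \<Rightarrow> complex^'m) \<Rightarrow> bool" where
  "local_eigenvector A1 j W v \<longleftrightarrow>
     smooth_on W (\<lambda>(x, \<xi>). v x \<xi>) \<and>
     (\<forall>(x, \<xi>)\<in>W. norm (v x \<xi>) = 1 \<and> A1 x \<xi> *v v x \<xi> = of_real (eigenvalue_no j (A1 x \<xi>)) *s v x \<xi>)"

text \<open>Normalised eigenvectors can be chosen smoothly only locally in general, so the choice depends on the
  base point \<open>(x, \<xi>)\<close> near which the eigenvector field is smooth.\<close>

definition eigenvector_near ::
    "('n::finite, 'm::finite) symb \<Rightarrow> nat \<Rightarrow> real^'n \<Rightarrow> real^'n \<Rightarrow> (real^'n \<Rightarrow> real^'n \<Rightarrow> complex^'m)" where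
  "eigenvector_near A1 j x \<xi> =
     (SOME v. \<exists>W. open W \<and> (x, \<xi>) \<in> W \<and> local_eigenvector A1 j W v)"

text \<open>The brackets \<open>{v\<^sup>*, Q, w}\<close> and \<open>{v\<^sup>*, w}\<close>; differentiation commutes with \<open>\<^sup>*\<close>.\<close>

definition bracket3 ::
    "(real^'n \<Rightarrow> real^'n \<Rightarrow> complex^'m) \<Rightarrow> ('n::finite, 'm::finite) symb \<Rightarrow>
     (real^'n \<Rightarrow> real^'n \<Rightarrow> complex^'m) \<Rightarrow> real^'n \<Rightarrow> real^'n \<Rightarrow> complex" where
  "bracket3 v Q w x \<xi> =
     (\<Sum>\<alpha>\<in>UNIV. cdot (dx \<alpha> v x \<xi>) (Q x \<xi> *v d\<xi> \<alpha> w x \<xi>) - cdot (d\<xi> \<alpha> v x \<xi>) (Q x \<xi> *v dx \<alpha> w x \<xi>))"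

definition bracket2 ::
    "(real^'n \<Rightarrow> real^'n \<Rightarrow> complex^'m) \<Rightarrow> (real^'n \<Rightarrow> real^'n \<Rightarrow> complex^'m) \<Rightarrow>
     real^'n \<Rightarrow> real^'n \<Rightarrow> complex" where
  "bracket2 v w x \<xi> =
     (\<Sum>\<alpha>\<in>UNIV. cdot (dx \<alpha> v x \<xi>) (d\<xi> \<alpha> w x \<xi>) - cdot (d\<xi> \<alpha> v x \<xi>) (dx \<alpha> w x \<xi>))"

definition density_a ::
    "('p, 'n::finite) chart set \<Rightarrow> (('p, 'n, 'm::finite) column \<Rightarrow> ('p, 'n, 'm) column) \<Rightarrow>
     ('p, 'n) chart \<Rightarrow> 'p \<Rightarrow> real" where
  "density_a atl A \<kappa> p =
     (let A1 = principal_symbol atl A \<kappa>; x = snd \<kappa> p in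
      \<Sum>j=1..m_plus A1 x.
        LINT \<xi> : {\<xi>. \<xi> \<noteq> 0 \<and> eigenvalue_no j (A1 x \<xi>) < 1} | lborel. 1 / (2 * pi) ^ CARD('n))"

definition b_integrand :: "('n::finite, 'm::finite) symb \<Rightarrow> ('n, 'm) symb \<Rightarrow> nat \<Rightarrow> real^'n \<Rightarrow> real^'n \<Rightarrow> complex" where
  "b_integrand A1 Asub j x \<xi> =
     (let v = eigenvector_near A1 j x \<xi>; h = (\<lambda>x \<xi>. complex_of_real (eigenvalue_no j (A1 x \<xi>))) in
        cdot (v x \<xi>) (Asub x \<xi> *v v x \<xi>)
        - \<i> / 2 * bracket3 v (\<lambda>x \<xi>. A1 x \<xi> - mat (h x \<xi>)) v x \<xi>
        + \<i> / of_nat (CARD('n) - 1) * h x \<xi> * bracket2 v v x \<xi>)"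

definition density_b ::
    "('p, 'n::finite) chart set \<Rightarrow> (('p, 'n, 'm::finite) column \<Rightarrow> ('p, 'n, 'm) column) \<Rightarrow>
     ('p, 'n) chart \<Rightarrow> 'p \<Rightarrow> complex" where
  "density_b atl A \<kappa> p =
     (let A1 = principal_symbol atl A \<kappa>; Asub = subprincipal_symbol atl A \<kappa>; x = snd \<kappa> p in
      - of_nat CARD('n) * (\<Sum>j=1..m_plus A1 x.
        LINT \<xi> : {\<xi>. \<xi> \<noteq> 0 \<and> eigenvalue_no j (A1 x \<xi>) < 1} | lborel.
          b_integrand A1 Asub j x \<xi> / of_real ((2 * pi) ^ CARD('n))))"

definition conjugated ::
    "('p \<Rightarrow> complex^'m^'m) \<Rightarrow> (('p, 'n::finite, 'm::finite) column \<Rightarrow> ('p, 'n, 'm) column) \<Rightarrow>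
     ('p, 'n, 'm) column \<Rightarrow> ('p, 'n, 'm) column" where
  "conjugated R A u = (\<lambda>\<kappa> p. R p *v A (\<lambda>\<kappa>' q. hconj (R q) *v u \<kappa>' q) \<kappa> p)"

end

(* The principal symbol of RAR* is R A_1 R*, so its eigenvalues, and with them a(x), do not change.
   In the integrand of b, conjugation produces, besides terms that cancel between A_sub and the generalised
   Poisson bracket, only i (h_xi f - h f_xi / (n - 1)), summed over the components of xi, where
   f = v* (R* R_x) v is homogeneous of degree 0 in xi. The divergence theorem shows that the integral of this
   over {h < 1} vanishes. To speak of symbols at all one needs that the full symbol of an operator is unique
   and how it changes under multiplication on the right, which is the composition formula for a
   multiplication operator. That A_1 is Hermitian follows by testing self-adjointness on wave packets.
   Eigenvectors are chosen arbitrarily on both sides, so independence of their phase is part of the claim. *)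
theory Submission
 imports Defs "HOL-Probability.Probability" "HOL-Computational_Algebra.Fundamental_Theorem_Algebra"
begin

subsection \<open>Calculus of \<open>C\<^sup>k\<close> functions\<close>

text \<open>Several notions are fixed by \<open>SOME\<close> or \<open>THE\<close>: the full symbol,
  the eigenvector at each covector, \<open>m_plus\<close>, the cover behind
  \<open>integral_density\<close>. Nothing can be said about such an object before existence, and
  often independence of the choice, is proved. So smooth eigenvectors have to be constructed near
  every covector, and the wave packets have to be placed inside a single piece of a cover about
  which nothing is known.

  The function f of the overview is a quadratic form in v and hence blind to the phase: it is smooth
  on the whole punctured fibre, although v exists only locally. This is what admits an integration
  by parts over the fibre. The weight 1/(n-1) in b is dictated by it: for h of degree 1 and f of
  degree 0 the integral of h f_xi over {h < 1} is n-1 times that of h_xi f. Since f has in general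
  no limit at 0 and the indicator of {h < 1} jumps, the field is first multiplied by a function of h
  that vanishes to second order at 0 and at 1.

  The integrand of b is never shown to be integrable; only the difference of the two integrands is
  controlled.\<close>

lemma frechet_derivative_eqI: "(f has_derivative D) (at x) ==> frechet_derivative f (at x) = D"
 by (rule frechet_derivative_at[symmetric])

lemma Ck_on_SucD: "Ck_on (Suc k) S f ==> Ck_on k S f"
proof (induction k arbitrary: f)
 case 0
 then show ?case
  by (auto intro!: continuous_at_imp_continuous_on differentiable_imp_continuous_within)
next
 case (Suc k)
 then show ?case by (metis Ck_on.simps(2))
qed

lemma Ck_on_continuous: "Ck_on k S f ==> continuous_on S f"
 by (induction k) (auto dest: Ck_on_SucD simp del: Ck_on.simps(2))

lemma Ck_on_subset: "Ck_on k S f ==> T \<subseteq> S ==> Ck_on k T f"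
 by (induction k arbitrary: f) (auto intro: continuous_on_subset)

lemma Ck_on_cong:
 assumes "open S" "!!x. x \<in> S ==> f x = g x" "Ck_on k S f"
 shows "Ck_on k S g"
 using assms(2,3)
proof (induction k arbitrary: f g)
 case 0
 then show ?case using continuous_on_cong[of S S f g] by simp
next
 case (Suc k)
 have d: "(g has_derivative frechet_derivative f (at x)) (at x)" if "x \<in> S" for x
  using has_derivative_transform_within_open[OF _ assms(1) that, of f _ UNIV g] Suc.prems that
  by (auto simp: frechet_derivative_works)
 then have e: "frechet_derivative g (at x) = frechet_derivative f (at x)" if "x \<in> S" for x
  using that frechet_derivative_eqI by blast
 have "Ck_on k S (%x. frechet_derivative g (at x) v)" for v
  by (rule Suc.IH[of "%x. frechet_derivative f (at x) v"]) (use Suc.prems e in auto)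
 then show ?case using d by (auto simp: differentiable_def)
qed

lemma Ck_on_SucI:
 assumes "open S" "!!x. x \<in> S ==> (f has_derivative f' x) (at x)"
  "!!v. Ck_on k S (%x. f' x v)"
 shows "Ck_on (Suc k) S f"
proof -
 have "Ck_on k S (%x. frechet_derivative f (at x) v)" for v
  by (rule Ck_on_cong[OF assms(1) _ assms(3)[of v]]) (simp add: frechet_derivative_eqI[OF assms(2)])
 then show ?thesis using assms(2) by (auto simp: differentiable_def)
qed

lemma Ck_on_Suc_has_derivative:
 "Ck_on (Suc k) S f ==> x \<in> S ==> (f has_derivative frechet_derivative f (at x)) (at x)"
 by (auto simp: frechet_derivative_works)

lemma Ck_on_local:
 assumes "!!x. x \<in> S ==> \<exists>T. open T \<and> x \<in> T \<and> Ck_on k T f"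
 shows "Ck_on k S f"
 using assms
proof (induction k arbitrary: f)
 case 0
 have "continuous (at x) f" if "x \<in> S" for x
  using 0[OF that] by (auto simp: continuous_on_eq_continuous_at)
 then show ?case by (simp add: continuous_at_imp_continuous_on)
next
 case (Suc k)
 have "f differentiable (at x)" if "x \<in> S" for x
  using Suc.prems[OF that] by auto
 moreover have "Ck_on k S (%x. frechet_derivative f (at x) v)" for v
  by (rule Suc.IH) (use Suc.prems in fastforce)
 ultimately show ?case by simp
qed

lemma Ck_on_const: "open S ==> Ck_on k S (%x. c)"
proof (induction k arbitrary: c)
 case (Suc k)
 show ?case by (rule Ck_on_SucI[where f' = "%x v. 0"]) (use Suc in \<open>auto intro!: derivative_eq_intros\<close>)
qed simp

lemma Ck_on_bounded_linear:
 assumes "open S" "bounded_linear L" "Ck_on k S f"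
 shows "Ck_on k S (%x. L (f x))"
 using assms(3)
proof (induction k arbitrary: f)
 case 0
 then show ?case by (simp add: bounded_linear.continuous_on[OF assms(2)])
next
 case (Suc k)
 show ?case
  by (rule Ck_on_SucI[where f' = "%x v. L (frechet_derivative f (at x) v)"])
   (use Suc assms Ck_on_Suc_has_derivative[OF Suc.prems] in
    \<open>auto intro: bounded_linear.has_derivative\<close>)
qed

lemma Ck_on_id: "open S ==> Ck_on k S (%x. x)"
proof (cases k)
 case (Suc k)
 assume "open S"
 then show ?thesis unfolding Suc
  by (intro Ck_on_SucI[where f' = "%x v. v"]) (auto simp: Ck_on_const has_derivative_ident)
qed auto

lemma Ck_on_add:
 assumes "open S" "Ck_on k S f" "Ck_on k S g"
 shows "Ck_on k S (%x. f x + g x)"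
 using assms(2,3)
proof (induction k arbitrary: f g)
 case (Suc k)
 show ?case
  by (rule Ck_on_SucI[where f' = "%x v. frechet_derivative f (at x) v + frechet_derivative g (at x) v"])
   (use assms in \<open>auto intro!: has_derivative_add Ck_on_Suc_has_derivative[OF Suc.prems(1)] Ck_on_Suc_has_derivative[OF Suc.prems(2)]
     Suc.IH conjunct2[OF iffD1[OF Ck_on.simps(2) Suc.prems(1)], rule_format] conjunct2[OF iffD1[OF Ck_on.simps(2) Suc.prems(2)], rule_format]\<close>)
qed (simp add: continuous_on_add)

lemma Ck_on_bilinear:
 assumes "open S" "bounded_bilinear pr" "Ck_on k S f" "Ck_on k S g"
 shows "Ck_on k S (%x. pr (f x) (g x))"
 using assms(3,4)
proof (induction k arbitrary: f g)
 case 0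
 then show ?case by (simp add: bounded_bilinear.continuous_on[OF assms(2)])
next
 case (Suc k)
 show ?case
 proof (rule Ck_on_SucI[where f' = "%x v. pr (f x) (frechet_derivative g (at x) v) + pr (frechet_derivative f (at x) v) (g x)"])
  fix v
  show "Ck_on k S (%x. pr (f x) (frechet_derivative g (at x) v) + pr (frechet_derivative f (at x) v) (g x))"
   by (intro Ck_on_add Suc.IH assms(1) Ck_on_SucD[OF Suc.prems(1)] Ck_on_SucD[OF Suc.prems(2)]) (use Suc.prems in auto)
 next
  fix x assume "x \<in> S"
  then show "((%x. pr (f x) (g x)) has_derivative
    (%v. pr (f x) (frechet_derivative g (at x) v) + pr (frechet_derivative f (at x) v) (g x))) (at x)"
   by (intro bounded_bilinear.FDERIV[OF assms(2)] Ck_on_Suc_has_derivative[OF Suc.prems(1)] Ck_on_Suc_has_derivative[OF Suc.prems(2)])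
 qed (rule assms(1))
qed

lemma Ck_on_sum:
 assumes "open S" "!!i. i \<in> I ==> Ck_on k S (f i)"
 shows "Ck_on k S (%x. \<Sum>i\<in>I. f i x)"
 using assms(2) by (induction I rule: infinite_finite_induct) (auto intro: Ck_on_add Ck_on_const assms(1))

text \<open>The chain rule evaluates the derivative of \<open>g\<close> in the direction
  \<open>frechet_derivative f (at x) v\<close>, which moves with \<open>x\<close>, while
  \<open>Ck_on\<close> only speaks of fixed directions. Expanding this direction in
  \<open>Basis\<close> leaves finitely many products of a coordinate of the derivative of
  \<open>f\<close> with a derivative of \<open>g\<close> in a fixed direction, and the induction
  hypothesis applies to these. This is where the Euclidean codomain of \<open>f\<close>
  enters.\<close>

lemma Ck_on_compose:
 fixes f :: "'a::real_normed_vector => 'b::euclidean_space"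
 assumes "open S" "open T" "!!x. x \<in> S ==> f x \<in> T" "Ck_on k S f" "Ck_on k T g"
 shows "Ck_on k S (%x. g (f x))"
 using assms(4,5)
proof (induction k arbitrary: g)
 case 0
 then show ?case using assms(3) by (auto intro: continuous_on_compose2)
next
 case (Suc k)
 let ?D = "%x v. \<Sum>b\<in>Basis. (frechet_derivative f (at x) v \<bullet> b) *\<^sub>R frechet_derivative g (at (f x)) b"
 show ?case
 proof (rule Ck_on_SucI[where f' = ?D, OF assms(1)])
  fix x assume x: "x \<in> S"
  let ?f = "frechet_derivative f (at x)" and ?g = "frechet_derivative g (at (f x))"
  have g: "(g has_derivative ?g) (at (f x))"
   using Ck_on_Suc_has_derivative[OF Suc.prems(2)] assms(3) x by blast
  have "?g (?f v) = ?D x v" for v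
  proof -
   have "?g (?f v) = ?g (\<Sum>b\<in>Basis. (?f v \<bullet> b) *\<^sub>R b)" by (simp add: euclidean_representation)
   also have "... = ?D x v"
    using has_derivative_linear[OF g] by (simp add: linear_sum linear_scale)
   finally show ?thesis .
  qed
  with diff_chain_at[OF Ck_on_Suc_has_derivative[OF Suc.prems(1) x] g]
  show "((%x. g (f x)) has_derivative ?D x) (at x)"
   by (simp add: o_def)
 next
  fix v
  show "Ck_on k S (%x. ?D x v)"
   by (intro Ck_on_sum Ck_on_bilinear[OF _ bounded_bilinear_scaleR] assms(1) Suc.IH
     Ck_on_bounded_linear[OF _ bounded_linear_inner_left] Ck_on_SucD[OF Suc.prems(1)])
    (use Suc.prems in auto)
 qed
qed

lemma smooth_on_Ck: "smooth_on S f ==> Ck_on k S f"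
 by (simp add: smooth_on_def)

lemma smooth_on_has_derivative:
 "smooth_on S f ==> x \<in> S ==> (f has_derivative frechet_derivative f (at x)) (at x)"
 using Ck_on_Suc_has_derivative smooth_on_def by blast

lemma smooth_on_differentiable: "smooth_on S f ==> x \<in> S ==> f differentiable (at x)"
 using smooth_on_has_derivative differentiable_def by blast

lemma smooth_on_derivative: "smooth_on S f ==> smooth_on S (%x. frechet_derivative f (at x) v)"
 unfolding smooth_on_def by (metis Ck_on.simps(2))

lemma smooth_on_continuous: "smooth_on S f ==> continuous_on S f"
 using Ck_on_continuous smooth_on_def by blast

lemma smooth_on_subset: "smooth_on S f ==> T \<subseteq> S ==> smooth_on T f"
 by (auto simp: smooth_on_def intro: Ck_on_subset)

lemma smooth_on_cong: "open S ==> smooth_on S f ==> (!!x. x \<in> S ==> f x = g x) ==> smooth_on S g"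
 unfolding smooth_on_def using Ck_on_cong by blast

lemma smooth_on_local: "(!!x. x \<in> S ==> \<exists>T. open T \<and> x \<in> T \<and> smooth_on T f) ==> smooth_on S f"
 unfolding smooth_on_def by (intro allI Ck_on_local) blast

lemma smooth_on_const: "open S ==> smooth_on S (%x. c)"
 and smooth_on_id: "open S ==> smooth_on S (%x. x)"
 by (auto simp: smooth_on_def intro: Ck_on_const Ck_on_id)

lemma smooth_on_add: "open S ==> smooth_on S f ==> smooth_on S g ==> smooth_on S (%x. f x + g x)"
 by (auto simp: smooth_on_def intro: Ck_on_add)

lemma smooth_on_sum:
 "open S ==> (!!i. i \<in> I ==> smooth_on S (f i)) ==> smooth_on S (%x. \<Sum>i\<in>I. f i x)"
 by (auto simp: smooth_on_def intro: Ck_on_sum)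

lemma smooth_on_bounded_linear:
 "bounded_linear L ==> open S ==> smooth_on S f ==> smooth_on S (%x. L (f x))"
 by (auto simp: smooth_on_def intro: Ck_on_bounded_linear)

lemma smooth_on_bilinear:
 "bounded_bilinear pr ==> open S ==> smooth_on S f ==> smooth_on S g ==> smooth_on S (%x. pr (f x) (g x))"
 by (auto simp: smooth_on_def intro: Ck_on_bilinear)

lemma smooth_on_compose:
 fixes f :: "'a::real_normed_vector => 'b::euclidean_space"
 shows "open S ==> open T ==> smooth_on S f ==> smooth_on T g ==> (!!x. x \<in> S ==> f x \<in> T) ==>
  smooth_on S (%x. g (f x))"
 unfolding smooth_on_def by (rule allI, rule Ck_on_compose[where T = T]) auto

lemmas smooth_on_scaleR = smooth_on_bilinear[OF bounded_bilinear_scaleR]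
 and smooth_on_inner = smooth_on_bilinear[OF bounded_bilinear_inner]

lemma smooth_on_mult:
 fixes f :: "'a::real_normed_vector => 'b::real_normed_algebra"
 shows "open S ==> smooth_on S f ==> smooth_on S g ==> smooth_on S (%x. f x * g x)"
 by (rule smooth_on_bilinear[OF bounded_bilinear_mult])

lemma smooth_on_minus: "open S ==> smooth_on S f ==> smooth_on S (%x. - f x)"
 by (rule smooth_on_bounded_linear[OF bounded_linear_minus[OF bounded_linear_ident]])

lemma smooth_on_diff: "open S ==> smooth_on S f ==> smooth_on S g ==> smooth_on S (%x. f x - g x)"
 using smooth_on_add[OF _ _ smooth_on_minus, of S f g] by simp

lemma smooth_on_prod:
 fixes f :: "'i => 'a::real_normed_vector => 'b::{real_normed_algebra,comm_ring_1}"
 assumes "open S" "!!i. i \<in> I ==> smooth_on S (f i)"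
 shows "smooth_on S (%x. \<Prod>i\<in>I. f i x)"
 using assms(2) by (induction I rule: infinite_finite_induct) (auto intro: smooth_on_mult smooth_on_const assms(1))

lemma smooth_on_Pair:
 assumes "open S" "smooth_on S f" "smooth_on S g"
 shows "smooth_on S (%x. (f x, g x))"
proof -
 have 1: "bounded_linear (%a. (a, 0))" and 2: "bounded_linear (%a. (0, a))"
  by (auto intro!: bounded_linear_Pair bounded_linear_ident bounded_linear_zero)
 show ?thesis
  using smooth_on_add[OF assms(1) smooth_on_bounded_linear[OF 1 assms(1,2)] smooth_on_bounded_linear[OF 2 assms(1,3)]]
  by simp
qed

lemma bounded_linear_axis: "bounded_linear (axis i :: 'a::real_normed_vector => 'a^'n::finite)"
proof (rule bounded_linear_intro[where K = 1])
 fix x y :: 'a and r :: real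
 show "axis i (x + y) = axis i x + axis i y" "axis i (r *\<^sub>R x) = r *\<^sub>R axis i x"
  by (auto simp: vec_eq_iff axis_def)
 have "norm (axis i x) \<le> (\<Sum>j\<in>UNIV. norm (axis i x $ j))"
  unfolding norm_vec_def by (rule L2_set_le_sum) simp
 also have "... = (\<Sum>j\<in>UNIV. if j = i then norm x else 0)"
  by (intro sum.cong) (auto simp: axis_def)
 finally show "norm (axis i x) \<le> norm x * 1" by simp
qed

lemma sum_axis: "(\<Sum>i\<in>UNIV. axis i (x $ i)) = (x :: 'a::real_normed_vector^'n::finite)"
 by (simp add: vec_eq_iff axis_def)

lemma smooth_on_vec:
 fixes f :: "'a::real_normed_vector => 'b::real_normed_vector^'n::finite"
 assumes "open S" "!!i. smooth_on S (%x. f x $ i)"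
 shows "smooth_on S f"
proof -
 have "smooth_on S (%x. \<Sum>i\<in>UNIV. axis i (f x $ i))"
  by (intro smooth_on_sum smooth_on_bounded_linear[OF bounded_linear_axis] assms)
 then show ?thesis by (simp add: sum_axis)
qed

lemma smooth_on_nth: "open S ==> smooth_on S f ==> smooth_on S (%x. f x $ i)"
 by (rule smooth_on_bounded_linear[OF bounded_linear_vec_nth])

lemma smooth_on_fst: "open S ==> smooth_on S fst"
 and smooth_on_snd: "open S ==> smooth_on S snd"
 using smooth_on_bounded_linear[OF bounded_linear_fst _ smooth_on_id]
  smooth_on_bounded_linear[OF bounded_linear_snd _ smooth_on_id] by auto

text \<open>The derivative is built from products of \<open>inverse\<close> with itself, so C^k
  passes to C^(k+1).\<close>

lemma smooth_on_inverse: "smooth_on (- {0}) (inverse :: real => real)"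
 unfolding smooth_on_def
proof
 fix k show "Ck_on k (- {0}) (inverse :: real => real)"
 proof (induction k)
  case (Suc k)
  show ?case
  proof (rule Ck_on_SucI[where f' = "%x v. - (inverse x * v * inverse x)"])
   show "Ck_on k (- {0}) (%x::real. - (inverse x * v * inverse x))" for v
    using Ck_on_bounded_linear[OF _ bounded_linear_minus[OF bounded_linear_mult_right[of v]]
     Ck_on_bilinear[OF _ bounded_bilinear_mult Suc Suc]]
    by (simp add: ac_simps open_Compl)
  qed (auto intro!: has_derivative_inverse')
 qed (auto intro!: continuous_intros)
qed

text \<open>The derivative is half of \<open>inverse (sqrt x)\<close>, so C^k passes to C^(k+1)
  through \<open>smooth_on_inverse\<close>.\<close>

lemma smooth_on_sqrt: "smooth_on {0<..} sqrt"
 unfolding smooth_on_def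
proof
 fix k show "Ck_on k {0<..} sqrt"
 proof (induction k)
  case (Suc k)
  show ?case
  proof (rule Ck_on_SucI[where f' = "%x v. inverse (sqrt x) * (v / 2)"])
   show "Ck_on k {0<..} (%x. inverse (sqrt x) * (v / 2))" for v
    by (rule Ck_on_bounded_linear[OF _ bounded_linear_mult_left
       Ck_on_compose[where T = "- {0}", OF _ _ _ Suc smooth_on_Ck[OF smooth_on_inverse]]]) auto
   show "(sqrt has_derivative (%v. inverse (sqrt x) * (v / 2))) (at x)" if "x \<in> {0<..}" for x
    using that DERIV_real_sqrt[of x] by (auto simp: has_field_derivative_def divide_simps mult_ac elim!: has_derivative_eq_rhs)
  qed auto
 qed (auto intro!: continuous_intros)
qed

subsection \<open>Partial derivatives\<close>

lemma has_vector_derivative_line: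
 assumes "(f has_derivative D) (at x)"
 shows "((%t. f (x + t *\<^sub>R v)) has_vector_derivative D v) (at 0)"
proof -
 have "((%t. x + t *\<^sub>R v) has_derivative (%t. t *\<^sub>R v)) (at 0)"
  by (auto intro!: derivative_eq_intros)
 then have "((%t. f (x + t *\<^sub>R v)) has_derivative (%t. D (t *\<^sub>R v))) (at 0)"
  using diff_chain_at[of "%t. x + t *\<^sub>R v" "%t. t *\<^sub>R v" 0 f D] assms by (simp add: o_def)
 then show ?thesis
  using has_derivative_linear[OF assms] by (simp add: has_vector_derivative_def linear_scale)
qed

lemma dx_eqI:
 assumes "((%(x, ksi). f x ksi) has_derivative D) (at (x, ksi))"
 shows "dx \<alpha> f x ksi = D (axis \<alpha> 1, 0)"
 using has_vector_derivative_line[OF assms, of "(axis \<alpha> 1, 0)"]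
 by (auto simp: dx_def intro: vector_derivative_at)

lemma d\<xi>_eqI:
 assumes "((%(x, ksi). f x ksi) has_derivative D) (at (x, ksi))"
 shows "d\<xi> \<alpha> f x ksi = D (0, axis \<alpha> 1)"
 using has_vector_derivative_line[OF assms, of "(0, axis \<alpha> 1)"]
 by (auto simp: d\<xi>_def intro: vector_derivative_at)

lemma dx_cong:
 assumes "open W" "(x, ksi) \<in> W" "!!x ksi. (x, ksi) \<in> W ==> f x ksi = g x ksi"
 shows "dx \<alpha> f x ksi = dx \<alpha> g x ksi"
 unfolding dx_def
proof (rule vector_derivative_cong_eq)
 have "((%t. (x + t *\<^sub>R axis \<alpha> 1, ksi)) \<longlongrightarrow> (x + 0 *\<^sub>R axis \<alpha> 1, ksi)) (nhds (0::real))"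
  by (intro tendsto_intros filterlim_ident)
 then have "\<forall>\<^sub>F t in nhds 0. (x + t *\<^sub>R axis \<alpha> 1, ksi) \<in> W"
  by (rule topological_tendstoD) (use assms in auto)
 then show "\<forall>\<^sub>F t in nhds 0. t \<in> UNIV --> f (x + t *\<^sub>R axis \<alpha> 1) ksi = g (x + t *\<^sub>R axis \<alpha> 1) ksi"
  by eventually_elim (use assms in auto)
qed auto

lemma d\<xi>_cong:
 assumes "open W" "(x, ksi) \<in> W" "!!x ksi. (x, ksi) \<in> W ==> f x ksi = g x ksi"
 shows "d\<xi> \<alpha> f x ksi = d\<xi> \<alpha> g x ksi"
 unfolding d\<xi>_def
proof (rule vector_derivative_cong_eq)
 have "((%t. (x, ksi + t *\<^sub>R axis \<alpha> 1)) \<longlongrightarrow> (x, ksi + 0 *\<^sub>R axis \<alpha> 1)) (nhds (0::real))"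
  by (intro tendsto_intros filterlim_ident)
 then have "\<forall>\<^sub>F t in nhds 0. (x, ksi + t *\<^sub>R axis \<alpha> 1) \<in> W"
  by (rule topological_tendstoD) (use assms in auto)
 then show "\<forall>\<^sub>F t in nhds 0. t \<in> UNIV --> f x (ksi + t *\<^sub>R axis \<alpha> 1) = g x (ksi + t *\<^sub>R axis \<alpha> 1)"
  by eventually_elim (use assms in auto)
qed auto

abbreviation smooth2 :: "((real^'n::finite) \<times> (real^'n)) set => (real^'n => real^'n => 'b::real_normed_vector) => bool" where
 "smooth2 W f \<equiv> smooth_on W (%(x, ksi). f x ksi)"

abbreviation grad2 :: "(real^'n::finite => real^'n => 'b::real_normed_vector) => real^'n => real^'n => (real^'n) \<times> (real^'n) => 'b" where
 "grad2 f x ksi \<equiv> frechet_derivative (%(x, ksi). f x ksi) (at (x, ksi))"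

lemma smooth2_has_derivative:
 "smooth2 W f ==> (x, ksi) \<in> W ==> ((%(x, ksi). f x ksi) has_derivative grad2 f x ksi) (at (x, ksi))"
 by (rule smooth_on_has_derivative)

lemma dx_eq: "smooth2 W f ==> (x, ksi) \<in> W ==> dx \<alpha> f x ksi = grad2 f x ksi (axis \<alpha> 1, 0)"
 and d\<xi>_eq: "smooth2 W f ==> (x, ksi) \<in> W ==> d\<xi> \<alpha> f x ksi = grad2 f x ksi (0, axis \<alpha> 1)"
 by (auto intro: dx_eqI d\<xi>_eqI smooth2_has_derivative)

lemma smooth2_dx:
 assumes "open W" "smooth2 W f" shows "smooth2 W (dx \<alpha> f)"
 by (rule smooth_on_cong[OF assms(1) smooth_on_derivative[OF assms(2), of "(axis \<alpha> 1, 0)"]])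
  (auto simp: dx_eq[OF assms(2)])

lemma smooth2_d\<xi>:
 assumes "open W" "smooth2 W f" shows "smooth2 W (d\<xi> \<alpha> f)"
 by (rule smooth_on_cong[OF assms(1) smooth_on_derivative[OF assms(2), of "(0, axis \<alpha> 1)"]])
  (auto simp: d\<xi>_eq[OF assms(2)])

lemma grad2_expand:
 assumes "smooth2 W f" "(x, ksi) \<in> W"
 shows "grad2 f x ksi (u, v) = (\<Sum>\<alpha>\<in>UNIV. (u $ \<alpha>) *\<^sub>R dx \<alpha> f x ksi + (v $ \<alpha>) *\<^sub>R d\<xi> \<alpha> f x ksi)"
proof -
 have L: "linear (grad2 f x ksi)"
  using has_derivative_linear[OF smooth2_has_derivative[OF assms]] .
 have "(u, v) = (\<Sum>\<alpha>\<in>UNIV. (u $ \<alpha>) *\<^sub>R (axis \<alpha> 1, 0) + (v $ \<alpha>) *\<^sub>R (0, axis \<alpha> 1))"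
  using basis_expansion[of u] basis_expansion[of v]
  by (simp add: sum.distrib sum_prod scalar_mult_eq_scaleR)
 then have "grad2 f x ksi (u, v) = grad2 f x ksi (\<Sum>\<alpha>\<in>UNIV. (u $ \<alpha>) *\<^sub>R (axis \<alpha> 1, 0) + (v $ \<alpha>) *\<^sub>R (0, axis \<alpha> 1))"
  by simp
 also have "... = (\<Sum>\<alpha>\<in>UNIV. (u $ \<alpha>) *\<^sub>R grad2 f x ksi (axis \<alpha> 1, 0) + (v $ \<alpha>) *\<^sub>R grad2 f x ksi (0, axis \<alpha> 1))"
  by (simp only: linear_sum[OF L] linear_add[OF L] linear_scale[OF L])
 finally show ?thesis by (simp only: dx_eq[OF assms] d\<xi>_eq[OF assms])
qed

text \<open>The second difference of \<open>f\<close> over the parallelogram with sides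
  \<open>h *\<^sub>R u\<close> and \<open>h *\<^sub>R v\<close> does not depend on the order of
  \<open>u\<close> and \<open>v\<close>. The mean value theorem, used twice, turns it into
  \<open>h * h\<close> times either mixed derivative at some point of the parallelogram; continuity
  of these derivatives gives equality as \<open>h\<close> tends to 0.\<close>

lemma second_derivative_symmetric_real:
 fixes f :: "'a::real_normed_vector => real"
 assumes S: "open S" "x \<in> S" and f: "Ck_on 2 S f"
 shows "frechet_derivative (%y. frechet_derivative f (at y) u) (at x) v =
  frechet_derivative (%y. frechet_derivative f (at y) v) (at x) u"
proof -
 let ?D = "%u y. frechet_derivative f (at y) u"
 let ?DD = "%u v y. frechet_derivative (?D u) (at y) v"
 have f1: "(f has_derivative (%u. ?D u y)) (at y)" if "y \<in> S" for y
  using f that by (auto simp: numeral_2_eq_2 frechet_derivative_works)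
 have f2: "(?D u has_derivative (%v. ?DD u v y)) (at y)" if "y \<in> S" for y u
  using f that by (auto simp: numeral_2_eq_2 frechet_derivative_works)
 have cont: "continuous_on S (?DD u v)" for u v
  using f by (auto simp: numeral_2_eq_2)
 have key: "\<exists>p q. 0 < p \<and> p < h \<and> 0 < q \<and> q < h \<and>
   f (x + h *\<^sub>R u + h *\<^sub>R v) - f (x + h *\<^sub>R u) - f (x + h *\<^sub>R v) + f x = h * h * ?DD u v (x + p *\<^sub>R u + q *\<^sub>R v)"
  if h: "0 < h" "h < e" and e: "!!p q. 0 \<le> p ==> p < e ==> 0 \<le> q ==> q < e ==> x + p *\<^sub>R u + q *\<^sub>R v \<in> S"
  for h e u v
 proof -
  let ?g = "%s. f (x + s *\<^sub>R u + h *\<^sub>R v) - f (x + s *\<^sub>R u)"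
  have line: "((%s. G (y + s *\<^sub>R w)) has_real_derivative D w) (at s)"
   if "(G has_derivative D) (at (y + s *\<^sub>R w))" for G D y w s
   using has_vector_derivative_line[OF that, of w]
   by (simp add: has_real_derivative_iff_has_vector_derivative[symmetric] DERIV_def algebra_simps)
  have d1: "(?g has_real_derivative ?D u (x + s *\<^sub>R u + h *\<^sub>R v) - ?D u (x + s *\<^sub>R u)) (at s)"
   if "0 \<le> s" "s \<le> h" for s
  proof -
   have 1: "x + h *\<^sub>R v + s *\<^sub>R u \<in> S" "x + s *\<^sub>R u \<in> S"
    using e[of s h] e[of s 0] that h by (auto simp: add_ac)
   from DERIV_diff[OF line[OF f1[OF 1(1)]] line[OF f1[OF 1(2)]]]
   show ?thesis by (simp add: add_ac)
  qed
  obtain p where p: "0 < p" "p < h" "?g h - ?g 0 = (h - 0) * (?D u (x + p *\<^sub>R u + h *\<^sub>R v) - ?D u (x + p *\<^sub>R u))"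
   using MVT2[OF h(1) d1] by auto
  have d2: "((%t. ?D u (x + p *\<^sub>R u + t *\<^sub>R v)) has_real_derivative ?DD u v (x + p *\<^sub>R u + t *\<^sub>R v)) (at t)"
   if "0 \<le> t" "t \<le> h" for t
   by (rule line[OF f2]) (use e[of p t] that h p in auto)
  obtain q where q: "0 < q" "q < h" "?D u (x + p *\<^sub>R u + h *\<^sub>R v) - ?D u (x + p *\<^sub>R u + 0 *\<^sub>R v) = (h - 0) * ?DD u v (x + p *\<^sub>R u + q *\<^sub>R v)"
   using MVT2[OF h(1) d2] by auto
  show ?thesis
   by (rule exI[of _ p], rule exI[of _ q]) (use p q in \<open>simp add: algebra_simps\<close>)
 qed
 obtain r where r: "r > 0" "ball x r \<subseteq> S" using S openE by blast
 \<comment> \<open>Keeps \<open>x + p *\<^sub>R u + q *\<^sub>R v\<close> in the ball of radius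
   \<open>r\<close> for all \<open>p\<close> and \<open>q\<close> below \<open>e\<close>; the
   summand 1 covers the case that both directions are 0.\<close>
 define e where "e = r / (norm u + norm v + 1)"
 have epos: "e > 0" using r by (simp add: e_def add_nonneg_pos)
 have inS: "x + p *\<^sub>R u + q *\<^sub>R v \<in> S" if "0 \<le> p" "p < e" "0 \<le> q" "q < e" for p q
 proof -
  have "norm (p *\<^sub>R u + q *\<^sub>R v) \<le> p * norm u + q * norm v"
   using norm_triangle_ineq[of "p *\<^sub>R u" "q *\<^sub>R v"] that by simp
  also have "... \<le> e * norm u + e * norm v"
   using that by (intro add_mono mult_right_mono) auto
  also have "... < e * (norm u + norm v + 1)" using epos by (simp add: algebra_simps)
  also have "... = r" using add_nonneg_pos[of "norm u + norm v" 1] by (simp add: e_def)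
  finally have "dist x (x + (p *\<^sub>R u + q *\<^sub>R v)) < r"
   by (metis dist_norm add_diff_cancel_left' dist_commute)
  then show ?thesis unfolding add.assoc using r(2) by (meson mem_ball subsetD)
 qed
 have ex: "\<exists>p q p' q'. \<bar>p\<bar> < e / (real k + 2) \<and> \<bar>q\<bar> < e / (real k + 2) \<and> \<bar>p'\<bar> < e / (real k + 2) \<and> \<bar>q'\<bar> < e / (real k + 2) \<and>
   ?DD u v (x + p *\<^sub>R u + q *\<^sub>R v) = ?DD v u (x + p' *\<^sub>R u + q' *\<^sub>R v)"
 for k :: nat
 proof -
  \<comment> \<open>With \<open>+ 2\<close> the step is strictly below \<open>e\<close> already for
    \<open>k = 0\<close>, so every parallelogram of the sequence lies in \<open>S\<close>.\<close>
  define h where "h = e / (real k + 2)"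
  have h: "0 < h" "h < e"
   using epos mult_pos_pos[OF epos, of "1 + real k"] by (auto simp: h_def field_simps)
  obtain p q where 1: "0 < p" "p < h" "0 < q" "q < h"
   "f (x + h *\<^sub>R u + h *\<^sub>R v) - f (x + h *\<^sub>R u) - f (x + h *\<^sub>R v) + f x = h * h * ?DD u v (x + p *\<^sub>R u + q *\<^sub>R v)"
   using key[OF h inS] by blast
  have inS': "x + p *\<^sub>R v + q *\<^sub>R u \<in> S" if "0 \<le> p" "p < e" "0 \<le> q" "q < e" for p q
   using inS[of q p] that by (simp add: add_ac)
  obtain p' q' where 2: "0 < p'" "p' < h" "0 < q'" "q' < h"
   "f (x + h *\<^sub>R v + h *\<^sub>R u) - f (x + h *\<^sub>R v) - f (x + h *\<^sub>R u) + f x = h * h * ?DD v u (x + p' *\<^sub>R v + q' *\<^sub>R u)"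
   using key[OF h inS'] by blast
  have e1: "x + h *\<^sub>R v + h *\<^sub>R u = x + h *\<^sub>R u + h *\<^sub>R v"
   and e2: "x + p' *\<^sub>R v + q' *\<^sub>R u = x + q' *\<^sub>R u + p' *\<^sub>R v" by (auto simp: add_ac)
  have "h * h * ?DD u v (x + p *\<^sub>R u + q *\<^sub>R v) = h * h * ?DD v u (x + q' *\<^sub>R u + p' *\<^sub>R v)"
   using 1(5) 2(5) unfolding e1 e2 by linarith
  with h have "?DD u v (x + p *\<^sub>R u + q *\<^sub>R v) = ?DD v u (x + q' *\<^sub>R u + p' *\<^sub>R v)" by simp
  with 1 2 show ?thesis
   unfolding h_def[symmetric] by (intro exI[of _ p] exI[of _ q] exI[of _ q'] exI[of _ p']) auto
 qed
 obtain p q p' q' where pq: "!!k::nat. \<bar>p k\<bar> < e / (real k + 2)" "!!k::nat. \<bar>q k\<bar> < e / (real k + 2)"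
  "!!k::nat. \<bar>p' k\<bar> < e / (real k + 2)" "!!k::nat. \<bar>q' k\<bar> < e / (real k + 2)"
  and eq: "!!k. ?DD u v (x + p k *\<^sub>R u + q k *\<^sub>R v) = ?DD v u (x + p' k *\<^sub>R u + q' k *\<^sub>R v)" using ex by metis
 have lim0: "r \<longlonglongrightarrow> 0" if "!!k::nat. \<bar>r k\<bar> < e / (real k + 2)" for r :: "nat => real"
 proof (rule Lim_null_comparison)
  show "\<forall>\<^sub>F k in sequentially. norm (r k) \<le> e / (real k + 2)"
   using that by (auto intro!: always_eventually less_imp_le)
  show "(%k. e / (real k + 2)) \<longlonglongrightarrow> 0"
   using LIMSEQ_ignore_initial_segment[OF lim_const_over_n[of e], of 2] by (simp add: add.commute)
 qed
 have lim: "(%k. ?DD a b (x + r k *\<^sub>R u + s k *\<^sub>R v)) \<longlonglongrightarrow> ?DD a b x"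
  if "r \<longlonglongrightarrow> 0" "s \<longlonglongrightarrow> 0" for r s a b
 proof -
  have "(%k. x + r k *\<^sub>R u + s k *\<^sub>R v) \<longlonglongrightarrow> x + 0 *\<^sub>R u + 0 *\<^sub>R v"
   by (intro tendsto_intros that)
  moreover have "isCont (?DD a b) x" using cont S by (simp add: continuous_on_eq_continuous_at)
  ultimately show ?thesis using isCont_tendsto_compose by fastforce
 qed
 show ?thesis
  using LIMSEQ_unique[OF lim[OF lim0[OF pq(1)] lim0[OF pq(2)], of u v]]
   lim[OF lim0[OF pq(3)] lim0[OF pq(4)], of v u] by (simp add: eq)
qed

lemma second_derivative_symmetric:
 fixes f :: "'a::real_normed_vector => 'b::euclidean_space"
 assumes S: "open S" "x \<in> S" and f: "Ck_on 2 S f"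
 shows "frechet_derivative (%y. frechet_derivative f (at y) u) (at x) v =
  frechet_derivative (%y. frechet_derivative f (at y) v) (at x) u"
proof (rule euclidean_eqI)
 fix b :: 'b assume "b \<in> Basis"
 have f1: "(f has_derivative frechet_derivative f (at y)) (at y)" if "y \<in> S" for y
  using f that by (auto simp: numeral_2_eq_2 frechet_derivative_works)
 have e1: "frechet_derivative (%y. f y \<bullet> b) (at y) w = frechet_derivative f (at y) w \<bullet> b" if "y \<in> S" for y w
  by (subst frechet_derivative_eqI[OF bounded_linear.has_derivative[OF bounded_linear_inner_left f1[OF that]]]) simp
 have e2: "frechet_derivative (%y. frechet_derivative (%y. f y \<bullet> b) (at y) u) (at x) v
   = frechet_derivative (%y. frechet_derivative f (at y) u) (at x) v \<bullet> b" for u v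
 proof -
  have "((%y. frechet_derivative f (at y) u) has_derivative frechet_derivative (%y. frechet_derivative f (at y) u) (at x)) (at x)"
   using f S by (auto simp: numeral_2_eq_2 frechet_derivative_works)
  from bounded_linear.has_derivative[OF bounded_linear_inner_left this, of b]
  have "((%y. frechet_derivative (%y. f y \<bullet> b) (at y) u) has_derivative
    (%v. frechet_derivative (%y. frechet_derivative f (at y) u) (at x) v \<bullet> b)) (at x)"
   by (rule has_derivative_transform_within_open[OF _ S]) (simp add: e1)
  from frechet_derivative_eqI[OF this] show ?thesis by simp
 qed
 show "frechet_derivative (%y. frechet_derivative f (at y) u) (at x) v \<bullet> b =
  frechet_derivative (%y. frechet_derivative f (at y) v) (at x) u \<bullet> b"
  using second_derivative_symmetric_real[OF S Ck_on_bounded_linear[OF S(1) bounded_linear_inner_left f], of b u v]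
  by (simp add: e2)
qed

lemma d\<xi>_dx_commute:
 fixes f :: "real^'n::finite => real^'n => 'b::euclidean_space"
 assumes W: "open W" "(x, ksi) \<in> W" and f: "smooth2 W f"
 shows "d\<xi> \<alpha> (dx \<beta> f) x ksi = dx \<beta> (d\<xi> \<alpha> f) x ksi"
proof -
 let ?F = "%(x, ksi). f x ksi"
 have "d\<xi> \<alpha> (dx \<beta> f) x ksi = d\<xi> \<alpha> (%x ksi. grad2 f x ksi (axis \<beta> 1, 0)) x ksi"
  by (rule d\<xi>_cong[OF W]) (simp add: dx_eq[OF f])
 also have "... = frechet_derivative (%y. frechet_derivative ?F (at y) (axis \<beta> 1, 0)) (at (x, ksi)) (0, axis \<alpha> 1)"
  by (rule d\<xi>_eqI) (use smooth_on_has_derivative[OF smooth_on_derivative[OF f] W(2)] in \<open>simp add: case_prod_unfold\<close>)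
 also have "... = frechet_derivative (%y. frechet_derivative ?F (at y) (0, axis \<alpha> 1)) (at (x, ksi)) (axis \<beta> 1, 0)"
  by (rule second_derivative_symmetric[OF W smooth_on_Ck[OF f]])
 also have "... = dx \<beta> (%x ksi. grad2 f x ksi (0, axis \<alpha> 1)) x ksi"
  by (rule dx_eqI[symmetric]) (use smooth_on_has_derivative[OF smooth_on_derivative[OF f] W(2)] in \<open>simp add: case_prod_unfold\<close>)
 also have "... = dx \<beta> (d\<xi> \<alpha> f) x ksi"
  by (rule dx_cong[OF W]) (simp add: d\<xi>_eq[OF f])
 finally show ?thesis .
qed

section \<open>Linearity and product rules for partial derivatives\<close>

lemma
 assumes "bounded_linear L" "smooth2 W f" "(x, ksi) \<in> W"
 shows dx_bounded_linear: "dx \<alpha> (%x ksi. L (f x ksi)) x ksi = L (dx \<alpha> f x ksi)"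
  and d\<xi>_bounded_linear: "d\<xi> \<alpha> (%x ksi. L (f x ksi)) x ksi = L (d\<xi> \<alpha> f x ksi)"
proof -
 have d: "((%(x, ksi). L (f x ksi)) has_derivative (%v. L (grad2 f x ksi v))) (at (x, ksi))"
  using bounded_linear.has_derivative[OF assms(1) smooth2_has_derivative[OF assms(2,3)]]
  by (simp add: case_prod_unfold)
 show "dx \<alpha> (%x ksi. L (f x ksi)) x ksi = L (dx \<alpha> f x ksi)" "d\<xi> \<alpha> (%x ksi. L (f x ksi)) x ksi = L (d\<xi> \<alpha> f x ksi)"
  by (simp_all add: dx_eqI[OF d] d\<xi>_eqI[OF d] dx_eq[OF assms(2,3)] d\<xi>_eq[OF assms(2,3)])
qed

lemma
 assumes "bounded_bilinear pr" "smooth2 W f" "smooth2 W g" "(x, ksi) \<in> W"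
 shows dx_bilinear: "dx \<alpha> (%x ksi. pr (f x ksi) (g x ksi)) x ksi = pr (dx \<alpha> f x ksi) (g x ksi) + pr (f x ksi) (dx \<alpha> g x ksi)"
  and d\<xi>_bilinear: "d\<xi> \<alpha> (%x ksi. pr (f x ksi) (g x ksi)) x ksi = pr (d\<xi> \<alpha> f x ksi) (g x ksi) + pr (f x ksi) (d\<xi> \<alpha> g x ksi)"
proof -
 have d: "((%(x, ksi). pr (f x ksi) (g x ksi)) has_derivative (%v. pr (f x ksi) (grad2 g x ksi v) + pr (grad2 f x ksi v) (g x ksi))) (at (x, ksi))"
  using bounded_bilinear.FDERIV[OF assms(1) smooth2_has_derivative[OF assms(2,4)] smooth2_has_derivative[OF assms(3,4)]]
  by (simp add: case_prod_unfold)
 show "dx \<alpha> (%x ksi. pr (f x ksi) (g x ksi)) x ksi = pr (dx \<alpha> f x ksi) (g x ksi) + pr (f x ksi) (dx \<alpha> g x ksi)"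
  "d\<xi> \<alpha> (%x ksi. pr (f x ksi) (g x ksi)) x ksi = pr (d\<xi> \<alpha> f x ksi) (g x ksi) + pr (f x ksi) (d\<xi> \<alpha> g x ksi)"
  by (simp_all add: dx_eqI[OF d] d\<xi>_eqI[OF d] dx_eq[OF assms(2,4)] d\<xi>_eq[OF assms(2,4)] dx_eq[OF assms(3,4)] d\<xi>_eq[OF assms(3,4)])
qed

lemma
 assumes "smooth2 W f" "smooth2 W g" "(x, ksi) \<in> W"
 shows dx_add: "dx \<alpha> (%x ksi. f x ksi + g x ksi) x ksi = dx \<alpha> f x ksi + dx \<alpha> g x ksi"
  and d\<xi>_add: "d\<xi> \<alpha> (%x ksi. f x ksi + g x ksi) x ksi = d\<xi> \<alpha> f x ksi + d\<xi> \<alpha> g x ksi"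
proof -
 have d: "((%(x, ksi). f x ksi + g x ksi) has_derivative (%v. grad2 f x ksi v + grad2 g x ksi v)) (at (x, ksi))"
  using has_derivative_add[OF smooth2_has_derivative[OF assms(1,3)] smooth2_has_derivative[OF assms(2,3)]]
  by (simp add: case_prod_unfold)
 show "dx \<alpha> (%x ksi. f x ksi + g x ksi) x ksi = dx \<alpha> f x ksi + dx \<alpha> g x ksi"
  "d\<xi> \<alpha> (%x ksi. f x ksi + g x ksi) x ksi = d\<xi> \<alpha> f x ksi + d\<xi> \<alpha> g x ksi"
  by (simp_all add: dx_eqI[OF d] d\<xi>_eqI[OF d] dx_eq[OF assms(1,3)] d\<xi>_eq[OF assms(1,3)] dx_eq[OF assms(2,3)] d\<xi>_eq[OF assms(2,3)])
qed

lemma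
 assumes "!!i. i \<in> I ==> smooth2 W (f i)" "(x, ksi) \<in> W"
 shows dx_sum: "dx \<alpha> (%x ksi. \<Sum>i\<in>I. f i x ksi) x ksi = (\<Sum>i\<in>I. dx \<alpha> (f i) x ksi)"
  and d\<xi>_sum: "d\<xi> \<alpha> (%x ksi. \<Sum>i\<in>I. f i x ksi) x ksi = (\<Sum>i\<in>I. d\<xi> \<alpha> (f i) x ksi)"
proof -
 have d: "((%(x, ksi). \<Sum>i\<in>I. f i x ksi) has_derivative (%v. \<Sum>i\<in>I. grad2 (f i) x ksi v)) (at (x, ksi))"
  using has_derivative_sum[of I "%i. %(x, ksi). f i x ksi"] smooth2_has_derivative[OF assms(1,2)]
  by (simp add: case_prod_unfold)
 show "dx \<alpha> (%x ksi. \<Sum>i\<in>I. f i x ksi) x ksi = (\<Sum>i\<in>I. dx \<alpha> (f i) x ksi)"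
   "d\<xi> \<alpha> (%x ksi. \<Sum>i\<in>I. f i x ksi) x ksi = (\<Sum>i\<in>I. d\<xi> \<alpha> (f i) x ksi)"
  using dx_eq[OF assms(1,2)] d\<xi>_eq[OF assms(1,2)]
  by (simp_all add: dx_eqI[OF d] d\<xi>_eqI[OF d])
qed

subsection \<open>Test functions\<close>

text \<open>All functions t^(-m) exp(-1/t), extended by 0 to t \<le> 0, and not just the one with m
  = 0: the family is closed under differentiation up to linear combinations, so smoothness is an
  induction over the order of differentiability with \<open>m\<close> arbitrary.\<close>

definition flat :: "nat => real => real" where
 "flat m t = (if t > 0 then inverse t ^ m * exp (- inverse t) else 0)"

lemma flat_tendsto: "(flat m \<longlongrightarrow> 0) (at 0)"
proof (rule filterlim_split_at)
 have "(flat m \<longlongrightarrow> 0) (at_left 0) \<longleftrightarrow> ((%t. 0) \<longlongrightarrow> (0::real)) (at_left (0::real))"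
  by (rule filterlim_cong[OF refl refl]) (auto simp: flat_def eventually_at_filter)
 then show "(flat m \<longlongrightarrow> 0) (at_left 0)" by simp
 have "((%t. inverse t ^ m / exp (inverse t)) \<longlongrightarrow> 0) (at_right (0::real))"
  by (rule filterlim_compose[OF tendsto_power_div_exp_0 filterlim_inverse_at_top_right])
 moreover have "(flat m \<longlongrightarrow> 0) (at_right 0) \<longleftrightarrow> ((%t. inverse t ^ m / exp (inverse t)) \<longlongrightarrow> 0) (at_right (0::real))"
  by (rule filterlim_cong[OF refl refl]) (auto simp: flat_def eventually_at_filter exp_minus divide_inverse)
 ultimately show "(flat m \<longlongrightarrow> 0) (at_right 0)" by simp
qed

lemma flat_derivative:
 "(flat m has_real_derivative flat (m + 2) t - real m * flat (m + 1) t) (at t)"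
proof -
 consider "t > 0" | "t < 0" | "t = 0" by linarith
 then show ?thesis
 proof cases
  case 1
  have e: "real m * inverse t ^ (m - 1) * inverse t * inverse t = real m * inverse t ^ (m + 1)"
   by (cases m) auto
  have "((%t. inverse t ^ m * exp (- inverse t)) has_real_derivative
    inverse t ^ m * (exp (- inverse t) * (inverse t * inverse t)) -
    real m * inverse t ^ (m - 1) * inverse t * inverse t * exp (- inverse t)) (at t)"
   using 1 by (auto intro!: derivative_eq_intros simp: power2_eq_square algebra_simps)
  moreover have "inverse t ^ m * (exp (- inverse t) * (inverse t * inverse t)) -
    real m * inverse t ^ (m - 1) * inverse t * inverse t * exp (- inverse t) =
    flat (m + 2) t - real m * flat (m + 1) t"
   unfolding e using 1 by (simp add: flat_def algebra_simps)
  ultimately have "((%t. inverse t ^ m * exp (- inverse t)) has_real_derivative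
    flat (m + 2) t - real m * flat (m + 1) t) (at t)" by simp
  then show ?thesis
   by (rule has_field_derivative_transform_within_open[where S = "{0<..}"]) (use 1 in \<open>auto simp: flat_def\<close>)
 next
  case 2
  have "((%t. 0::real) has_real_derivative 0) (at t)" by simp
  then have "(flat m has_real_derivative 0) (at t)"
   by (rule has_field_derivative_transform_within_open[where S = "{..<0}"]) (use 2 in \<open>auto simp: flat_def\<close>)
  with 2 show ?thesis by (simp add: flat_def)
 next
  case 3
  \<comment> \<open>At 0 the difference quotient of \<open>flat m\<close> is
    \<open>flat (Suc m)\<close> itself.\<close>
  have "((%h. (flat m (0 + h) - flat m 0) / h) \<longlongrightarrow> 0) (at 0) \<longleftrightarrow> (flat (Suc m) \<longlongrightarrow> 0) (at 0)"
   by (rule filterlim_cong[OF refl refl]) (auto simp: flat_def eventually_at_filter divide_inverse)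
  then show ?thesis using flat_tendsto[of "Suc m"] 3 by (simp add: DERIV_def flat_def)
 qed
qed

lemma smooth_on_flat: "smooth_on UNIV (flat m)"
 unfolding smooth_on_def
proof
 fix k show "Ck_on k UNIV (flat m)"
 proof (induction k arbitrary: m)
  case 0
  show ?case
   using DERIV_isCont[OF flat_derivative[of m]] by (simp add: continuous_at_imp_continuous_on)
 next
  case (Suc k)
  show ?case
  proof (rule Ck_on_SucI[where f' = "%t v. flat (m + 2) t * v + flat (m + 1) t * (- real m * v)"])
   show "(flat m has_derivative (%v. flat (m + 2) t * v + flat (m + 1) t * (- real m * v))) (at t)" for t
    using flat_derivative[of m t] unfolding has_field_derivative_def
    by (rule has_derivative_eq_rhs) (auto simp: algebra_simps)
   show "Ck_on k UNIV (%t. flat (m + 2) t * v + flat (m + 1) t * (- real m * v))" for v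
    by (intro Ck_on_add Ck_on_bounded_linear[OF _ bounded_linear_mult_left] Suc open_UNIV)
  qed auto
 qed
qed

lemma flat_pos_iff: "flat 0 t > 0 \<longleftrightarrow> t > 0" and flat_nonneg: "flat 0 t \<ge> 0"
 and flat_zero_iff: "flat 0 t = 0 \<longleftrightarrow> t \<le> 0"
 by (auto simp: flat_def)

text \<open>The quotient u / (u + w), where \<open>u\<close> is positive exactly inside the ball of
  radius 2 r and \<open>w\<close> exactly outside the closed ball of radius r. The two never vanish
  together, so the denominator is positive; using the square of the distance keeps everything smooth
  at the centre.\<close>

lemma ball_bump_exists:
 fixes a :: "'a::euclidean_space"
 assumes "r > 0"
 shows "\<exists>\<beta> :: 'a => real. smooth_on UNIV \<beta> \<and> (\<forall>x. 0 \<le> \<beta> x \<and> \<beta> x \<le> 1) \<and>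
  (\<forall>x\<in>ball a r. \<beta> x = 1) \<and> (\<forall>x. x \<notin> ball a (2 * r) --> \<beta> x = 0)"
proof -
 define q where "q x = (x - a) \<bullet> (x - a)" for x
 define u where "u x = flat 0 (4 * r\<^sup>2 - q x)" for x
 define w where "w x = flat 0 (q x - r\<^sup>2)" for x
 have q: "smooth_on UNIV q"
  unfolding q_def by (intro smooth_on_inner smooth_on_diff smooth_on_id smooth_on_const open_UNIV)
 have u: "smooth_on UNIV u" unfolding u_def
  by (rule smooth_on_compose[OF _ _ _ smooth_on_flat]) (auto intro!: smooth_on_diff smooth_on_const q)
 have w: "smooth_on UNIV w" unfolding w_def
  by (rule smooth_on_compose[OF _ _ _ smooth_on_flat]) (auto intro!: smooth_on_diff smooth_on_const q)
 have rr: "r\<^sup>2 < 4 * r\<^sup>2" using assms by simp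
 have pos: "u x + w x > 0" for x
 proof (cases "q x < 4 * r\<^sup>2")
  case True
  then have "u x > 0" by (simp add: u_def flat_pos_iff)
  moreover have "w x \<ge> 0" by (simp add: w_def flat_nonneg)
  ultimately show ?thesis by simp
 next
  case False
  then have "r\<^sup>2 < q x" using rr by linarith
  then have "w x > 0" by (simp add: w_def flat_pos_iff)
  moreover have "u x \<ge> 0" by (simp add: u_def flat_nonneg)
  ultimately show ?thesis by simp
 qed
 define \<beta> where "\<beta> x = u x * inverse (u x + w x)" for x
 have "smooth_on UNIV \<beta>" unfolding \<beta>_def
  by (intro smooth_on_mult u smooth_on_compose[OF _ _ _ smooth_on_inverse] smooth_on_add w open_UNIV)
   (use pos in \<open>auto simp: less_le\<close>)
 moreover have "0 \<le> \<beta> x \<and> \<beta> x \<le> 1" for x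
  using pos[of x] flat_nonneg[of "q x - r\<^sup>2"] flat_nonneg[of "4 * r\<^sup>2 - q x"]
  by (simp add: \<beta>_def field_simps u_def[symmetric] w_def[symmetric])
 moreover have "\<beta> x = 1" if "x \<in> ball a r" for x
 proof -
  have "norm (x - a) < r" using that by (simp add: dist_norm norm_minus_commute)
  then have "q x < r\<^sup>2" by (simp add: q_def dot_square_norm power_strict_mono)
  then have "w x = 0" by (simp add: w_def flat_zero_iff)
  with pos[of x] show ?thesis by (simp add: \<beta>_def)
 qed
 moreover have "\<beta> x = 0" if "x \<notin> ball a (2 * r)" for x
 proof -
  have "2 * r \<le> norm (x - a)" using that by (simp add: dist_norm norm_minus_commute)
  then have "(2 * r)\<^sup>2 \<le> q x"
   unfolding q_def dot_square_norm by (rule power_mono) (use assms in simp)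
  then have "u x = 0" by (simp add: u_def flat_zero_iff power2_eq_square)
  then show ?thesis by (simp add: \<beta>_def)
 qed
 ultimately show ?thesis by blast
qed

lemma supp_subset: "closed K ==> (!!x. x \<notin> K ==> f x = 0) ==> supp f \<subseteq> K"
 unfolding supp_def by (rule closure_minimal) auto

lemma zero_outside_supp: "x \<notin> supp f ==> f x = 0"
 unfolding supp_def using closure_subset[of "{x. f x \<noteq> 0}"] by auto

lemma closed_supp: "closed (supp f)"
 by (simp add: supp_def)

text \<open>One minus the product of the factors \<open>1 - \<beta> a x\<close> over a finite
  subcover: a single vanishing factor forces the value 1, and outside all doubled balls every factor
  is 1. The value 1 is reached on an open neighbourhood \<open>V\<close> of \<open>K\<close>, not
  just on \<open>K\<close>, because derivatives of the cut-off have to vanish there as well.\<close>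

lemma plateau_exists:
 fixes K :: "'a::euclidean_space set"
 assumes "compact K" "open U" "K \<subseteq> U"
 obtains \<rho> :: "'a => real" and V where "test_function U \<rho>" "!!x. 0 \<le> \<rho> x" "!!x. \<rho> x \<le> 1"
  "open V" "K \<subseteq> V" "!!x. x \<in> V ==> \<rho> x = 1"
proof -
 have "\<forall>a\<in>K. \<exists>r>0. cball a (2 * r) \<subseteq> U"
 proof
  fix a assume "a \<in> K"
  then obtain e where "e > 0" "cball a e \<subseteq> U" using assms open_contains_cball by blast
  then show "\<exists>r>0. cball a (2 * r) \<subseteq> U" by (intro exI[of _ "e / 2"]) auto
 qed
 then obtain r where r: "!!a. a \<in> K ==> r a > 0" "!!a. a \<in> K ==> cball a (2 * r a) \<subseteq> U" by metis
 have "K \<subseteq> (\<Union>a\<in>K. ball a (r a))" using r(1) by force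
 then obtain F where F: "F \<subseteq> K" "finite F" "K \<subseteq> (\<Union>a\<in>F. ball a (r a))"
  using compactE_image[OF assms(1), of K "%a. ball a (r a)"] by auto
 have "\<forall>a\<in>K. \<exists>\<beta> :: 'a => real. smooth_on UNIV \<beta> \<and> (\<forall>x. 0 \<le> \<beta> x \<and> \<beta> x \<le> 1) \<and>
  (\<forall>x\<in>ball a (r a). \<beta> x = 1) \<and> (\<forall>x. x \<notin> ball a (2 * r a) --> \<beta> x = 0)"
  using ball_bump_exists r(1) by blast
 from bchoice[OF this] obtain \<beta> :: "'a => 'a => real" where \<beta>0: "\<forall>a\<in>K. smooth_on UNIV (\<beta> a) \<and> (\<forall>x. 0 \<le> \<beta> a x \<and> \<beta> a x \<le> 1) \<and>
  (\<forall>x\<in>ball a (r a). \<beta> a x = 1) \<and> (\<forall>x. x \<notin> ball a (2 * r a) --> \<beta> a x = 0)"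
  by blast
 then have \<beta>: "!!a. a \<in> K ==> smooth_on UNIV (\<beta> a)"
  "!!a x. a \<in> K ==> 0 \<le> \<beta> a x" "!!a x. a \<in> K ==> \<beta> a x \<le> 1"
  "!!a x. a \<in> K ==> x \<in> ball a (r a) ==> \<beta> a x = 1" "!!a x. a \<in> K ==> x \<notin> ball a (2 * r a) ==> \<beta> a x = 0"
  by blast+
 define \<rho> where "\<rho> x = 1 - (\<Prod>a\<in>F. 1 - \<beta> a x)" for x
 let ?C = "\<Union>a\<in>F. cball a (2 * r a)"
 have C: "compact ?C" using F(2) by (intro compact_UN) auto
 have "smooth_on UNIV \<rho>" unfolding \<rho>_def
  by (intro smooth_on_diff smooth_on_prod smooth_on_const \<beta>(1) open_UNIV) (use F in auto)
 moreover have s: "supp \<rho> \<subseteq> ?C"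
 proof (rule supp_subset)
  fix x assume x: "x \<notin> ?C"
  have "\<beta> a x = 0" if "a \<in> F" for a
   using x that F(1) by (intro \<beta>(5)) auto
  then show "\<rho> x = 0" by (simp add: \<rho>_def)
 qed (use C compact_imp_closed in blast)
 moreover have "compact (supp \<rho>)" using s C closed_supp[of \<rho>]
  by (metis Int_absorb1 compact_Int_closed)
 moreover have "?C \<subseteq> U" using r(2) F(1) by blast
 ultimately have "test_function U \<rho>" by (auto simp: test_function_def)
 moreover have "0 \<le> \<rho> x" "\<rho> x \<le> 1" for x
  using prod_le_1[of F "%a. 1 - \<beta> a x"] prod_nonneg[of F "%a. 1 - \<beta> a x"] \<beta>(2,3) F(1)
  by (auto simp: \<rho>_def subset_iff)
 moreover have "\<rho> x = 1" if x: "x \<in> (\<Union>a\<in>F. ball a (r a))" for x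
 proof -
  obtain a where a: "a \<in> F" "x \<in> ball a (r a)" using x by blast
  then have "1 - \<beta> a x = 0" using \<beta>(4)[of a x] F(1) by auto
  with a F(2) have "(\<Prod>a\<in>F. 1 - \<beta> a x) = 0" by (auto intro: prod_zero)
  then show ?thesis by (simp add: \<rho>_def)
 qed
 ultimately show thesis
  using that[of \<rho> "\<Union>a\<in>F. ball a (r a)"] F(3) by blast
qed

lemma supp_compact_if_subset: "supp f \<subseteq> K ==> compact K ==> compact (supp f)"
 by (metis Int_absorb1 compact_Int_closed closed_supp)

lemma supp_mono: "(!!x. f x = 0 ==> g x = 0) ==> supp g \<subseteq> supp f"
 unfolding supp_def by (rule closure_mono) auto

lemma test_functionI:
 "smooth_on UNIV f ==> compact K ==> K \<subseteq> S ==> (!!x. x \<notin> K ==> f x = 0) ==> test_function S f"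
 unfolding test_function_def
 using supp_subset[OF compact_imp_closed, of K f] supp_compact_if_subset[of f K] by blast

lemma test_function_mono: "test_function S f ==> S \<subseteq> T ==> test_function T f"
 by (auto simp: test_function_def)

lemma test_function_smooth: "test_function S f ==> smooth_on UNIV f"
 by (simp add: test_function_def)

lemma test_function_bilinear_left:
 assumes "bounded_bilinear pr" "test_function S f" "smooth_on UNIV g"
 shows "test_function S (%x. pr (f x) (g x))"
 by (rule test_functionI[where K = "supp f"])
  (use assms in \<open>auto simp: test_function_def zero_outside_supp bounded_bilinear.zero_left intro: smooth_on_bilinear\<close>)

lemma test_function_bounded_linear:
 assumes "bounded_linear L" "test_function S f"
 shows "test_function S (%x. L (f x))"
 by (rule test_functionI[where K = "supp f"])
  (use assms linear_0[OF bounded_linear.linear[OF assms(1)]] in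
   \<open>auto simp: test_function_def zero_outside_supp intro: smooth_on_bounded_linear\<close>)

lemma test_function_derivative:
 assumes "test_function S f"
 shows "test_function S (%x. frechet_derivative f (at x) v)"
proof (rule test_functionI[where K = "supp f"])
 fix x assume x: "x \<notin> supp f"
 have "((%x. 0) has_derivative (%v. 0)) (at x)" by simp
 then have "(f has_derivative (%v. 0)) (at x)"
  by (rule has_derivative_transform_within_open[where s = "- supp f"])
   (use x closed_supp[of f] in \<open>auto simp: zero_outside_supp open_Compl\<close>)
 then show "frechet_derivative f (at x) v = 0" by (simp add: frechet_derivative_eqI)
qed (use assms in \<open>auto simp: test_function_def intro: smooth_on_derivative\<close>)

text \<open>Smoothness is local, and the open sets \<open>S\<close> and \<open>- K\<close> cover the
  space: on the first the extension is \<open>f\<close>, on the second it is 0.\<close>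

lemma smooth_on_extend_zero:
 assumes "open S" "smooth_on S f" "closed K" "K \<subseteq> S" "!!x. x \<in> S ==> x \<notin> K ==> f x = 0"
 shows "smooth_on UNIV (%x. if x \<in> S then f x else 0)"
proof (rule smooth_on_local)
 fix x
 show "\<exists>T. open T \<and> x \<in> T \<and> smooth_on T (%x. if x \<in> S then f x else 0)"
 proof (cases "x \<in> S")
  case True
  then show ?thesis using assms(1,2) by (intro exI[of _ S]) (auto intro: smooth_on_cong)
 next
  case False
  then show ?thesis
   by (intro exI[of _ "- K"] conjI smooth_on_cong[OF _ smooth_on_const[of "- K" 0]])
    (use assms in \<open>auto simp: open_Compl\<close>)
 qed
qed

lemma test_function_extend:
 assumes "open S" "smooth_on S f" "test_function S (\<rho> :: _ => real)"
 shows "test_function S (%x. if x \<in> S then \<rho> x *\<^sub>R f x else 0)"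
proof (rule test_functionI[where K = "supp \<rho>"])
 show "smooth_on UNIV (%x. if x \<in> S then \<rho> x *\<^sub>R f x else 0)"
  by (rule smooth_on_extend_zero[OF assms(1) _ closed_supp[of \<rho>]])
   (use assms in \<open>auto simp: test_function_def zero_outside_supp intro!: smooth_on_scaleR intro: smooth_on_subset\<close>)
qed (use assms in \<open>auto simp: test_function_def zero_outside_supp\<close>)

lemma test_function_bounded:
 assumes "test_function S f" obtains B where "!!x. norm (f x) \<le> B"
proof -
 have "compact (f ` supp f)"
  using assms by (intro compact_continuous_image) (auto simp: test_function_def intro: continuous_on_subset smooth_on_continuous)
 then have "bounded (f ` supp f)" by (rule compact_imp_bounded)
 then obtain B where B: "!!y. y \<in> f ` supp f ==> norm y \<le> B"
  unfolding bounded_iff by blast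
 have "norm (f x) \<le> max B 0" for x
 proof (cases "x \<in> supp f")
  case True
  then have "norm (f x) \<le> B" by (intro B) auto
  then show ?thesis by simp
 qed (simp add: zero_outside_supp)
 then show ?thesis using that by blast
qed

subsection \<open>Integrals over Euclidean space\<close>

text \<open>Dominated convergence for the quotients that define the Frechet derivative, along an
  arbitrary sequence tending to \<open>z\<close>. The rule is stated for the total derivative
  because it serves to differentiate an oscillatory integral jointly in three variables.\<close>

lemma has_derivative_integral:
 fixes g :: "'z::real_normed_vector => 'y => 'b::{banach,second_countable_topology}"
 assumes U: "open U" "z \<in> U"
  and der: "!!w y. w \<in> U ==> ((%w. g w y) has_derivative g' w y) (at w)"
  and int: "!!w. w \<in> U ==> integrable M (g w)"
  and int': "!!v. integrable M (%y. g' z y v)"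
  and bnd: "!!w y v. w \<in> U ==> norm (g' w y v) \<le> B y * norm v"
  and B: "integrable M B"
 shows "((%w. \<integral>y. g w y \<partial>M) has_derivative (%v. \<integral>y. g' z y v \<partial>M)) (at z)"
proof -
 obtain r where r: "r > 0" "ball z r \<subseteq> U" using openE[OF U] by blast
 have lin: "linear (g' z y)" for y using has_derivative_linear[OF der[OF U(2)]] .
 have bl: "bounded_linear (%v. \<integral>y. g' z y v \<partial>M)"
 proof (rule bounded_linear_intro)
  show "(\<integral>y. g' z y (v + w) \<partial>M) = (\<integral>y. g' z y v \<partial>M) + (\<integral>y. g' z y w \<partial>M)" for v w
   by (simp add: linear_add[OF lin] int')
  show "(\<integral>y. g' z y (c *\<^sub>R v) \<partial>M) = c *\<^sub>R (\<integral>y. g' z y v \<partial>M)" for c v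
   by (simp add: linear_scale[OF lin])
  show "norm (\<integral>y. g' z y v \<partial>M) \<le> norm v * (\<integral>y. B y \<partial>M)" for v
  proof -
   have "norm (\<integral>y. g' z y v \<partial>M) \<le> (\<integral>y. B y * norm v \<partial>M)"
    by (rule order_trans[OF integral_norm_bound Bochner_Integration.integral_mono[OF integrable_norm[OF int'] integrable_mult_left[OF B]]])
     (rule bnd[OF U(2)])
   then show ?thesis by (simp add: mult.commute)
  qed
 qed
 have "((%w. norm ((\<integral>y. g w y \<partial>M) - (\<integral>y. g z y \<partial>M) - (\<integral>y. g' z y (w - z) \<partial>M)) / norm (w - z)) \<longlongrightarrow> 0)
   (at z within ball z r)"
  unfolding tendsto_at_iff_sequentially
 proof (intro allI impI)
  fix X :: "nat => 'z" assume X: "\<forall>i. X i \<in> ball z r - {z}" "X \<longlonglongrightarrow> z"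
  have XU: "X i \<in> U" for i using X(1) r(2) by auto
  define q where "q i y = inverse (norm (X i - z)) *\<^sub>R (g (X i) y - g z y - g' z y (X i - z))" for i y
  have intq: "integrable M (q i)" for i
   unfolding q_def by (intro integrable_scaleR_right Bochner_Integration.integrable_diff int int' XU U)
  have "(%i. integral\<^sup>L M (q i)) \<longlonglongrightarrow> integral\<^sup>L M (%y. 0)"
  proof (rule integral_dominated_convergence[where w = "%y. 2 * B y"])
   show "integrable M (%y. 2 * B y)" using B by simp
   show "AE y in M. (%i. q i y) \<longlonglongrightarrow> 0"
   proof (rule AE_I2)
    fix y
    have "((%w. norm (g w y - g z y - g' z y (w - z)) / norm (w - z)) \<longlongrightarrow> 0) (at z within ball z r)"
     using has_derivative_at_withinI[OF der[OF U(2)], of y "ball z r"]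
     by (simp add: has_derivative_iff_norm)
    then have "(%i. norm (g (X i) y - g z y - g' z y (X i - z)) / norm (X i - z)) \<longlonglongrightarrow> 0"
     using X by (auto simp only: tendsto_at_iff_sequentially o_def)
    moreover have "norm (q i y) = norm (g (X i) y - g z y - g' z y (X i - z)) / norm (X i - z)" for i
     by (simp add: q_def divide_inverse mult.commute)
    ultimately have "(%i. norm (q i y)) \<longlonglongrightarrow> 0" by simp
    then show "(%i. q i y) \<longlonglongrightarrow> 0" by (simp add: tendsto_norm_zero_iff)
   qed
   \<comment> \<open>One \<open>B y\<close> bounds the increment of \<open>g\<close> by the mean
     value inequality on the ball, the other bounds the linear term.\<close>
   show "AE y in M. norm (q i y) \<le> 2 * B y" for i
   proof (rule AE_I2)
    fix y
    have "0 \<le> B y * norm (X i - z)" using order_trans[OF norm_ge_zero bnd[OF U(2), of y "X i - z"]] .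
    then have B0: "0 \<le> B y" using X(1) by (auto simp: zero_le_mult_iff)
    have "norm (g (X i) y - g z y) \<le> B y * norm (X i - z)"
    proof (rule differentiable_bound[where S = "ball z r" and f' = "%w. g' w y"])
     fix w assume w: "w \<in> ball z r"
     then have wU: "w \<in> U" using r(2) by blast
     show "((%w. g w y) has_derivative g' w y) (at w within ball z r)"
      by (rule has_derivative_at_withinI[OF der[OF wU]])
     show "onorm (g' w y) \<le> B y" using B0 by (rule onorm_bound) (rule bnd[OF wU])
    qed (use X(1) r(1) in auto)
    moreover have "norm (g' z y (X i - z)) \<le> B y * norm (X i - z)" by (rule bnd[OF U(2)])
    ultimately have "norm (g (X i) y - g z y - g' z y (X i - z)) \<le> 2 * B y * norm (X i - z)"
     using norm_triangle_ineq4[of "g (X i) y - g z y" "g' z y (X i - z)"] by linarith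
    moreover have "norm (X i - z) > 0" using X(1) by auto
    ultimately have "norm (g (X i) y - g z y - g' z y (X i - z)) / norm (X i - z) \<le> 2 * B y"
     by (simp add: divide_le_eq)
    then show "norm (q i y) \<le> 2 * B y" by (simp add: q_def divide_inverse mult.commute)
   qed
  qed (use intq in \<open>auto intro: borel_measurable_integrable\<close>)
  then have *: "(%i. norm (integral\<^sup>L M (q i))) \<longlonglongrightarrow> 0" by (simp add: tendsto_norm_zero_iff)
  have q': "integral\<^sup>L M (q i) = inverse (norm (X i - z)) *\<^sub>R ((\<integral>y. g (X i) y \<partial>M) - (\<integral>y. g z y \<partial>M) - (\<integral>y. g' z y (X i - z) \<partial>M))" for i
   unfolding q_def using int[OF XU[of i]] int[OF U(2)] int'[of "X i - z"] by simp
  have "norm (integral\<^sup>L M (q i)) = norm ((\<integral>y. g (X i) y \<partial>M) - (\<integral>y. g z y \<partial>M) - (\<integral>y. g' z y (X i - z) \<partial>M)) / norm (X i - z)" for i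
   unfolding q' by (simp add: divide_inverse mult.commute)
  with * show "((%w. norm ((\<integral>y. g w y \<partial>M) - (\<integral>y. g z y \<partial>M) - (\<integral>y. g' z y (w - z) \<partial>M)) / norm (w - z)) \<circ> X) \<longlonglongrightarrow> 0"
   by (simp add: o_def)
 qed
 then show ?thesis
  unfolding has_derivative_iff_norm using bl r(1) by (simp add: at_within_open[of z "ball z r"])
qed

section \<open>Affine substitutions, product integrals, integrability by decay, integrals of
  derivatives\<close>

lemma lborel_integral_affine:
 fixes f :: "'a::euclidean_space => 'b::{banach,second_countable_topology}"
 assumes f: "f \<in> borel_measurable borel" and c: "c \<noteq> 0"
 shows "(\<integral>x. f x \<partial>lborel) = \<bar>c\<bar> ^ DIM('a) *\<^sub>R (\<integral>x. f (t + c *\<^sub>R x) \<partial>lborel)"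
proof -
 note f[measurable]
 have "(\<integral>x. f x \<partial>lborel) = (\<integral>x. f x \<partial>density (distr lborel borel (%x. t + c *\<^sub>R x)) (%_. ennreal (\<bar>c\<bar> ^ DIM('a))))"
  by (rule arg_cong[where f = "%M. integral\<^sup>L M f"], rule lborel_affine[OF c])
 also have "... = (\<integral>x. \<bar>c\<bar> ^ DIM('a) *\<^sub>R f (t + c *\<^sub>R x) \<partial>lborel)"
  by (subst integral_density, simp, simp, simp) (subst integral_distr, auto)
 finally show ?thesis by simp
qed

lemma lborel_integrable_affine:
 fixes f :: "'a::euclidean_space => 'b::{banach,second_countable_topology}"
 assumes f: "integrable lborel f" and c: "c \<noteq> 0"
 shows "integrable lborel (%x. f (t + c *\<^sub>R x))"
proof -
 have [measurable]: "f \<in> borel_measurable borel" using borel_measurable_integrable[OF f] by simp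
 have "integrable (density (distr lborel borel (%x. t + c *\<^sub>R x)) (%_. ennreal (\<bar>c\<bar> ^ DIM('a)))) f"
  by (rule subst[of lborel, where P = "%M. integrable M f", OF lborel_affine[OF c] f])
 then have "integrable lborel (%x. \<bar>c\<bar> ^ DIM('a) *\<^sub>R f (t + c *\<^sub>R x))"
  by (subst (asm) integrable_density) (auto simp: integrable_distr_eq)
 then have "integrable lborel (%x. inverse (\<bar>c\<bar> ^ DIM('a)) *\<^sub>R (\<bar>c\<bar> ^ DIM('a) *\<^sub>R f (t + c *\<^sub>R x)))"
  by (rule integrable_scaleR_right)
 then show ?thesis using c by simp
qed

lemma lborel_integral_translate:
 fixes f :: "'a::euclidean_space => 'b::{banach,second_countable_topology}"
 assumes f: "f \<in> borel_measurable borel"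
 shows "(\<integral>x. f (x + t) \<partial>lborel) = (\<integral>x. f x \<partial>lborel)"
 using lborel_integral_affine[OF f, of 1 t] by (simp add: add.commute)

lemma lborel_integral_prod:
 fixes f :: "'a::euclidean_space => real => complex"
 assumes "!!b. b \<in> Basis ==> integrable lborel (f b)"
 shows "(\<integral>x. (\<Prod>b\<in>Basis. f b (x \<bullet> b)) \<partial>(lborel :: 'a measure)) = (\<Prod>b\<in>Basis. \<integral>x. f b x \<partial>lborel)"
proof -
 have [measurable]: "f b \<in> borel_measurable borel" if "b \<in> Basis" for b
  using borel_measurable_integrable[OF assms[OF that]] by simp
 interpret product_sigma_finite "%b::'a. lborel :: real measure" by standard
 have "(\<integral>x. (\<Prod>b\<in>Basis. f b (x \<bullet> b)) \<partial>(lborel :: 'a measure)) =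
   (\<integral>x. (\<Prod>b\<in>Basis. f b ((\<Sum>c\<in>Basis. x c *\<^sub>R c) \<bullet> b)) \<partial>(\<Pi>\<^sub>M b\<in>(Basis :: 'a set). lborel))"
  by (subst lborel_eq) (simp add: integral_distr)
 also have "... = (\<integral>x. (\<Prod>b\<in>Basis. f b (x b)) \<partial>(\<Pi>\<^sub>M b\<in>(Basis :: 'a set). lborel))"
  by (intro Bochner_Integration.integral_cong prod.cong)
   (auto simp: inner_sum_left inner_Basis if_distrib sum.delta cong: if_cong)
 also have "... = (\<Prod>b\<in>Basis. \<integral>x. f b x \<partial>lborel)"
  by (rule product_integral_prod) (use assms in auto)
 finally show ?thesis .
qed

text \<open>The product form reduces integrability to the one-dimensional function 1/(1 + s^2),
  without polar coordinates.\<close>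

definition decay_weight :: "'a::euclidean_space => real" where
 "decay_weight x = (\<Prod>b\<in>Basis. inverse (1 + (x \<bullet> b)\<^sup>2))"

lemma integrable_decay_weight: "integrable lborel (decay_weight :: 'a::euclidean_space => real)"
proof (rule integrableI_nonneg)
 show "decay_weight \<in> borel_measurable (lborel :: 'a measure)"
  unfolding decay_weight_def by measurable
 show "AE x in lborel. 0 \<le> decay_weight (x :: 'a)"
  by (auto simp: decay_weight_def intro!: prod_nonneg)
 have 1: "integrable lborel (%x::real. inverse (1 + x\<^sup>2))"
  using integrable_inverse_1_plus_square by (simp add: set_integrable_def einterval_def)
 have "(\<integral>\<^sup>+x. ennreal (inverse (1 + x\<^sup>2)) \<partial>lborel) < \<infinity>"
  using integrableD(2)[OF 1] by (simp add: top.not_eq_extremum)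
 moreover have "(\<integral>\<^sup>+x. ennreal (decay_weight (x :: 'a)) \<partial>lborel) = (\<integral>\<^sup>+x. (\<Prod>b\<in>(Basis :: 'a set). ennreal (inverse (1 + (x \<bullet> b)\<^sup>2))) \<partial>lborel)"
  by (intro nn_integral_cong) (simp add: decay_weight_def prod_ennreal)
 moreover have "... = (\<Prod>b\<in>(Basis :: 'a set). \<integral>\<^sup>+x. ennreal (inverse (1 + x\<^sup>2)) \<partial>lborel)"
  by (rule nn_integral_lborel_prod) auto
 ultimately show "(\<integral>\<^sup>+x. ennreal (decay_weight (x :: 'a)) \<partial>lborel) < \<infinity>"
  by (simp add: power_less_top_ennreal)
qed

text \<open>Each of the \<open>DIM('a)\<close> factors is at least (1 + |x|)^(-2); hence the
  exponent \<open>2 * DIM('a)\<close> in the decay conditions below.\<close>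

lemma decay_weight_lower: "inverse ((1 + norm x) ^ (2 * DIM('a))) \<le> decay_weight (x :: 'a::euclidean_space)"
proof -
 have "(\<Prod>b\<in>(Basis :: 'a set). inverse ((1 + norm x)\<^sup>2)) \<le> decay_weight x"
  unfolding decay_weight_def
 proof (intro prod_mono conjI)
  fix b :: 'a assume "b \<in> Basis"
  then have "(x \<bullet> b)\<^sup>2 \<le> (norm x)\<^sup>2"
   using Basis_le_norm[of b x] by (metis abs_le_square_iff abs_norm_cancel)
  then have "1 + (x \<bullet> b)\<^sup>2 \<le> 1 + (norm x)\<^sup>2 + 2 * norm x" using norm_ge_zero[of x] by linarith
  then have "1 + (x \<bullet> b)\<^sup>2 \<le> (1 + norm x)\<^sup>2" by (simp add: power2_sum)
  then show "inverse ((1 + norm x)\<^sup>2) \<le> inverse (1 + (x \<bullet> b)\<^sup>2)"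
   by (intro le_imp_inverse_le) (auto simp: add_pos_nonneg)
 qed auto
 then show ?thesis by (simp add: power_inverse[symmetric] power_mult)
qed

lemma decay_bound:
 fixes g :: "'a::euclidean_space => 'b::real_normed_vector"
 assumes "(1 + norm x) ^ (2 * DIM('a)) * norm (g x) \<le> C"
 shows "norm (g x) \<le> C * decay_weight x"
proof -
 have p: "(1 + norm x) ^ (2 * DIM('a)) > 0" by (intro zero_less_power add_pos_nonneg) auto
 have "0 \<le> C" using assms mult_nonneg_nonneg[OF less_imp_le[OF p] norm_ge_zero[of "g x"]] by linarith
 have "norm (g x) \<le> C * inverse ((1 + norm x) ^ (2 * DIM('a)))"
  using assms p by (simp add: field_simps)
 also have "... \<le> C * decay_weight x" by (rule mult_left_mono[OF decay_weight_lower \<open>0 \<le> C\<close>])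
 finally show ?thesis .
qed

lemma integrable_decay:
 fixes g :: "'a::euclidean_space => 'b::{banach,second_countable_topology}"
 assumes "g \<in> borel_measurable borel" "!!x. (1 + norm x) ^ (2 * DIM('a)) * norm (g x) \<le> C"
 shows "integrable lborel g"
proof (rule Bochner_Integration.integrable_bound[OF integrable_mult_right[OF integrable_decay_weight, of C]])
 have "norm (g x) \<le> norm (C * decay_weight x)" for x
  using decay_bound[where g = g, OF assms(2), of x] by (simp add: order_trans[OF _ abs_ge_self])
 then show "AE x in lborel. norm (g x) \<le> norm (C * decay_weight x)" by simp
qed (use assms(1) in simp)

lemma integrable_compact_support:
 fixes f :: "'a::euclidean_space => 'b::{banach,second_countable_topology}"
 assumes "continuous_on UNIV f" "compact K" "!!x. x \<notin> K ==> f x = 0"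
 shows "integrable lborel f"
proof -
 have "(%x. indicator K x *\<^sub>R f x) = f" using assms(3) by (auto simp: fun_eq_iff indicator_def)
 then show ?thesis
  using borel_integrable_compact[OF assms(2) continuous_on_subset[OF assms(1), of K]] by simp
qed

text \<open>The integral of \<open>F (y + t *\<^sub>R e)\<close> does not depend on
  \<open>t\<close>, and differentiation under the integral at \<open>t = 0\<close> gives the
  integral of \<open>F' y e\<close>. The derivative is asked to be bounded and, in the direction
  \<open>e\<close>, integrable, but not continuous; so the lemma also covers fields glued from
  pieces that match to first order only.\<close>

lemma integral_derivative_eq_0:
 fixes F :: "'a::euclidean_space => 'b::euclidean_space"
 assumes der: "!!y. (F has_derivative F' y) (at y)"
  and bnd: "!!y v. norm (F' y v) \<le> C * norm v"
  and zero: "!!y. norm y > r ==> F y = 0"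
  and int: "integrable lborel (%y. F' y e)"
 shows "(\<integral>y. F' y e \<partial>lborel) = 0"
proof -
 have zero': "F' y v = 0" if "norm y > r" for y v
 proof -
  have "((%y. 0) has_derivative (%v. 0)) (at y)" by simp
  then have "(F has_derivative (%v. 0)) (at y)"
   by (rule has_derivative_transform_within_open[where s = "- cball 0 r"])
    (use zero that in \<open>auto simp: open_Compl\<close>)
  then show ?thesis using has_derivative_unique der by metis
 qed
 have cont: "continuous_on UNIV F"
  using der by (auto simp: continuous_on_eq_continuous_at intro: has_derivative_continuous)
 then have meas: "F \<in> borel_measurable borel" by (rule borel_measurable_continuous_onI)
 have Fint: "integrable lborel F"
  by (rule integrable_compact_support[OF cont compact_cball[of 0 r]]) (auto intro: zero)
 have C: "0 \<le> C * norm e" using order_trans[OF norm_ge_zero bnd] .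
 \<comment> \<open>For |t| < 1 the derivative at \<open>y + t *\<^sub>R e\<close> vanishes unless
   \<open>y\<close> lies in this enlarged ball, which provides an integrable majorant.\<close>
 let ?K = "cball (0::'a) (r + norm e)"
 have "((%t. \<integral>y. F (y + t *\<^sub>R e) \<partial>lborel) has_derivative (%v. \<integral>y. F' (y + 0 *\<^sub>R e) (v *\<^sub>R e) \<partial>lborel)) (at (0::real))"
 proof (rule has_derivative_integral[where U = "ball 0 1" and B = "%y. indicator ?K y * (C * norm e)"])
  show "((%t. F (y + t *\<^sub>R e)) has_derivative (%v. F' (y + t *\<^sub>R e) (v *\<^sub>R e))) (at t)" for t y
  proof -
   have "((%t. y + t *\<^sub>R e) has_derivative (%v. v *\<^sub>R e)) (at t)" by (auto intro!: derivative_eq_intros)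
   from diff_chain_at[OF this der] show ?thesis by (simp add: o_def)
  qed
  show "integrable lborel (%y. F (y + t *\<^sub>R e))" for t
   using lborel_integrable_affine[OF Fint, of 1 "t *\<^sub>R e"] by (simp add: add.commute)
  show "integrable lborel (%y. F' (y + 0 *\<^sub>R e) (v *\<^sub>R e))" for v
   using int by (simp add: linear_scale[OF has_derivative_linear[OF der]])
  show "norm (F' (y + t *\<^sub>R e) (v *\<^sub>R e)) \<le> indicator ?K y * (C * norm e) * norm v" if "t \<in> ball 0 1" for t y v
  proof (cases "y \<in> ?K")
   case True
   then show ?thesis using bnd[of "y + t *\<^sub>R e" "v *\<^sub>R e"] by (simp add: mult_ac)
  next
   case False
   have "norm (t *\<^sub>R e) \<le> norm e" using that by (simp add: mult_left_le_one_le)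
   then have "norm (y + t *\<^sub>R e) > r"
    using False norm_triangle_ineq4[of "y + t *\<^sub>R e" "t *\<^sub>R e"] by auto
   then show ?thesis using zero' False by simp
  qed
  show "integrable lborel (%y. indicator ?K y * (C * norm e))"
   by (intro integrable_mult_left integrable_real_indicator) (auto simp: emeasure_bounded_finite[simplified])
 qed auto
 moreover have "(\<integral>y. F (y + t *\<^sub>R e) \<partial>lborel) = (\<integral>y. F y \<partial>lborel)" for t
  by (rule lborel_integral_translate[OF meas])
 ultimately have "((%t::real. \<integral>y. F y \<partial>lborel) has_derivative (%v. \<integral>y. F' y (v *\<^sub>R e) \<partial>lborel)) (at 0)" by simp
 then have "(%v::real. \<integral>y. F' y (v *\<^sub>R e) \<partial>lborel) = (%v. 0)"
  by (rule has_derivative_unique) simp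
 then show ?thesis by (metis scaleR_one)
qed

subsection \<open>The Fourier transform of test functions\<close>

definition pd :: "'n::finite => (real^'n => 'b::real_normed_vector) => real^'n => 'b" where
 "pd \<alpha> f x = frechet_derivative f (at x) (axis \<alpha> 1)"

definition ft :: "(real^'n::finite => complex) => real^'n => complex" where
 "ft f eta = (\<integral>y. cis (- (y \<bullet> eta)) * f y \<partial>lborel)"

lemma test_function_pd: "test_function S f ==> test_function S (pd \<alpha> f)"
 unfolding pd_def by (rule test_function_derivative)

lemma test_function_integrable:
 fixes f :: "'a::euclidean_space => 'b::{banach,second_countable_topology}"
 shows "test_function S f ==> integrable lborel f"
 by (rule integrable_compact_support[where K = "supp f"])
  (auto simp: test_function_def zero_outside_supp smooth_on_continuous)

lemma smooth_on_cis: "smooth_on UNIV cis"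
 unfolding smooth_on_def
proof
 fix k show "Ck_on k UNIV cis"
 proof (induction k)
  case 0
  show ?case by (auto intro!: continuous_intros)
 next
  case (Suc k)
  show ?case
  proof (rule Ck_on_SucI[where f' = "%t v. cis t * (\<i> * of_real v)"])
   have "(cis has_vector_derivative \<i> * cis t) (at t)" for t
   proof -
    have "((%t. exp (\<i> * of_real t)) has_vector_derivative \<i> * exp (\<i> * of_real t)) (at t)"
     by (auto intro!: derivative_eq_intros has_vector_derivative_real_field)
    then show ?thesis by (simp add: cis_conv_exp[abs_def])
   qed
   then show "(cis has_derivative (%v. cis t * (\<i> * of_real v))) (at t)" for t
    by (auto simp: has_vector_derivative_def scaleR_conv_of_real mult_ac)
   show "Ck_on k UNIV (%t. cis t * (\<i> * of_real v))" for v
    by (intro Ck_on_bounded_linear[OF _ bounded_linear_mult_left] Suc open_UNIV)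
  qed auto
 qed
qed

lemma cis_has_derivative: "(cis has_derivative (%v. cis t * (\<i> * of_real v))) (at t)"
proof -
 have "((%t. exp (\<i> * of_real t)) has_vector_derivative \<i> * exp (\<i> * of_real t)) (at t)"
  by (auto intro!: derivative_eq_intros has_vector_derivative_real_field)
 then have "(cis has_vector_derivative \<i> * cis t) (at t)" by (simp add: cis_conv_exp[abs_def])
 then show ?thesis by (auto simp: has_vector_derivative_def scaleR_conv_of_real mult_ac)
qed

lemma cis_measurable[measurable]: "cis \<in> borel_measurable borel"
 by (auto intro!: borel_measurable_continuous_onI continuous_intros)

lemma smooth_on_cis_inner: "smooth_on UNIV (%y::'a::real_inner. cis (y \<bullet> eta))"
 by (rule smooth_on_compose[OF _ _ _ smooth_on_cis])
  (auto intro!: smooth_on_bounded_linear[OF bounded_linear_inner_left] smooth_on_id)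

lemma ft_integrable:
 assumes "test_function S f" shows "integrable lborel (%y. cis (- (y \<bullet> eta)) * f y)"
 by (rule Bochner_Integration.integrable_bound[OF test_function_integrable[OF assms]])
  (use borel_measurable_integrable[OF test_function_integrable[OF assms]] in \<open>auto simp: norm_mult\<close>)

text \<open>Integration by parts: the integral of the derivative of
  \<open>cis (- (y \<bullet> eta)) * f y\<close> vanishes, and the product rule splits this integral
  into the two sides.\<close>

lemma ft_pd:
 assumes f: "test_function S f"
 shows "ft (pd \<alpha> f) eta = \<i> * of_real (eta $ \<alpha>) * ft f eta"
proof -
 let ?g = "%y. cis (y \<bullet> (- eta)) * f y"
 have g: "test_function S ?g"
  using test_function_bilinear_left[OF bounded_bilinear_mult f smooth_on_cis_inner[of "- eta"]] by (simp add: mult.commute)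
 have sm: "smooth_on UNIV f" using f by (rule test_function_smooth)
 have e: "frechet_derivative ?g (at y) (axis \<alpha> 1) = cis (- (y \<bullet> eta)) * pd \<alpha> f y - \<i> * of_real (eta $ \<alpha>) * (cis (- (y \<bullet> eta)) * f y)" for y
 proof -
  have "((%y. y \<bullet> (- eta)) has_derivative (%v. v \<bullet> (- eta))) (at y)"
   by (rule bounded_linear_imp_has_derivative[OF bounded_linear_inner_left])
  from diff_chain_at[OF this cis_has_derivative]
  have "((%y. cis (y \<bullet> (- eta))) has_derivative (%v. cis (y \<bullet> (- eta)) * (\<i> * of_real (v \<bullet> (- eta))))) (at y)"
   by (simp add: o_def)
  from has_derivative_mult[OF this smooth_on_has_derivative[OF sm UNIV_I]]
  show ?thesis by (subst frechet_derivative_eqI) (auto simp: pd_def inner_axis inner_commute algebra_simps)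
 qed
 have "bounded (supp ?g)" using g unfolding test_function_def by (blast intro: compact_imp_bounded)
 then obtain r where r: "supp ?g \<subseteq> cball 0 r"
  using bounded_subset_ballD[of "supp ?g" 0] ball_subset_cball by (meson order_trans)
 have bd: "\<exists>C. \<forall>y v. norm (frechet_derivative ?g (at y) v) \<le> C * norm v"
 proof -
  have "\<exists>B. \<forall>y. norm (frechet_derivative ?g (at y) b) \<le> B" for b
  proof -
   obtain B where "!!y. norm (frechet_derivative ?g (at y) b) \<le> B"
    using test_function_bounded[OF test_function_derivative[OF g, of b]] by blast
   then show ?thesis by blast
  qed
  then obtain B where B: "!!b y. norm (frechet_derivative ?g (at y) b) \<le> B b" by metis
  have "norm (frechet_derivative ?g (at y) v) \<le> (\<Sum>b\<in>Basis. B b) * norm v" for y v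
  proof -
   have L: "linear (frechet_derivative ?g (at y))"
    using has_derivative_linear[OF smooth_on_has_derivative[OF test_function_smooth[OF g]]] by simp
   have "frechet_derivative ?g (at y) v = frechet_derivative ?g (at y) (\<Sum>b\<in>Basis. (v \<bullet> b) *\<^sub>R b)"
    by (simp add: euclidean_representation)
   also have "... = (\<Sum>b\<in>Basis. (v \<bullet> b) *\<^sub>R frechet_derivative ?g (at y) b)"
    by (simp only: linear_sum[OF L] linear_scale[OF L])
   also have "norm ... \<le> (\<Sum>b\<in>Basis. B b * norm v)"
   proof (rule sum_norm_le)
    fix b :: "real^'a" assume "b \<in> Basis"
    then show "norm ((v \<bullet> b) *\<^sub>R frechet_derivative ?g (at y) b) \<le> B b * norm v"
     using mult_mono[OF Basis_le_norm[of b v] B[of y b]] by (simp add: mult.commute)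
   qed
   finally show ?thesis by (simp add: sum_distrib_right)
  qed
  then show ?thesis by blast
 qed
 then obtain C where C: "!!y v. norm (frechet_derivative ?g (at y) v) \<le> C * norm v" by blast
 have I: "(\<integral>y. frechet_derivative ?g (at y) (axis \<alpha> 1) \<partial>lborel) = 0"
  by (rule integral_derivative_eq_0[where F = ?g and C = C and r = r])
   (use C r zero_outside_supp[of _ ?g] smooth_on_has_derivative[OF test_function_smooth[OF g]]
    test_function_integrable[OF test_function_derivative[OF g, of "axis \<alpha> 1"]] in \<open>auto simp: subset_iff not_le[symmetric]\<close>)
 have "0 = (\<integral>y. cis (- (y \<bullet> eta)) * pd \<alpha> f y - \<i> * of_real (eta $ \<alpha>) * (cis (- (y \<bullet> eta)) * f y) \<partial>lborel)"
  using I unfolding e by simp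
 also have "... = ft (pd \<alpha> f) eta - \<i> * of_real (eta $ \<alpha>) * ft f eta"
  unfolding ft_def
  by (subst Bochner_Integration.integral_diff) (use ft_integrable[OF test_function_pd[OF f]] ft_integrable[OF f] in auto)
 finally show ?thesis by simp
qed

lemma measurable_inner_pair[measurable]: "(%(x::'a::euclidean_space, y). x \<bullet> y) \<in> borel_measurable (borel \<Otimes>\<^sub>M borel)"
 unfolding borel_prod by (auto intro!: borel_measurable_continuous_onI continuous_intros simp: case_prod_unfold)

lemma ft_measurable[measurable]:
 assumes "f \<in> borel_measurable borel" shows "ft f \<in> borel_measurable borel"
proof -
 have [measurable]: "f \<in> borel_measurable lborel" using assms by simp
 have "(%eta. \<integral>y. cis (- (y \<bullet> eta)) * f y \<partial>lborel) \<in> borel_measurable borel" by measurable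
 then show ?thesis by (simp add: ft_def[abs_def])
qed

lemma ft_test_measurable:
 assumes "test_function S f" shows "ft f \<in> borel_measurable borel"
 using borel_measurable_integrable[OF test_function_integrable[OF assms]] by (intro ft_measurable) simp

text \<open>Each further factor 1 + |eta| is paid for by one derivative of \<open>f\<close>: |eta|
  is at most the sum of the |eta_\<alpha>|, and \<open>ft_pd\<close> turns each of these factors
  into the transform of a partial derivative.\<close>

lemma ft_decay:
 assumes "test_function S f" shows "\<exists>C. \<forall>eta. (1 + norm eta) ^ K * norm (ft f eta) \<le> C"
 using assms
proof (induction K arbitrary: f)
 case 0
 have "norm (ft f eta) \<le> (\<integral>y. norm (f y) \<partial>lborel)" for eta
  unfolding ft_def
  by (rule order_trans[OF integral_norm_bound]) (simp add: norm_mult)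
 then show ?case by auto
next
 case (Suc K)
 obtain C where C: "!!eta. (1 + norm eta) ^ K * norm (ft f eta) \<le> C" using Suc by blast
 have "\<forall>\<alpha>. \<exists>C. \<forall>eta. (1 + norm eta) ^ K * norm (ft (pd \<alpha> f) eta) \<le> C"
  using Suc.IH[OF test_function_pd[OF Suc.prems]] by blast
 then obtain D where D: "!!\<alpha> eta. (1 + norm eta) ^ K * norm (ft (pd \<alpha> f) eta) \<le> D \<alpha>" by metis
 have "(1 + norm eta) ^ Suc K * norm (ft f eta) \<le> C + (\<Sum>\<alpha>\<in>UNIV. D \<alpha>)" for eta
 proof -
  have "(1 + norm eta) ^ Suc K * norm (ft f eta) \<le> (1 + (\<Sum>\<alpha>\<in>UNIV. \<bar>eta $ \<alpha>\<bar>)) * ((1 + norm eta) ^ K * norm (ft f eta))"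
   using norm_le_l1_cart[of eta]
   by (simp only: power_Suc mult.assoc) (intro mult_right_mono, auto)
  also have "... = (1 + norm eta) ^ K * norm (ft f eta) + (\<Sum>\<alpha>\<in>UNIV. (1 + norm eta) ^ K * norm (ft (pd \<alpha> f) eta))"
   by (simp add: ft_pd[OF Suc.prems] norm_mult algebra_simps sum_distrib_left)
  also have "... \<le> C + (\<Sum>\<alpha>\<in>UNIV. D \<alpha>)" by (intro add_mono C sum_mono D)
  finally show ?thesis .
 qed
 then show ?case by blast
qed

lemma ft_integrable_poly:
 assumes "test_function S (f :: real^'n::finite => complex)"
 shows "integrable lborel (%eta. (1 + norm eta) ^ K * norm (ft f eta))"
proof -
 obtain C where C: "!!eta. (1 + norm eta) ^ (K + 2 * DIM(real^'n)) * norm (ft f eta) \<le> C"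
  using ft_decay[OF assms] by blast
 have [measurable]: "ft f \<in> borel_measurable borel" by (rule ft_test_measurable[OF assms])
 show ?thesis
  by (rule integrable_decay[where C = C]) (use C in \<open>auto simp: power_add mult_ac abs_mult\<close>)
qed

lemma ft_L1:
 assumes "test_function S (f :: real^'n::finite => complex)"
 shows "integrable lborel (ft f)"
 by (rule integrable_norm_cancel)
  (use ft_integrable_poly[OF assms, of 0] ft_test_measurable[OF assms] in simp_all)

text \<open>Supplies the integrability on the product space that Fubini asks for: an oscillating
  factor of modulus at most 1 does no harm to a product of two integrable functions.\<close>

lemma integrable_product_bounded:
 fixes a :: "'a::euclidean_space => complex" and b :: "'b::euclidean_space => complex"
 assumes a: "integrable lborel a" and b: "integrable lborel b"
  and k[measurable]: "(%(x, y). k x y) \<in> borel_measurable (borel \<Otimes>\<^sub>M borel)" and k1: "!!x y. norm (k x y) \<le> 1"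
 shows "integrable (lborel \<Otimes>\<^sub>M lborel) (%(x, y). k x y * (a x * b y) :: complex)"
proof -
 have [measurable]: "a \<in> borel_measurable borel" "b \<in> borel_measurable borel"
  using borel_measurable_integrable[OF a] borel_measurable_integrable[OF b] by auto
 have [measurable]: "(%(x, y). k x y) \<in> borel_measurable (lborel \<Otimes>\<^sub>M lborel)"
  using k by (simp cong: measurable_cong_sets)
 have 1: "integrable (lborel \<Otimes>\<^sub>M lborel) (%(x, y). a x * b y)"
 proof (rule lborel_pair.Fubini_integrable)
  show "(%(x, y). a x * b y) \<in> borel_measurable (lborel \<Otimes>\<^sub>M lborel)" by measurable
  show "integrable lborel (%x. \<integral>y. norm (case (x, y) of (x, y) => a x * b y) \<partial>lborel)"
   using integrable_norm[OF a] by (simp add: norm_mult)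
  show "AE x in lborel. integrable lborel (%y. case (x, y) of (x, y) => a x * b y)"
   using b by simp
 qed
 have "norm (k x y * (a x * b y)) \<le> norm (a x * b y)" for x y
  unfolding norm_mult[of "k x y"] by (intro mult_left_le_one_le k1) auto
 then show ?thesis
  by (intro Bochner_Integration.integrable_bound[OF 1]) auto
qed


subsection \<open>Fourier inversion\<close>

definition gauss :: "'a::euclidean_space => complex" where
 "gauss x = of_real (exp (- (x \<bullet> x) / 2))"

lemma gauss_prod: "gauss (x :: 'a::euclidean_space) = (\<Prod>b\<in>Basis. of_real (exp (- (x \<bullet> b)\<^sup>2 / 2)))"
proof -
 have "- (x \<bullet> x) / 2 = (\<Sum>b\<in>Basis. - (x \<bullet> b)\<^sup>2 / 2)"
  by (subst euclidean_inner) (simp add: sum_divide_distrib[symmetric] sum_negf power2_eq_square)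
 then show ?thesis by (simp add: gauss_def exp_sum)
qed

lemma gauss_measurable[measurable]: "gauss \<in> borel_measurable borel"
 unfolding gauss_def[abs_def] by (auto intro!: borel_measurable_continuous_onI continuous_intros)

lemma cis_inner_prod: "cis (x \<bullet> y) = (\<Prod>b\<in>Basis. cis ((x \<bullet> b) * (y \<bullet> b)))"
 by (subst euclidean_inner) (simp add: cis_conv_exp sum_distrib_left exp_sum)

text \<open>Read off from the characteristic function of the standard normal distribution, whose
  density is the Gaussian divided by sqrt(2 pi).\<close>

lemma gauss_integral_real:
 "integrable lborel (%s::real. cis (t * s) * of_real (exp (- s\<^sup>2 / 2)))"
 "(\<integral>s. cis (t * s) * of_real (exp (- s\<^sup>2 / 2)) \<partial>lborel) = of_real (sqrt (2 * pi) * exp (- t\<^sup>2 / 2))"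
proof -
 have d: "std_normal_density s = exp (- s\<^sup>2 / 2) / sqrt (2 * pi)" for s
  by (simp add: std_normal_density_def)
 have "integrable lborel (%s. sqrt (2 * pi) * std_normal_density s)"
  by (intro integrable_mult_right integrable_normal_density) auto
 then have 1: "integrable lborel (%s::real. exp (- s\<^sup>2 / 2))" by (simp add: d)
 show "integrable lborel (%s::real. cis (t * s) * of_real (exp (- s\<^sup>2 / 2)))"
  by (rule Bochner_Integration.integrable_bound[OF 1]) (auto simp: norm_mult)
 have "char std_normal_distribution t = (\<integral>s. std_normal_density s *\<^sub>R cis (t * s) \<partial>lborel)"
  unfolding char_def by (subst integral_density) (auto simp: cis_conv_exp mult_ac)
 also have "... = (\<integral>s. (1 / sqrt (2 * pi)) *\<^sub>R (cis (t * s) * of_real (exp (- s\<^sup>2 / 2))) \<partial>lborel)"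
  by (intro Bochner_Integration.integral_cong) (auto simp: d scaleR_conv_of_real)
 also have "... = (1 / sqrt (2 * pi)) *\<^sub>R (\<integral>s. cis (t * s) * of_real (exp (- s\<^sup>2 / 2)) \<partial>lborel)"
  by (rule integral_scaleR_right)
 finally have "(1 / sqrt (2 * pi)) *\<^sub>R (\<integral>s. cis (t * s) * of_real (exp (- s\<^sup>2 / 2)) \<partial>lborel) = of_real (exp (- t\<^sup>2 / 2))"
  by (simp add: char_std_normal_distribution)
 then have "sqrt (2 * pi) *\<^sub>R ((1 / sqrt (2 * pi)) *\<^sub>R (\<integral>s. cis (t * s) * of_real (exp (- s\<^sup>2 / 2)) \<partial>lborel)) = sqrt (2 * pi) *\<^sub>R of_real (exp (- t\<^sup>2 / 2))"
  by (rule arg_cong)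
 then show "(\<integral>s. cis (t * s) * of_real (exp (- s\<^sup>2 / 2)) \<partial>lborel) = of_real (sqrt (2 * pi) * exp (- t\<^sup>2 / 2))"
  by (simp add: scaleR_conv_of_real)
qed

lemma gauss_fourier:
 "(\<integral>eta. cis (x \<bullet> eta) * gauss eta \<partial>lborel) = of_real (sqrt (2 * pi) ^ DIM('a)) * gauss (x :: 'a::euclidean_space)"
proof -
 have "(\<integral>eta. cis (x \<bullet> eta) * gauss eta \<partial>lborel) =
   (\<integral>eta. (\<Prod>b\<in>Basis. cis ((x \<bullet> b) * (eta \<bullet> b)) * of_real (exp (- (eta \<bullet> b)\<^sup>2 / 2))) \<partial>lborel)"
  by (simp add: cis_inner_prod gauss_prod prod.distrib)
 also have "... = (\<Prod>b\<in>(Basis :: 'a set). of_real (sqrt (2 * pi) * exp (- (x \<bullet> b)\<^sup>2 / 2)))"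
  by (subst lborel_integral_prod[where f = "%b s. cis ((x \<bullet> b) * s) * of_real (exp (- s\<^sup>2 / 2))"])
   (rule gauss_integral_real(1), simp only: gauss_integral_real(2))
 finally show ?thesis by (simp add: gauss_prod prod.distrib)
qed

text \<open>The Bochner integral of a function that is not integrable is 0 by convention, whereas
  \<open>gauss_fourier\<close> at 0 gives a nonzero value.\<close>

lemma gauss_nonneg_integrable: "integrable lborel (gauss :: 'a::euclidean_space => complex)"
proof (rule ccontr)
 assume "\<not> ?thesis"
 then have "(\<integral>eta. gauss (eta :: 'a) \<partial>lborel) = 0" by (rule not_integrable_integral_eq)
 with gauss_fourier[of "0 :: 'a"] show False by (simp add: gauss_def)
qed

lemma gauss_fourier_scaled:
 assumes "\<epsilon> > 0"
 shows "(\<integral>eta. cis (x \<bullet> eta) * gauss (\<epsilon> *\<^sub>R eta) \<partial>lborel) =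
  of_real (sqrt (2 * pi) ^ DIM('a) / \<epsilon> ^ DIM('a)) * gauss ((1 / \<epsilon>) *\<^sub>R (x :: 'a::euclidean_space))"
proof -
 have "(\<integral>eta. cis (x \<bullet> eta) * gauss (\<epsilon> *\<^sub>R eta) \<partial>lborel) =
   \<bar>1 / \<epsilon>\<bar> ^ DIM('a) *\<^sub>R (\<integral>eta. cis (x \<bullet> (0 + (1 / \<epsilon>) *\<^sub>R eta)) * gauss (\<epsilon> *\<^sub>R (0 + (1 / \<epsilon>) *\<^sub>R eta)) \<partial>lborel)"
  by (rule lborel_integral_affine) (use assms in auto)
 also have "(\<integral>eta. cis (x \<bullet> (0 + (1 / \<epsilon>) *\<^sub>R eta)) * gauss (\<epsilon> *\<^sub>R (0 + (1 / \<epsilon>) *\<^sub>R eta)) \<partial>lborel) =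
   (\<integral>eta. cis (((1 / \<epsilon>) *\<^sub>R x) \<bullet> eta) * gauss eta \<partial>lborel)"
  using assms by simp
 also have "... = of_real (sqrt (2 * pi) ^ DIM('a)) * gauss ((1 / \<epsilon>) *\<^sub>R x)" by (rule gauss_fourier)
 finally show ?thesis using assms by (simp add: scaleR_conv_of_real power_divide field_simps)
qed

lemma norm_gauss_le: "norm (gauss x) \<le> 1"
 by (simp add: gauss_def)

lemma gauss_scaled_tendsto: "(%k. gauss (inverse (real (Suc k)) *\<^sub>R x)) \<longlonglongrightarrow> 1"
proof -
 have "(%k. gauss (inverse (real (Suc k)) *\<^sub>R x)) \<longlonglongrightarrow> gauss (0 *\<^sub>R x)"
  unfolding gauss_def by (intro tendsto_intros LIMSEQ_inverse_real_of_nat) auto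
 then show ?thesis by (simp add: gauss_def)
qed

text \<open>A factor \<open>gauss (\<epsilon> *\<^sub>R eta)\<close> makes the double integral
  absolutely convergent, so that Fubini applies; the integral over \<open>eta\<close> is then a
  Gaussian kernel of width \<epsilon>, and the substitution y = x + \<epsilon> w takes \<epsilon>
  out of the kernel. Both sides converge by dominated convergence along \<epsilon> = 1/(k+1). The
  constant (2 pi)^n is the product of two factors sqrt(2 pi)^n, one from the transform of the
  Gaussian and one from its total mass.\<close>

lemma fourier_inversion:
 fixes f :: "real^'n::finite => complex"
 assumes f: "test_function S f"
 shows "(\<integral>eta. cis (x \<bullet> eta) * ft f eta \<partial>lborel) = of_real ((2 * pi) ^ CARD('n)) * f x"
proof -
 let ?e = "%k. inverse (real (Suc k))"
 let ?G = "of_real (sqrt (2 * pi) ^ CARD('n)) :: complex"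
 have [measurable]: "f \<in> borel_measurable borel" "ft f \<in> borel_measurable borel"
  using borel_measurable_integrable[OF test_function_integrable[OF f]] ft_test_measurable[OF f] by auto
 obtain B where B: "!!y. norm (f y) \<le> B" using test_function_bounded[OF f] by blast
 have gint: "integrable lborel (%eta :: real^'n. gauss (c *\<^sub>R eta))" if "c > 0" for c
  using lborel_integrable_affine[OF gauss_nonneg_integrable, of c "0 :: real^'n"] that by simp
 have eq: "(\<integral>eta. gauss (?e k *\<^sub>R eta) * (cis (x \<bullet> eta) * ft f eta) \<partial>lborel) = ?G * (\<integral>w. f (x + ?e k *\<^sub>R w) * gauss w \<partial>lborel)" for k
 proof -
  have e: "?e k > 0" by simp
  have "(\<integral>eta. gauss (?e k *\<^sub>R eta) * (cis (x \<bullet> eta) * ft f eta) \<partial>lborel) =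
    (\<integral>eta. (\<integral>y. cis ((x - y) \<bullet> eta) * (gauss (?e k *\<^sub>R eta) * f y) \<partial>lborel) \<partial>lborel)"
  proof (rule Bochner_Integration.integral_cong[OF refl])
   fix eta :: "real^'n"
   have "gauss (?e k *\<^sub>R eta) * (cis (x \<bullet> eta) * ft f eta) = (\<integral>y. (gauss (?e k *\<^sub>R eta) * cis (x \<bullet> eta)) * (cis (- (y \<bullet> eta)) * f y) \<partial>lborel)"
    unfolding ft_def by (simp add: mult.assoc)
   also have "... = (\<integral>y. cis ((x - y) \<bullet> eta) * (gauss (?e k *\<^sub>R eta) * f y) \<partial>lborel)"
   proof (rule Bochner_Integration.integral_cong[OF refl])
    fix y :: "real^'n"
    have "cis ((x - y) \<bullet> eta) = cis (x \<bullet> eta) * cis (- (y \<bullet> eta))"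
     by (simp add: cis_mult inner_diff_left)
    then show "gauss (?e k *\<^sub>R eta) * cis (x \<bullet> eta) * (cis (- (y \<bullet> eta)) * f y) = cis ((x - y) \<bullet> eta) * (gauss (?e k *\<^sub>R eta) * f y)"
     by simp
   qed
   finally show "gauss (?e k *\<^sub>R eta) * (cis (x \<bullet> eta) * ft f eta) = (\<integral>y. cis ((x - y) \<bullet> eta) * (gauss (?e k *\<^sub>R eta) * f y) \<partial>lborel)" .
  qed
  also have "... = (\<integral>y. (\<integral>eta. cis ((x - y) \<bullet> eta) * (gauss (?e k *\<^sub>R eta) * f y) \<partial>lborel) \<partial>lborel)"
  proof (rule lborel_pair.Fubini_integral[symmetric])
   have "integrable (lborel \<Otimes>\<^sub>M lborel) (%(eta, y). cis ((x - y) \<bullet> eta) * (gauss (?e k *\<^sub>R eta) * f y))"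
    by (rule integrable_product_bounded[OF gint[OF e] test_function_integrable[OF f]])
     (auto simp: borel_prod case_prod_unfold intro!: borel_measurable_continuous_onI continuous_intros)
   then show "integrable (lborel \<Otimes>\<^sub>M lborel) (%(eta, y). cis ((x - y) \<bullet> eta) * (gauss (?e k *\<^sub>R eta) * f y))" .
  qed
  also have "... = (\<integral>y. of_real (sqrt (2 * pi) ^ CARD('n) / ?e k ^ CARD('n)) * (gauss ((1 / ?e k) *\<^sub>R (x - y)) * f y) \<partial>lborel)"
  proof (rule Bochner_Integration.integral_cong[OF refl])
   fix y :: "real^'n"
   have "(\<integral>eta. cis ((x - y) \<bullet> eta) * (gauss (?e k *\<^sub>R eta) * f y) \<partial>lborel) = (\<integral>eta. cis ((x - y) \<bullet> eta) * gauss (?e k *\<^sub>R eta) \<partial>lborel) * f y"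
    by (simp only: mult.assoc[symmetric] integral_mult_left_zero)
   then show "(\<integral>eta. cis ((x - y) \<bullet> eta) * (gauss (?e k *\<^sub>R eta) * f y) \<partial>lborel) =
     of_real (sqrt (2 * pi) ^ CARD('n) / ?e k ^ CARD('n)) * (gauss ((1 / ?e k) *\<^sub>R (x - y)) * f y)"
    using gauss_fourier_scaled[OF e, of "x - y"] by (simp only: mult.assoc DIM_cart DIM_real mult_1_right)
  qed
  also have "... = \<bar>?e k\<bar> ^ DIM(real^'n) *\<^sub>R (\<integral>w. of_real (sqrt (2 * pi) ^ CARD('n) / ?e k ^ CARD('n)) * (gauss ((1 / ?e k) *\<^sub>R (x - (x + ?e k *\<^sub>R w))) * f (x + ?e k *\<^sub>R w)) \<partial>lborel)"
   by (rule lborel_integral_affine) auto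
  also have "(\<integral>w. of_real (sqrt (2 * pi) ^ CARD('n) / ?e k ^ CARD('n)) * (gauss ((1 / ?e k) *\<^sub>R (x - (x + ?e k *\<^sub>R w))) * f (x + ?e k *\<^sub>R w)) \<partial>lborel) =
    (\<integral>w. of_real (sqrt (2 * pi) ^ CARD('n) / ?e k ^ CARD('n)) * (f (x + ?e k *\<^sub>R w) * gauss w) \<partial>lborel)"
   using e by (intro Bochner_Integration.integral_cong) (auto simp: gauss_def)
  also have "... = of_real (sqrt (2 * pi) ^ CARD('n) / ?e k ^ CARD('n)) * (\<integral>w. f (x + ?e k *\<^sub>R w) * gauss w \<partial>lborel)"
   by (rule integral_mult_right_zero)
  finally show ?thesis using e by (simp add: scaleR_conv_of_real mult.assoc[symmetric] del: of_nat_Suc)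
 qed
 have L: "(%k. \<integral>eta. gauss (?e k *\<^sub>R eta) * (cis (x \<bullet> eta) * ft f eta) \<partial>lborel) \<longlonglongrightarrow> (\<integral>eta. 1 * (cis (x \<bullet> eta) * ft f eta) \<partial>lborel)"
 proof (rule integral_dominated_convergence[where w = "%eta. norm (ft f eta)"])
  show "integrable lborel (%eta. norm (ft f eta))" using ft_L1[OF f] by simp
  show "AE eta in lborel. norm (gauss (?e k *\<^sub>R eta) * (cis (x \<bullet> eta) * ft f eta)) \<le> norm (ft f eta)" for k
   by (auto simp: norm_mult intro!: mult_left_le_one_le norm_gauss_le)
  show "AE eta in lborel. (%k. gauss (?e k *\<^sub>R eta) * (cis (x \<bullet> eta) * ft f eta)) \<longlonglongrightarrow> 1 * (cis (x \<bullet> eta) * ft f eta)"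
   by (intro AE_I2 tendsto_mult[OF gauss_scaled_tendsto tendsto_const])
 qed auto
 have cf: "isCont f x"
  using smooth_on_continuous[OF test_function_smooth[OF f]] by (simp add: continuous_on_eq_continuous_at)
 have R: "(%k. \<integral>w. f (x + ?e k *\<^sub>R w) * gauss w \<partial>lborel) \<longlonglongrightarrow> (\<integral>w. f x * gauss w \<partial>(lborel :: (real^'n) measure))"
 proof (rule integral_dominated_convergence[where w = "%w :: real^'n. B * norm (gauss w)"])
  show "integrable lborel (%w :: real^'n. B * norm (gauss w))"
   using gauss_nonneg_integrable by (intro integrable_mult_right integrable_norm)
  show "AE w in lborel. norm (f (x + ?e k *\<^sub>R w) * gauss w) \<le> B * norm (gauss w)" for k
   by (auto simp: norm_mult intro!: mult_right_mono B)
  show "AE w in lborel. (%k. f (x + ?e k *\<^sub>R w) * gauss w) \<longlonglongrightarrow> f x * gauss w"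
  proof (rule AE_I2)
   fix w :: "real^'n"
   have "(%k. x + ?e k *\<^sub>R w) \<longlonglongrightarrow> x + 0 *\<^sub>R w"
    by (intro tendsto_intros LIMSEQ_inverse_real_of_nat)
   then have "(%k. f (x + ?e k *\<^sub>R w)) \<longlonglongrightarrow> f x" using isCont_tendsto_compose[OF cf] by simp
   then show "(%k. f (x + ?e k *\<^sub>R w) * gauss w) \<longlonglongrightarrow> f x * gauss w" by (intro tendsto_intros)
  qed
 qed auto
 have "(\<integral>eta. 1 * (cis (x \<bullet> eta) * ft f eta) \<partial>lborel) = ?G * (\<integral>w. f x * gauss w \<partial>(lborel :: (real^'n) measure))"
  by (rule LIMSEQ_unique[OF L]) (simp only: eq tendsto_mult[OF tendsto_const R])
 also have "(\<integral>w. f x * gauss (w :: real^'n) \<partial>lborel) = f x * ?G"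
  using gauss_fourier[of "0 :: real^'n"] by (simp add: gauss_def[of 0])
 also have "?G * (f x * ?G) = of_real ((2 * pi) ^ CARD('n)) * f x"
 proof -
  have "sqrt (2 * pi) ^ CARD('n) * sqrt (2 * pi) ^ CARD('n) = (2 * pi) ^ CARD('n)"
   by (subst power_mult_distrib[symmetric]) (simp only: real_sqrt_mult_self abs_of_pos[of "2 * pi"], simp)
  then have "?G * ?G = of_real ((2 * pi) ^ CARD('n))" by (simp only: of_real_mult[symmetric])
  moreover have "?G * (f x * ?G) = (?G * ?G) * f x" by (simp only: ac_simps)
  ultimately show ?thesis by simp
 qed
 finally show ?thesis by simp
qed

subsection \<open>Symbol estimates\<close>

text \<open>The same estimates as in \<open>symbol_bound\<close>, but organised by peeling off the innermost
 derivative: this is what makes the closure properties below plain inductions.\<close>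

primrec SB :: "nat => real => (real^'n::finite) set => (real^'n => real^'n => 'b::real_normed_vector) => bool" where
 "SB 0 d S a \<longleftrightarrow> (\<exists>C. \<forall>x. \<forall>ksi\<in>S. norm (a x ksi) \<le> C * (1 + norm ksi) powr d)"
| "SB (Suc k) d S a \<longleftrightarrow> (\<exists>C. \<forall>x. \<forall>ksi\<in>S. norm (a x ksi) \<le> C * (1 + norm ksi) powr d) \<and>
   (\<forall>\<alpha>. SB k (d - 1) S (d\<xi> \<alpha> a) \<and> SB k d S (dx \<alpha> a))"

text \<open>Two sets of covectors are kept apart: smoothness is required over \<open>Z\<close>, the
  estimates only over \<open>S\<close>. Symbols of operators use \<open>UNIV\<close> for both;
  expansions into homogeneous components, which are singular at 0, use the complement of 0 for
  \<open>Z\<close> and the covectors of norm at least 1 for \<open>S\<close>.\<close>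

definition symb_on :: "(real^'n::finite) set => (real^'n) set => real => (real^'n => real^'n => 'b::real_normed_vector) => bool" where
 "symb_on Z S d a \<longleftrightarrow> smooth2 (UNIV \<times> Z) a \<and> (\<forall>k. SB k d S a)"

lemma SB_bound: "SB k d S a ==> \<exists>C. \<forall>x. \<forall>ksi\<in>S. norm (a x ksi) \<le> C * (1 + norm ksi) powr d"
 by (cases k) auto

lemma symb_on_smooth: "symb_on Z S d a ==> smooth2 (UNIV \<times> Z) a"
 by (simp add: symb_on_def)

lemma symb_on_bound:
 assumes "symb_on Z S d a" shows "\<exists>C\<ge>0. \<forall>x. \<forall>ksi\<in>S. norm (a x ksi) \<le> C * (1 + norm ksi) powr d"
proof -
 have "SB 0 d S a" using assms by (simp add: symb_on_def)
 then obtain C where C: "!!x ksi. ksi \<in> S ==> norm (a x ksi) \<le> C * (1 + norm ksi) powr d" by auto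
 have "norm (a x ksi) \<le> max C 0 * (1 + norm ksi) powr d" if "ksi \<in> S" for x ksi
  using order_trans[OF C[OF that] mult_right_mono[of C "max C 0"]] by simp
 then show ?thesis by (intro exI[of _ "max C 0"]) simp
qed

lemma SB_cong:
 assumes "open Z" "S \<subseteq> Z" "!!x ksi. ksi \<in> Z ==> a x ksi = b x ksi" "SB k d S a"
 shows "SB k d S b"
 using assms(3,4)
proof (induction k arbitrary: d a b)
 case 0
 then show ?case using assms(2) by (metis SB.simps(1) subsetD)
next
 case (Suc k)
 have W: "open (UNIV \<times> Z)" using assms(1) by (simp add: open_Times)
 have "SB k (d - 1) S (d\<xi> \<alpha> b)" for \<alpha>
  by (rule Suc.IH[of "d\<xi> \<alpha> a"]) (use Suc.prems d\<xi>_cong[OF W, of _ _ a b] in auto)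
 moreover have "SB k d S (dx \<alpha> b)" for \<alpha>
  by (rule Suc.IH[of "dx \<alpha> a"]) (use Suc.prems dx_cong[OF W, of _ _ a b] in auto)
 moreover have "\<exists>C. \<forall>x. \<forall>ksi\<in>S. norm (b x ksi) \<le> C * (1 + norm ksi) powr d"
  using Suc.prems assms(2) by (auto simp: subset_iff)
 ultimately show ?case by simp
qed

lemma symb_on_cong:
 assumes "open Z" "S \<subseteq> Z" "!!x ksi. ksi \<in> Z ==> a x ksi = b x ksi" "symb_on Z S d a"
 shows "symb_on Z S d b"
 using assms SB_cong[OF assms(1-3)] smooth_on_cong[of "UNIV \<times> Z" "%(x, ksi). a x ksi" "%(x, ksi). b x ksi"]
 by (auto simp: symb_on_def open_Times)

lemma symb_on_d\<xi>: "open Z ==> symb_on Z S d a ==> symb_on Z S (d - 1) (d\<xi> \<alpha> a)"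
 unfolding symb_on_def by (metis SB.simps(2) open_Times open_UNIV smooth2_d\<xi>)

lemma symb_on_dx: "open Z ==> symb_on Z S d a ==> symb_on Z S d (dx \<alpha> a)"
 unfolding symb_on_def by (metis SB.simps(2) open_Times open_UNIV smooth2_dx)

lemma powr_one_plus_norm_mono: "d \<le> e ==> (1 + norm ksi) powr d \<le> (1 + norm ksi) powr e"
 by (rule powr_mono) auto

lemma SB_mono: "SB k d S a ==> d \<le> e ==> SB k e S a"
proof (induction k arbitrary: d e a)
 case (Suc k)
 have "SB 0 e S a"
 proof -
  obtain C where C: "!!x ksi. ksi \<in> S ==> norm (a x ksi) \<le> C * (1 + norm ksi) powr d" using Suc.prems by auto
  have "norm (a x ksi) \<le> max C 0 * (1 + norm ksi) powr e" if "ksi \<in> S" for x ksi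
  proof -
   have "C * (1 + norm ksi) powr d \<le> max C 0 * (1 + norm ksi) powr e"
    by (intro mult_mono powr_one_plus_norm_mono \<open>d \<le> e\<close>) auto
   with C[OF that, of x] show ?thesis by linarith
  qed
  then show ?thesis by auto
 qed
 moreover have "SB k (e - 1) S (d\<xi> \<alpha> a)" "SB k e S (dx \<alpha> a)" for \<alpha>
  using Suc.IH[of "d - 1" "d\<xi> \<alpha> a" "e - 1"] Suc.IH[of d "dx \<alpha> a" e] Suc.prems by auto
 ultimately show ?case by simp
next
 case 0
 then obtain C where C: "!!x ksi. ksi \<in> S ==> norm (a x ksi) \<le> C * (1 + norm ksi) powr d" by auto
 have "norm (a x ksi) \<le> max C 0 * (1 + norm ksi) powr e" if "ksi \<in> S" for x ksi
 proof -
  have "C * (1 + norm ksi) powr d \<le> max C 0 * (1 + norm ksi) powr e"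
   by (intro mult_mono powr_one_plus_norm_mono \<open>d \<le> e\<close>) auto
  with C[OF that, of x] show ?thesis by linarith
 qed
 then show ?case by auto
qed

lemma symb_on_mono: "symb_on Z S d a ==> d \<le> e ==> symb_on Z S e a"
 by (auto simp: symb_on_def intro: SB_mono)

lemma symb_on_restrict:
 fixes a :: "real^'n::finite => real^'n => 'b::real_normed_vector"
 assumes "symb_on Z S d a" "Z' \<subseteq> Z" "S' \<subseteq> S" shows "symb_on Z' S' d a"
proof -
 have "SB k d S' a" if "SB k d S a" for k d and a :: "real^'n => real^'n => 'b"
  using that
 proof (induction k arbitrary: d a)
  have *: "\<exists>C. \<forall>x. \<forall>ksi\<in>S'. norm (a x ksi) \<le> C * (1 + norm ksi) powr d"
   if "SB k d S a" for k d and a :: "real^'n => real^'n => 'b"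
   using SB_bound[OF that] assms(3) by (meson subsetD)
  {
   case 0
   then show ?case using *[of 0 d a] by simp
  next
   case (Suc k)
   then show ?case using *[of "Suc k" d a] by simp
  }
 qed
 then show ?thesis using assms by (auto simp: symb_on_def intro: smooth_on_subset)
qed

lemma dx_const: "dx \<alpha> (%x ksi. c) = (%x ksi. 0)" and d\<xi>_const: "d\<xi> \<alpha> (%x ksi. g x) = (%x ksi. 0)"
 by (auto simp: fun_eq_iff dx_def d\<xi>_def)

lemma SB_zero: "SB k d S (%x ksi. 0)"
proof (induction k arbitrary: d)
 case 0
 show ?case by (auto intro: exI[of _ 0])
next
 case (Suc k)
 then show ?case by (auto simp: dx_const d\<xi>_const intro: exI[of _ 0])
qed

lemma symb_on_zero: "open Z ==> symb_on Z S d (%x ksi. 0)"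
 by (auto simp: symb_on_def SB_zero case_prod_unfold intro: smooth_on_const open_Times)

lemma smooth2_of_x: "open W ==> smooth_on UNIV g ==> smooth2 W (%x ksi. g x)"
 for g :: "real^'n::finite => 'b::real_normed_vector"
 by (auto simp: case_prod_unfold intro: smooth_on_compose[OF _ _ smooth_on_fst, of W UNIV g])

lemma dx_of_x: "g differentiable (at x) ==> dx \<alpha> (%x ksi. g x) x ksi = pd \<alpha> g x"
proof -
 assume "g differentiable (at x)"
 then have g: "(g has_derivative frechet_derivative g (at x)) (at x)" by (simp add: frechet_derivative_works)
 have "((%z. g (fst z)) has_derivative (%v. frechet_derivative g (at x) (fst v))) (at (x, ksi))"
  using diff_chain_at[of fst fst "(x, ksi)" g "frechet_derivative g (at x)"] g
  by (simp add: o_def bounded_linear_imp_has_derivative[OF bounded_linear_fst])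
 then have "((%(x, ksi). g x) has_derivative (%v. frechet_derivative g (at x) (fst v))) (at (x, ksi))"
  by (simp add: case_prod_unfold)
 from dx_eqI[OF this] show ?thesis by (simp add: pd_def)
qed

lemma symb_on_test:
 assumes "open Z" "test_function U g" shows "symb_on Z S 0 (%x ksi. g x)"
proof -
 have "SB k 0 S (%x ksi. g x)" for k using assms(2)
 proof (induction k arbitrary: g)
  have *: "\<exists>C. \<forall>x. \<forall>ksi\<in>S. norm (g x) \<le> C * (1 + norm ksi) powr 0" if g: "test_function U g" for g :: "real^'a => 'b"
  proof -
   obtain B where "!!x. norm (g x) \<le> B" using test_function_bounded[OF g] by blast
   then show ?thesis by (intro exI[of _ B]) (auto simp: powr_zero_eq_one add_nonneg_eq_0_iff)
  qed
  {
   case 0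
   then show ?case using * by auto
  next
   case (Suc k)
   have "dx \<alpha> (%x ksi. g x) = (%x ksi. pd \<alpha> g x)" for \<alpha>
    using Suc.prems by (intro ext dx_of_x smooth_on_differentiable[OF test_function_smooth]) auto
   then show ?case using *[OF Suc.prems] Suc.IH[OF test_function_pd[OF Suc.prems]] SB_zero[of k "-1" S]
    by (simp add: d\<xi>_const)
  }
 qed
 then show ?thesis using assms
  by (auto simp: symb_on_def intro: smooth2_of_x test_function_smooth open_Times)
qed

lemma symb_on_bounded_linear:
 assumes "open Z" "S \<subseteq> Z" "bounded_linear L" "symb_on Z S d a"
 shows "symb_on Z S d (%x ksi. L (a x ksi))"
proof -
 have W: "open (UNIV \<times> Z)" using assms(1) by (simp add: open_Times)
 obtain K where K: "K > 0" "!!x. norm (L x) \<le> norm x * K" using bounded_linear.pos_bounded[OF assms(3)] by blast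
 have bd: "\<exists>C. \<forall>x. \<forall>ksi\<in>S. norm (L (a x ksi)) \<le> C * (1 + norm ksi) powr d" if a: "symb_on Z S d a" for d a
 proof -
  obtain C where "C \<ge> 0" and C: "!!x ksi. ksi \<in> S ==> norm (a x ksi) \<le> C * (1 + norm ksi) powr d" using symb_on_bound[OF a] by blast
  have "norm (L (a x ksi)) \<le> (C * K) * (1 + norm ksi) powr d" if "ksi \<in> S" for x ksi
   using order_trans[OF K(2) mult_right_mono[OF C[OF that, of x] less_imp_le[OF K(1)]]] by (simp add: mult_ac)
  then show ?thesis by blast
 qed
 have "SB k d S (%x ksi. L (a x ksi))" for k using assms(4)
 proof (induction k arbitrary: d a)
  case 0
  then show ?case using bd by simp
 next
  case (Suc k)
  have "SB k (d - 1) S (d\<xi> \<alpha> (%x ksi. L (a x ksi)))" for \<alpha>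
   by (rule SB_cong[OF assms(1,2) _ Suc.IH[OF symb_on_d\<xi>[OF assms(1) Suc.prems, of \<alpha>]]])
    (use d\<xi>_bounded_linear[OF assms(3) symb_on_smooth[OF Suc.prems]] in simp)
  moreover have "SB k d S (dx \<alpha> (%x ksi. L (a x ksi)))" for \<alpha>
   by (rule SB_cong[OF assms(1,2) _ Suc.IH[OF symb_on_dx[OF assms(1) Suc.prems, of \<alpha>]]])
    (use dx_bounded_linear[OF assms(3) symb_on_smooth[OF Suc.prems]] in simp)
  ultimately show ?case using bd[OF Suc.prems] by simp
 qed
 then show ?thesis using smooth_on_bounded_linear[OF assms(3) W symb_on_smooth[OF assms(4)]]
  by (simp add: symb_on_def case_prod_unfold)
qed

lemma SB_add:
 assumes "open Z" "S \<subseteq> Z" "smooth2 (UNIV \<times> Z) f" "smooth2 (UNIV \<times> Z) g" "SB k d S f" "SB k d S g"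
 shows "SB k d S (%x ksi. f x ksi + g x ksi)"
 using assms(3-6)
proof (induction k arbitrary: d f g)
 have W: "open (UNIV \<times> Z)" using assms(1) by (simp add: open_Times)
 have *: "\<exists>C. \<forall>x. \<forall>ksi\<in>S. norm (a x ksi + b x ksi) \<le> C * (1 + norm ksi) powr d"
  if ab: "SB k d S a" "SB k d S b" for d k a b
 proof -
  obtain C where C: "!!x ksi. ksi \<in> S ==> norm (a x ksi) \<le> C * (1 + norm ksi) powr d" using SB_bound[OF ab(1)] by blast
  obtain D where D: "!!x ksi. ksi \<in> S ==> norm (b x ksi) \<le> D * (1 + norm ksi) powr d" using SB_bound[OF ab(2)] by blast
  have "norm (a x ksi + b x ksi) \<le> (C + D) * (1 + norm ksi) powr d" if "ksi \<in> S" for x ksi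
   using order_trans[OF norm_triangle_ineq add_mono[OF C[OF that, of x] D[OF that, of x]]] by (simp add: algebra_simps)
  then show ?thesis by blast
 qed
 {
  case 0
  then show ?case using *[of 0 d f g] by simp
 next
  case (Suc k)
  have "SB k (d - 1) S (d\<xi> \<alpha> (%x ksi. f x ksi + g x ksi))" for \<alpha>
   by (rule SB_cong[OF assms(1,2) _ Suc.IH[OF smooth2_d\<xi>[OF W Suc.prems(1)] smooth2_d\<xi>[OF W Suc.prems(2)]]])
    (use Suc.prems d\<xi>_add[OF Suc.prems(1,2)] in auto)
  moreover have "SB k d S (dx \<alpha> (%x ksi. f x ksi + g x ksi))" for \<alpha>
   by (rule SB_cong[OF assms(1,2) _ Suc.IH[OF smooth2_dx[OF W Suc.prems(1)] smooth2_dx[OF W Suc.prems(2)]]])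
    (use Suc.prems dx_add[OF Suc.prems(1,2)] in auto)
  ultimately show ?case using *[OF Suc.prems(3,4)] by simp
 }
qed

lemma symb_on_add:
 assumes "open Z" "S \<subseteq> Z" "symb_on Z S d a" "symb_on Z S d b"
 shows "symb_on Z S d (%x ksi. a x ksi + b x ksi)"
 unfolding symb_on_def
proof (intro conjI allI)
 show "smooth2 (UNIV \<times> Z) (%x ksi. a x ksi + b x ksi)"
  using smooth_on_add[OF _ symb_on_smooth[OF assms(3)] symb_on_smooth[OF assms(4)]] assms(1)
  by (simp add: case_prod_unfold open_Times)
 show "SB k d S (%x ksi. a x ksi + b x ksi)" for k
  by (rule SB_add[OF assms(1,2)]) (use assms(3,4) in \<open>simp_all add: symb_on_def\<close>)
qed

lemma symb_on_sum:
 assumes "open Z" "S \<subseteq> Z" "!!i. i \<in> I ==> symb_on Z S d (a i)"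
 shows "symb_on Z S d (%x ksi. \<Sum>i\<in>I. a i x ksi)"
 using assms(3)
proof (induction I rule: infinite_finite_induct)
 case (insert i I)
 then show ?case using symb_on_add[OF assms(1,2), of d "a i"] by simp
qed (simp_all add: symb_on_zero assms(1))

lemma symb_on_minus:
 "open Z ==> S \<subseteq> Z ==> symb_on Z S d a ==> symb_on Z S d (%x ksi. - a x ksi)"
 by (rule symb_on_bounded_linear[OF _ _ bounded_linear_minus[OF bounded_linear_ident]])

lemma symb_on_diff:
 "open Z ==> S \<subseteq> Z ==> symb_on Z S d a ==> symb_on Z S d b ==> symb_on Z S d (%x ksi. a x ksi - b x ksi)"
 using symb_on_add[of Z S d a "%x ksi. - b x ksi"] symb_on_minus[of Z S d b] by simp

text \<open>Leibniz rule: a derivative of the product is a sum of two products of the same kind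
  whose orders add up to the order required of the derivative, so the induction runs over all
  \<open>a\<close>, \<open>b\<close>, \<open>d\<close> and \<open>e\<close> at once.\<close>

lemma symb_on_bilinear:
 assumes "open Z" "S \<subseteq> Z" "bounded_bilinear pr" "symb_on Z S d a" "symb_on Z S e b"
 shows "symb_on Z S (d + e) (%x ksi. pr (a x ksi) (b x ksi))"
proof -
 have W: "open (UNIV \<times> Z)" using assms(1) by (simp add: open_Times)
 obtain K where K: "K > 0" "!!x y. norm (pr x y) \<le> norm x * norm y * K" using bounded_bilinear.pos_bounded[OF assms(3)] by blast
 have bd: "\<exists>C. \<forall>x. \<forall>ksi\<in>S. norm (pr (a x ksi) (b x ksi)) \<le> C * (1 + norm ksi) powr (d + e)"
  if a: "symb_on Z S d a" and b: "symb_on Z S e b" for d e a b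
 proof -
  obtain C where C: "C \<ge> 0" "!!x ksi. ksi \<in> S ==> norm (a x ksi) \<le> C * (1 + norm ksi) powr d" using symb_on_bound[OF a] by blast
  obtain D where D: "D \<ge> 0" "!!x ksi. ksi \<in> S ==> norm (b x ksi) \<le> D * (1 + norm ksi) powr e" using symb_on_bound[OF b] by blast
  have "norm (pr (a x ksi) (b x ksi)) \<le> (C * D * K) * (1 + norm ksi) powr (d + e)" if "ksi \<in> S" for x ksi
  proof -
   have "norm (a x ksi) * norm (b x ksi) \<le> (C * (1 + norm ksi) powr d) * (D * (1 + norm ksi) powr e)"
    by (intro mult_mono C(2) D(2) that mult_nonneg_nonneg C(1)) auto
   then have "norm (a x ksi) * norm (b x ksi) * K \<le> (C * (1 + norm ksi) powr d) * (D * (1 + norm ksi) powr e) * K"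
    using K(1) by (intro mult_right_mono) auto
   then show ?thesis using K(2)[of "a x ksi" "b x ksi"] by (simp add: powr_add mult_ac)
  qed
  then show ?thesis by blast
 qed
 have sm: "smooth2 (UNIV \<times> Z) (%x ksi. pr (a x ksi) (b x ksi))" if a: "symb_on Z S d a" and b: "symb_on Z S e b" for d e a b
  using smooth_on_bilinear[OF assms(3) W symb_on_smooth[OF a] symb_on_smooth[OF b]] by (simp add: case_prod_unfold)
 have "SB k (d + e) S (%x ksi. pr (a x ksi) (b x ksi))" for k using assms(4,5)
 proof (induction k arbitrary: d e a b)
  case 0
  then show ?case using bd by simp
 next
  case (Suc k)
  note d\<xi>' = symb_on_d\<xi>[OF assms(1) Suc.prems(1)] symb_on_d\<xi>[OF assms(1) Suc.prems(2)]
  note dx' = symb_on_dx[OF assms(1) Suc.prems(1)] symb_on_dx[OF assms(1) Suc.prems(2)]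
  have e1: "d - 1 + e = d + e - 1" "d + (e - 1) = d + e - 1" by auto
  have "SB k (d + e - 1) S (d\<xi> \<alpha> (%x ksi. pr (a x ksi) (b x ksi)))" for \<alpha>
   by (rule SB_cong[OF assms(1,2) _ SB_add[OF assms(1,2) sm[OF d\<xi>'(1) Suc.prems(2)] sm[OF Suc.prems(1) d\<xi>'(2)]
      Suc.IH[OF d\<xi>'(1) Suc.prems(2), unfolded e1] Suc.IH[OF Suc.prems(1) d\<xi>'(2), unfolded e1]]])
    (use d\<xi>_bilinear[OF assms(3) symb_on_smooth[OF Suc.prems(1)] symb_on_smooth[OF Suc.prems(2)]] in simp)
  moreover have "SB k (d + e) S (dx \<alpha> (%x ksi. pr (a x ksi) (b x ksi)))" for \<alpha>
   by (rule SB_cong[OF assms(1,2) _ SB_add[OF assms(1,2) sm[OF dx'(1) Suc.prems(2)] sm[OF Suc.prems(1) dx'(2)]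
      Suc.IH[OF dx'(1) Suc.prems(2)] Suc.IH[OF Suc.prems(1) dx'(2)]]])
    (use dx_bilinear[OF assms(3) symb_on_smooth[OF Suc.prems(1)] symb_on_smooth[OF Suc.prems(2)]] in simp)
  ultimately show ?case using bd[OF Suc.prems] by simp
 qed
 then show ?thesis using sm[OF assms(4,5)] by (simp add: symb_on_def)
qed

lemma symb_on_vec:
 fixes a :: "real^'n::finite => real^'n => 'b::real_normed_vector^'m::finite"
 assumes "open Z" "S \<subseteq> Z" "!!i. symb_on Z S d (%x ksi. a x ksi $ i)"
 shows "symb_on Z S d a"
proof -
 have "symb_on Z S d (%x ksi. \<Sum>i\<in>UNIV. axis i (a x ksi $ i))"
  by (intro symb_on_sum symb_on_bounded_linear[OF _ _ bounded_linear_axis] assms)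
 then show ?thesis by (simp add: sum_axis)
qed

lemma symb_on_nth:
 "open Z ==> S \<subseteq> Z ==> symb_on Z S d a ==> symb_on Z S d (%x ksi. a x ksi $ i)"
 by (rule symb_on_bounded_linear[OF _ _ bounded_linear_vec_nth])

text \<open>\<open>symbol_bound\<close> applies all \<open>d\<xi>\<close> before all
  \<open>dx\<close>, while \<open>SB\<close> peels off the innermost derivative of either kind. To
  pass from the first form to the second, an innermost \<open>dx\<close> has to be carried past the
  list of \<open>d\<xi>\<close> by symmetry of second derivatives (\<open>comm\<close>); as this
  equality holds only over \<open>Z\<close>, it is used through the congruence
  \<open>cong_dx\<close>.\<close>

lemma symbol_bound_iff:
 fixes a :: "('n::finite, 'm::finite) symb"
 assumes Z: "open Z" "S \<subseteq> Z" and sm: "smooth2 (UNIV \<times> Z) a"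
 shows "symbol_bound d S a \<longleftrightarrow> (\<forall>k. SB k d S a)"
proof
 have W: "open (UNIV \<times> Z)" using Z by (simp add: open_Times)
 have cong_dx: "foldr dx \<beta> f x ksi = foldr dx \<beta> g x ksi"
  if "!!x ksi. ksi \<in> Z ==> f x ksi = g x ksi" "ksi \<in> Z" for f g :: "('n, 'm) symb" and \<beta> x ksi
  using that
 proof (induction \<beta> arbitrary: x ksi)
  case (Cons \<gamma> \<beta>)
  then show ?case by (auto intro!: dx_cong[OF W])
 qed auto
 have sm_d\<xi>: "smooth2 (UNIV \<times> Z) (foldr d\<xi> \<alpha> a)" if "smooth2 (UNIV \<times> Z) a" for \<alpha> and a :: "('n, 'm) symb"
  using that by (induction \<alpha>) (auto intro: smooth2_d\<xi>[OF W])
 have comm: "foldr d\<xi> \<alpha> (dx \<gamma> a) x ksi = dx \<gamma> (foldr d\<xi> \<alpha> a) x ksi" if "smooth2 (UNIV \<times> Z) a" "ksi \<in> Z" for a :: "('n, 'm) symb" and x ksi \<alpha> \<gamma>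
  using that(2)
 proof (induction \<alpha> arbitrary: x ksi)
  case (Cons \<delta> \<alpha>)
  have "d\<xi> \<delta> (foldr d\<xi> \<alpha> (dx \<gamma> a)) x ksi = d\<xi> \<delta> (dx \<gamma> (foldr d\<xi> \<alpha> a)) x ksi"
   by (rule d\<xi>_cong[OF W]) (use Cons in auto)
  also have "... = dx \<gamma> (d\<xi> \<delta> (foldr d\<xi> \<alpha> a)) x ksi"
   by (rule d\<xi>_dx_commute[OF W _ sm_d\<xi>[OF that(1)]]) (use Cons in auto)
  finally show ?case by simp
 qed auto
 show "\<forall>k. SB k d S a" if "symbol_bound d S a"
 proof
  fix k show "SB k d S a" using that sm
  proof (induction k arbitrary: d a)
   case 0
   then show ?case unfolding symbol_bound_def by (force dest!: spec[of _ "[]"])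
  next
   case (Suc k)
   have 1: "\<exists>C. \<forall>x. \<forall>ksi\<in>S. norm (a x ksi) \<le> C * (1 + norm ksi) powr d"
    using Suc.prems(1) unfolding symbol_bound_def by (force dest!: spec[of _ "[]"])
   have "symbol_bound (d - 1) S (d\<xi> \<gamma> a)" for \<gamma>
    unfolding symbol_bound_def
   proof (intro allI)
    fix \<alpha> \<beta>
    obtain C where "\<forall>x. \<forall>ksi\<in>S. norm (foldr dx \<beta> (foldr d\<xi> (\<alpha> @ [\<gamma>]) a) x ksi) \<le> C * (1 + norm ksi) powr (d - real (length (\<alpha> @ [\<gamma>])))"
     using Suc.prems(1) unfolding symbol_bound_def by blast
    then show "\<exists>C. \<forall>x. \<forall>ksi\<in>S. norm (foldr dx \<beta> (foldr d\<xi> \<alpha> (d\<xi> \<gamma> a)) x ksi) \<le> C * (1 + norm ksi) powr (d - 1 - real (length \<alpha>))"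
     by (intro exI[of _ C]) (simp add: diff_diff_eq add.commute)
   qed
   moreover have "symbol_bound d S (dx \<gamma> a)" for \<gamma>
    unfolding symbol_bound_def
   proof (intro allI)
    fix \<alpha> \<beta>
    obtain C where C: "\<forall>x. \<forall>ksi\<in>S. norm (foldr dx (\<beta> @ [\<gamma>]) (foldr d\<xi> \<alpha> a) x ksi) \<le> C * (1 + norm ksi) powr (d - real (length \<alpha>))"
     using Suc.prems(1) unfolding symbol_bound_def by blast
    have "foldr dx \<beta> (foldr d\<xi> \<alpha> (dx \<gamma> a)) x ksi = foldr dx (\<beta> @ [\<gamma>]) (foldr d\<xi> \<alpha> a) x ksi" if "ksi \<in> S" for x ksi
     using cong_dx[of "foldr d\<xi> \<alpha> (dx \<gamma> a)" "dx \<gamma> (foldr d\<xi> \<alpha> a)" ksi \<beta> x] comm[OF Suc.prems(2)] that Z(2) by auto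
    with C show "\<exists>C. \<forall>x. \<forall>ksi\<in>S. norm (foldr dx \<beta> (foldr d\<xi> \<alpha> (dx \<gamma> a)) x ksi) \<le> C * (1 + norm ksi) powr (d - real (length \<alpha>))"
     by (intro exI[of _ C]) simp
   qed
   ultimately show ?case
    using 1 Suc.IH smooth2_d\<xi>[OF W Suc.prems(2)] smooth2_dx[OF W Suc.prems(2)] by simp
  qed
 qed
 show "symbol_bound d S a" if "\<forall>k. SB k d S a"
  unfolding symbol_bound_def
 proof (intro allI)
  fix \<alpha> \<beta> :: "'n list"
  have x: "\<forall>k. SB k d S (foldr dx \<beta> a)" if "\<forall>k. SB k d S a" for a :: "('n, 'm) symb" and d
   using that
  proof (induction \<beta> arbitrary: a rule: rev_induct)
   case (snoc \<gamma> \<beta>)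
   have "\<forall>k. SB k d S (dx \<gamma> a)" using snoc.prems by (metis SB.simps(2))
   from snoc.IH[OF this] show ?case by simp
  qed auto
  have xi: "\<forall>k. SB k (d - real (length \<alpha>)) S (foldr d\<xi> \<alpha> a)" if "\<forall>k. SB k d S a" for a :: "('n, 'm) symb" and d
   using that
  proof (induction \<alpha> arbitrary: a d rule: rev_induct)
   case (snoc \<gamma> \<alpha>)
   have "\<forall>k. SB k (d - 1) S (d\<xi> \<gamma> a)" using snoc.prems by (metis SB.simps(2))
   from snoc.IH[OF this] show ?case by (simp add: diff_diff_eq add.commute)
  qed auto
  show "\<exists>C. \<forall>x. \<forall>ksi\<in>S. norm (foldr dx \<beta> (foldr d\<xi> \<alpha> a) x ksi) \<le> C * (1 + norm ksi) powr (d - real (length \<alpha>))"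
   using x[OF xi[OF that]] SB_bound by blast
 qed
qed

lemma symb_on_iff_symbol_bound:
 fixes a :: "('n::finite, 'm::finite) symb"
 assumes "open Z" "S \<subseteq> Z" "smooth2 (UNIV \<times> Z) a"
 shows "symb_on Z S d a \<longleftrightarrow> symbol_bound d S a"
 using symbol_bound_iff[OF assms] assms(3) by (simp add: symb_on_def)

lemma symbol_class_iff: "a \<in> symbol_class d \<longleftrightarrow> symb_on UNIV UNIV d a"
 using symbol_bound_iff[of UNIV UNIV a d] by (auto simp: symbol_class_def symb_on_def)

subsection \<open>Composition of a symbol with a multiplication operator\<close>

abbreviation sym :: "real => (real^'n::finite => real^'n => 'b::real_normed_vector) => bool" where
 "sym \<equiv> symb_on UNIV UNIV"

text \<open>The factor -i makes the Fourier transform turn this operator into multiplication by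
  eta_\<alpha> with no constant left over (\<open>ft_Dd\<close>).\<close>

definition Dd :: "'n::finite => (real^'n => complex) => real^'n => complex" where
 "Dd \<alpha> f = (%y. - \<i> * pd \<alpha> f y)"

definition kern :: "real => (real^'n::finite => real^'n => complex) => (real^'n => complex) => real^'n => real^'n => real^'n => complex" where
 "kern t a f x ksi eta = cis (x \<bullet> eta) * a x (ksi + t *\<^sub>R eta) * ft f eta"

text \<open>For \<open>t = 1\<close> this is the full symbol of the composition of \<open>Op a\<close> with multiplication by \<open>f\<close>; for \<open>t = 0\<close> it is \<open>a f\<close>.
 The expansion of the composed symbol is the Taylor expansion in \<open>t\<close>.\<close>

definition T :: "real => (real^'n::finite => real^'n => complex) => (real^'n => complex) => real^'n => real^'n => complex" where
 "T t a f x ksi = (1 / (2 * pi) ^ CARD('n)) *\<^sub>R (\<integral>eta. kern t a f x ksi eta \<partial>lborel)"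

lemma test_Dd: "test_function S f ==> test_function S (Dd \<alpha> f)"
 unfolding Dd_def by (rule test_function_bounded_linear[OF bounded_linear_mult_right test_function_pd])

lemma ft_Dd: "test_function S f ==> ft (Dd \<alpha> f) eta = of_real (eta $ \<alpha>) * ft f eta"
proof -
 assume f: "test_function S f"
 have "ft (Dd \<alpha> f) eta = - \<i> * ft (pd \<alpha> f) eta"
  unfolding ft_def Dd_def by (subst integral_mult_right_zero[symmetric]) (simp add: mult_ac)
 then show ?thesis by (simp add: ft_pd[OF f] flip: mult.assoc)
qed

text \<open>Peetre's inequality: since 1 + |ksi| and 1 + |ksi + t eta| are each at most 2 (1 +
  |eta|) times the other, raising to the power \<open>d\<close> works for either sign of
  \<open>d\<close>. The exponent of the extra factor is rounded up to a natural number, so that the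
  polynomial decay of a Fourier transform can absorb it. The range of \<open>t\<close> goes beyond
  [0,1] to leave room for differentiation at the end points.\<close>

lemma peetre:
 fixes ksi eta :: "'a::real_normed_vector"
 assumes t: "\<bar>t\<bar> \<le> 2" and m: "\<bar>d\<bar> \<le> real m"
 shows "(1 + norm (ksi + t *\<^sub>R eta)) powr d \<le> (2 * (1 + norm eta)) ^ m * (1 + norm ksi) powr d"
proof -
 define A B G where "A = 1 + norm ksi" "B = 1 + norm (ksi + t *\<^sub>R eta)" "G = 2 * (1 + norm eta)"
 have pos: "A \<ge> 1" "B \<ge> 1" "G \<ge> 1" by (auto simp: A_B_G_def)
 have teta: "norm (t *\<^sub>R eta) \<le> 2 * norm eta" using t by (simp add: mult_right_mono)
 have AB: "B \<le> A + 2 * norm eta" "A \<le> B + 2 * norm eta"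
  using norm_triangle_ineq[of ksi "t *\<^sub>R eta"] norm_triangle_ineq4[of "ksi + t *\<^sub>R eta" "t *\<^sub>R eta"] teta
  by (auto simp: A_B_G_def)
 have G: "G = 2 + 2 * norm eta" by (simp add: A_B_G_def)
 have le: "X + 2 * norm eta \<le> X * G" if "X \<ge> 1" for X
 proof -
  have "2 * norm eta \<le> X * (2 * norm eta)" using that mult_right_mono[of 1 X "2 * norm eta"] by simp
  then show ?thesis using that by (simp add: G algebra_simps)
 qed
 have BG: "B \<le> A * G" and AG: "A \<le> B * G" using AB le pos by force+
 have Gm: "G powr \<bar>d\<bar> \<le> G ^ m"
  using powr_mono[OF m pos(3)] pos(3) by (simp add: powr_realpow)
 have "B powr d \<le> G powr \<bar>d\<bar> * A powr d"
 proof (cases "d \<ge> 0")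
  case True
  then have "B powr d \<le> (A * G) powr d" using BG pos by (intro powr_mono2) auto
  then show ?thesis using True pos by (simp add: powr_mult mult.commute)
 next
  case False
  have "A / G \<le> B" using AG pos by (simp add: divide_le_eq)
  then have "B powr d \<le> (A / G) powr d" using False pos by (intro powr_mono2') auto
  then show ?thesis using False pos by (simp add: powr_divide powr_minus_divide abs_of_neg)
 qed
 also have "... \<le> G ^ m * A powr d" by (intro mult_right_mono Gm) auto
 finally show ?thesis by (simp add: A_B_G_def)
qed

lemma sym_continuous: "sym d a ==> continuous_on UNIV (%z. a (fst z) (snd z))"
 using smooth_on_continuous[OF symb_on_smooth[of UNIV UNIV d a]] by (simp add: case_prod_unfold)

lemma sym_measurable:
 assumes "sym d (a :: real^'n::finite => real^'n => complex)"
 shows "(%eta. a x (ksi + t *\<^sub>R eta)) \<in> borel_measurable borel"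
proof (rule borel_measurable_continuous_onI)
 have "continuous_on UNIV (%eta. (x, ksi + t *\<^sub>R eta))" by (intro continuous_intros)
 from continuous_on_compose2[OF sym_continuous[OF assms] this]
 show "continuous_on UNIV (%eta. a x (ksi + t *\<^sub>R eta))" by simp
qed

text \<open>Peetre's inequality trades the growth of \<open>a\<close> in \<open>eta\<close> for a
  polynomial, which the transform of a test function absorbs. The bound separates the variables, so
  one integrable function of \<open>eta\<close> serves all \<open>t\<close>, \<open>x\<close> and
  \<open>ksi\<close>.\<close>

lemma kern_bound:
 assumes a: "sym d a" and f: "test_function U f"
 shows "\<exists>B. integrable lborel B \<and> (\<forall>eta. 0 \<le> B eta) \<and>
  (\<forall>t x ksi eta. \<bar>t\<bar> \<le> 2 --> norm (kern t a f x ksi eta) \<le> B eta * (1 + norm ksi) powr d)"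
proof -
 obtain C where C0: "C \<ge> 0" and C': "!!x ksi. ksi \<in> UNIV ==> norm (a x ksi) \<le> C * (1 + norm ksi) powr d"
  using symb_on_bound[OF a] by blast
 note C = C0 C'[OF UNIV_I]
 obtain m where m: "\<bar>d\<bar> \<le> real m" using real_arch_simple by blast
 define B where "B eta = (C * 2 ^ m) * ((1 + norm eta) ^ m * norm (ft f eta))" for eta
 show ?thesis
 proof (intro exI[of _ B] conjI allI impI)
  show "integrable lborel B" unfolding B_def by (intro integrable_mult_right ft_integrable_poly[OF f])
  show "0 \<le> B eta" for eta using C(1) by (auto simp: B_def)
  fix t :: real and x ksi eta assume t: "\<bar>t\<bar> \<le> 2"
  have "norm (kern t a f x ksi eta) = norm (a x (ksi + t *\<^sub>R eta)) * norm (ft f eta)" by (simp add: kern_def norm_mult)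
  also have "... \<le> (C * ((2 * (1 + norm eta)) ^ m * (1 + norm ksi) powr d)) * norm (ft f eta)"
   by (intro mult_right_mono order_trans[OF C(2)] mult_left_mono peetre t m C(1)) auto
  also have "... = B eta * (1 + norm ksi) powr d" by (simp only: B_def power_mult_distrib mult_ac)
  finally show "norm (kern t a f x ksi eta) \<le> B eta * (1 + norm ksi) powr d" .
 qed
qed

lemma kern_measurable:
 assumes "sym d a" "test_function U f" shows "kern t a f x ksi \<in> borel_measurable borel"
proof -
 note [measurable] = sym_measurable[OF assms(1)] ft_test_measurable[OF assms(2)]
 show ?thesis unfolding kern_def[abs_def] by measurable
qed

lemma kern_integrable:
 assumes "sym d a" "test_function U f" "\<bar>t\<bar> \<le> 2"
 shows "integrable lborel (kern t a f x ksi)"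
proof -
 obtain B where B: "integrable lborel B" "!!eta. 0 \<le> B eta"
  "!!t x ksi eta. \<bar>t\<bar> \<le> 2 ==> norm (kern t a f x ksi eta) \<le> B eta * (1 + norm ksi) powr d"
  using kern_bound[OF assms(1,2)] by blast
 show ?thesis
  by (rule Bochner_Integration.integrable_bound[OF integrable_mult_left[OF B(1), of "(1 + norm ksi) powr d"]])
   (use kern_measurable[OF assms(1,2)] B(2,3) assms(3) in \<open>auto simp: abs_mult intro!: AE_I2\<close>)
qed

lemma T_bound:
 assumes "sym d a" "test_function U f"
 shows "\<exists>C. \<forall>t x ksi. \<bar>t\<bar> \<le> 2 --> norm (T t a f x ksi) \<le> C * (1 + norm ksi) powr d"
proof -
 obtain B where B: "integrable lborel B" "!!eta. 0 \<le> B eta"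
  "!!t x ksi eta. \<bar>t\<bar> \<le> 2 ==> norm (kern t a f x ksi eta) \<le> B eta * (1 + norm ksi) powr d"
  using kern_bound[OF assms(1,2)] by blast
 have "norm (T t a f x ksi) \<le> ((1 / (2 * pi) ^ CARD('a)) * (\<integral>eta. B eta \<partial>lborel)) * (1 + norm ksi) powr d" if t: "\<bar>t\<bar> \<le> 2" for t x ksi
 proof -
  have "norm (\<integral>eta. kern t a f x ksi eta \<partial>lborel) \<le> (\<integral>eta. norm (kern t a f x ksi eta) \<partial>lborel)" by (rule integral_norm_bound)
  also have "... \<le> (\<integral>eta. B eta * (1 + norm ksi) powr d \<partial>lborel)"
   by (rule Bochner_Integration.integral_mono[OF integrable_norm[OF kern_integrable[OF assms t]] integrable_mult_left[OF B(1)]])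
    (rule B(3)[OF t])
  also have "... = (\<integral>eta. B eta \<partial>lborel) * (1 + norm ksi) powr d" by simp
  finally have "norm (\<integral>eta. kern t a f x ksi eta \<partial>lborel) \<le> (\<integral>eta. B eta \<partial>lborel) * (1 + norm ksi) powr d" .
  then have "(1 / (2 * pi) ^ CARD('a)) * norm (\<integral>eta. kern t a f x ksi eta \<partial>lborel) \<le> (1 / (2 * pi) ^ CARD('a)) * ((\<integral>eta. B eta \<partial>lborel) * (1 + norm ksi) powr d)"
   by (rule mult_left_mono) simp
  then show ?thesis by (simp only: T_def norm_scaleR mult.assoc) simp
 qed
 then show ?thesis by blast
qed

text \<open>All first derivatives are kernels of the same form. In \<open>x\<close> the exponential
  brings down i eta_\<alpha>, which passes into the transform as \<open>pd \<alpha> f\<close>; in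
  \<open>ksi\<close> only \<open>a\<close> is hit; in \<open>t\<close> the chain rule gives
  eta_\<alpha> times \<open>d\<xi> \<alpha> a\<close>, that is, \<open>Dd \<alpha> f\<close> in the
  transform. Derivatives of every order are thus reached by induction over \<open>a\<close> and
  \<open>f\<close>.\<close>

lemma kern_has_derivative:
 assumes a: "sym d a" and f: "test_function U f"
 shows "((%(t, x, ksi). kern t a f x ksi eta) has_derivative (%(s, u, v). \<Sum>\<alpha>\<in>UNIV.
   (u $ \<alpha>) *\<^sub>R (kern t (dx \<alpha> a) f x ksi eta + kern t a (pd \<alpha> f) x ksi eta) +
   (v $ \<alpha>) *\<^sub>R kern t (d\<xi> \<alpha> a) f x ksi eta + s *\<^sub>R kern t (d\<xi> \<alpha> a) (Dd \<alpha> f) x ksi eta)) (at (t, x, ksi))"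
proof -
 let ?z = "(t, x, ksi)"
 have "((%z. fst (snd z) \<bullet> eta) has_derivative (%z. fst (snd z) \<bullet> eta)) (at ?z)"
  by (auto intro!: derivative_eq_intros)
 from diff_chain_at[OF this cis_has_derivative]
 have h1: "((%z. cis (fst (snd z) \<bullet> eta)) has_derivative (%z. cis (x \<bullet> eta) * (\<i> * of_real (fst (snd z) \<bullet> eta)))) (at ?z)"
  by (simp add: o_def)
 have "((%z. (fst (snd z), snd (snd z) + fst z *\<^sub>R eta)) has_derivative (%z. (fst (snd z), snd (snd z) + fst z *\<^sub>R eta))) (at ?z)"
  by (auto intro!: derivative_eq_intros)
 from diff_chain_at[OF this, of "%(x, ksi). a x ksi" "grad2 a x (ksi + t *\<^sub>R eta)"] smooth2_has_derivative[OF symb_on_smooth[OF a], of x "ksi + t *\<^sub>R eta"]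
 have h2: "((%z. a (fst (snd z)) (snd (snd z) + fst z *\<^sub>R eta)) has_derivative
   (%z. grad2 a x (ksi + t *\<^sub>R eta) (fst (snd z), snd (snd z) + fst z *\<^sub>R eta))) (at ?z)"
  by (simp add: o_def)
 have h: "((%z. kern (fst z) a f (fst (snd z)) (snd (snd z)) eta) has_derivative
   (%z. (cis (x \<bullet> eta) * grad2 a x (ksi + t *\<^sub>R eta) (fst (snd z), snd (snd z) + fst z *\<^sub>R eta) +
    cis (x \<bullet> eta) * (\<i> * of_real (fst (snd z) \<bullet> eta)) * a x (ksi + t *\<^sub>R eta)) * ft f eta)) (at ?z)"
  unfolding kern_def using has_derivative_mult_left[OF has_derivative_mult[OF h1 h2]] by simp
 have eq: "(cis (x \<bullet> eta) * grad2 a x (ksi + t *\<^sub>R eta) (u, v + s *\<^sub>R eta) +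
    cis (x \<bullet> eta) * (\<i> * of_real (u \<bullet> eta)) * a x (ksi + t *\<^sub>R eta)) * ft f eta =
   (\<Sum>\<alpha>\<in>UNIV. (u $ \<alpha>) *\<^sub>R (kern t (dx \<alpha> a) f x ksi eta + kern t a (pd \<alpha> f) x ksi eta) +
   (v $ \<alpha>) *\<^sub>R kern t (d\<xi> \<alpha> a) f x ksi eta + s *\<^sub>R kern t (d\<xi> \<alpha> a) (Dd \<alpha> f) x ksi eta)" for s u v
 proof -
  have "u \<bullet> eta = (\<Sum>\<alpha>\<in>UNIV. u $ \<alpha> * eta $ \<alpha>)" by (simp add: inner_vec_def)
  then have 1: "cis (x \<bullet> eta) * (\<i> * of_real (u \<bullet> eta)) * a x (ksi + t *\<^sub>R eta) * ft f eta =
    (\<Sum>\<alpha>\<in>UNIV. (u $ \<alpha>) *\<^sub>R kern t a (pd \<alpha> f) x ksi eta)"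
   by (simp add: kern_def ft_pd[OF f] scaleR_conv_of_real sum_distrib_left sum_distrib_right mult_ac)
  have "cis (x \<bullet> eta) * grad2 a x (ksi + t *\<^sub>R eta) (u, v + s *\<^sub>R eta) * ft f eta =
    (\<Sum>\<alpha>\<in>UNIV. (u $ \<alpha>) *\<^sub>R kern t (dx \<alpha> a) f x ksi eta + (v $ \<alpha>) *\<^sub>R kern t (d\<xi> \<alpha> a) f x ksi eta + s *\<^sub>R kern t (d\<xi> \<alpha> a) (Dd \<alpha> f) x ksi eta)"
  proof -
   have c: "(v + s *\<^sub>R eta) $ \<alpha> = v $ \<alpha> + s * eta $ \<alpha>" for \<alpha> by simp
   have "c * (p *\<^sub>R X + (q + s * r) *\<^sub>R Y) * F = p *\<^sub>R (c * X * F) + q *\<^sub>R (c * Y * F) + s *\<^sub>R (c * Y * (of_real r * F))"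
    for c X Y F :: complex and p q r :: real
    by (simp add: scaleR_conv_of_real algebra_simps)
   then show ?thesis
    by (simp only: grad2_expand[OF symb_on_smooth[OF a, unfolded UNIV_Times_UNIV] UNIV_I] kern_def ft_Dd[OF f] c sum_distrib_left sum_distrib_right)
  qed
  then show ?thesis by (simp only: distrib_right 1 sum.distrib scaleR_add_right) (simp add: algebra_simps)
 qed
 show ?thesis using h unfolding eq by (simp add: case_prod_unfold)
qed

lemma T_has_derivative:
 assumes a: "sym d a" and f: "test_function U f" and t: "\<bar>t\<bar> < 2"
 shows "((%(t, x, ksi). T t a f x ksi) has_derivative (%(s, u, v). \<Sum>\<alpha>\<in>UNIV.
   (u $ \<alpha>) *\<^sub>R (T t (dx \<alpha> a) f x ksi + T t a (pd \<alpha> f) x ksi) +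
   (v $ \<alpha>) *\<^sub>R T t (d\<xi> \<alpha> a) f x ksi + s *\<^sub>R T t (d\<xi> \<alpha> a) (Dd \<alpha> f) x ksi)) (at (t, x, ksi))"
proof -
 \<comment> \<open>The majorant of a kernel carries the factor (1 + |ksi|)^d, which is uniform only
   for bounded \<open>ksi\<close>; differentiability is local, so a ball that contains the given
   covector suffices.\<close>
 define \<rho> where "\<rho> = norm ksi + 1"
 let ?U = "ball 0 2 \<times> UNIV \<times> ball 0 \<rho> :: (real \<times> (real^'a) \<times> (real^'a)) set"
 have dxa: "sym d (dx \<alpha> a)" for \<alpha> by (rule symb_on_dx[OF open_UNIV a])
 have dxia: "sym d (d\<xi> \<alpha> a)" for \<alpha> using symb_on_mono[OF symb_on_d\<xi>[OF open_UNIV a], of d] by simp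
 note pdf = test_function_pd[OF f] and Ddf = test_Dd[OF f]
 have K: "\<exists>B. integrable lborel B \<and> (\<forall>eta. 0 \<le> B eta) \<and> (\<forall>t x ksi eta. \<bar>t\<bar> < 2 --> norm ksi < \<rho> --> norm (kern t b g x ksi eta) \<le> B eta)"
  if b: "sym d b" and g: "test_function U g" for b g
 proof -
  obtain B where B: "integrable lborel B" "!!eta. 0 \<le> B eta"
   "!!t x ksi eta. \<bar>t\<bar> \<le> 2 ==> norm (kern t b g x ksi eta) \<le> B eta * (1 + norm ksi) powr d"
   using kern_bound[OF b g] by blast
  have p: "(1 + norm \<zeta>) powr d \<le> (1 + \<rho>) powr \<bar>d\<bar>" if "norm \<zeta> < \<rho>" for \<zeta> :: "real^'a"
   by (rule order_trans[OF powr_mono[of d "\<bar>d\<bar>"] powr_mono2]) (use that in auto)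
  have "norm (kern t b g x \<zeta> eta) \<le> B eta * (1 + \<rho>) powr \<bar>d\<bar>" if "\<bar>t\<bar> < 2" "norm \<zeta> < \<rho>" for t x \<zeta> eta
   using order_trans[OF B(3)[of t x \<zeta> eta] mult_left_mono[OF p[OF that(2)] B(2)[of eta]]] that(1) by simp
  then show ?thesis
   using B(1,2) by (intro exI[of _ "%eta. B eta * (1 + \<rho>) powr \<bar>d\<bar>"]) auto
 qed
 obtain B1 where B1: "!!\<alpha>. integrable lborel (B1 \<alpha>)" "!!\<alpha> eta. 0 \<le> B1 \<alpha> eta"
  "!!\<alpha> t x ksi eta. \<bar>t\<bar> < 2 ==> norm ksi < \<rho> ==> norm (kern t (dx \<alpha> a) f x ksi eta) \<le> B1 \<alpha> eta"
  using K[OF dxa f] by metis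
 obtain B2 where B2: "!!\<alpha>. integrable lborel (B2 \<alpha>)" "!!\<alpha> eta. 0 \<le> B2 \<alpha> eta"
  "!!\<alpha> t x ksi eta. \<bar>t\<bar> < 2 ==> norm ksi < \<rho> ==> norm (kern t a (pd \<alpha> f) x ksi eta) \<le> B2 \<alpha> eta"
  using K[OF a pdf] by metis
 obtain B3 where B3: "!!\<alpha>. integrable lborel (B3 \<alpha>)" "!!\<alpha> eta. 0 \<le> B3 \<alpha> eta"
  "!!\<alpha> t x ksi eta. \<bar>t\<bar> < 2 ==> norm ksi < \<rho> ==> norm (kern t (d\<xi> \<alpha> a) f x ksi eta) \<le> B3 \<alpha> eta"
  using K[OF dxia f] by metis
 obtain B4 where B4: "!!\<alpha>. integrable lborel (B4 \<alpha>)" "!!\<alpha> eta. 0 \<le> B4 \<alpha> eta"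
  "!!\<alpha> t x ksi eta. \<bar>t\<bar> < 2 ==> norm ksi < \<rho> ==> norm (kern t (d\<xi> \<alpha> a) (Dd \<alpha> f) x ksi eta) \<le> B4 \<alpha> eta"
 proof -
  have "\<exists>B. integrable lborel B \<and> (\<forall>eta. 0 \<le> B eta) \<and> (\<forall>t x ksi eta. \<bar>t\<bar> < 2 --> norm ksi < \<rho> --> norm (kern t (d\<xi> \<alpha> a) (Dd \<alpha> f) x ksi eta) \<le> B eta)" for \<alpha>
   by (rule K[OF dxia Ddf])
  then show thesis using that by metis
 qed
 define G where "G = (%(t, x, ksi) eta (s, u, v). \<Sum>\<alpha>\<in>UNIV.
   (u $ \<alpha>) *\<^sub>R (kern t (dx \<alpha> a) f x ksi eta + kern t a (pd \<alpha> f) x ksi eta) +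
   (v $ \<alpha>) *\<^sub>R kern t (d\<xi> \<alpha> a) f x ksi eta + s *\<^sub>R kern t (d\<xi> \<alpha> a) (Dd \<alpha> f) x ksi eta)"
 note ki = kern_integrable[OF dxa f less_imp_le[OF t]] kern_integrable[OF a pdf less_imp_le[OF t]]
  kern_integrable[OF dxia f less_imp_le[OF t]] kern_integrable[OF dxia Ddf less_imp_le[OF t]]
 have intG: "integrable lborel (%eta. G (t, x, ksi) eta v)" for v
  unfolding G_def case_prod_unfold using ki
  by (intro Bochner_Integration.integrable_sum Bochner_Integration.integrable_add integrable_scaleR_right) auto
 have "((%z. \<integral>eta. (case z of (t, x, ksi) => kern t a f x ksi eta) \<partial>lborel) has_derivative (%v. \<integral>eta. G (t, x, ksi) eta v \<partial>lborel)) (at (t, x, ksi))"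
 proof (rule has_derivative_integral[where U = ?U and B = "%eta. \<Sum>\<alpha>\<in>UNIV. B1 \<alpha> eta + B2 \<alpha> eta + B3 \<alpha> eta + B4 \<alpha> eta"])
  show "open ?U" by (intro open_Times) auto
  show "(t, x, ksi) \<in> ?U" using t by (auto simp: \<rho>_def)
  show "((%z. case z of (t, x, ksi) => kern t a f x ksi eta) has_derivative G w eta) (at w)" for w eta
  proof -
   obtain t x ksi where w: "w = (t, x, ksi)" by (cases w)
   show ?thesis using kern_has_derivative[OF a f, where t = t and x = x and ksi = ksi and eta = eta] by (simp add: w G_def)
  qed
  show "integrable lborel (%eta. case w of (t, x, ksi) => kern t a f x ksi eta)" if "w \<in> ?U" for w
   using that kern_integrable[OF a f, of "fst w" "fst (snd w)" "snd (snd w)"] by (auto simp: case_prod_unfold)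
  show "integrable lborel (%eta. G (t, x, ksi) eta v)" for v by (rule intG)
  show "integrable lborel (%eta. \<Sum>\<alpha>\<in>UNIV. B1 \<alpha> eta + B2 \<alpha> eta + B3 \<alpha> eta + B4 \<alpha> eta)"
   using B1 B2 B3 B4 by (intro Bochner_Integration.integrable_sum Bochner_Integration.integrable_add) auto
  show "norm (G w eta v) \<le> (\<Sum>\<alpha>\<in>UNIV. B1 \<alpha> eta + B2 \<alpha> eta + B3 \<alpha> eta + B4 \<alpha> eta) * norm v" if "w \<in> ?U" for w eta v
  proof -
   obtain t x ksi where w: "w = (t, x, ksi)" by (cases w)
   obtain s u y where v: "v = (s, u, y)" by (cases v)
   have tx: "\<bar>t\<bar> < 2" "norm ksi < \<rho>" using that by (auto simp: w)
   have n: "\<bar>u $ \<alpha>\<bar> \<le> norm v" "\<bar>y $ \<alpha>\<bar> \<le> norm v" "\<bar>s\<bar> \<le> norm v" for \<alpha>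
   proof -
    have "norm s \<le> norm v" "norm (u, y) \<le> norm v"
     using norm_fst_le[of s "(u, y)"] norm_snd_le[of "(u, y)" s] by (auto simp: v)
    moreover have "norm u \<le> norm (u, y)" "norm y \<le> norm (u, y)"
     using norm_fst_le[of u y] norm_snd_le[of y u] by auto
    ultimately show "\<bar>u $ \<alpha>\<bar> \<le> norm v" "\<bar>y $ \<alpha>\<bar> \<le> norm v" "\<bar>s\<bar> \<le> norm v"
     using component_le_norm_cart[of u \<alpha>] component_le_norm_cart[of y \<alpha>] by auto
   qed
   have "norm (G w eta v) \<le> (\<Sum>\<alpha>\<in>UNIV. norm v * (B1 \<alpha> eta + B2 \<alpha> eta) + norm v * B3 \<alpha> eta + norm v * B4 \<alpha> eta)"
    unfolding G_def w v prod.case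
   proof (rule sum_norm_le)
    fix \<alpha>
    show "norm ((u $ \<alpha>) *\<^sub>R (kern t (dx \<alpha> a) f x ksi eta + kern t a (pd \<alpha> f) x ksi eta) +
     (y $ \<alpha>) *\<^sub>R kern t (d\<xi> \<alpha> a) f x ksi eta + s *\<^sub>R kern t (d\<xi> \<alpha> a) (Dd \<alpha> f) x ksi eta)
     \<le> norm (s, u, y) * (B1 \<alpha> eta + B2 \<alpha> eta) + norm (s, u, y) * B3 \<alpha> eta + norm (s, u, y) * B4 \<alpha> eta"
     unfolding v[symmetric]
     by (intro order_trans[OF norm_triangle_ineq add_mono] order_trans[OF norm_triangle_ineq add_mono[OF B1(3)[OF tx] B2(3)[OF tx]]]
       order_trans[OF eq_refl[OF norm_scaleR] mult_mono[OF n(1)]] order_trans[OF eq_refl[OF norm_scaleR] mult_mono[OF n(2) B3(3)[OF tx]]]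
       order_trans[OF eq_refl[OF norm_scaleR] mult_mono[OF n(3) B4(3)[OF tx]]]) auto
   qed
   also have "... = (\<Sum>\<alpha>\<in>UNIV. B1 \<alpha> eta + B2 \<alpha> eta + B3 \<alpha> eta + B4 \<alpha> eta) * norm v"
    unfolding sum_distrib_right by (intro sum.cong) (auto simp: algebra_simps)
   finally show ?thesis .
  qed
 qed
 from has_derivative_scaleR_right[OF this, of "1 / (2 * pi) ^ CARD('a)"]
 have "((%z. case z of (t, x, ksi) => T t a f x ksi) has_derivative (%v. (1 / (2 * pi) ^ CARD('a)) *\<^sub>R (\<integral>eta. G (t, x, ksi) eta v \<partial>lborel))) (at (t, x, ksi))"
  by (simp add: T_def case_prod_unfold)
 moreover have "(1 / (2 * pi) ^ CARD('a)) *\<^sub>R (\<integral>eta. G (t, x, ksi) eta (s, u, v) \<partial>lborel) = (\<Sum>\<alpha>\<in>UNIV.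
   (u $ \<alpha>) *\<^sub>R (T t (dx \<alpha> a) f x ksi + T t a (pd \<alpha> f) x ksi) +
   (v $ \<alpha>) *\<^sub>R T t (d\<xi> \<alpha> a) f x ksi + s *\<^sub>R T t (d\<xi> \<alpha> a) (Dd \<alpha> f) x ksi)" for s u v
  unfolding G_def prod.case T_def using ki
  by (subst Bochner_Integration.integral_sum)
   (auto simp: scaleR_sum_right algebra_simps intro!: sum.cong)
 then have "(%v. (1 / (2 * pi) ^ CARD('a)) *\<^sub>R (\<integral>eta. G (t, x, ksi) eta v \<partial>lborel)) = (%(s, u, v). \<Sum>\<alpha>\<in>UNIV.
   (u $ \<alpha>) *\<^sub>R (T t (dx \<alpha> a) f x ksi + T t a (pd \<alpha> f) x ksi) +
   (v $ \<alpha>) *\<^sub>R T t (d\<xi> \<alpha> a) f x ksi + s *\<^sub>R T t (d\<xi> \<alpha> a) (Dd \<alpha> f) x ksi)"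
  by (simp only: fun_eq_iff split_paired_all prod.case) simp
 ultimately show ?thesis by (simp only:)
qed

lemma T_has_derivative2:
 assumes a: "sym d a" and f: "test_function U f" and t: "\<bar>t\<bar> < 2"
 shows "((%(x, ksi). T t a f x ksi) has_derivative (%(u, v). \<Sum>\<alpha>\<in>UNIV.
   (u $ \<alpha>) *\<^sub>R (T t (dx \<alpha> a) f x ksi + T t a (pd \<alpha> f) x ksi) + (v $ \<alpha>) *\<^sub>R T t (d\<xi> \<alpha> a) f x ksi)) (at (x, ksi))"
proof -
 have "((%z. (t, z)) has_derivative (%z. (0, z))) (at (x, ksi))"
  by (intro has_derivative_Pair has_derivative_const has_derivative_ident)
 from diff_chain_at[OF this T_has_derivative[OF a f t]]
 show ?thesis by (simp add: o_def case_prod_unfold)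
qed

lemma T_has_vector_derivative:
 assumes a: "sym d a" and f: "test_function U f" and t: "\<bar>t\<bar> < 2"
 shows "((%t. T t a f x ksi) has_vector_derivative (\<Sum>\<alpha>\<in>UNIV. T t (d\<xi> \<alpha> a) (Dd \<alpha> f) x ksi)) (at t)"
proof -
 have "((%t. (t, x, ksi)) has_derivative (%s. (s, 0))) (at t)"
  by (rule has_derivative_Pair[OF has_derivative_ident has_derivative_const])
 from diff_chain_at[OF this T_has_derivative[OF a f t]]
 show ?thesis by (simp add: o_def case_prod_unfold has_vector_derivative_def scaleR_sum_right)
qed

lemma sum_axis_scaleR: "(\<Sum>\<beta>\<in>UNIV. (axis \<alpha> (1::real) $ \<beta>) *\<^sub>R g \<beta>) = g \<alpha>"
 for g :: "'n::finite => 'b::real_vector"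
proof -
 have "(\<Sum>\<beta>\<in>UNIV. (axis \<alpha> (1::real) $ \<beta>) *\<^sub>R g \<beta>) = (\<Sum>\<beta>\<in>UNIV. if \<beta> = \<alpha> then g \<beta> else 0)"
  by (intro sum.cong) (auto simp: axis_def)
 then show ?thesis by simp
qed

lemma dx_T: "sym d a ==> test_function U f ==> \<bar>t\<bar> < 2 ==>
  dx \<alpha> (T t a f) = (%x ksi. T t (dx \<alpha> a) f x ksi + T t a (pd \<alpha> f) x ksi)"
 and d\<xi>_T: "sym d a ==> test_function U f ==> \<bar>t\<bar> < 2 ==> d\<xi> \<alpha> (T t a f) = T t (d\<xi> \<alpha> a) f"
 by (auto simp: fun_eq_iff dx_eqI[OF T_has_derivative2] d\<xi>_eqI[OF T_has_derivative2] sum_axis_scaleR)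

text \<open>By \<open>T_has_derivative2\<close> every directional derivative is a finite sum of the
  same operation applied to other pairs \<open>a\<close>, \<open>f\<close>. The derivative
  \<open>d\<xi> \<alpha> a\<close> is counted as a symbol of order \<open>d\<close>, above its true
  order, so that one \<open>d\<close> serves the whole induction.\<close>

lemma smooth_T:
 assumes "sym d a" "test_function U f" "\<bar>t\<bar> < 2"
 shows "smooth2 UNIV (T t a f)"
proof -
 have "Ck_on k UNIV (%z. T t a f (fst z) (snd z))" for k
  using assms(1,2)
 proof (induction k arbitrary: a f)
  case 0
  have "(%z. T t a f (fst z) (snd z)) differentiable (at z)" for z
   using T_has_derivative2[OF 0 assms(3), of "fst z" "snd z"] by (auto simp: differentiable_def case_prod_unfold)
  then show ?case by (auto intro!: continuous_at_imp_continuous_on differentiable_imp_continuous_within)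
 next
  case (Suc k)
  have dxia: "sym d (d\<xi> \<alpha> a)" for \<alpha> using symb_on_mono[OF symb_on_d\<xi>[OF open_UNIV Suc.prems(1)], of d] by simp
  note IH = Suc.IH[OF symb_on_dx[OF open_UNIV Suc.prems(1)] Suc.prems(2)] Suc.IH[OF Suc.prems(1) test_function_pd[OF Suc.prems(2)]]
   Suc.IH[OF dxia Suc.prems(2)]
  show ?case
  proof (rule Ck_on_SucI)
   show "((%z. T t a f (fst z) (snd z)) has_derivative (%v. \<Sum>\<alpha>\<in>UNIV.
     (fst v $ \<alpha>) *\<^sub>R (T t (dx \<alpha> a) f (fst z) (snd z) + T t a (pd \<alpha> f) (fst z) (snd z)) + (snd v $ \<alpha>) *\<^sub>R T t (d\<xi> \<alpha> a) f (fst z) (snd z))) (at z)" for z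
    using T_has_derivative2[OF Suc.prems assms(3), of "fst z" "snd z"] by (simp add: case_prod_unfold)
   show "Ck_on k UNIV (%z. \<Sum>\<alpha>\<in>UNIV.
     (fst v $ \<alpha>) *\<^sub>R (T t (dx \<alpha> a) f (fst z) (snd z) + T t a (pd \<alpha> f) (fst z) (snd z)) + (snd v $ \<alpha>) *\<^sub>R T t (d\<xi> \<alpha> a) f (fst z) (snd z))" for v
    by (intro Ck_on_sum Ck_on_add Ck_on_bounded_linear[OF _ bounded_linear_scaleR_right] IH open_UNIV)
  qed simp
 qed
 then show ?thesis by (simp add: smooth_on_def case_prod_unfold)
qed

lemma symb_on_T:
 assumes "sym d a" "test_function U f" "\<bar>t\<bar> < 2"
 shows "sym d (T t a f)"
proof -
 have SBT: "SB k d UNIV (T t a f)" for k using assms(1,2)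
 proof (induction k arbitrary: a f d)
  case 0
  then show ?case using T_bound[OF 0] assms(3) by force
 next
  case (Suc k)
  have 1: "\<exists>C. \<forall>x. \<forall>ksi\<in>UNIV. norm (T t a f x ksi) \<le> C * (1 + norm ksi) powr d" using T_bound[OF Suc.prems] assms(3) by force
  have "SB k d UNIV (dx \<alpha> (T t a f))" for \<alpha>
   unfolding dx_T[OF Suc.prems assms(3)]
   by (rule SB_add[OF open_UNIV subset_UNIV _ _ Suc.IH[OF symb_on_dx[OF open_UNIV Suc.prems(1)] Suc.prems(2)] Suc.IH[OF Suc.prems(1) test_function_pd[OF Suc.prems(2)]]])
    (use smooth_T[OF symb_on_dx[OF open_UNIV Suc.prems(1)] Suc.prems(2) assms(3)] smooth_T[OF Suc.prems(1) test_function_pd[OF Suc.prems(2)] assms(3)] in simp_all)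
  moreover have "SB k (d - 1) UNIV (d\<xi> \<alpha> (T t a f))" for \<alpha>
   unfolding d\<xi>_T[OF Suc.prems assms(3)] by (rule Suc.IH[OF symb_on_d\<xi>[OF open_UNIV Suc.prems(1)] Suc.prems(2)])
  ultimately show ?case using 1 by simp
 qed
 then show ?thesis using smooth_T[OF assms] by (simp add: symb_on_def)
qed

lemma T_0:
 assumes "test_function U (f :: real^'n::finite => complex)"
 shows "T 0 a f x ksi = a x ksi * f x"
proof -
 have "(\<integral>eta. kern 0 a f x ksi eta \<partial>lborel) = (\<integral>eta. a x ksi * (cis (x \<bullet> eta) * ft f eta) \<partial>lborel)"
  by (intro Bochner_Integration.integral_cong) (auto simp: kern_def)
 also have "... = a x ksi * (of_real ((2 * pi) ^ CARD('n)) * f x)"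
  by (simp only: integral_mult_right_zero fourier_inversion[OF assms])
 finally show ?thesis by (simp add: T_def scaleR_conv_of_real)
qed

section \<open>The exact composition formula, by convolution of Fourier transforms\<close>

lemma ft_mult:
 fixes f u :: "real^'n::finite => complex"
 assumes f: "test_function U f" and u: "test_function V u"
 shows "(1 / (2 * pi) ^ CARD('n)) *\<^sub>R (\<integral>eta. ft f eta * ft u (\<zeta> - eta) \<partial>lborel) = ft (%y. f y * u y) \<zeta>"
proof -
 have "(\<integral>eta. ft f eta * ft u (\<zeta> - eta) \<partial>lborel) = (\<integral>eta. (\<integral>y. cis (y \<bullet> (eta - \<zeta>)) * (u y * ft f eta) \<partial>lborel) \<partial>lborel)"
 proof (rule Bochner_Integration.integral_cong[OF refl])
  fix eta
  have "ft f eta * ft u (\<zeta> - eta) = (\<integral>y. ft f eta * (cis (- (y \<bullet> (\<zeta> - eta))) * u y) \<partial>lborel)"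
   by (simp add: ft_def)
  then show "ft f eta * ft u (\<zeta> - eta) = (\<integral>y. cis (y \<bullet> (eta - \<zeta>)) * (u y * ft f eta) \<partial>lborel)"
   by (simp add: inner_diff_right mult_ac)
 qed
 also have "... = (\<integral>y. (\<integral>eta. cis (y \<bullet> (eta - \<zeta>)) * (u y * ft f eta) \<partial>lborel) \<partial>lborel)"
 proof (rule lborel_pair.Fubini_integral)
  show "integrable (lborel \<Otimes>\<^sub>M lborel) (%(y, eta). cis (y \<bullet> (eta - \<zeta>)) * (u y * ft f eta))"
   by (rule integrable_product_bounded[OF test_function_integrable[OF u] ft_L1[OF f]])
    (auto simp: borel_prod case_prod_unfold intro!: borel_measurable_continuous_onI continuous_intros)
 qed
 also have "... = (\<integral>y. of_real ((2 * pi) ^ CARD('n)) * (cis (- (y \<bullet> \<zeta>)) * (f y * u y)) \<partial>lborel)"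
 proof (rule Bochner_Integration.integral_cong[OF refl])
  fix y
  have "cis (y \<bullet> (eta - \<zeta>)) = cis (- (y \<bullet> \<zeta>)) * cis (y \<bullet> eta)" for eta
   by (simp add: cis_mult inner_diff_right)
  then have "(\<integral>eta. cis (y \<bullet> (eta - \<zeta>)) * (u y * ft f eta) \<partial>lborel) = (\<integral>eta. (cis (- (y \<bullet> \<zeta>)) * u y) * (cis (y \<bullet> eta) * ft f eta) \<partial>lborel)"
   by (simp add: mult_ac)
  also have "... = (cis (- (y \<bullet> \<zeta>)) * u y) * (of_real ((2 * pi) ^ CARD('n)) * f y)"
   by (simp only: integral_mult_right_zero fourier_inversion[OF f])
  finally show "(\<integral>eta. cis (y \<bullet> (eta - \<zeta>)) * (u y * ft f eta) \<partial>lborel) = of_real ((2 * pi) ^ CARD('n)) * (cis (- (y \<bullet> \<zeta>)) * (f y * u y))"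
   by (simp only: mult_ac)
 qed
 also have "... = of_real ((2 * pi) ^ CARD('n)) * ft (%y. f y * u y) \<zeta>"
  by (simp only: integral_mult_right_zero ft_def)
 finally show ?thesis by (simp add: scaleR_conv_of_real)
qed

text \<open>Both sides are iterated integrals of the same function \<Phi>: the transform of a
  product is a convolution (\<open>ft_mult\<close>), and zeta = ksi + eta turns the left side into
  the integral of \<Phi> over all pairs (ksi, eta). As \<open>T 1 b u x 0\<close> is the operator
  with symbol \<open>b\<close> applied to \<open>u\<close>, the composition formula is obtained
  exactly, before any asymptotics.\<close>

lemma T_compose:
 fixes f u :: "real^'n::finite => complex"
 assumes a: "sym d a" and f: "test_function U f" and u: "test_function V u"
 shows "T 1 a (%y. f y * u y) x 0 = T 1 (T 1 a f) u x 0"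
proof -
 let ?c = "1 / (2 * pi) ^ CARD('n)"
 define \<Phi> where "\<Phi> ksi eta = cis (x \<bullet> (ksi + eta)) * a x (ksi + eta) * ft u ksi * ft f eta" for ksi eta
 have [measurable]: "ft u \<in> borel_measurable borel" "ft f \<in> borel_measurable borel"
  using ft_test_measurable f u by auto
 have "continuous_on UNIV (%z::(real^'n) \<times> (real^'n). (x, fst z + snd z))" by (intro continuous_intros)
 from continuous_on_compose2[OF sym_continuous[OF a] this]
 have "continuous_on UNIV (%z. a x (fst z + snd z))" by simp
 then have am: "(%z. a x (fst z + snd z)) \<in> borel_measurable (borel \<Otimes>\<^sub>M borel)"
  unfolding borel_prod by (rule borel_measurable_continuous_onI)
 have cm: "(%z::(real^'n) \<times> (real^'n). cis (x \<bullet> (fst z + snd z))) \<in> borel_measurable (borel \<Otimes>\<^sub>M borel)"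
  unfolding borel_prod by (intro borel_measurable_continuous_onI continuous_intros)
 have \<Phi>m[measurable]: "(%z. \<Phi> (fst z) (snd z)) \<in> borel_measurable (borel \<Otimes>\<^sub>M borel)"
  unfolding \<Phi>_def using am cm by measurable
 obtain C where C0: "C \<ge> 0" and C': "!!x ksi. ksi \<in> UNIV ==> norm (a x ksi) \<le> C * (1 + norm ksi) powr d"
  using symb_on_bound[OF a] by blast
 obtain m where m: "\<bar>d\<bar> \<le> real m" using real_arch_simple by blast
 \<comment> \<open>Peetre's inequality bounds the symbol at \<open>ksi + eta\<close> by separate
   powers of 1 + |ksi| and 1 + |eta|, which leaves a product of two integrable functions.\<close>
 have \<Phi>b: "norm (\<Phi> ksi eta) \<le> (C * 2 ^ m) * (((1 + norm ksi) ^ m * norm (ft u ksi)) * ((1 + norm eta) ^ m * norm (ft f eta)))" for ksi eta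
 proof -
  have "(1 + norm ksi) powr d \<le> (1 + norm ksi) ^ m"
   using powr_mono[of d "real m" "1 + norm ksi"] m by (simp add: powr_realpow add_pos_nonneg)
  then have "(1 + norm (ksi + eta)) powr d \<le> (2 * (1 + norm eta)) ^ m * (1 + norm ksi) ^ m"
   using order_trans[OF peetre[of 1 d m ksi eta] mult_left_mono] m by simp
  then have "norm (a x (ksi + eta)) \<le> C * ((2 * (1 + norm eta)) ^ m * (1 + norm ksi) ^ m)"
   by (rule order_trans[OF C'[OF UNIV_I] mult_left_mono[OF _ C0]])
  then have "norm (a x (ksi + eta)) * (norm (ft u ksi) * norm (ft f eta)) \<le> C * ((2 * (1 + norm eta)) ^ m * (1 + norm ksi) ^ m) * (norm (ft u ksi) * norm (ft f eta))"
   by (rule mult_right_mono) simp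
  then show ?thesis by (simp only: \<Phi>_def norm_mult norm_cis mult_1_left power_mult_distrib mult_ac)
 qed
 have i1: "integrable (lborel \<Otimes>\<^sub>M lborel) (%(ksi, eta). (1::complex) * (of_real ((1 + norm (ksi::real^'n)) ^ m * norm (ft u ksi)) * of_real ((1 + norm (eta::real^'n)) ^ m * norm (ft f eta))))"
  by (rule integrable_product_bounded[OF integrable_of_real[OF ft_integrable_poly[OF u]] integrable_of_real[OF ft_integrable_poly[OF f]]]) auto
 have \<Phi>i: "integrable (lborel \<Otimes>\<^sub>M lborel) (%(ksi, eta). \<Phi> ksi eta)"
 proof (rule Bochner_Integration.integrable_bound[OF integrable_mult_right[OF i1, of "of_real (C * 2 ^ m)"]])
  show "(%(ksi, eta). \<Phi> ksi eta) \<in> borel_measurable (lborel \<Otimes>\<^sub>M lborel)"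
   using \<Phi>m by (simp add: case_prod_unfold cong: measurable_cong_sets)
  show "AE z in lborel \<Otimes>\<^sub>M lborel. norm (case z of (ksi, eta) => \<Phi> ksi eta) \<le>
    norm (of_real (C * 2 ^ m) * (case z of (ksi, eta) => (1::complex) * (of_real ((1 + norm (ksi::real^'n)) ^ m * norm (ft u ksi)) * of_real ((1 + norm (eta::real^'n)) ^ m * norm (ft f eta)))))"
  proof -
   have "norm (1 + complex_of_real (norm y)) = 1 + norm y" for y :: "real^'n"
   proof -
    have e: "1 + complex_of_real (norm y) = complex_of_real (1 + norm y)" by simp
    show ?thesis unfolding e norm_of_real by simp
   qed
   then show ?thesis
    using \<Phi>b C0 by (auto simp: norm_mult abs_mult norm_power case_prod_unfold intro!: AE_I2)
  qed
 qed
 \<comment> \<open>Instead of a change of variables in the product space, the shear by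
   \<open>eta\<close> is treated as a translation in one variable for each fixed \<open>eta\<close>,
   followed by Fubini.\<close>
 have \<Psi>i: "integrable (lborel \<Otimes>\<^sub>M lborel) (%(eta, \<zeta>). \<Phi> (\<zeta> - eta) eta)"
 proof (rule lborel_pair.Fubini_integrable)
  have "(%z. \<Phi> (fst (snd z - fst z, fst z)) (snd (snd z - fst z, fst z))) \<in> borel_measurable (borel \<Otimes>\<^sub>M borel)"
   by (rule measurable_compose[OF _ \<Phi>m]) measurable
  then show "(%(eta, \<zeta>). \<Phi> (\<zeta> - eta) eta) \<in> borel_measurable (lborel \<Otimes>\<^sub>M lborel)"
   by (simp add: case_prod_unfold cong: measurable_cong_sets)
  have [measurable]: "(%ksi. \<Phi> ksi eta) \<in> borel_measurable borel" for eta
   using measurable_compose[OF _ \<Phi>m, of "%ksi. (ksi, eta)" borel] by simp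
  have "(\<integral>\<zeta>. norm (\<Phi> (\<zeta> - eta) eta) \<partial>lborel) = (\<integral>ksi. norm (\<Phi> ksi eta) \<partial>lborel)" for eta
   using lborel_integral_translate[of "%ksi. norm (\<Phi> ksi eta)" "- eta"] by simp
  moreover have "integrable lborel (%eta. \<integral>ksi. norm (\<Phi> ksi eta) \<partial>lborel)"
   using lborel_pair.integrable_snd[of "%ksi eta. norm (\<Phi> ksi eta)"] integrable_norm[OF \<Phi>i] by (simp add: case_prod_unfold)
  ultimately show "integrable lborel (%eta. \<integral>\<zeta>. norm (case (eta, \<zeta>) of (eta, \<zeta>) => \<Phi> (\<zeta> - eta) eta) \<partial>lborel)"
   by simp
  have "AE eta in lborel. integrable lborel (%ksi. \<Phi> ksi eta)"
   using lborel_pair.AE_integrable_snd[OF \<Phi>i] by simp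
  then show "AE eta in lborel. integrable lborel (%\<zeta>. case (eta, \<zeta>) of (eta, \<zeta>) => \<Phi> (\<zeta> - eta) eta)"
  proof eventually_elim
   case (elim eta)
   from lborel_integrable_affine[OF this, of 1 "- eta"] show ?case by simp
  qed
 qed
 have L: "kern 1 a (%y. f y * u y) x 0 \<zeta> = ?c *\<^sub>R (\<integral>eta. \<Phi> (\<zeta> - eta) eta \<partial>lborel)" for \<zeta>
 proof -
  have "kern 1 a (%y. f y * u y) x 0 \<zeta> = ?c *\<^sub>R (cis (x \<bullet> \<zeta>) * a x \<zeta> * (\<integral>eta. ft f eta * ft u (\<zeta> - eta) \<partial>lborel))"
   by (simp add: kern_def ft_mult[OF f u, symmetric])
  also have "cis (x \<bullet> \<zeta>) * a x \<zeta> * (\<integral>eta. ft f eta * ft u (\<zeta> - eta) \<partial>lborel) = (\<integral>eta. \<Phi> (\<zeta> - eta) eta \<partial>lborel)"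
   by (subst integral_mult_right_zero[symmetric]) (simp add: \<Phi>_def mult_ac)
  finally show ?thesis .
 qed
 have R: "kern 1 (T 1 a f) u x 0 ksi = ?c *\<^sub>R (\<integral>eta. \<Phi> ksi eta \<partial>lborel)" for ksi
 proof -
  have c: "cis (x \<bullet> (ksi + eta)) = cis (x \<bullet> ksi) * cis (x \<bullet> eta)" for eta by (simp add: cis_mult inner_add_right)
  have "(\<integral>eta. \<Phi> ksi eta \<partial>lborel) = (\<integral>eta. (cis (x \<bullet> ksi) * ft u ksi) * (kern 1 a f x ksi eta) \<partial>lborel)"
   by (simp add: \<Phi>_def kern_def c mult_ac)
  also have "... = (cis (x \<bullet> ksi) * ft u ksi) * (\<integral>eta. kern 1 a f x ksi eta \<partial>lborel)" by simp
  finally show ?thesis by (simp add: kern_def[of 1 "T 1 a f"] T_def mult_ac)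
 qed
 have "(\<integral>\<zeta>. (\<integral>eta. \<Phi> (\<zeta> - eta) eta \<partial>lborel) \<partial>lborel) = (\<integral>eta. (\<integral>\<zeta>. \<Phi> (\<zeta> - eta) eta \<partial>lborel) \<partial>lborel)"
  using lborel_pair.Fubini_integral[of "%eta \<zeta>. \<Phi> (\<zeta> - eta) eta"] \<Psi>i by simp
 also have "... = (\<integral>eta. (\<integral>ksi. \<Phi> ksi eta \<partial>lborel) \<partial>lborel)"
 proof (rule Bochner_Integration.integral_cong[OF refl])
  fix eta
  have "(%ksi. \<Phi> ksi eta) \<in> borel_measurable borel"
   using measurable_compose[OF _ \<Phi>m, of "%ksi. (ksi, eta)" borel] by simp
  from lborel_integral_translate[OF this, of "- eta"]
  show "(\<integral>\<zeta>. \<Phi> (\<zeta> - eta) eta \<partial>lborel) = (\<integral>ksi. \<Phi> ksi eta \<partial>lborel)" by simp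
 qed
 also have "... = (\<integral>ksi. (\<integral>eta. \<Phi> ksi eta \<partial>lborel) \<partial>lborel)"
  by (rule lborel_pair.Fubini_integral) (use \<Phi>i in simp)
 finally show ?thesis by (simp add: T_def[of 1 a "%y. f y * u y"] T_def[of 1 "T 1 a f"] L R)
qed

lemma ft_modulate: "ft (%y. cis (y \<bullet> eta) * f y) \<zeta> = ft f (\<zeta> - eta)"
 unfolding ft_def by (rule Bochner_Integration.integral_cong) (auto simp: inner_diff_right cis_mult mult.assoc[symmetric])

lemma test_function_modulate:
 assumes "test_function S (f :: real^'n::finite => complex)" shows "test_function S (%y. cis (y \<bullet> eta) * f y)"
 using test_function_bilinear_left[OF bounded_bilinear_mult assms smooth_on_cis_inner[of eta]] by (simp add: mult.commute)

text \<open>A pseudodifferential operator acting on an oscillating function reads off its symbol.\<close>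

lemma T_modulate:
 fixes f :: "real^'n::finite => complex"
 assumes a: "sym d a" and f: "test_function U f"
 shows "T 1 a (%y. cis (y \<bullet> eta) * f y) x 0 = cis (x \<bullet> eta) * T 1 a f x eta"
proof -
 have "(\<integral>\<zeta>. kern 1 a (%y. cis (y \<bullet> eta) * f y) x 0 \<zeta> \<partial>lborel) = (\<integral>\<zeta>. kern 1 a (%y. cis (y \<bullet> eta) * f y) x 0 (\<zeta> + eta) \<partial>lborel)"
  by (rule lborel_integral_translate[symmetric]) (rule kern_measurable[OF a test_function_modulate[OF f]])
 also have "... = (\<integral>\<zeta>. cis (x \<bullet> eta) * kern 1 a f x eta \<zeta> \<partial>lborel)"
  by (intro Bochner_Integration.integral_cong refl)
   (simp only: kern_def ft_modulate, simp add: inner_add_right cis_mult[symmetric] mult_ac add.commute)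
 finally show ?thesis by (simp add: T_def)
qed

subsection \<open>The asymptotic expansion\<close>

text \<open>The sum over all lists of \<open>l\<close> indices counts a multi-index of length
  \<open>l\<close> as often as it has orderings, so E l divided by l! is the usual sum of (d_xi^beta
  a) (D^beta f) / beta! over all multi-indices beta of length l.\<close>

primrec E :: "nat => (real^'n::finite => real^'n => complex) => (real^'n => complex) => real^'n => real^'n => complex" where
 "E 0 = (%a f x ksi. a x ksi * f x)"
| "E (Suc l) = (%a f x ksi. \<Sum>\<alpha>\<in>UNIV. E l (d\<xi> \<alpha> a) (Dd \<alpha> f) x ksi)"

definition Rem :: "nat => real => (real^'n::finite => real^'n => complex) => (real^'n => complex) => real^'n => real^'n => complex" where
 "Rem N t a f x ksi = T t a f x ksi - (\<Sum>l<N. (t ^ l / fact l) *\<^sub>R E l a f x ksi)"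

lemma frechet_derivative_cong:
 assumes "open S" "x \<in> S" "!!y. y \<in> S ==> f y = g y"
 shows "frechet_derivative f (at x) = frechet_derivative g (at x)"
proof -
 have "(f has_derivative D) (at x) = (g has_derivative D) (at x)" for D
  using has_derivative_transform_within_open[of f D x UNIV S g] has_derivative_transform_within_open[of g D x UNIV S f] assms
  by auto
 then show ?thesis by (simp add: frechet_derivative_def)
qed

lemma E_cong:
 assumes "open \<Omega>" "open Z" "!!x ksi. x \<in> \<Omega> ==> ksi \<in> Z ==> a x ksi = b x ksi" "!!x. x \<in> \<Omega> ==> f x = g x" "x \<in> \<Omega>" "ksi \<in> Z"
 shows "E l a f x ksi = E l b g x ksi"
 using assms(3-6)
proof (induction l arbitrary: a b f g x ksi)
 case (Suc l)
 have W: "open (\<Omega> \<times> Z)" using assms(1,2) by (rule open_Times)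
 have "E l (d\<xi> \<alpha> a) (Dd \<alpha> f) x ksi = E l (d\<xi> \<alpha> b) (Dd \<alpha> g) x ksi" for \<alpha>
 proof (rule Suc.IH)
  show "d\<xi> \<alpha> a x ksi = d\<xi> \<alpha> b x ksi" if "x \<in> \<Omega>" "ksi \<in> Z" for x ksi
   by (rule d\<xi>_cong[OF W]) (use that Suc.prems in auto)
  show "Dd \<alpha> f x = Dd \<alpha> g x" if "x \<in> \<Omega>" for x
   using frechet_derivative_cong[OF assms(1) that Suc.prems(2)] by (simp add: Dd_def pd_def)
 qed (use Suc.prems in auto)
 then show ?case by simp
qed auto

lemma E_zero: "E l (%x ksi. 0) f x ksi = 0"
 by (induction l arbitrary: f) (auto simp: d\<xi>_const)

lemma E_sum:
 assumes "open \<Omega>" "open Z" "!!i. i \<in> I ==> smooth2 (\<Omega> \<times> Z) (a i)" "x \<in> \<Omega>" "ksi \<in> Z"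
 shows "E l (%x ksi. \<Sum>i\<in>I. a i x ksi) f x ksi = (\<Sum>i\<in>I. E l (a i) f x ksi)"
 using assms(3)
proof (induction l arbitrary: a f)
 case 0
 then show ?case by (simp add: sum_distrib_right)
next
 case (Suc l)
 have W: "open (\<Omega> \<times> Z)" using assms(1,2) by (rule open_Times)
 have "E l (d\<xi> \<alpha> (%x ksi. \<Sum>i\<in>I. a i x ksi)) (Dd \<alpha> f) x ksi = E l (%x ksi. \<Sum>i\<in>I. d\<xi> \<alpha> (a i) x ksi) (Dd \<alpha> f) x ksi" for \<alpha>
  by (rule E_cong[OF assms(1,2)]) (use d\<xi>_sum[where W = "\<Omega> \<times> Z" and I = I and f = a, OF Suc.prems] assms in auto)
 also have "... \<alpha> = (\<Sum>i\<in>I. E l (d\<xi> \<alpha> (a i)) (Dd \<alpha> f) x ksi)" for \<alpha>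
  by (rule Suc.IH) (use Suc.prems smooth2_d\<xi>[OF W] in auto)
 finally have e: "E l (d\<xi> \<alpha> (%x ksi. \<Sum>i\<in>I. a i x ksi)) (Dd \<alpha> f) x ksi = (\<Sum>i\<in>I. E l (d\<xi> \<alpha> (a i)) (Dd \<alpha> f) x ksi)" for \<alpha> .
 show ?case unfolding E.simps e by (rule sum.swap)
qed

lemma E_mult_x:
 assumes "open \<Omega>" "open Z" "smooth2 (\<Omega> \<times> Z) a" "x \<in> \<Omega>" "ksi \<in> Z"
 shows "E l (%x ksi. \<phi> x * a x ksi) f x ksi = \<phi> x * E l a f x ksi"
 using assms(3)
proof (induction l arbitrary: a f)
 case (Suc l)
 have W: "open (\<Omega> \<times> Z)" using assms(1,2) by (rule open_Times)
 have "E l (d\<xi> \<alpha> (%x ksi. \<phi> x * a x ksi)) (Dd \<alpha> f) x ksi = E l (%x ksi. \<phi> x * d\<xi> \<alpha> a x ksi) (Dd \<alpha> f) x ksi" for \<alpha>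
 proof (rule E_cong[OF assms(1,2)])
  fix x ksi assume "x \<in> \<Omega>" "ksi \<in> Z"
  have "d\<xi> \<alpha> (%y ksi. \<phi> y * a y ksi) x ksi = d\<xi> \<alpha> (%y ksi. \<phi> x * a y ksi) x ksi" by (simp add: d\<xi>_def)
  also have "... = \<phi> x * d\<xi> \<alpha> a x ksi"
   by (rule d\<xi>_bounded_linear[OF bounded_linear_mult_right Suc.prems]) (use \<open>x \<in> \<Omega>\<close> \<open>ksi \<in> Z\<close> in auto)
  finally show "d\<xi> \<alpha> (%x ksi. \<phi> x * a x ksi) x ksi = \<phi> x * d\<xi> \<alpha> a x ksi" .
 qed (use assms in auto)
 also have "... \<alpha> = \<phi> x * E l (d\<xi> \<alpha> a) (Dd \<alpha> f) x ksi" for \<alpha>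
  by (rule Suc.IH[OF smooth2_d\<xi>[OF W Suc.prems]])
 finally show ?case by (simp add: sum_distrib_left)
qed simp

lemma smooth_on_Dd: "open S ==> smooth_on S f ==> smooth_on S (Dd \<alpha> f)"
 unfolding Dd_def pd_def by (intro smooth_on_bounded_linear[OF bounded_linear_mult_right] smooth_on_derivative)

lemma smooth2_E:
 assumes "open \<Omega>" "open Z" "smooth2 (\<Omega> \<times> Z) a" "smooth_on \<Omega> f"
 shows "smooth2 (\<Omega> \<times> Z) (E l a f)"
 using assms(3,4)
proof (induction l arbitrary: a f)
 have W: "open (\<Omega> \<times> Z)" using assms(1,2) by (rule open_Times)
 {
  case 0
  have "smooth_on (\<Omega> \<times> Z) (%z. f (fst z))"
   by (rule smooth_on_compose[OF W assms(1) smooth_on_fst[OF W] 0(2)]) auto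
  then show ?case using smooth_on_mult[OF W 0(1)] by (simp add: case_prod_unfold)
 next
  case (Suc l)
  have "smooth_on (\<Omega> \<times> Z) (%z. \<Sum>\<alpha>\<in>UNIV. E l (d\<xi> \<alpha> a) (Dd \<alpha> f) (fst z) (snd z))"
   using Suc.IH[OF smooth2_d\<xi>[OF W Suc.prems(1)] smooth_on_Dd[OF assms(1) Suc.prems(2)]]
   by (intro smooth_on_sum W) (simp add: case_prod_unfold)
  then show ?case by (simp add: case_prod_unfold)
 }
qed

lemma symb_on_E:
 assumes "open Z" "S \<subseteq> Z" "symb_on Z S d a" "test_function U f"
 shows "symb_on Z S (d - real l) (E l a f)"
 using assms(3,4)
proof (induction l arbitrary: a f d)
 case 0
 then show ?case
  using symb_on_bilinear[OF assms(1,2) bounded_bilinear_mult 0(1) symb_on_test[OF assms(1) 0(2)]] by simp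
next
 case (Suc l)
 have "symb_on Z S (d - 1 - real l) (E l (d\<xi> \<alpha> a) (Dd \<alpha> f))" for \<alpha>
  by (rule Suc.IH[OF symb_on_d\<xi>[OF assms(1) Suc.prems(1)] test_Dd[OF Suc.prems(2)]])
 then have "symb_on Z S (d - 1 - real l) (%x ksi. \<Sum>\<alpha>\<in>UNIV. E l (d\<xi> \<alpha> a) (Dd \<alpha> f) x ksi)"
  by (intro symb_on_sum assms(1,2))
 then show ?case by (simp add: diff_diff_eq add.commute)
qed

lemma d\<xi>_homogeneous:
 fixes a :: "real^'n::finite => real^'n => 'b::real_normed_vector"
 assumes \<Omega>: "open \<Omega>" and a: "smooth2 (\<Omega> \<times> - {0}) a"
  and h: "!!x ksi. x \<in> \<Omega> ==> ksi \<noteq> 0 ==> a x (t *\<^sub>R ksi) = (t powi e) *\<^sub>R a x ksi"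
  and t: "t > 0" and x: "x \<in> \<Omega>" "ksi \<noteq> 0"
 shows "d\<xi> \<alpha> a x (t *\<^sub>R ksi) = (t powi (e - 1)) *\<^sub>R d\<xi> \<alpha> a x ksi"
proof -
 have W: "open (\<Omega> \<times> - {0 :: real^'n})" using \<Omega> by (intro open_Times) auto
 have m: "(x, t *\<^sub>R ksi) \<in> \<Omega> \<times> - {0}" "(x, ksi) \<in> \<Omega> \<times> - {0}" using x t by auto
 have "((%z. (fst z, t *\<^sub>R snd z)) has_derivative (%z. (fst z, t *\<^sub>R snd z))) (at (x, ksi))"
  by (auto intro!: derivative_eq_intros)
 from diff_chain_at[OF this, of "%(x, ksi). a x ksi" "grad2 a x (t *\<^sub>R ksi)"] smooth2_has_derivative[OF a m(1)]
 have d: "((%(y, \<zeta>). a y (t *\<^sub>R \<zeta>)) has_derivative (%z. grad2 a x (t *\<^sub>R ksi) (fst z, t *\<^sub>R snd z))) (at (x, ksi))"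
  by (simp add: o_def case_prod_unfold)
 have L: "linear (grad2 a x (t *\<^sub>R ksi))" using has_derivative_linear[OF smooth2_has_derivative[OF a m(1)]] .
 have "t *\<^sub>R d\<xi> \<alpha> a x (t *\<^sub>R ksi) = d\<xi> \<alpha> (%y \<zeta>. a y (t *\<^sub>R \<zeta>)) x ksi"
  using linear_scale[OF L, of t "(0, axis \<alpha> 1)"] by (simp add: d\<xi>_eqI[OF d] d\<xi>_eq[OF a m(1)])
 also have "... = d\<xi> \<alpha> (%y \<zeta>. (t powi e) *\<^sub>R a y \<zeta>) x ksi"
  by (rule d\<xi>_cong[OF W m(2)]) (auto simp: h)
 also have "... = (t powi e) *\<^sub>R d\<xi> \<alpha> a x ksi"
  by (rule d\<xi>_bounded_linear[OF bounded_linear_scaleR_right a m(2)])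
 finally have "inverse t *\<^sub>R (t *\<^sub>R d\<xi> \<alpha> a x (t *\<^sub>R ksi)) = inverse t *\<^sub>R ((t powi e) *\<^sub>R d\<xi> \<alpha> a x ksi)" by simp
 then show ?thesis using t by (simp add: power_int_diff divide_inverse mult.commute)
qed

text \<open>Each of the \<open>l\<close> derivatives in the covector lowers the degree by one;
  \<open>f\<close> does not depend on the covector.\<close>

lemma E_homogeneous:
 assumes \<Omega>: "open \<Omega>" and a: "smooth2 (\<Omega> \<times> - {0}) a"
  and h: "!!x ksi. x \<in> \<Omega> ==> ksi \<noteq> 0 ==> a x (t *\<^sub>R ksi) = (t powi e) *\<^sub>R a x ksi"
  and t: "t > 0" and x: "x \<in> \<Omega>" "ksi \<noteq> 0"
 shows "E l a f x (t *\<^sub>R ksi) = (t powi (e - int l)) *\<^sub>R E l a f x ksi"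
 using a h
proof (induction l arbitrary: a f e)
 case 0
 then show ?case using x by simp
next
 case (Suc l)
 have W: "open (\<Omega> \<times> - {0 :: real^'a})" using \<Omega> by (intro open_Times) auto
 have "E l (d\<xi> \<alpha> a) (Dd \<alpha> f) x (t *\<^sub>R ksi) = (t powi (e - 1 - int l)) *\<^sub>R E l (d\<xi> \<alpha> a) (Dd \<alpha> f) x ksi" for \<alpha>
  by (rule Suc.IH[OF smooth2_d\<xi>[OF W Suc.prems(1)]]) (rule d\<xi>_homogeneous[OF \<Omega> Suc.prems(1,2) t])
 moreover have "e - 1 - int l = e - int (Suc l)" by simp
 ultimately show ?case by (simp add: scaleR_sum_right)
qed

lemma d\<xi>_commute:
 fixes f :: "real^'n::finite => real^'n => 'b::euclidean_space"
 assumes f: "smooth2 UNIV f"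
 shows "d\<xi> \<alpha> (d\<xi> \<beta> f) = d\<xi> \<beta> (d\<xi> \<alpha> f)"
proof (intro ext)
 fix x ksi
 let ?F = "%(x, ksi). f x ksi"
 have *: "d\<xi> \<alpha> (d\<xi> \<beta> f) x ksi = frechet_derivative (%y. frechet_derivative ?F (at y) (0, axis \<beta> 1)) (at (x, ksi)) (0, axis \<alpha> 1)" for \<alpha> \<beta>
 proof -
  have "d\<xi> \<alpha> (d\<xi> \<beta> f) x ksi = d\<xi> \<alpha> (%x ksi. grad2 f x ksi (0, axis \<beta> 1)) x ksi"
   by (rule d\<xi>_cong[OF open_UNIV UNIV_I]) (simp add: d\<xi>_eq[OF f])
  also have "... = frechet_derivative (%y. frechet_derivative ?F (at y) (0, axis \<beta> 1)) (at (x, ksi)) (0, axis \<alpha> 1)"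
   by (rule d\<xi>_eqI) (use smooth_on_has_derivative[OF smooth_on_derivative[OF f] UNIV_I] in \<open>simp add: case_prod_unfold\<close>)
  finally show ?thesis .
 qed
 show "d\<xi> \<alpha> (d\<xi> \<beta> f) x ksi = d\<xi> \<beta> (d\<xi> \<alpha> f) x ksi"
  unfolding * by (rule second_derivative_symmetric[OF open_UNIV UNIV_I smooth_on_Ck[OF f]])
qed

lemma pd_Dd_commute:
 assumes "test_function U f" shows "pd \<alpha> (Dd \<beta> f) = Dd \<beta> (pd \<alpha> f)"
proof
 fix x
 have 1: "((%x. frechet_derivative f (at x) (axis \<beta> 1)) has_derivative frechet_derivative (%x. frechet_derivative f (at x) (axis \<beta> 1)) (at x)) (at x)"
  by (rule smooth_on_has_derivative[OF smooth_on_derivative[OF test_function_smooth[OF assms]] UNIV_I])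
 have "pd \<alpha> (Dd \<beta> f) x = - \<i> * pd \<alpha> (pd \<beta> f) x"
  using frechet_derivative_eqI[OF has_derivative_mult_right[OF 1, of "- \<i>"]] by (simp add: Dd_def pd_def[abs_def])
 also have "pd \<alpha> (pd \<beta> f) x = pd \<beta> (pd \<alpha> f) x"
  unfolding pd_def by (rule second_derivative_symmetric[OF open_UNIV UNIV_I smooth_on_Ck[OF test_function_smooth[OF assms]]])
 finally show "pd \<alpha> (Dd \<beta> f) x = Dd \<beta> (pd \<alpha> f) x" by (simp add: Dd_def)
qed

lemma smooth2_E_UNIV: "sym d a ==> test_function U f ==> smooth2 UNIV (E l a f)"
 using smooth2_E[of UNIV UNIV a f l] symb_on_smooth[of UNIV UNIV d a] test_function_smooth[of U f] by simp

lemma dx_d\<xi>_E: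
 assumes "sym d a" "test_function U f"
 shows "d\<xi> \<alpha> (E l a f) x ksi = E l (d\<xi> \<alpha> a) f x ksi"
  and "dx \<alpha> (E l a f) x ksi = E l (dx \<alpha> a) f x ksi + E l a (pd \<alpha> f) x ksi"
proof -
 show "d\<xi> \<alpha> (E l a f) x ksi = E l (d\<xi> \<alpha> a) f x ksi" using assms
 proof (induction l arbitrary: a f d)
  case 0
  have s: "smooth2 UNIV (%x ksi. f x)" by (rule smooth2_of_x[OF open_UNIV test_function_smooth[OF 0(2)]])
  from d\<xi>_bilinear[OF bounded_bilinear_mult symb_on_smooth[OF 0(1), unfolded UNIV_Times_UNIV] s UNIV_I]
  show ?case by (simp add: d\<xi>_const)
 next
  case (Suc l)
  have s: "sym d (d\<xi> \<beta> a)" for \<beta> using symb_on_mono[OF symb_on_d\<xi>[OF open_UNIV Suc.prems(1)], of d] by simp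
  have "d\<xi> \<alpha> (E (Suc l) a f) x ksi = (\<Sum>\<beta>\<in>UNIV. d\<xi> \<alpha> (E l (d\<xi> \<beta> a) (Dd \<beta> f)) x ksi)"
   unfolding E.simps by (rule d\<xi>_sum[OF smooth2_E_UNIV[OF s test_Dd[OF Suc.prems(2)]] UNIV_I])
  also have "... = (\<Sum>\<beta>\<in>UNIV. E l (d\<xi> \<beta> (d\<xi> \<alpha> a)) (Dd \<beta> f) x ksi)"
   using Suc.IH[OF s test_Dd[OF Suc.prems(2)]] d\<xi>_commute[of a] symb_on_smooth[OF Suc.prems(1)] by simp
  finally show ?case by simp
 qed
 show "dx \<alpha> (E l a f) x ksi = E l (dx \<alpha> a) f x ksi + E l a (pd \<alpha> f) x ksi" using assms
 proof (induction l arbitrary: a f d)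
  case 0
  have s: "smooth2 UNIV (%x ksi. f x)" by (rule smooth2_of_x[OF open_UNIV test_function_smooth[OF 0(2)]])
  from dx_bilinear[OF bounded_bilinear_mult symb_on_smooth[OF 0(1), unfolded UNIV_Times_UNIV] s UNIV_I]
  show ?case by (simp add: dx_of_x[OF smooth_on_differentiable[OF test_function_smooth[OF 0(2)]]])
 next
  case (Suc l)
  have s: "sym d (d\<xi> \<beta> a)" for \<beta> using symb_on_mono[OF symb_on_d\<xi>[OF open_UNIV Suc.prems(1)], of d] by simp
  have sm: "smooth2 UNIV a" using symb_on_smooth[OF Suc.prems(1)] by simp
  have c: "dx \<alpha> (d\<xi> \<beta> a) = d\<xi> \<beta> (dx \<alpha> a)" for \<beta>
   using d\<xi>_dx_commute[OF open_UNIV UNIV_I sm] by (auto simp: fun_eq_iff)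
  have "dx \<alpha> (E (Suc l) a f) x ksi = (\<Sum>\<beta>\<in>UNIV. dx \<alpha> (E l (d\<xi> \<beta> a) (Dd \<beta> f)) x ksi)"
   unfolding E.simps by (rule dx_sum[OF smooth2_E_UNIV[OF s test_Dd[OF Suc.prems(2)]] UNIV_I])
  also have "... = (\<Sum>\<beta>\<in>UNIV. E l (d\<xi> \<beta> (dx \<alpha> a)) (Dd \<beta> f) x ksi + E l (d\<xi> \<beta> a) (Dd \<beta> (pd \<alpha> f)) x ksi)"
   using Suc.IH[OF s test_Dd[OF Suc.prems(2)]] by (simp add: c pd_Dd_commute[OF Suc.prems(2)])
  finally show ?case by (simp add: sum.distrib)
 qed
qed

text \<open>Taylor's formula by induction: the \<open>t\<close> derivative of the remainder of order
  N + 1 is a sum of remainders of order N for the pairs \<open>d\<xi> \<alpha> a\<close>,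
  \<open>Dd \<alpha> f\<close>, whose symbols have order d - 1, and the remainder vanishes at t = 0
  by Fourier inversion (\<open>T_0\<close>). The mean value inequality on [0,1] carries the bound
  over.\<close>

lemma Rem_bound:
 assumes "sym d a" "test_function U f"
 shows "\<exists>C. \<forall>t x ksi. 0 \<le> t --> t \<le> 1 --> norm (Rem N t a f x ksi) \<le> C * (1 + norm ksi) powr (d - real N)"
 using assms
proof (induction N arbitrary: a f d)
 case 0
 obtain C where "\<forall>t x ksi. \<bar>t\<bar> \<le> 2 --> norm (T t a f x ksi) \<le> C * (1 + norm ksi) powr d" using T_bound[OF 0] by blast
 then show ?case by (intro exI[of _ C]) (auto simp: Rem_def)
next
 case (Suc N)
 have "\<forall>\<alpha>. \<exists>C. \<forall>t x ksi. 0 \<le> t --> t \<le> 1 --> norm (Rem N t (d\<xi> \<alpha> a) (Dd \<alpha> f) x ksi) \<le> C * (1 + norm ksi) powr (d - 1 - real N)"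
  using Suc.IH[OF symb_on_d\<xi>[OF open_UNIV Suc.prems(1)] test_Dd[OF Suc.prems(2)]] by blast
 from choice[OF this] obtain C where C: "!!\<alpha> t x ksi. 0 \<le> t ==> t \<le> 1 ==>
   norm (Rem N t (d\<xi> \<alpha> a) (Dd \<alpha> f) x ksi) \<le> C \<alpha> * (1 + norm ksi) powr (d - 1 - real N)" by blast
 have "norm (Rem (Suc N) t a f x ksi) \<le> (\<Sum>\<alpha>\<in>UNIV. C \<alpha>) * (1 + norm ksi) powr (d - 1 - real N)" if t: "0 \<le> t" "t \<le> 1" for t x ksi
 proof -
  let ?K = "(\<Sum>\<alpha>\<in>UNIV. C \<alpha>) * (1 + norm ksi) powr (d - 1 - real N)"
  have eq: "Rem (Suc N) s a f x ksi = T s a f x ksi - (a x ksi * f x + (\<Sum>l<N. (s ^ Suc l / fact (Suc l)) *\<^sub>R E (Suc l) a f x ksi))" for s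
   unfolding Rem_def by (subst sum.lessThan_Suc_shift) simp
  have der: "((%s. Rem (Suc N) s a f x ksi) has_vector_derivative (\<Sum>\<alpha>\<in>UNIV. Rem N s (d\<xi> \<alpha> a) (Dd \<alpha> f) x ksi)) (at s)" if "s \<in> {0..1}" for s
  proof -
   have p: "((%s. (s ^ Suc l / fact (Suc l)) *\<^sub>R E (Suc l) a f x ksi) has_vector_derivative (s ^ l / fact l) *\<^sub>R E (Suc l) a f x ksi) (at s)" for l
   proof -
    have "((%s. s ^ Suc l / fact (Suc l)) has_real_derivative real (Suc l) * s ^ l / fact (Suc l)) (at s)"
     by (intro DERIV_cdivide) (use DERIV_pow[of "Suc l" s] in simp)
    moreover have "real (Suc l) * s ^ l / fact (Suc l) = s ^ l / fact l" by (simp add: fact_Suc del: of_nat_Suc)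
    ultimately show ?thesis
     by (intro has_vector_derivative_scaleR[OF _ has_vector_derivative_const, THEN has_vector_derivative_eq_rhs]) auto
   qed
   have "((%s. Rem (Suc N) s a f x ksi) has_vector_derivative
     (\<Sum>\<alpha>\<in>UNIV. T s (d\<xi> \<alpha> a) (Dd \<alpha> f) x ksi) - (0 + (\<Sum>l<N. (s ^ l / fact l) *\<^sub>R E (Suc l) a f x ksi))) (at s)"
    unfolding eq using that
    by (intro has_vector_derivative_diff has_vector_derivative_add has_vector_derivative_const has_vector_derivative_sum p
      T_has_vector_derivative[OF Suc.prems]) auto
   moreover have "(\<Sum>\<alpha>\<in>UNIV. T s (d\<xi> \<alpha> a) (Dd \<alpha> f) x ksi) - (0 + (\<Sum>l<N. (s ^ l / fact l) *\<^sub>R E (Suc l) a f x ksi)) =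
     (\<Sum>\<alpha>\<in>UNIV. Rem N s (d\<xi> \<alpha> a) (Dd \<alpha> f) x ksi)"
    unfolding Rem_def E.simps scaleR_sum_right by (subst sum.swap) (simp add: sum_subtractf)
   ultimately show ?thesis by simp
  qed
  have "norm (Rem (Suc N) t a f x ksi - Rem (Suc N) 0 a f x ksi) \<le> ?K * norm (t - 0)"
  proof (rule differentiable_bound[where S = "{0..1}" and f' = "%s h. h *\<^sub>R (\<Sum>\<alpha>\<in>UNIV. Rem N s (d\<xi> \<alpha> a) (Dd \<alpha> f) x ksi)"])
   fix s :: real assume s: "s \<in> {0..1}"
   show "((%s. Rem (Suc N) s a f x ksi) has_derivative (%h. h *\<^sub>R (\<Sum>\<alpha>\<in>UNIV. Rem N s (d\<xi> \<alpha> a) (Dd \<alpha> f) x ksi))) (at s within {0..1})"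
    using der[OF s] has_derivative_at_withinI by (auto simp: has_vector_derivative_def)
   have "norm (\<Sum>\<alpha>\<in>UNIV. Rem N s (d\<xi> \<alpha> a) (Dd \<alpha> f) x ksi) \<le> (\<Sum>\<alpha>\<in>UNIV. C \<alpha> * (1 + norm ksi) powr (d - 1 - real N))"
    by (rule sum_norm_le) (use C s in auto)
   then have n: "norm (\<Sum>\<alpha>\<in>UNIV. Rem N s (d\<xi> \<alpha> a) (Dd \<alpha> f) x ksi) \<le> ?K" by (simp add: sum_distrib_right)
   show "onorm (%h. h *\<^sub>R (\<Sum>\<alpha>\<in>UNIV. Rem N s (d\<xi> \<alpha> a) (Dd \<alpha> f) x ksi)) \<le> ?K"
    by (rule onorm_bound) (use order_trans[OF norm_ge_zero n] mult_left_mono[OF n abs_ge_zero] in \<open>auto simp: mult.commute\<close>)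
  qed (use t in auto)
  moreover have "Rem (Suc N) 0 a f x ksi = 0" unfolding eq by (simp add: T_0[OF Suc.prems(2)])
  moreover have "?K * norm (t - 0) \<le> ?K"
  proof -
   have "0 \<le> C \<alpha> * (1 + norm ksi) powr (d - 1 - real N)" for \<alpha> using order_trans[OF norm_ge_zero C[of 0 \<alpha> x ksi]] by simp
   then have "0 \<le> ?K" by (simp add: sum_distrib_right sum_nonneg)
   then show ?thesis using t by (intro mult_right_le_one_le) auto
  qed
  ultimately show ?thesis by simp
 qed
 then show ?case by (intro exI[of _ "\<Sum>\<alpha>\<in>UNIV. C \<alpha>"]) (simp add: diff_diff_eq add.commute)
qed

text \<open>Differentiating a remainder in \<open>x\<close> or \<open>ksi\<close> gives remainders
  for other pairs \<open>a\<close>, \<open>f\<close>, so the pointwise \<open>Rem_bound\<close>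
  yields the estimates of all orders.\<close>

lemma symb_on_Rem:
 assumes "sym d a" "test_function U f"
 shows "sym (d - real N) (Rem N 1 a f)"
proof -
 have smE: "smooth2 UNIV (%x ksi. \<Sum>l<N. (1 ^ l / fact l) *\<^sub>R E l a f x ksi)" if "sym d a" "test_function U f" for d a f
 proof -
  have "smooth_on UNIV (%z. \<Sum>l<N. (1 ^ l / fact l) *\<^sub>R E l a f (fst z) (snd z))"
   by (intro smooth_on_sum smooth_on_bounded_linear[OF bounded_linear_scaleR_right] open_UNIV smooth2_E_UNIV[OF that, unfolded case_prod_unfold])
  then show ?thesis by (simp add: case_prod_unfold)
 qed
 have sm: "smooth2 UNIV (Rem N 1 a f)" if "sym d a" "test_function U f" for d a f
  using smooth_on_diff[OF open_UNIV smooth_T[OF that, of 1] smE[OF that]]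
  by (simp add: Rem_def[abs_def] case_prod_unfold)
 have d: "d\<xi> \<alpha> (Rem N 1 a f) = Rem N 1 (d\<xi> \<alpha> a) f"
  "dx \<alpha> (Rem N 1 a f) = (%x ksi. Rem N 1 (dx \<alpha> a) f x ksi + Rem N 1 a (pd \<alpha> f) x ksi)"
  if a: "sym d a" and f: "test_function U f" for d a f \<alpha>
 proof -
  have sE: "smooth2 UNIV (%x ksi. (1 ^ l / fact l) *\<^sub>R E l a f x ksi)" for l
   using smooth_on_bounded_linear[OF bounded_linear_scaleR_right open_UNIV smooth2_E_UNIV[OF a f]] by (simp add: case_prod_unfold)
  have mE: "smooth2 UNIV (%x ksi. - (\<Sum>l<N. (1 ^ l / fact l) *\<^sub>R E l a f x ksi))"
   using smooth_on_minus[OF open_UNIV smE[OF a f]] by (simp add: case_prod_unfold)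
  have R: "Rem N 1 a f = (%x ksi. T 1 a f x ksi + - (\<Sum>l<N. (1 ^ l / fact l) *\<^sub>R E l a f x ksi))" by (simp add: Rem_def[abs_def])
  have sT: "smooth2 UNIV (T 1 a f)" using smooth_T[OF a f] by simp
  show "d\<xi> \<alpha> (Rem N 1 a f) = Rem N 1 (d\<xi> \<alpha> a) f"
  proof (intro ext)
   fix x ksi
   have "d\<xi> \<alpha> (%x ksi. - (\<Sum>l<N. (1 ^ l / fact l) *\<^sub>R E l a f x ksi)) x ksi = - (\<Sum>l<N. (1 ^ l / fact l) *\<^sub>R E l (d\<xi> \<alpha> a) f x ksi)"
    using d\<xi>_bounded_linear[OF bounded_linear_minus[OF bounded_linear_ident] smE[OF a f] UNIV_I, of \<alpha> x ksi]
     d\<xi>_sum[where I = "{..<N}" and \<alpha> = \<alpha> and x = x and ksi = ksi, OF sE UNIV_I]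
     d\<xi>_bounded_linear[OF bounded_linear_scaleR_right smooth2_E_UNIV[OF a f] UNIV_I, of \<alpha> _ _ x ksi] dx_d\<xi>_E(1)[OF a f] by simp
   then show "d\<xi> \<alpha> (Rem N 1 a f) x ksi = Rem N 1 (d\<xi> \<alpha> a) f x ksi"
    unfolding R using d\<xi>_add[OF sT mE UNIV_I, of \<alpha> x ksi] d\<xi>_T[OF a f, of 1 \<alpha>] by (simp add: Rem_def)
  qed
  show "dx \<alpha> (Rem N 1 a f) = (%x ksi. Rem N 1 (dx \<alpha> a) f x ksi + Rem N 1 a (pd \<alpha> f) x ksi)"
  proof (intro ext)
   fix x ksi
   have "dx \<alpha> (%x ksi. - (\<Sum>l<N. (1 ^ l / fact l) *\<^sub>R E l a f x ksi)) x ksi =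
     - (\<Sum>l<N. (1 ^ l / fact l) *\<^sub>R (E l (dx \<alpha> a) f x ksi + E l a (pd \<alpha> f) x ksi))"
    using dx_bounded_linear[OF bounded_linear_minus[OF bounded_linear_ident] smE[OF a f] UNIV_I, of \<alpha> x ksi]
     dx_sum[where I = "{..<N}" and \<alpha> = \<alpha> and x = x and ksi = ksi, OF sE UNIV_I]
     dx_bounded_linear[OF bounded_linear_scaleR_right smooth2_E_UNIV[OF a f] UNIV_I, of \<alpha> _ _ x ksi] dx_d\<xi>_E(2)[OF a f] by simp
   then show "dx \<alpha> (Rem N 1 a f) x ksi = Rem N 1 (dx \<alpha> a) f x ksi + Rem N 1 a (pd \<alpha> f) x ksi"
    unfolding R using dx_add[OF sT mE UNIV_I, of \<alpha> x ksi] dx_T[OF a f, of 1 \<alpha>]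
    by (simp add: Rem_def scaleR_add_right sum.distrib)
  qed
 qed
 have "SB k (d - real N) UNIV (Rem N 1 a f)" for k using assms
 proof (induction k arbitrary: a f d)
  case 0
  obtain C where C: "\<forall>t x ksi. 0 \<le> t --> t \<le> 1 --> norm (Rem N t a f x ksi) \<le> C * (1 + norm ksi) powr (d - real N)"
   using Rem_bound[OF 0] by blast
  have "\<forall>x. \<forall>ksi\<in>UNIV. norm (Rem N 1 a f x ksi) \<le> C * (1 + norm ksi) powr (d - real N)"
   using C[rule_format, of 1] by simp
  then show ?case unfolding SB.simps by blast
 next
  case (Suc k)
  note px = symb_on_dx[OF open_UNIV Suc.prems(1)] and pxi = symb_on_d\<xi>[OF open_UNIV Suc.prems(1)] and pf = test_function_pd[OF Suc.prems(2)]
  have 1: "\<exists>C. \<forall>x. \<forall>ksi\<in>UNIV. norm (Rem N 1 a f x ksi) \<le> C * (1 + norm ksi) powr (d - real N)"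
  proof -
   obtain C where C: "\<forall>t x ksi. 0 \<le> t --> t \<le> 1 --> norm (Rem N t a f x ksi) \<le> C * (1 + norm ksi) powr (d - real N)"
    using Rem_bound[OF Suc.prems] by blast
   show ?thesis by (rule exI[of _ C]) (use C[rule_format, of 1] in simp)
  qed
  have e: "d - 1 - real N = d - real N - 1" by simp
  have "SB k (d - real N - 1) UNIV (d\<xi> \<alpha> (Rem N 1 a f))" for \<alpha>
   unfolding d(1)[OF Suc.prems] by (rule Suc.IH[OF pxi Suc.prems(2), unfolded e])
  moreover have "SB k (d - real N) UNIV (dx \<alpha> (Rem N 1 a f))" for \<alpha>
   unfolding d(2)[OF Suc.prems]
   by (rule SB_add[OF open_UNIV subset_UNIV _ _ Suc.IH[OF px Suc.prems(2)] Suc.IH[OF Suc.prems(1) pf]])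
    (use sm[OF px Suc.prems(2)] sm[OF Suc.prems(1) pf] in simp_all)
  ultimately show ?case using 1 by simp
 qed
 then show ?thesis using sm[OF assms] by (simp add: symb_on_def)
qed

text \<open>Both the Taylor expansion in \<open>t\<close> and the expansion of \<open>a\<close> are
  cut off at \<open>N\<close>, and what remains of each has order d - N. The surviving terms are
  indexed by a square of pairs (l, k), of which the triangle l + k < N is the claimed sum.\<close>

lemma expansion_T:
 fixes P :: "nat => real^'n::finite => real^'n => complex"
 assumes Z: "open Z" "S \<subseteq> Z" and a: "sym d a" and f: "test_function U f"
  and P: "!!k. smooth2 (UNIV \<times> Z) (P k)"
  and r: "!!N. symb_on Z S (d - real N) (%x ksi. a x ksi - (\<Sum>k<N. P k x ksi))"
 shows "symb_on Z S (d - real N) (%x ksi. T 1 a f x ksi - (\<Sum>k<N. \<Sum>l\<le>k. (1 / fact l) *\<^sub>R E l (P (k - l)) f x ksi))"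
proof -
 have aZ: "symb_on Z S d a" by (rule symb_on_restrict[OF a]) auto
 \<comment> \<open>The orders of the single terms are not among the assumptions: \<open>P k\<close>
   is the difference of two consecutive remainders.\<close>
 have Ps: "symb_on Z S (d - real k) (P k)" for k
 proof -
  have "symb_on Z S (d - real k) (%x ksi. (a x ksi - (\<Sum>i<k. P i x ksi)) - (a x ksi - (\<Sum>i<Suc k. P i x ksi)))"
   by (intro symb_on_diff Z r symb_on_mono[OF r[of "Suc k"]]) simp
  then show ?thesis by (rule symb_on_cong[OF Z, rotated]) simp
 qed
 let ?r = "%x ksi. a x ksi - (\<Sum>k<N. P k x ksi)"
 have rs: "symb_on Z S (d - real N) ?r" by (rule r)
 have Ea: "E l a f x ksi = (\<Sum>k<N. E l (P k) f x ksi) + E l ?r f x ksi" if "ksi \<in> Z" for l x ksi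
 proof -
  let ?b = "%k. if k < N then P k else ?r"
  have "E l a f x ksi = E l (%x ksi. \<Sum>k<Suc N. ?b k x ksi) f x ksi" by (rule arg_cong[where f = "%a. E l a f x ksi"]) auto
  also have "... = (\<Sum>k<Suc N. E l (?b k) f x ksi)"
   by (rule E_sum[OF open_UNIV Z(1)]) (use P symb_on_smooth[OF rs] that in auto)
  finally show ?thesis by simp
 qed
 let ?g = "%l k x ksi. (1 / fact l) *\<^sub>R E l (P k) f x ksi"
 \<comment> \<open>The pairs of the square outside the triangle; the term at (l, k) has order d - k
   - l, which is at most d - N there.\<close>
 define D where "D = {..<N} \<times> {..<N} - {(l, k). l + k < N}"
 have gs: "symb_on Z S (d - real N) (%x ksi. \<Sum>(l, k)\<in>D. ?g l k x ksi)"
  unfolding case_prod_unfold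
 proof (intro symb_on_sum Z symb_on_bounded_linear[OF _ _ bounded_linear_scaleR_right])
  fix i assume i: "i \<in> D"
  have "symb_on Z S (d - real (snd i) - real (fst i)) (E (fst i) (P (snd i)) f)" by (rule symb_on_E[OF Z Ps f])
  then show "symb_on Z S (d - real N) (E (fst i) (P (snd i)) f)"
   by (rule symb_on_mono) (use i in \<open>auto simp: D_def\<close>)
 qed
 have Es: "symb_on Z S (d - real N) (%x ksi. \<Sum>l<N. (1 / fact l) *\<^sub>R E l ?r f x ksi)"
  by (intro symb_on_sum Z symb_on_bounded_linear[OF _ _ bounded_linear_scaleR_right] symb_on_mono[OF symb_on_E[OF Z rs f]]) simp
 have "symb_on Z S (d - real N) (%x ksi. Rem N 1 a f x ksi + ((\<Sum>l<N. (1 / fact l) *\<^sub>R E l ?r f x ksi) + (\<Sum>(l, k)\<in>D. ?g l k x ksi)))"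
  by (intro symb_on_add Z Es gs symb_on_restrict[OF symb_on_Rem[OF a f]]) auto
 then show ?thesis
 proof (rule symb_on_cong[OF Z, rotated])
  fix x ksi assume ksi: "ksi \<in> Z"
  have "(\<Sum>l<N. (1 / fact l) *\<^sub>R E l a f x ksi) = (\<Sum>l<N. \<Sum>k<N. ?g l k x ksi) + (\<Sum>l<N. (1 / fact l) *\<^sub>R E l ?r f x ksi)"
   by (simp add: Ea[OF ksi] scaleR_add_right scaleR_sum_right sum.distrib)
  also have "(\<Sum>l<N. \<Sum>k<N. ?g l k x ksi) = (\<Sum>(l, k)\<in>{..<N} \<times> {..<N}. ?g l k x ksi)" by (rule sum.cartesian_product)
  also have "... = (\<Sum>(l, k)\<in>D. ?g l k x ksi) + (\<Sum>(l, k)\<in>{(l, k). l + k < N}. ?g l k x ksi)"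
   unfolding D_def by (rule sum.subset_diff) auto
  also have "(\<Sum>(l, k)\<in>{(l, k). l + k < N}. ?g l k x ksi) = (\<Sum>k<N. \<Sum>l\<le>k. ?g l (k - l) x ksi)"
   by (rule sum.triangle_reindex)
  finally show "Rem N 1 a f x ksi + ((\<Sum>l<N. (1 / fact l) *\<^sub>R E l ?r f x ksi) + (\<Sum>(l, k)\<in>D. ?g l k x ksi)) =
    T 1 a f x ksi - (\<Sum>k<N. \<Sum>l\<le>k. ?g l (k - l) x ksi)"
   by (simp add: Rem_def)
 qed
qed

section \<open>From scalar entries to matrix symbols\<close>

abbreviation ent :: "('n::finite, 'm::finite) symb => 'm => 'm => real^'n => real^'n => complex" where
 "ent a i j \<equiv> %x ksi. a x ksi $ i $ j"

lemma test_function_nth: "test_function S f ==> test_function S (%y. f y $ i)"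
 by (rule test_function_bounded_linear[OF bounded_linear_vec_nth])

lemma symb_on_ent: "open Z ==> S \<subseteq> Z ==> symb_on Z S d a ==> symb_on Z S d (ent a i j)"
 by (intro symb_on_nth)

lemma integral_nth:
 fixes f :: "'a::euclidean_space => complex^'m::finite"
 assumes "!!i. integrable lborel (%x. f x $ i)"
 shows "integral\<^sup>L lborel f $ i = (\<integral>x. f x $ i \<partial>lborel)"
proof -
 have "integrable lborel (%x. \<Sum>i\<in>UNIV. axis i (f x $ i))"
  by (intro Bochner_Integration.integrable_sum integrable_bounded_linear[OF bounded_linear_axis] assms)
 then have "integrable lborel f" by (simp add: sum_axis)
 then show ?thesis by (rule integral_bounded_linear[OF bounded_linear_vec_nth, symmetric])
qed

lemma Op_nth:
 fixes u :: "real^'n::finite => complex^'m::finite"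
 assumes a: "a \<in> symbol_class d" and u: "test_function U u"
 shows "Op a u x $ i = (\<Sum>j\<in>UNIV. T 1 (ent a i j) (%y. u y $ j) x 0)"
proof -
 note aij = symb_on_ent[OF open_UNIV subset_UNIV iffD1[OF symbol_class_iff a]] and uj = test_function_nth[OF u]
 have f: "fourier u ksi $ j = ft (%y. u y $ j) ksi" for ksi j
  unfolding fourier_def ft_def by (subst integral_nth) (use ft_integrable[OF uj] in auto)
 have k: "(cis (x \<bullet> ksi) *s (a x ksi *v fourier u ksi)) $ i = (\<Sum>j\<in>UNIV. kern 1 (ent a i j) (%y. u y $ j) x 0 ksi)" for ksi i
  by (simp add: matrix_vector_mult_def f kern_def sum_distrib_left mult.assoc)
 have ki: "integrable lborel (kern 1 (ent a i j) (%y. u y $ j) x 0)" for i j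
  by (rule kern_integrable[OF aij uj]) simp
 have "Op a u x $ i = (1 / (2 * pi) ^ CARD('n)) *\<^sub>R (LINT ksi|lborel. (cis (x \<bullet> ksi) *s (a x ksi *v fourier u ksi)) $ i)"
  unfolding Op_def vector_scaleR_component
  by (subst integral_nth) (use ki in \<open>simp_all only: k Bochner_Integration.integrable_sum\<close>)
 also have "... = (\<Sum>j\<in>UNIV. T 1 (ent a i j) (%y. u y $ j) x 0)"
  unfolding k T_def by (subst Bochner_Integration.integral_sum) (use ki in \<open>auto simp: scaleR_sum_right\<close>)
 finally show ?thesis .
qed

lemma test_function_matrix_vector:
 fixes F :: "real^'n::finite => complex^'m::finite^'k::finite"
 assumes "!!i j. test_function U (%y. F y $ i $ j)" "test_function V u"
 shows "test_function V (%y. F y *v u y)"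
proof (rule test_functionI[where K = "supp u"])
 show "smooth_on UNIV (%y. F y *v u y)"
  by (rule smooth_on_vec) (auto simp: matrix_vector_mult_def intro!: smooth_on_sum smooth_on_mult
    test_function_smooth[OF assms(1)] smooth_on_nth test_function_smooth[OF assms(2)])
qed (use assms(2) in \<open>auto simp: test_function_def zero_outside_supp\<close>)

text \<open>Symbol of multiplication by \<open>F\<close>, followed by the operator with symbol
  \<open>a\<close>, followed by multiplication by \<open>G\<close>. Multiplication on the left acts
  on values, so only \<open>F\<close> takes part in the oscillatory integral.\<close>

definition comp_symb :: "(real^'n::finite => complex^'m^'m) => ('n, 'm::finite) symb => (real^'n => complex^'m^'m) => ('n, 'm) symb" where
 "comp_symb G a F x ksi = (\<chi> i k. \<Sum>j\<in>UNIV. \<Sum>l\<in>UNIV. G x $ i $ j * T 1 (ent a j l) (%y. F y $ l $ k) x ksi)"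

lemma sym_comp_symb:
 assumes a: "sym d a" and F: "!!i j. test_function U (%y. F y $ i $ j)" and G: "!!i j. test_function U (%y. G y $ i $ j)"
 shows "sym d (comp_symb G a F)"
proof -
 have "sym d (ent (comp_symb G a F) i k)" for i k
 proof -
  have "sym (0 + d) (%x ksi. G x $ i $ j * T 1 (ent a j l) (%y. F y $ l $ k) x ksi)" for j l
   by (rule symb_on_bilinear[OF open_UNIV subset_UNIV bounded_bilinear_mult symb_on_test[OF open_UNIV G]
      symb_on_T[OF symb_on_ent[OF open_UNIV subset_UNIV a] F]]) simp
  then show ?thesis by (simp add: comp_symb_def symb_on_sum)
 qed
 then show ?thesis by (intro symb_on_vec) auto
qed

text \<open>Entry by entry this is \<open>T_compose\<close>; the rest is the interchange of finite
  sums with integrals.\<close>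

lemma Op_comp_symb:
 assumes a: "a \<in> symbol_class d" and u: "test_function V u"
  and F: "!!i j. test_function U (%y. F y $ i $ j)" and G: "!!i j. test_function U (%y. G y $ i $ j)"
 shows "Op (comp_symb G a F) u x = G x *v Op a (%y. F y *v u y) x"
proof -
 note aS = iffD1[OF symbol_class_iff a]
 note aij = symb_on_ent[OF open_UNIV subset_UNIV aS] and uj = test_function_nth[OF u]
 have c: "comp_symb G a F \<in> symbol_class d"
  using sym_comp_symb[OF aS F G] by (simp add: symbol_class_iff)
 have Fu: "test_function V (%y. F y *v u y)" by (rule test_function_matrix_vector[OF F u])
 have T_sum: "T 1 (%x ksi. \<Sum>i\<in>I. c i x * b i x ksi) v x 0 = (\<Sum>i\<in>I. c i x * T 1 (b i) v x 0)"
  if b: "!!i. i \<in> I ==> sym d (b i)" and v: "test_function V v" for I :: "('m \<times> 'm) set" and b c v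
 proof -
  have "kern 1 (%x ksi. \<Sum>i\<in>I. c i x * b i x ksi) v x 0 ksi = (\<Sum>i\<in>I. c i x * kern 1 (b i) v x 0 ksi)" for ksi
   by (simp add: kern_def sum_distrib_left sum_distrib_right mult_ac)
  then have "(\<integral>ksi. kern 1 (%x ksi. \<Sum>i\<in>I. c i x * b i x ksi) v x 0 ksi \<partial>lborel) = (\<integral>ksi. (\<Sum>i\<in>I. c i x * kern 1 (b i) v x 0 ksi) \<partial>lborel)"
   by (intro Bochner_Integration.integral_cong refl)
  also have "... = (\<Sum>i\<in>I. c i x * (\<integral>ksi. kern 1 (b i) v x 0 ksi \<partial>lborel))"
   using kern_integrable[OF b v] by (simp add: Bochner_Integration.integral_sum)
  finally have "(\<integral>ksi. kern 1 (%x ksi. \<Sum>i\<in>I. c i x * b i x ksi) v x 0 ksi \<partial>lborel) = (\<Sum>i\<in>I. c i x * (\<integral>ksi. kern 1 (b i) v x 0 ksi \<partial>lborel))" .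
  then show ?thesis by (simp add: T_def scaleR_sum_right)
 qed
 have T_sum2: "T 1 b (%y. \<Sum>k\<in>UNIV. v k y) x 0 = (\<Sum>k\<in>UNIV. T 1 b (v k) x 0)"
  if b: "sym d b" and v: "!!k. test_function V (v k)" for b and v :: "'m => _"
 proof -
  have "ft (%y. \<Sum>k\<in>UNIV. v k y) eta = (\<Sum>k\<in>UNIV. ft (v k) eta)" for eta
   unfolding ft_def sum_distrib_left using ft_integrable[OF v] by (subst Bochner_Integration.integral_sum) auto
  then have "kern 1 b (%y. \<Sum>k\<in>UNIV. v k y) x 0 ksi = (\<Sum>k\<in>UNIV. kern 1 b (v k) x 0 ksi)" for ksi
   by (simp add: kern_def sum_distrib_left)
  then have "(\<integral>ksi. kern 1 b (%y. \<Sum>k\<in>UNIV. v k y) x 0 ksi \<partial>lborel) = (\<integral>ksi. (\<Sum>k\<in>UNIV. kern 1 b (v k) x 0 ksi) \<partial>lborel)"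
   by (intro Bochner_Integration.integral_cong refl)
  also have "... = (\<Sum>k\<in>UNIV. \<integral>ksi. kern 1 b (v k) x 0 ksi \<partial>lborel)"
   by (rule Bochner_Integration.integral_sum) (rule kern_integrable[OF b v], simp)
  finally show ?thesis by (simp add: T_def scaleR_sum_right)
 qed
 show ?thesis
 proof (simp only: vec_eq_iff, rule allI)
  fix i
  have "Op (comp_symb G a F) u x $ i = (\<Sum>k\<in>UNIV. T 1 (ent (comp_symb G a F) i k) (%y. u y $ k) x 0)"
   by (rule Op_nth[OF c u])
  also have "... = (\<Sum>k\<in>UNIV. \<Sum>(j, l)\<in>UNIV. G x $ i $ j * T 1 (T 1 (ent a j l) (%y. F y $ l $ k)) (%y. u y $ k) x 0)"
  proof (rule sum.cong[OF refl])
   fix k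
   have "ent (comp_symb G a F) i k = (%x ksi. \<Sum>jl\<in>UNIV. G x $ i $ fst jl * T 1 (ent a (fst jl) (snd jl)) (%y. F y $ snd jl $ k) x ksi)"
    by (simp add: comp_symb_def sum.cartesian_product case_prod_unfold)
   then show "T 1 (ent (comp_symb G a F) i k) (%y. u y $ k) x 0 =
     (\<Sum>(j, l)\<in>UNIV. G x $ i $ j * T 1 (T 1 (ent a j l) (%y. F y $ l $ k)) (%y. u y $ k) x 0)"
    by (simp only:) (subst T_sum, auto intro!: symb_on_T aij F uj simp: case_prod_unfold)
  qed
  also have "... = (\<Sum>k\<in>UNIV. \<Sum>(j, l)\<in>UNIV. G x $ i $ j * T 1 (ent a j l) (%y. F y $ l $ k * u y $ k) x 0)"
   using T_compose[OF aij F uj] by simp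
  also have "... = (\<Sum>j\<in>UNIV. G x $ i $ j * (\<Sum>l\<in>UNIV. \<Sum>k\<in>UNIV. T 1 (ent a j l) (%y. F y $ l $ k * u y $ k) x 0))"
   unfolding UNIV_Times_UNIV[symmetric] sum.cartesian_product[symmetric] sum_distrib_left
   by (subst sum.swap) (intro sum.cong refl sum.swap)
  also have "... = (\<Sum>j\<in>UNIV. G x $ i $ j * Op a (%y. F y *v u y) x $ j)"
  proof -
   have "test_function V (%y. F y $ l $ k * u y $ k)" for l k
    using test_function_bilinear_left[OF bounded_bilinear_mult uj test_function_smooth[OF F]] by (simp add: mult.commute)
   then have "Op a (%y. F y *v u y) x $ j = (\<Sum>l\<in>UNIV. \<Sum>k\<in>UNIV. T 1 (ent a j l) (%y. F y $ l $ k * u y $ k) x 0)" for j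
    unfolding Op_nth[OF a Fu] by (intro sum.cong refl) (simp add: matrix_vector_mult_def T_sum2[OF aij])
   then show ?thesis by simp
  qed
  finally show "Op (comp_symb G a F) u x $ i = (G x *v Op a (%y. F y *v u y) x) $ i"
   by (simp add: matrix_vector_mult_def)
 qed
qed

subsection \<open>The full symbol of the conjugated operator\<close>

lemma smooth_structure_chart: "smooth_structure atl ==> kap \<in> atl ==> is_chart kap"
 unfolding smooth_structure_def by metis

lemma chart_open: "is_chart kap ==> open (coords kap)" and chart_open_domain: "is_chart kap ==> open (fst kap)"
 by (simp_all add: is_chart_def)

lemma point_coord: "is_chart kap ==> p \<in> fst kap ==> point kap (snd kap p) = p"
 by (auto simp: is_chart_def homeomorphism_def)

lemma coord_point: "is_chart kap ==> x \<in> coords kap ==> snd kap (point kap x) = x"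
 by (auto simp: is_chart_def homeomorphism_def)

lemma point_in: "is_chart kap ==> x \<in> coords kap ==> point kap x \<in> fst kap"
 by (auto simp: is_chart_def homeomorphism_def)

lemma coord_in: "p \<in> fst kap ==> snd kap p \<in> coords kap"
 by (simp add: coords_def)

text \<open>The terms of the composition sorted by degree: \<open>p (k - l)\<close> has degree 1 -
  (k - l), and the \<open>l\<close> covector derivatives in \<open>E l\<close> lower it to 1 -
  k.\<close>

definition conj_symbol :: "(real^'n::finite => complex^'m^'m) => (nat => ('n, 'm::finite) symb) => nat => ('n, 'm) symb" where
 "conj_symbol Q p k x ksi = (\<chi> i s. \<Sum>j\<in>UNIV. \<Sum>r\<in>UNIV. \<Sum>l\<le>k. (1 / fact l) *\<^sub>R
   (Q x $ i $ j * E l (ent (p (k - l)) j r) (%y. hconj (Q y) $ r $ s) x ksi))"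

lemma smooth_on_hconj_nth:
 "open S ==> smooth_on S Q ==> smooth_on S (%y. hconj (Q y) $ r $ s)"
 by (auto simp: hconj_def intro!: smooth_on_bounded_linear[OF bounded_linear_cnj] smooth_on_nth)

lemma smooth2_cutoff:
 fixes p :: "('n::finite, 'm::finite) symb"
 assumes U: "open U" and \<phi>: "test_function U (\<phi> :: _ => complex)" and p: "smooth2 (U \<times> - {0}) p"
 shows "smooth2 (UNIV \<times> - {0}) (%x ksi. cscale (\<phi> x) (p x ksi))"
proof (rule smooth_on_local)
 fix z :: "(real^'n) \<times> (real^'n)" assume z: "z \<in> UNIV \<times> - {0}"
 have W: "open (U \<times> - {0 :: real^'n})" "open ((- supp \<phi>) \<times> - {0 :: real^'n})"
  using U closed_supp[of \<phi>] by (auto intro!: open_Times)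
 show "\<exists>T. open T \<and> z \<in> T \<and> smooth_on T (%(x, ksi). cscale (\<phi> x) (p x ksi))"
 proof (cases "fst z \<in> supp \<phi>")
  case True
  have s: "smooth_on (U \<times> - {0 :: real^'n}) (%z. \<phi> (fst z))"
   by (rule smooth_on_compose[OF W(1) open_UNIV smooth_on_fst[OF W(1)] test_function_smooth[OF \<phi>]]) auto
  have "smooth_on (U \<times> - {0}) (%(x, ksi). cscale (\<phi> x) (p x ksi))"
   using p s by (intro smooth_on_vec W) (auto simp: cscale_def case_prod_unfold intro!: smooth_on_mult smooth_on_nth W)
  then show ?thesis using True z \<phi> W(1) by (intro exI[of _ "U \<times> - {0}"]) (auto simp: test_function_def mem_Times_iff)
 next
  case False
  have "smooth_on ((- supp \<phi>) \<times> - {0}) (%(x, ksi). cscale (\<phi> x) (p x ksi))"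
   by (rule smooth_on_cong[OF W(2) smooth_on_const[OF W(2), of 0]]) (auto simp: zero_outside_supp cscale_def vec_eq_iff)
  then show ?thesis using False z W(2) by (intro exI[of _ "(- supp \<phi>) \<times> - {0}"]) (auto simp: mem_Times_iff)
 qed
qed

text \<open>Only the values of \<open>R\<close> at points where a cut-off does not vanish are seen,
  so functions \<open>F\<close> and \<open>G\<close> on the whole coordinate space may stand in for
  it.\<close>

lemma localised_conjugated:
 assumes kap: "is_chart kap"
  and F: "!!y. y \<in> coords kap ==> \<psi> y \<noteq> 0 ==> F y = hconj (R (point kap y))"
  and G: "!!y. y \<in> coords kap ==> \<phi> y \<noteq> 0 ==> G y = R (point kap y)"
 shows "localised atl (conjugated R A) kap \<phi> \<psi> u x = G x *v localised atl A kap \<phi> \<psi> (%y. F y *v u y) x"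
proof -
 have "(%kap' q. hconj (R q) *v from_chart atl kap (%y. \<psi> y *s u y) kap' q) = from_chart atl kap (%y. \<psi> y *s (F y *v u y))"
 proof (intro ext)
  fix kap' q
  show "hconj (R q) *v from_chart atl kap (%y. \<psi> y *s u y) kap' q = from_chart atl kap (%y. \<psi> y *s (F y *v u y)) kap' q"
  proof (cases "kap' \<in> atl \<and> q \<in> fst kap \<inter> fst kap' \<and> \<psi> (snd kap q) \<noteq> 0")
   case True
   then have "F (snd kap q) = hconj (R q)" using F[of "snd kap q"] point_coord[OF kap] coord_in[of q kap] by auto
   with True show ?thesis
    by (simp add: from_chart_def vec_eq_iff matrix_vector_mult_def sum_distrib_left scaleR_sum_right mult_ac)
  qed (auto simp: from_chart_def vec_eq_iff matrix_vector_mult_def)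
 qed
 then show ?thesis using G[of x]
  by (cases "\<phi> x = 0") (auto simp: localised_def conjugated_def vec_eq_iff matrix_vector_mult_def sum_distrib_left mult_ac)
qed

text \<open>In coordinates \<open>R\<close> lives on the chart only and is not a test function, so
  \<open>comp_symb\<close> does not apply to it. A plateau equal to 1 near the supports of both
  cut-offs produces test functions \<open>G\<close> and \<open>F\<close> that agree with
  \<open>R\<close> and its adjoint where the cut-offs see them; the exact composition and its
  expansion then give the symbol of the localised operator.\<close>

lemma has_full_symbol_conjugated:
 fixes p :: "nat => ('n::finite, 'm::finite) symb"
 assumes kap: "is_chart kap" and R: "smooth_on (coords kap) (R \<circ> point kap)" and p: "has_full_symbol atl A kap p"
 shows "has_full_symbol atl (conjugated R A) kap (conj_symbol (R \<circ> point kap) p)"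
proof -
 let ?U = "coords kap" and ?Z = "- {0 :: real^'n}" and ?S = "{ksi :: real^'n. 1 \<le> norm ksi}"
 let ?Q = "R \<circ> point kap"
 let ?h = "%r s y. hconj (?Q y) $ r $ s"
 have U: "open ?U" using chart_open[OF kap] .
 have Z: "open ?Z" "?S \<subseteq> ?Z" by auto
 have W: "open (?U \<times> ?Z)" using U Z by (intro open_Times)
 have ps: "smooth2 (?U \<times> ?Z) (p k)" for k using p by (simp add: has_full_symbol_def)
 have ph: "p k x (t *\<^sub>R ksi) = (t powi (1 - int k)) *\<^sub>R p k x ksi" if "x \<in> ?U" "ksi \<noteq> 0" "t > 0" for k x ksi t
  using p that by (simp add: has_full_symbol_def)
 have es: "smooth2 (?U \<times> ?Z) (ent (p k) j r)" for k j r
  using smooth_on_nth[OF W smooth_on_nth[OF W ps[of k], of j], of r] by (simp add: case_prod_unfold)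
 have hs: "smooth_on ?U (?h r s)" for r s by (rule smooth_on_hconj_nth[OF U R])
 have 1: "smooth2 (?U \<times> ?Z) (conj_symbol ?Q p k)" for k
 proof -
  have Es: "smooth_on (?U \<times> ?Z) (%z. E l (ent (p (k - l)) j r) (?h r s) (fst z) (snd z))" for l j r s
   using smooth2_E[OF U Z(1) es hs] by (simp add: case_prod_unfold)
  have Qs: "smooth_on (?U \<times> ?Z) (%z. ?Q (fst z))"
   by (rule smooth_on_compose[OF W U smooth_on_fst[OF W] R]) auto
  have "smooth_on (?U \<times> ?Z) (%z. conj_symbol ?Q p k (fst z) (snd z))"
  proof (intro smooth_on_vec W)
   fix i s
   have "smooth_on (?U \<times> ?Z) (%z. \<Sum>j\<in>UNIV. \<Sum>r\<in>UNIV. \<Sum>l\<le>k. (1 / fact l) *\<^sub>R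
     (?Q (fst z) $ i $ j * E l (ent (p (k - l)) j r) (?h r s) (fst z) (snd z)))"
    by (intro smooth_on_sum smooth_on_bounded_linear[OF bounded_linear_scaleR_right] smooth_on_mult smooth_on_nth W Es Qs)
   then show "smooth_on (?U \<times> ?Z) (%z. conj_symbol ?Q p k (fst z) (snd z) $ i $ s)"
    by (simp add: conj_symbol_def)
  qed
  then show ?thesis by (simp add: case_prod_unfold)
 qed
 have 2: "conj_symbol ?Q p k x (t *\<^sub>R ksi) = (t powi (1 - int k)) *\<^sub>R conj_symbol ?Q p k x ksi"
  if x: "x \<in> ?U" "ksi \<noteq> 0" and t: "t > 0" for k x ksi t
 proof -
  have e: "E l (ent (p (k - l)) j r) (?h r s) x (t *\<^sub>R ksi) = (t powi (1 - int k)) *\<^sub>R E l (ent (p (k - l)) j r) (?h r s) x ksi"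
   if l: "l \<le> k" for l j r s
  proof -
   have "E l (ent (p (k - l)) j r) (?h r s) x (t *\<^sub>R ksi) = (t powi (1 - int (k - l) - int l)) *\<^sub>R E l (ent (p (k - l)) j r) (?h r s) x ksi"
    by (rule E_homogeneous[OF U es _ t x]) (simp add: ph t)
   moreover have "1 - int (k - l) - int l = 1 - int k" using l by simp
   ultimately show ?thesis by simp
  qed
  have "conj_symbol ?Q p k x (t *\<^sub>R ksi) $ i $ s = (t powi (1 - int k)) *\<^sub>R (conj_symbol ?Q p k x ksi $ i $ s)" for i s
  proof -
   have "conj_symbol ?Q p k x (t *\<^sub>R ksi) $ i $ s = (\<Sum>j\<in>UNIV. \<Sum>r\<in>UNIV. \<Sum>l\<le>k. (t powi (1 - int k)) *\<^sub>R ((1 / fact l) *\<^sub>R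
     (?Q x $ i $ j * E l (ent (p (k - l)) j r) (?h r s) x ksi)))"
    unfolding conj_symbol_def vec_lambda_beta
   proof (intro sum.cong refl)
    fix j r l assume "l \<in> {..k}"
    then have e': "E l (ent (p (k - l)) j r) (?h r s) x (t *\<^sub>R ksi) = (t powi (1 - int k)) *\<^sub>R E l (ent (p (k - l)) j r) (?h r s) x ksi"
     by (intro e) simp
    show "(1 / fact l) *\<^sub>R (?Q x $ i $ j * E l (ent (p (k - l)) j r) (?h r s) x (t *\<^sub>R ksi)) =
     (t powi (1 - int k)) *\<^sub>R ((1 / fact l) *\<^sub>R (?Q x $ i $ j * E l (ent (p (k - l)) j r) (?h r s) x ksi))"
     unfolding e' by simp
   qed
   then show ?thesis by (simp only: scaleR_sum_right conj_symbol_def vec_lambda_beta)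
  qed
  then show ?thesis by (simp add: vec_eq_iff)
 qed
 have 3: "\<exists>a\<in>symbol_class 1.
      (\<forall>u. test_function UNIV u --> localised atl (conjugated R A) kap \<phi> \<psi> u = Op a u) \<and>
      (supp \<phi> \<subseteq> interior {x. \<psi> x = 1} -->
       (\<forall>N. symbol_bound (1 - real N) ?S (%x ksi. a x ksi - (\<Sum>k<N. cscale (\<phi> x) (conj_symbol ?Q p k x ksi)))))"
  if \<phi>: "test_function ?U \<phi>" and \<psi>: "test_function ?U \<psi>" for \<phi> \<psi>
 proof -
  obtain a where a: "a \<in> symbol_class 1" "!!u. test_function UNIV u ==> localised atl A kap \<phi> \<psi> u = Op a u"
   "supp \<phi> \<subseteq> interior {x. \<psi> x = 1} ==> \<forall>N. symbol_bound (1 - real N) ?S (%x ksi. a x ksi - (\<Sum>k<N. cscale (\<phi> x) (p k x ksi)))"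
   using p \<phi> \<psi> unfolding has_full_symbol_def by meson
  have "compact (supp \<phi> \<union> supp \<psi>)" "supp \<phi> \<union> supp \<psi> \<subseteq> ?U" using \<phi> \<psi> by (auto simp: test_function_def)
  then obtain \<rho> :: "real^'n => real" and V where \<rho>: "test_function ?U \<rho>" and V: "open V" "supp \<phi> \<union> supp \<psi> \<subseteq> V" "!!x. x \<in> V ==> \<rho> x = 1"
   using plateau_exists[OF _ U] by metis
  define G where "G y = (if y \<in> ?U then \<rho> y *\<^sub>R ?Q y else 0)" for y
  define F where "F y = hconj (G y)" for y
  have "test_function ?U G" unfolding G_def by (rule test_function_extend[OF U R \<rho>])
  then have G: "test_function ?U (%y. G y $ i $ j)" for i j by (intro test_function_nth)
  then have F: "test_function ?U (%y. F y $ i $ j)" for i j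
   using test_function_bounded_linear[OF bounded_linear_cnj G] by (simp add: F_def hconj_def)
  have GV: "G y = ?Q y" if "y \<in> ?U \<inter> V" for y using that V(3) by (auto simp: G_def)
  have supp_V: "y \<in> V" if "\<phi> y \<noteq> 0 \<or> \<psi> y \<noteq> 0" for y using that V(2) zero_outside_supp by blast
  let ?b = "comp_symb G a F"
  have b: "sym 1 ?b" using sym_comp_symb[OF iffD1[OF symbol_class_iff a(1)] F G] .
  have L: "localised atl (conjugated R A) kap \<phi> \<psi> u = Op ?b u" if u: "test_function UNIV u" for u
  proof
   fix x
   have "localised atl (conjugated R A) kap \<phi> \<psi> u x = G x *v localised atl A kap \<phi> \<psi> (%y. F y *v u y) x"
    by (rule localised_conjugated[OF kap]) (use GV supp_V in \<open>auto simp: F_def\<close>)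
   also have "... = Op ?b u x"
    using a(2)[OF test_function_matrix_vector[OF F u]] Op_comp_symb[OF a(1) u F G] by simp
   finally show "localised atl (conjugated R A) kap \<phi> \<psi> u x = Op ?b u x" .
  qed
  have B: "symbol_bound (1 - real N) ?S (%x ksi. ?b x ksi - (\<Sum>k<N. cscale (\<phi> x) (conj_symbol ?Q p k x ksi)))"
   if sub: "supp \<phi> \<subseteq> interior {x. \<psi> x = 1}" for N
  proof -
   let ?P = "%k x ksi. cscale (\<phi> x) (p k x ksi)"
   have WZ: "open (UNIV \<times> ?Z :: ((real^'n) \<times> (real^'n)) set)" using Z by (intro open_Times) auto
   have Ps: "smooth2 (UNIV \<times> ?Z) (?P k)" for k by (rule smooth2_cutoff[OF U \<phi> ps])
   have as: "smooth2 (UNIV \<times> ?Z) a"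
    using smooth_on_subset[OF symb_on_smooth[OF iffD1[OF symbol_class_iff a(1)]]] by auto
   have rs: "smooth2 (UNIV \<times> ?Z) (%x ksi. a x ksi - (\<Sum>k<N. ?P k x ksi))" for N
    using smooth_on_diff[OF WZ as smooth_on_sum[OF WZ, of "{..<N}" "%k (x, ksi). ?P k x ksi"]] Ps by (simp add: case_prod_unfold)
   have r: "symb_on ?Z ?S (1 - real N) (%x ksi. a x ksi - (\<Sum>k<N. ?P k x ksi))" for N
    using a(3)[OF sub] symb_on_iff_symbol_bound[OF Z rs] by simp
   have Pent: "ent (?P k) j l = (%x ksi. \<phi> x * p k x ksi $ j $ l)" for k j l by (simp add: cscale_def)
   have x1: "symb_on ?Z ?S (1 - real N) (%x ksi. T 1 (ent a j r) (%y. F y $ r $ s) x ksi -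
     (\<Sum>k<N. \<Sum>l\<le>k. (1 / fact l) *\<^sub>R E l (ent (?P (k - l)) j r) (%y. F y $ r $ s) x ksi))" for j r s
   proof (rule expansion_T[OF Z symb_on_ent[OF open_UNIV subset_UNIV iffD1[OF symbol_class_iff a(1)]] F])
    show "smooth2 (UNIV \<times> ?Z) (ent (?P k) j r)" for k
     using smooth_on_nth[OF WZ smooth_on_nth[OF WZ Ps[of k], of j], of r] by (simp add: case_prod_unfold)
    show "symb_on ?Z ?S (1 - real N) (%x ksi. a x ksi $ j $ r - (\<Sum>k<N. ?P k x ksi $ j $ r))" for N
     using symb_on_ent[OF Z r[of N], of j r] by simp
   qed
   \<comment> \<open>\<open>E l\<close> contains derivatives, so agreement is needed on open sets:
     near a point of the support of \<phi> the functions \<open>G\<close> and \<open>F\<close>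
     coincide with \<open>R\<close> and its adjoint, and off the support \<phi> vanishes in a
     neighbourhood.\<close>
   have id: "G x $ i $ j * E l (ent (?P k) j r) (%y. F y $ r $ s) x ksi = \<phi> x * (?Q x $ i $ j * E l (ent (p k) j r) (?h r s) x ksi)"
    if ksi: "ksi \<in> ?Z" for x ksi i j l k r s
   proof (cases "x \<in> supp \<phi>")
    case True
    then have xV: "x \<in> ?U \<inter> V" using V(2) \<phi> by (auto simp: test_function_def)
    have o: "open (?U \<inter> V)" using U V(1) by auto
    have "smooth2 ((?U \<inter> V) \<times> ?Z) (ent (p k) j r)" by (rule smooth_on_subset[OF es]) auto
    from E_mult_x[OF o Z(1) this xV ksi]
    have "E l (ent (?P k) j r) (%y. F y $ r $ s) x ksi = \<phi> x * E l (ent (p k) j r) (%y. F y $ r $ s) x ksi" by (simp add: Pent)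
    also have "E l (ent (p k) j r) (%y. F y $ r $ s) x ksi = E l (ent (p k) j r) (?h r s) x ksi"
     by (rule E_cong[OF o Z(1) _ _ xV ksi]) (use GV in \<open>auto simp: F_def\<close>)
    finally show ?thesis using GV[OF xV] by simp
   next
    case False
    have "E l (ent (?P k) j r) (%y. F y $ r $ s) x ksi = E l (%x ksi. 0) (%y. F y $ r $ s) x ksi"
     by (rule E_cong[of "- supp \<phi>" ?Z]) (use False ksi closed_supp[of \<phi>] in \<open>auto simp: cscale_def zero_outside_supp\<close>)
    then show ?thesis using zero_outside_supp[OF False] by (simp add: E_zero)
   qed
   have "symb_on ?Z ?S (1 - real N) (%x ksi. ?b x ksi - (\<Sum>k<N. cscale (\<phi> x) (conj_symbol ?Q p k x ksi)))"
   proof (intro symb_on_vec Z)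
    fix i s
    have "symb_on ?Z ?S (0 + (1 - real N)) (%x ksi. G x $ i $ j * (T 1 (ent a j r) (%y. F y $ r $ s) x ksi -
      (\<Sum>k<N. \<Sum>l\<le>k. (1 / fact l) *\<^sub>R E l (ent (?P (k - l)) j r) (%y. F y $ r $ s) x ksi)))" for j r
     by (rule symb_on_bilinear[OF Z bounded_bilinear_mult symb_on_test[OF Z(1) G] x1])
    then have "symb_on ?Z ?S (1 - real N) (%x ksi. \<Sum>j\<in>UNIV. \<Sum>r\<in>UNIV. G x $ i $ j * (T 1 (ent a j r) (%y. F y $ r $ s) x ksi -
      (\<Sum>k<N. \<Sum>l\<le>k. (1 / fact l) *\<^sub>R E l (ent (?P (k - l)) j r) (%y. F y $ r $ s) x ksi)))"
     by (intro symb_on_sum Z) simp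
    then show "symb_on ?Z ?S (1 - real N) (%x ksi. (?b x ksi - (\<Sum>k<N. cscale (\<phi> x) (conj_symbol ?Q p k x ksi))) $ i $ s)"
    proof (rule symb_on_cong[OF Z, rotated])
     fix x ksi assume ksi: "ksi \<in> ?Z"
     have "(\<Sum>k<N. cscale (\<phi> x) (conj_symbol ?Q p k x ksi)) $ i $ s =
       (\<Sum>k<N. \<Sum>j\<in>UNIV. \<Sum>r\<in>UNIV. \<Sum>l\<le>k. (1 / fact l) *\<^sub>R (\<phi> x * (?Q x $ i $ j * E l (ent (p (k - l)) j r) (?h r s) x ksi)))"
      by (simp add: cscale_def conj_symbol_def sum_distrib_left)
     also have "... = (\<Sum>k<N. \<Sum>j\<in>UNIV. \<Sum>r\<in>UNIV. \<Sum>l\<le>k. (1 / fact l) *\<^sub>R (G x $ i $ j * E l (ent (?P (k - l)) j r) (%y. F y $ r $ s) x ksi))"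
      by (simp only: id[OF ksi])
     also have "... = (\<Sum>j\<in>UNIV. \<Sum>k<N. \<Sum>r\<in>UNIV. \<Sum>l\<le>k. (1 / fact l) *\<^sub>R (G x $ i $ j * E l (ent (?P (k - l)) j r) (%y. F y $ r $ s) x ksi))"
      by (rule sum.swap)
     also have "... = (\<Sum>j\<in>UNIV. \<Sum>r\<in>UNIV. \<Sum>k<N. \<Sum>l\<le>k. (1 / fact l) *\<^sub>R (G x $ i $ j * E l (ent (?P (k - l)) j r) (%y. F y $ r $ s) x ksi))"
      by (rule sum.cong[OF refl], rule sum.swap)
     finally have e: "(\<Sum>k<N. cscale (\<phi> x) (conj_symbol ?Q p k x ksi)) $ i $ s =
      (\<Sum>j\<in>UNIV. \<Sum>r\<in>UNIV. G x $ i $ j * (\<Sum>k<N. \<Sum>l\<le>k. (1 / fact l) *\<^sub>R E l (ent (?P (k - l)) j r) (%y. F y $ r $ s) x ksi))"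
      by (simp add: sum_distrib_left)
     show "(\<Sum>j\<in>UNIV. \<Sum>r\<in>UNIV. G x $ i $ j * (T 1 (ent a j r) (%y. F y $ r $ s) x ksi -
      (\<Sum>k<N. \<Sum>l\<le>k. (1 / fact l) *\<^sub>R E l (ent (?P (k - l)) j r) (%y. F y $ r $ s) x ksi))) =
      (?b x ksi - (\<Sum>k<N. cscale (\<phi> x) (conj_symbol ?Q p k x ksi))) $ i $ s"
      by (simp only: vector_minus_component e) (simp add: comp_symb_def right_diff_distrib sum_subtractf)
    qed
   qed
   then show ?thesis using symb_on_iff_symbol_bound[OF Z symb_on_smooth] by blast
  qed
  show ?thesis using iffD2[OF symbol_class_iff b] L B by blast
 qed
 show ?thesis unfolding has_full_symbol_def using 1 2 3 by auto
qed

section \<open>Matrix and vector operations as bounded linear and bilinear maps\<close>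

lemma bounded_bilinear_matrix_mult: "bounded_bilinear ((**) :: complex^'m::finite^'m => complex^'m^'m => complex^'m^'m)"
 unfolding bilinear_conv_bounded_bilinear[symmetric] bilinear_def
 by (auto intro!: linearI simp: vec_eq_iff matrix_matrix_mult_def sum.distrib scaleR_sum_right algebra_simps)

lemma bounded_bilinear_matrix_vector: "bounded_bilinear ((*v) :: complex^'m::finite^'m => complex^'m => complex^'m)"
 unfolding bilinear_conv_bounded_bilinear[symmetric] bilinear_def
 by (auto intro!: linearI simp: vec_eq_iff matrix_vector_mult_def sum.distrib scaleR_sum_right algebra_simps)

lemma bounded_bilinear_cdot: "bounded_bilinear (cdot :: complex^'m::finite => complex^'m => complex)"
 unfolding bilinear_conv_bounded_bilinear[symmetric] bilinear_def
 by (auto intro!: linearI simp: cdot_def sum.distrib scaleR_sum_right algebra_simps)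

lemma bounded_linear_hconj: "bounded_linear (hconj :: complex^'m::finite^'m => complex^'m^'m)"
 unfolding linear_conv_bounded_linear[symmetric]
 by (auto intro!: linearI simp: vec_eq_iff hconj_def)

lemma bounded_linear_cscale: "bounded_linear (cscale c :: complex^'m::finite^'m => complex^'m^'m)"
 unfolding linear_conv_bounded_linear[symmetric]
 by (auto intro!: linearI simp: vec_eq_iff cscale_def algebra_simps)

subsection \<open>Uniqueness of the leading symbols\<close>

text \<open>Near \<open>x\<close> the cut-off is constant, so the first-order Taylor term vanishes
  there and the second remainder is the whole difference. An error of order d - 2 is small enough to
  leave two homogeneous components visible.\<close>

lemma T_plateau:
 fixes a :: "real^'n::finite => real^'n => complex"
 assumes a: "sym d a" and ch: "test_function U ch" and V: "open V" "x \<in> V" "!!y. y \<in> V ==> ch y = 1"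
 shows "\<exists>C. \<forall>ksi. norm (T 1 a ch x ksi - a x ksi) \<le> C * (1 + norm ksi) powr (d - 2)"
proof -
 obtain C where C: "\<forall>t x ksi. 0 \<le> t --> t \<le> 1 --> norm (Rem 2 t a ch x ksi) \<le> C * (1 + norm ksi) powr (d - real 2)"
  using Rem_bound[OF a ch] by blast
 have "Dd \<alpha> ch x = 0" for \<alpha>
  using frechet_derivative_cong[OF V(1,2), of ch "%y. 1"] V(3) by (simp add: Dd_def pd_def)
 then have "Rem 2 1 a ch x ksi = T 1 a ch x ksi - a x ksi" for ksi
  using V(2,3) by (simp add: Rem_def numeral_2_eq_2)
 then show ?thesis using C[rule_format, of 1 x] by (intro exI[of _ C]) auto
qed

lemma T_axis:
 fixes a :: "('n::finite, 'm::finite) symb"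
 assumes a: "a \<in> symbol_class d" and ch: "test_function U ch"
 shows "Op a (%y. cis (y \<bullet> eta) *s (ch y *s c)) x = cis (x \<bullet> eta) *s (\<chi> i. \<Sum>j\<in>UNIV. T 1 (ent a i j) ch x eta * c $ j)"
proof -
 note aij = symb_on_ent[OF open_UNIV subset_UNIV iffD1[OF symbol_class_iff a]]
 let ?u = "%y. cis (y \<bullet> eta) *s (ch y *s c)"
 have u: "test_function U ?u"
 proof (rule test_functionI[where K = "supp ch"])
  show "smooth_on UNIV ?u"
   by (rule smooth_on_vec) (auto intro!: smooth_on_mult smooth_on_cis_inner smooth_on_const test_function_smooth[OF ch])
 qed (use ch in \<open>auto simp: test_function_def zero_outside_supp vec_eq_iff\<close>)
 have "T 1 (ent a i j) (%y. ?u y $ j) x 0 = cis (x \<bullet> eta) * (T 1 (ent a i j) ch x eta * c $ j)" for i j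
 proof -
  have "ft (%y. g y * c) \<zeta> = ft g \<zeta> * c" for g :: "real^'n => complex" and c \<zeta>
  proof -
   have "ft (%y. g y * c) \<zeta> = (\<integral>y. (cis (- (y \<bullet> \<zeta>)) * g y) * c \<partial>lborel)" by (simp add: ft_def mult.assoc)
   then show ?thesis by (simp only: integral_mult_left_zero ft_def)
  qed
  then have "kern 1 b (%y. g y * c) x 0 \<zeta> = kern 1 b g x 0 \<zeta> * c" for b :: "real^'n => real^'n => complex" and g c \<zeta>
   by (simp add: kern_def)
  then have *: "T 1 b (%y. g y * c) x 0 = T 1 b g x 0 * c" for b :: "real^'n => real^'n => complex" and g c
   by (simp add: T_def)
  have e: "(%y. ?u y $ j) = (%y. (cis (y \<bullet> eta) * ch y) * c $ j)" by (simp add: mult.assoc)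
  show ?thesis unfolding e * T_modulate[OF aij ch] by (simp only: mult.assoc)
 qed
 note e = this
 show ?thesis unfolding vec_eq_iff Op_nth[OF a u] e by (simp add: sum_distrib_left)
qed

lemma homogeneous_expansion_unique:
 fixes d0 d1 :: "'b::real_normed_vector"
 assumes "t0 > 0" and C: "!!t. t \<ge> t0 ==> norm (t *\<^sub>R d0 + d1) \<le> C / t"
 shows "d0 = 0" "d1 = 0"
proof -
 have C0: "C \<ge> 0" using order_trans[OF norm_ge_zero C[of t0]] assms(1) by (simp add: zero_le_divide_iff)
 show d0: "d0 = 0"
 proof (rule ccontr)
  assume "d0 \<noteq> 0"
  define t where "t = max t0 ((norm d1 + C / t0 + 1) / norm d0)"
  have t: "t \<ge> t0" "t > 0" using assms(1) by (auto simp: t_def)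
  have "(norm d1 + C / t0 + 1) \<le> t * norm d0"
   using \<open>d0 \<noteq> 0\<close> by (simp add: t_def pos_divide_le_eq[symmetric])
  also have "t * norm d0 = norm ((t *\<^sub>R d0 + d1) - d1)" using t by simp
  also have "... \<le> C / t + norm d1" using norm_triangle_ineq4[of "t *\<^sub>R d0 + d1" d1] C[OF t(1)] by linarith
  also have "C / t \<le> C / t0" using C0 t assms(1) by (intro divide_left_mono) auto
  finally show False by simp
 qed
 show "d1 = 0"
 proof (rule ccontr)
  assume "d1 \<noteq> 0"
  define t where "t = max t0 ((C + 1) / norm d1)"
  have t: "t \<ge> t0" "t > 0" using assms(1) by (auto simp: t_def)
  have "C + 1 \<le> t * norm d1" using \<open>d1 \<noteq> 0\<close> by (simp add: t_def pos_divide_le_eq[symmetric])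
  moreover have "norm d1 * t \<le> C" using C[OF t(1)] t(2) by (simp add: d0 pos_le_divide_eq)
  ultimately show False by (simp add: mult.commute)
 qed
qed

text \<open>Two nested plateaus, because \<open>has_full_symbol\<close> provides the expansion when
  \<psi> equals 1 near the support of \<phi>.\<close>

lemma cutoffs_exist:
 fixes K :: "(real^'n::finite) set"
 assumes "compact K" "K \<subseteq> U" "open U"
 shows "\<exists>(\<phi> :: real^'n => complex) (\<psi> :: real^'n => complex) V. test_function U \<phi> \<and> test_function U \<psi> \<and>
  supp \<phi> \<subseteq> interior {x. \<psi> x = 1} \<and> open V \<and> K \<subseteq> V \<and> (\<forall>y\<in>V. \<phi> y = 1)"
proof -
 obtain \<phi> :: "real^'n => real" and V where \<phi>: "test_function U \<phi>" "open V" "K \<subseteq> V" "!!y. y \<in> V ==> \<phi> y = 1"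
  using plateau_exists[OF assms(1,3,2)] by metis
 have s: "compact (supp \<phi>)" "supp \<phi> \<subseteq> U" using \<phi>(1) by (auto simp: test_function_def)
 obtain \<psi> :: "real^'n => real" and V' where \<psi>: "test_function U \<psi>" "open V'" "supp \<phi> \<subseteq> V'" "!!y. y \<in> V' ==> \<psi> y = 1"
  using plateau_exists[OF s(1) assms(3) s(2)] by metis
 have "supp (%x. complex_of_real (\<phi> x)) \<subseteq> supp \<phi>" by (rule supp_mono) simp
 moreover have "V' \<subseteq> interior {x. complex_of_real (\<psi> x) = 1}"
  using \<psi>(2,4) by (intro interior_maximal) auto
 ultimately show ?thesis
  using \<phi> \<psi>(3) test_function_bounded_linear[OF bounded_linear_of_real[where 'a = complex] \<phi>(1)]
   test_function_bounded_linear[OF bounded_linear_of_real[where 'a = complex] \<psi>(1)]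
  by (intro exI[of _ "%x. complex_of_real (\<phi> x)"] exI[of _ "%x. complex_of_real (\<psi> x)"] exI[of _ V]) auto
qed

text \<open>Of the symbol estimates only those for empty lists of derivatives are kept: the leading
  components will be recovered from sizes alone.\<close>

lemma has_full_symbol_cutoff:
 assumes p: "has_full_symbol atl A kap p" and "test_function (coords kap) \<phi>" "test_function (coords kap) \<psi>" "supp \<phi> \<subseteq> interior {x. \<psi> x = 1}"
 shows "\<exists>a\<in>symbol_class 1. (\<forall>u. test_function UNIV u --> localised atl A kap \<phi> \<psi> u = Op a u) \<and>
  (\<forall>N. \<exists>C. \<forall>x ksi. 1 \<le> norm ksi --> norm (a x ksi - (\<Sum>k<N. cscale (\<phi> x) (p k x ksi))) \<le> C * (1 + norm ksi) powr (1 - real N))"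
proof -
 obtain a where a: "a \<in> symbol_class 1" "\<forall>u. test_function UNIV u --> localised atl A kap \<phi> \<psi> u = Op a u"
  "\<forall>N. symbol_bound (1 - real N) {ksi. 1 \<le> norm ksi} (%x ksi. a x ksi - (\<Sum>k<N. cscale (\<phi> x) (p k x ksi)))"
  using assms unfolding has_full_symbol_def by meson
 have "\<exists>C. \<forall>x ksi. 1 \<le> norm ksi --> norm (a x ksi - (\<Sum>k<N. cscale (\<phi> x) (p k x ksi))) \<le> C * (1 + norm ksi) powr (1 - real N)" for N
 proof -
  have "\<exists>C. \<forall>x. \<forall>ksi\<in>{ksi. 1 \<le> norm ksi}. norm (foldr dx [] (foldr d\<xi> [] (%x ksi. a x ksi - (\<Sum>k<N. cscale (\<phi> x) (p k x ksi)))) x ksi)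
    \<le> C * (1 + norm ksi) powr (1 - real N - real (length ([] :: 'b list)))"
   using a(3) unfolding symbol_bound_def by blast
  then show ?thesis by simp
 qed
 with a show ?thesis by blast
qed

text \<open>Plane waves cut off by \<phi> recover \<open>T 1\<close> of the entries from the
  operator alone, so these values agree for the two amplitudes \<open>a\<close> and
  \<open>a'\<close>. Since \<phi> is 1 near \<open>x\<close>, they differ from the amplitudes by
  O(1/|ksi|), and so do the sums of the two leading components. Along the ray through
  \<open>ksi\<close> the sums thus agree up to O(1/t), and their different degrees separate the
  components.\<close>

lemma full_symbol_unique:
 fixes p p' :: "nat => ('n::finite, 'm::finite) symb"
 assumes U: "open (coords kap)" and p: "has_full_symbol atl A kap p" and p': "has_full_symbol atl A kap p'"
  and x: "x \<in> coords kap" and ksi: "ksi \<noteq> 0"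
 shows "p 0 x ksi = p' 0 x ksi" "p 1 x ksi = p' 1 x ksi"
proof -
 obtain \<phi> \<psi> :: "real^'n => complex" and V where \<phi>: "test_function (coords kap) \<phi>" "test_function (coords kap) \<psi>"
  "supp \<phi> \<subseteq> interior {x. \<psi> x = 1}" and V: "open V" "{x} \<subseteq> V" "\<forall>y\<in>V. \<phi> y = 1"
  using cutoffs_exist[of "{x}" "coords kap"] U x by auto
 have V3: "!!y. y \<in> V ==> \<phi> y = 1" using V(3) by blast
 have phx: "\<phi> x = 1" using V by auto
 obtain a where a: "a \<in> symbol_class 1" "!!u. test_function UNIV u ==> localised atl A kap \<phi> \<psi> u = Op a u"
  "\<forall>N. \<exists>C. \<forall>x ksi. 1 \<le> norm ksi --> norm (a x ksi - (\<Sum>k<N. cscale (\<phi> x) (p k x ksi))) \<le> C * (1 + norm ksi) powr (1 - real N)"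
  using has_full_symbol_cutoff[OF p \<phi>] by blast
 obtain a' where a': "a' \<in> symbol_class 1" "!!u. test_function UNIV u ==> localised atl A kap \<phi> \<psi> u = Op a' u"
  "\<forall>N. \<exists>C. \<forall>x ksi. 1 \<le> norm ksi --> norm (a' x ksi - (\<Sum>k<N. cscale (\<phi> x) (p' k x ksi))) \<le> C * (1 + norm ksi) powr (1 - real N)"
  using has_full_symbol_cutoff[OF p' \<phi>] by blast
 have hp: "p k x (t *\<^sub>R ksi) = (t powi (1 - int k)) *\<^sub>R p k x ksi" "p' k x (t *\<^sub>R ksi) = (t powi (1 - int k)) *\<^sub>R p' k x ksi" if "t > 0" for k t
  using p p' x ksi that by (auto simp: has_full_symbol_def)
 have main: "(p 0 x ksi - p' 0 x ksi) $ i $ j = 0 \<and> (p 1 x ksi - p' 1 x ksi) $ i $ j = 0" for i j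
 proof -
  note aij = symb_on_ent[OF open_UNIV subset_UNIV iffD1[OF symbol_class_iff a(1)], of i j]
   and aij' = symb_on_ent[OF open_UNIV subset_UNIV iffD1[OF symbol_class_iff a'(1)], of i j]
  have TT: "T 1 (ent a i j) \<phi> x eta = T 1 (ent a' i j) \<phi> x eta" for eta
  proof -
   let ?u = "%y. cis (y \<bullet> eta) *s (\<phi> y *s axis j 1) :: complex^'m"
   have u: "test_function UNIV ?u"
   proof (rule test_functionI[where K = "supp \<phi>"])
    show "smooth_on UNIV ?u"
     by (rule smooth_on_vec) (auto intro!: smooth_on_mult smooth_on_cis_inner smooth_on_const test_function_smooth[OF \<phi>(1)])
   qed (use \<phi>(1) in \<open>auto simp: test_function_def zero_outside_supp vec_eq_iff\<close>)
   have "Op a ?u x $ i = Op a' ?u x $ i" using a(2)[OF u] a'(2)[OF u] by simp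
   then have "(\<Sum>k\<in>UNIV. T 1 (ent a i k) \<phi> x eta * axis j 1 $ k) = (\<Sum>k\<in>UNIV. T 1 (ent a' i k) \<phi> x eta * axis j 1 $ k)"
    unfolding T_axis[OF a(1) \<phi>(1)] T_axis[OF a'(1) \<phi>(1)] by simp
   moreover have "(\<Sum>k\<in>UNIV. f k * axis j 1 $ k) = f j" for f :: "'m => complex"
   proof -
    have "(\<Sum>k\<in>UNIV. f k * axis j 1 $ k) = (\<Sum>k\<in>UNIV. if k = j then f k else 0)" by (intro sum.cong) (auto simp: axis_def)
    then show ?thesis by simp
   qed
   ultimately show ?thesis by simp
  qed
  obtain C1 where C1: "!!ksi. norm (T 1 (ent a i j) \<phi> x ksi - a x ksi $ i $ j) \<le> C1 * (1 + norm ksi) powr (1 - 2)"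
   using T_plateau[OF aij \<phi>(1) V(1) _ V3, of x] V(2) by auto
  obtain C2 where C2: "!!ksi. norm (T 1 (ent a' i j) \<phi> x ksi - a' x ksi $ i $ j) \<le> C2 * (1 + norm ksi) powr (1 - 2)"
   using T_plateau[OF aij' \<phi>(1) V(1) _ V3, of x] V(2) by auto
  obtain C3 where C3: "!!x ksi. 1 \<le> norm ksi ==> norm (a x ksi - (\<Sum>k<2. cscale (\<phi> x) (p k x ksi))) \<le> C3 * (1 + norm ksi) powr (1 - real 2)"
   using a(3) by blast
  obtain C4 where C4: "!!x ksi. 1 \<le> norm ksi ==> norm (a' x ksi - (\<Sum>k<2. cscale (\<phi> x) (p' k x ksi))) \<le> C4 * (1 + norm ksi) powr (1 - real 2)"
   using a'(3) by blast
  define C where "C = max (C1 + C2 + C3 + C4) 0"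
  have ij: "norm (M $ i $ j) \<le> norm M" for M :: "complex^'m^'m"
   using order_trans[OF Finite_Cartesian_Product.norm_nth_le Finite_Cartesian_Product.norm_nth_le] by blast
  have s2: "(\<Sum>k<2. cscale (\<phi> x) (P k x \<zeta>)) $ i $ j = P 0 x \<zeta> $ i $ j + P 1 x \<zeta> $ i $ j" for P :: "nat => ('n, 'm) symb" and \<zeta>
   by (simp add: numeral_2_eq_2 cscale_def phx)
  have "norm (t *\<^sub>R (p 0 x ksi - p' 0 x ksi) $ i $ j + (p 1 x ksi - p' 1 x ksi) $ i $ j) \<le> (C / norm ksi) / t" if t: "t \<ge> 1 / norm ksi" for t
  proof -
   have tpos: "t > 0" using t ksi by (meson less_le_trans zero_less_divide_1_iff zero_less_norm_iff)
   have n1: "1 \<le> norm (t *\<^sub>R ksi)" using t ksi tpos by (simp add: divide_le_eq)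
   let ?\<zeta> = "t *\<^sub>R ksi" and ?w = "(1 + norm (t *\<^sub>R ksi)) powr (- 1)"
   have e1: "1 - real 2 = - 1" by simp
   have b3: "norm (a x ?\<zeta> $ i $ j - (p 0 x ?\<zeta> $ i $ j + p 1 x ?\<zeta> $ i $ j)) \<le> C3 * ?w"
    using order_trans[OF ij C3[OF n1, of x]] unfolding vector_minus_component s2 e1 .
   have b4: "norm (a' x ?\<zeta> $ i $ j - (p' 0 x ?\<zeta> $ i $ j + p' 1 x ?\<zeta> $ i $ j)) \<le> C4 * ?w"
    using order_trans[OF ij C4[OF n1, of x]] unfolding vector_minus_component s2 e1 .
   have b1: "norm (T 1 (ent a i j) \<phi> x ?\<zeta> - a x ?\<zeta> $ i $ j) \<le> C1 * ?w" "norm (T 1 (ent a' i j) \<phi> x ?\<zeta> - a' x ?\<zeta> $ i $ j) \<le> C2 * ?w"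
    using C1[of ?\<zeta>] C2[of ?\<zeta>] by auto
   have tri: "norm (P - P') \<le> A1 + A2 + A3 + A4"
    if "norm (X - P) \<le> A3" "norm (X' - P') \<le> A4" "norm (Y - X) \<le> A1" "norm (Y - X') \<le> A2" for P P' X X' Y :: complex and A1 A2 A3 A4
   proof -
    have "P - P' = (Y - X') + (X' - P') - (Y - X) - (X - P)" by simp
    also have "norm ... \<le> norm (Y - X') + norm (X' - P') + norm (Y - X) + norm (X - P)"
     by (intro order_trans[OF norm_triangle_ineq4] add_mono norm_triangle_ineq order_refl)
    finally show ?thesis using that by linarith
   qed
   have "norm ((p 0 x ?\<zeta> $ i $ j + p 1 x ?\<zeta> $ i $ j) - (p' 0 x ?\<zeta> $ i $ j + p' 1 x ?\<zeta> $ i $ j)) \<le> C1 * ?w + C2 * ?w + C3 * ?w + C4 * ?w"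
    by (rule tri[OF b3 b4 b1(1) b1(2)[folded TT]])
   also have "... = (C1 + C2 + C3 + C4) * ?w" by (simp only: distrib_right)
   also have "... \<le> C * ?w" by (intro mult_right_mono) (auto simp: C_def)
   also have "... \<le> C * (1 / (t * norm ksi))"
   proof (intro mult_left_mono)
    have "?w = 1 / (1 + norm ?\<zeta>)" by (simp add: powr_minus_divide add_nonneg_nonneg)
    also have "... \<le> 1 / norm ?\<zeta>" using n1 by (intro divide_left_mono) (auto simp: mult_pos_pos add_pos_nonneg)
    finally show "?w \<le> 1 / (t * norm ksi)" using tpos by simp
   qed (simp add: C_def)
   also have "... = (C / norm ksi) / t" by simp
   finally show ?thesis using tpos by (simp add: hp algebra_simps)
  qed
  from homogeneous_expansion_unique[of "1 / norm ksi", OF _ this] ksi show ?thesis by simp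
 qed
 show "p 0 x ksi = p' 0 x ksi" "p 1 x ksi = p' 1 x ksi" using main by (auto simp: vec_eq_iff)
qed

section \<open>The two leading symbols of the conjugated operator\<close>

lemma conj_symbol_0: "conj_symbol Q p 0 x ksi = Q x ** p 0 x ksi ** hconj (Q x)"
proof -
 have "(\<Sum>j\<in>UNIV. \<Sum>r\<in>UNIV. Q x $ i $ j * (p 0 x ksi $ j $ r * hconj (Q x) $ r $ s)) =
   (\<Sum>r\<in>UNIV. (\<Sum>j\<in>UNIV. Q x $ i $ j * p 0 x ksi $ j $ r) * hconj (Q x) $ r $ s)" for i s
  unfolding sum_distrib_right by (subst sum.swap) (simp add: mult.assoc)
 then show ?thesis by (simp add: vec_eq_iff conj_symbol_def matrix_matrix_mult_def)
qed

lemma pd_nth: "f differentiable (at x) ==> pd \<alpha> (%y. f y $ i) x = pd \<alpha> f x $ i"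
 unfolding pd_def
 by (subst frechet_derivative_eqI[OF bounded_linear.has_derivative[OF bounded_linear_vec_nth]]) (auto simp: frechet_derivative_works)

lemma conj_symbol_1:
 fixes p :: "nat => ('n::finite, 'm::finite) symb"
 assumes W: "open U" and Q: "smooth_on U Q" and p0: "smooth2 (U \<times> - {0}) (p 0)" and x: "x \<in> U" "ksi \<noteq> 0"
 shows "conj_symbol Q p 1 x ksi = Q x ** p 1 x ksi ** hconj (Q x) +
  (\<Sum>\<alpha>\<in>UNIV. cscale (- \<i>) (Q x ** d\<xi> \<alpha> (p 0) x ksi ** pd \<alpha> (%y. hconj (Q y)) x))"
proof -
 have hd: "(%y. hconj (Q y)) differentiable (at x)"
  by (rule smooth_on_differentiable[OF smooth_on_bounded_linear[OF bounded_linear_hconj W Q] x(1)])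
 have Dh: "Dd \<alpha> (%y. hconj (Q y) $ r $ s) x = - \<i> * pd \<alpha> (%y. hconj (Q y)) x $ r $ s" for \<alpha> r s
 proof -
  have "(%y. hconj (Q y) $ r) differentiable (at x)"
   by (rule smooth_on_differentiable[OF smooth_on_nth[OF W smooth_on_bounded_linear[OF bounded_linear_hconj W Q]] x(1)])
  then show ?thesis by (simp add: Dd_def pd_nth hd)
 qed
 have WZ: "open (U \<times> - {0 :: real^'n})" using W by (intro open_Times) auto
 have xm: "(x, ksi) \<in> U \<times> - {0}" using x by auto
 have d0: "d\<xi> \<alpha> (ent (p 0) j r) x ksi = d\<xi> \<alpha> (p 0) x ksi $ j $ r" for \<alpha> j r
  by (rule d\<xi>_bounded_linear[OF bounded_linear_compose[OF bounded_linear_vec_nth bounded_linear_vec_nth] p0 xm])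
 have "conj_symbol Q p 1 x ksi $ i $ s = (\<Sum>j\<in>UNIV. \<Sum>r\<in>UNIV. Q x $ i $ j * (p 1 x ksi $ j $ r * hconj (Q x) $ r $ s)) +
   (\<Sum>\<alpha>\<in>UNIV. - \<i> * (\<Sum>j\<in>UNIV. \<Sum>r\<in>UNIV. Q x $ i $ j * (d\<xi> \<alpha> (p 0) x ksi $ j $ r * pd \<alpha> (%y. hconj (Q y)) x $ r $ s)))" for i s
 proof -
  have "conj_symbol Q p 1 x ksi $ i $ s = (\<Sum>j\<in>UNIV. \<Sum>r\<in>UNIV. Q x $ i $ j * (p 1 x ksi $ j $ r * hconj (Q x) $ r $ s)) +
   (\<Sum>j\<in>UNIV. \<Sum>r\<in>UNIV. \<Sum>\<alpha>\<in>UNIV. - \<i> * (Q x $ i $ j * (d\<xi> \<alpha> (p 0) x ksi $ j $ r * pd \<alpha> (%y. hconj (Q y)) x $ r $ s)))"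
   by (simp add: conj_symbol_def d0 Dh sum.distrib sum_distrib_left mult_ac)
  also have "(\<Sum>j\<in>UNIV. \<Sum>r\<in>UNIV. \<Sum>\<alpha>\<in>UNIV. - \<i> * (Q x $ i $ j * (d\<xi> \<alpha> (p 0) x ksi $ j $ r * pd \<alpha> (%y. hconj (Q y)) x $ r $ s))) =
   (\<Sum>j\<in>UNIV. \<Sum>\<alpha>\<in>UNIV. \<Sum>r\<in>UNIV. - \<i> * (Q x $ i $ j * (d\<xi> \<alpha> (p 0) x ksi $ j $ r * pd \<alpha> (%y. hconj (Q y)) x $ r $ s)))"
   by (rule sum.cong[OF refl], rule sum.swap)
  also have "... = (\<Sum>\<alpha>\<in>UNIV. \<Sum>j\<in>UNIV. \<Sum>r\<in>UNIV. - \<i> * (Q x $ i $ j * (d\<xi> \<alpha> (p 0) x ksi $ j $ r * pd \<alpha> (%y. hconj (Q y)) x $ r $ s)))"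
   by (rule sum.swap)
  finally show ?thesis by (simp only: sum_distrib_left)
 qed
 moreover have "(\<Sum>j\<in>UNIV. \<Sum>r\<in>UNIV. Q x $ i $ j * (M $ j $ r * N $ r $ s)) = (Q x ** M ** N) $ i $ s" for M N :: "complex^'m^'m" and i s
  unfolding matrix_matrix_mult_def vec_lambda_beta sum_distrib_right by (subst sum.swap) (simp add: mult.assoc)
 ultimately show ?thesis by (simp add: vec_eq_iff cscale_def)
qed

lemma full_symbol_component:
 "classical_psido atl A ==> kap \<in> atl ==> has_full_symbol atl A kap (symbol_component atl A kap)"
 unfolding symbol_component_def classical_psido_def by (metis someI_ex)

lemma principal_symbol_smooth:
 "classical_psido atl A ==> kap \<in> atl ==> smooth2 (coords kap \<times> - {0}) (principal_symbol atl A kap)"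
 using full_symbol_component[of atl A kap] by (simp add: has_full_symbol_def principal_symbol_def)

lemma principal_symbol_homogeneous:
 "classical_psido atl A ==> kap \<in> atl ==> x \<in> coords kap ==> ksi \<noteq> 0 ==> t > 0 ==>
  principal_symbol atl A kap x (t *\<^sub>R ksi) = t *\<^sub>R principal_symbol atl A kap x ksi"
 using full_symbol_component[of atl A kap] by (simp add: has_full_symbol_def principal_symbol_def)

text \<open>The composition adds -i Q A1_xi hconj(Q)_x to the degree 0 component. The mixed second
  derivative of Q A1 hconj(Q), multiplied by i/2, adds i/2 times this same product and i/2 times Q_x
  A1_xi hconj(Q). Together the factors are i/2 and -i/2 (\<open>ci\<close>), which gives the
  antisymmetric combination. The components on both sides are those picked by \<open>SOME\<close>;
  \<open>full_symbol_unique\<close> identifies them with \<open>conj_symbol\<close>.\<close>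

lemma conjugated_symbols:
 fixes A :: "('p::t2_space, 'n::finite, 'm::finite) column => ('p, 'n, 'm) column"
 assumes atl: "smooth_structure atl" and A: "classical_psido atl A" and R: "smooth_on_manifold atl R"
  and kap: "kap \<in> atl" and x: "x \<in> coords kap" "ksi \<noteq> 0"
 defines "Q \<equiv> R \<circ> point kap" and "A1 \<equiv> principal_symbol atl A kap"
 shows "principal_symbol atl (conjugated R A) kap x ksi = Q x ** A1 x ksi ** hconj (Q x)"
  and "subprincipal_symbol atl (conjugated R A) kap x ksi = Q x ** subprincipal_symbol atl A kap x ksi ** hconj (Q x) +
   cscale (\<i> / 2) (\<Sum>\<alpha>\<in>UNIV. pd \<alpha> Q x ** d\<xi> \<alpha> A1 x ksi ** hconj (Q x) - Q x ** d\<xi> \<alpha> A1 x ksi ** pd \<alpha> (%y. hconj (Q y)) x)"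
proof -
 let ?U = "coords kap" and ?p = "symbol_component atl A kap" and ?A' = "conjugated R A"
 let ?h = "%y. hconj (Q y)"
 have cht: "is_chart kap" by (rule smooth_structure_chart[OF atl kap])
 have U: "open ?U" by (rule chart_open[OF cht])
 have W: "open (?U \<times> - {0 :: real^'n})" using U by (intro open_Times) auto
 have Q: "smooth_on ?U Q" using R kap by (simp add: smooth_on_manifold_def Q_def)
 have h: "smooth_on ?U ?h" by (rule smooth_on_bounded_linear[OF bounded_linear_hconj U Q])
 have p: "has_full_symbol atl A kap ?p" by (rule full_symbol_component[OF A kap])
 have q: "has_full_symbol atl ?A' kap (conj_symbol Q ?p)"
  using has_full_symbol_conjugated[OF cht _ p, of R] Q by (simp add: Q_def)
 have q': "has_full_symbol atl ?A' kap (symbol_component atl ?A' kap)"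
  unfolding symbol_component_def using someI[of "has_full_symbol atl ?A' kap", OF q] .
 have A1: "A1 = ?p 0" by (simp add: A1_def principal_symbol_def)
 have sA1: "smooth2 (?U \<times> - {0}) A1" unfolding A1_def by (rule principal_symbol_smooth[OF A kap])
 have pr: "principal_symbol atl ?A' kap x ksi = Q x ** A1 x ksi ** hconj (Q x)" if "x \<in> ?U" "ksi \<noteq> 0" for x ksi
  using full_symbol_unique(1)[OF U q' q that] by (simp add: principal_symbol_def conj_symbol_0 A1)
 show "principal_symbol atl ?A' kap x ksi = Q x ** A1 x ksi ** hconj (Q x)" by (rule pr[OF x])
 have s1: "symbol_component atl ?A' kap 1 x ksi = Q x ** ?p 1 x ksi ** hconj (Q x) +
  (\<Sum>\<alpha>\<in>UNIV. cscale (- \<i>) (Q x ** d\<xi> \<alpha> A1 x ksi ** pd \<alpha> ?h x))"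
  using full_symbol_unique(2)[OF U q' q x] conj_symbol_1[OF U Q, of ?p] p x by (simp add: has_full_symbol_def A1)
 have Q2: "smooth2 (?U \<times> - {0}) (%x ksi. Q x)"
  using smooth_on_compose[OF W U smooth_on_fst[OF W] Q] by (auto simp: case_prod_unfold)
 have h2: "smooth2 (?U \<times> - {0}) (%x ksi. ?h x)"
  using smooth_on_compose[OF W U smooth_on_fst[OF W] h] by (auto simp: case_prod_unfold)
 have mm: "smooth2 (?U \<times> - {0}) (%x ksi. M x ksi ** N x ksi)" if "smooth2 (?U \<times> - {0}) M" "smooth2 (?U \<times> - {0}) N" for M N :: "('n, 'm) symb"
  using smooth_on_bilinear[OF bounded_bilinear_matrix_mult W that] by (simp add: case_prod_unfold)
 have pdQ: "smooth2 (?U \<times> - {0}) (%x ksi. pd \<alpha> Q x)" and pdh: "smooth2 (?U \<times> - {0}) (%x ksi. pd \<alpha> ?h x)" for \<alpha>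
  using smooth_on_compose[OF W U smooth_on_fst[OF W] smooth_on_derivative[OF Q]] smooth_on_compose[OF W U smooth_on_fst[OF W] smooth_on_derivative[OF h]]
  by (auto simp: case_prod_unfold pd_def)
 have dxA1: "smooth2 (?U \<times> - {0}) (dx \<alpha> A1)" for \<alpha> by (rule smooth2_dx[OF W sA1])
 have dx1: "dx \<alpha> (principal_symbol atl ?A' kap) x ksi =
   (pd \<alpha> Q x ** A1 x ksi ** ?h x + Q x ** dx \<alpha> A1 x ksi ** ?h x) + Q x ** A1 x ksi ** pd \<alpha> ?h x" if x: "x \<in> ?U" "ksi \<noteq> 0" for x ksi \<alpha>
 proof -
  have xm: "(x, ksi) \<in> ?U \<times> - {0}" using x by auto
  have "dx \<alpha> (principal_symbol atl ?A' kap) x ksi = dx \<alpha> (%x ksi. Q x ** A1 x ksi ** ?h x) x ksi"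
   by (rule dx_cong[OF W xm]) (use pr in auto)
  also have "... = dx \<alpha> (%x ksi. Q x ** A1 x ksi) x ksi ** ?h x + (Q x ** A1 x ksi) ** dx \<alpha> (%x ksi. ?h x) x ksi"
   by (rule dx_bilinear[OF bounded_bilinear_matrix_mult mm[OF Q2 sA1] h2 xm])
  also have "dx \<alpha> (%x ksi. Q x ** A1 x ksi) x ksi = dx \<alpha> (%x ksi. Q x) x ksi ** A1 x ksi + Q x ** dx \<alpha> A1 x ksi"
   by (rule dx_bilinear[OF bounded_bilinear_matrix_mult Q2 sA1 xm])
  finally show ?thesis
   by (simp add: dx_of_x[OF smooth_on_differentiable[OF Q x(1)]] dx_of_x[OF smooth_on_differentiable[OF h x(1)]] bounded_bilinear.add_left[OF bounded_bilinear_matrix_mult])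
 qed
 have xm: "(x, ksi) \<in> ?U \<times> - {0}" using x by auto
 have dxi3: "d\<xi> \<alpha> (%x ksi. M x ** B x ksi ** N x) x ksi = M x ** d\<xi> \<alpha> B x ksi ** N x"
  if M: "smooth2 (?U \<times> - {0}) (%x ksi. M x)" and B: "smooth2 (?U \<times> - {0}) B" and N: "smooth2 (?U \<times> - {0}) (%x ksi. N x)"
  for M N :: "real^'n => complex^'m^'m" and B \<alpha>
  using d\<xi>_bilinear[OF bounded_bilinear_matrix_mult mm[OF M B] N xm, of \<alpha>] d\<xi>_bilinear[OF bounded_bilinear_matrix_mult M B xm, of \<alpha>]
  by (simp add: d\<xi>_const)
 have dd: "d\<xi> \<alpha> (dx \<alpha> (principal_symbol atl ?A' kap)) x ksi =
   pd \<alpha> Q x ** d\<xi> \<alpha> A1 x ksi ** ?h x + Q x ** d\<xi> \<alpha> (dx \<alpha> A1) x ksi ** ?h x + Q x ** d\<xi> \<alpha> A1 x ksi ** pd \<alpha> ?h x" for \<alpha>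
 proof -
  note m1 = mm[OF mm[OF pdQ sA1] h2] and m2 = mm[OF mm[OF Q2 dxA1] h2] and m3 = mm[OF mm[OF Q2 sA1] pdh]
  have m12: "smooth2 (?U \<times> - {0}) (%x ksi. pd \<alpha> Q x ** A1 x ksi ** ?h x + Q x ** dx \<alpha> A1 x ksi ** ?h x)"
   using smooth_on_add[OF W m1 m2] by (simp add: case_prod_unfold)
  have "d\<xi> \<alpha> (dx \<alpha> (principal_symbol atl ?A' kap)) x ksi = d\<xi> \<alpha> (%x ksi. (pd \<alpha> Q x ** A1 x ksi ** ?h x + Q x ** dx \<alpha> A1 x ksi ** ?h x) + Q x ** A1 x ksi ** pd \<alpha> ?h x) x ksi"
   by (rule d\<xi>_cong[OF W xm]) (use dx1 in auto)
  then show ?thesis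
   by (simp only: d\<xi>_add[OF m12 m3 xm] d\<xi>_add[OF m1 m2 xm] dxi3[OF pdQ sA1 h2] dxi3[OF Q2 dxA1 h2] dxi3[OF Q2 sA1 pdh])
 qed
 have c: "cscale c (\<Sum>\<alpha>\<in>I. M \<alpha>) = (\<Sum>\<alpha>\<in>I. cscale c (M \<alpha>))" for c and M :: "'n => complex^'m^'m" and I
  by (simp add: vec_eq_iff cscale_def sum_distrib_left)
 have mc: "Q x ** (cscale c M) ** N = cscale c (Q x ** M ** N)" for c and M N :: "complex^'m^'m"
  by (simp add: vec_eq_iff cscale_def matrix_matrix_mult_def sum_distrib_left sum_distrib_right mult_ac)
 have ms: "Q x ** (\<Sum>\<alpha>\<in>UNIV. M \<alpha>) ** N = (\<Sum>\<alpha>\<in>UNIV. Q x ** M \<alpha> ** N)" for M :: "'n => complex^'m^'m" and N :: "complex^'m^'m"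
  using linear_sum[OF bounded_linear.linear[OF bounded_bilinear.bounded_linear_left[OF bounded_bilinear_matrix_mult, of N]], of "%\<alpha>. Q x ** M \<alpha>" UNIV]
   linear_sum[OF bounded_linear.linear[OF bounded_bilinear.bounded_linear_right[OF bounded_bilinear_matrix_mult, of "Q x"]], of M UNIV]
  by simp
 have ca: "cscale c (M + N) = cscale c M + cscale c N" "cscale c (M - N) = cscale c M - cscale c N" for c and M N :: "complex^'m^'m"
  by (simp_all add: vec_eq_iff cscale_def algebra_simps)
 have ci: "cscale (- \<i>) M + cscale (\<i> / 2) M = - cscale (\<i> / 2) M" for M :: "complex^'m^'m"
  by (simp add: vec_eq_iff cscale_def algebra_simps)
 show "subprincipal_symbol atl ?A' kap x ksi = Q x ** subprincipal_symbol atl A kap x ksi ** hconj (Q x) +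
   cscale (\<i> / 2) (\<Sum>\<alpha>\<in>UNIV. pd \<alpha> Q x ** d\<xi> \<alpha> A1 x ksi ** hconj (Q x) - Q x ** d\<xi> \<alpha> A1 x ksi ** pd \<alpha> ?h x)"
 proof -
  have "subprincipal_symbol atl ?A' kap x ksi = Q x ** ?p 1 x ksi ** ?h x +
   (\<Sum>\<alpha>\<in>UNIV. cscale (- \<i>) (Q x ** d\<xi> \<alpha> A1 x ksi ** pd \<alpha> ?h x) +
     (cscale (\<i> / 2) (pd \<alpha> Q x ** d\<xi> \<alpha> A1 x ksi ** ?h x) + cscale (\<i> / 2) (Q x ** d\<xi> \<alpha> (dx \<alpha> A1) x ksi ** ?h x) + cscale (\<i> / 2) (Q x ** d\<xi> \<alpha> A1 x ksi ** pd \<alpha> ?h x)))"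
   unfolding subprincipal_symbol_def s1 dd c ca by (simp add: sum.distrib)
  also have "... = Q x ** ?p 1 x ksi ** ?h x +
   (\<Sum>\<alpha>\<in>UNIV. cscale (\<i> / 2) (Q x ** d\<xi> \<alpha> (dx \<alpha> A1) x ksi ** ?h x) + (cscale (\<i> / 2) (pd \<alpha> Q x ** d\<xi> \<alpha> A1 x ksi ** ?h x) - cscale (\<i> / 2) (Q x ** d\<xi> \<alpha> A1 x ksi ** pd \<alpha> ?h x)))"
  proof -
   have g: "a1 + (b1 + c1 + d1) = c1 + (b1 - d1)" if "a1 + d1 = - d1" for a1 b1 c1 d1 :: "complex^'m^'m"
   proof -
    have "a1 + (b1 + c1 + d1) = (a1 + d1) + (b1 + c1)" by (simp add: algebra_simps)
    then show ?thesis using that by (simp add: algebra_simps)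
   qed
   show ?thesis by (rule arg_cong2[where f = "(+)", OF refl], rule sum.cong[OF refl], rule g[OF ci])
  qed
  also have "... = Q x ** subprincipal_symbol atl A kap x ksi ** ?h x +
   cscale (\<i> / 2) (\<Sum>\<alpha>\<in>UNIV. pd \<alpha> Q x ** d\<xi> \<alpha> A1 x ksi ** ?h x - Q x ** d\<xi> \<alpha> A1 x ksi ** pd \<alpha> ?h x)"
   unfolding subprincipal_symbol_def A1_def[symmetric] c ca
    bounded_bilinear.add_right[OF bounded_bilinear_matrix_mult] bounded_bilinear.add_left[OF bounded_bilinear_matrix_mult] ms mc sum.distrib
   by (simp add: add.assoc)
  finally show ?thesis .
 qed
qed

subsection \<open>Half-densities supported in a chart\<close>

lemma chart_continuous: "is_chart kap ==> continuous_on (fst kap) (snd kap)"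
 and point_continuous: "is_chart kap ==> continuous_on (coords kap) (point kap)"
 by (simp_all add: is_chart_def homeomorphism_def)

lemma open_chart_image:
 assumes kap: "is_chart kap" and S: "open S" "S \<subseteq> fst kap"
 shows "open (snd kap ` S)"
proof -
 have "snd kap ` S = coords kap \<inter> point kap -` S"
  using S(2) point_coord[OF kap] coord_point[OF kap] by (force simp: coords_def image_iff)
 then show ?thesis
  using continuous_open_preimage[OF point_continuous[OF kap] chart_open[OF kap] S(1)] by simp
qed

lemma open_point_image:
 assumes kap: "is_chart kap" and X: "open X" "X \<subseteq> coords kap"
 shows "open (point kap ` X)"
proof -
 have "point kap ` X = fst kap \<inter> snd kap -` X"
  using X(2) point_coord[OF kap] coord_point[OF kap] point_in[OF kap] by (force simp: image_iff)
 then show ?thesis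
  using continuous_open_preimage[OF chart_continuous[OF kap] chart_open_domain[OF kap] X(1)] by simp
qed

abbreviation overlap :: "('p, 'n::finite) chart => ('p, 'n) chart => (real^'n) set" where
 "overlap kap kap' \<equiv> snd kap' ` (fst kap \<inter> fst kap')"

lemma open_overlap: "is_chart kap ==> is_chart kap' ==> open (overlap kap kap')"
 by (rule open_chart_image) (auto intro: chart_open_domain)

lemma transition_smooth:
 assumes "smooth_structure atl" "kap \<in> atl" "kap' \<in> atl"
 shows "smooth_on (overlap kap kap') (transition kap kap')"
 using assms unfolding smooth_structure_def compatible_def by metis

lemma transition_coord: "is_chart kap' ==> p \<in> fst kap' ==> transition kap kap' (snd kap' p) = snd kap p"
 by (simp add: transition_def point_coord)

section \<open>Cocycle rule and smoothness of the Jacobian factors\<close>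

lemma jac_chain:
 assumes atl: "smooth_structure atl" and kap: "kap \<in> atl" "kap' \<in> atl" "kap'' \<in> atl"
  and p: "p \<in> fst kap" "p \<in> fst kap'" "p \<in> fst kap''"
 shows "jac kap kap'' p = jac kap kap' p * jac kap' kap'' p"
proof -
 note c = smooth_structure_chart[OF atl kap(1)] smooth_structure_chart[OF atl kap(2)] smooth_structure_chart[OF atl kap(3)]
 let ?y = "snd kap'' p"
 define S where "S = snd kap'' ` (fst kap \<inter> fst kap' \<inter> fst kap'')"
 have S: "open S" "?y \<in> S"
  unfolding S_def using open_chart_image[OF c(3)] chart_open_domain[OF c(1)] chart_open_domain[OF c(2)] chart_open_domain[OF c(3)] p
  by (auto intro!: open_Int)
 have d1: "(transition kap' kap'' has_derivative frechet_derivative (transition kap' kap'') (at ?y)) (at ?y)"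
  by (rule smooth_on_has_derivative[OF transition_smooth[OF atl kap(2,3)]]) (use p in auto)
 have t: "transition kap' kap'' ?y = snd kap' p" by (rule transition_coord[OF c(3) p(3)])
 have d2: "(transition kap kap' has_derivative frechet_derivative (transition kap kap') (at (snd kap' p))) (at (transition kap' kap'' ?y))"
  unfolding t by (rule smooth_on_has_derivative[OF transition_smooth[OF atl kap(1,2)]]) (use p in auto)
 have "(transition kap kap'' has_derivative frechet_derivative (transition kap kap') (at (snd kap' p)) \<circ> frechet_derivative (transition kap' kap'') (at ?y)) (at ?y)"
 proof (rule has_derivative_transform_within_open[OF diff_chain_at[OF d1 d2] S])
  fix y assume "y \<in> S"
  then obtain q where q: "q \<in> fst kap" "q \<in> fst kap'" "q \<in> fst kap''" "y = snd kap'' q" by (auto simp: S_def)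
  then show "(transition kap kap' \<circ> transition kap' kap'') y = transition kap kap'' y"
   by (simp add: transition_coord c)
 qed
 then have "frechet_derivative (transition kap kap'') (at ?y) = frechet_derivative (transition kap kap') (at (snd kap' p)) \<circ> frechet_derivative (transition kap' kap'') (at ?y)"
  by (rule frechet_derivative_eqI)
 then show ?thesis
  using has_derivative_linear[OF d1] has_derivative_linear[OF d2]
  by (simp add: jac_def matrix_compose det_mul abs_mult)
qed

lemma jac_self:
 assumes kap: "is_chart kap" and p: "p \<in> fst kap" shows "jac kap kap p = 1"
proof -
 have "((%x. x) has_derivative (%x. x)) (at (snd kap p))" by simp
 then have "(transition kap kap has_derivative (%x. x)) (at (snd kap p))"
  by (rule has_derivative_transform_within_open[OF _ chart_open[OF kap] coord_in[OF p]]) (simp add: transition_def coord_point[OF kap])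
 then show ?thesis using matrix_id_mat_1 by (simp add: jac_def frechet_derivative_eqI)
qed

text \<open>By the cocycle rule the Jacobians of a transition and of its inverse multiply to 1, so
  neither vanishes.\<close>

lemma jac_pos:
 assumes "smooth_structure atl" "kap \<in> atl" "kap' \<in> atl" "p \<in> fst kap" "p \<in> fst kap'"
 shows "jac kap kap' p > 0"
proof -
 have "jac kap kap' p * jac kap' kap p = 1"
  using jac_chain[of atl kap kap' kap p] jac_self[of kap p] assms smooth_structure_chart by metis
 then have "jac kap kap' p \<noteq> 0" by auto
 then show ?thesis by (simp add: jac_def)
qed

text \<open>The absolute value of the determinant d is rewritten as sqrt(d * d), which is smooth
  because d has no zero on the overlap; no distinction of signs is made.\<close>

lemma jac_smooth:
 assumes atl: "smooth_structure atl" and kap: "kap \<in> atl" "kap' \<in> atl"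
 shows "smooth_on (overlap kap kap') (%y. jac kap kap' (point kap' y))"
  and "smooth_on (overlap kap kap') (%y. sqrt (jac kap kap' (point kap' y)))"
proof -
 note c = smooth_structure_chart[OF atl kap(1)] smooth_structure_chart[OF atl kap(2)]
 let ?O = "overlap kap kap'"
 have O: "open ?O" by (rule open_overlap[OF c])
 let ?d = "%y. det (matrix (frechet_derivative (transition kap kap') (at y)))"
 have sp: "snd kap' (point kap' y) = y" "point kap' y \<in> fst kap" "point kap' y \<in> fst kap'" if "y \<in> ?O" for y
  using that point_coord[OF c(2)] by auto
 have j: "jac kap kap' (point kap' y) = sqrt (?d y * ?d y)" if "y \<in> ?O" for y
  by (simp add: jac_def sp[OF that] real_sqrt_abs2)
 have pos: "jac kap kap' (point kap' y) > 0" if "y \<in> ?O" for y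
  using jac_pos[OF atl kap] sp[OF that] by simp
 have ds: "smooth_on ?O ?d"
  unfolding det_def
 proof (intro smooth_on_sum O smooth_on_mult smooth_on_const smooth_on_prod)
  fix f i
  show "smooth_on ?O (%y. matrix (frechet_derivative (transition kap kap') (at y)) $ i $ f i)"
   unfolding matrix_def vec_lambda_beta
   by (intro smooth_on_nth O smooth_on_derivative transition_smooth[OF atl kap])
 qed
 have "smooth_on ?O (%y. sqrt (?d y * ?d y))"
 proof (rule smooth_on_compose[OF O _ smooth_on_mult[OF O ds ds] smooth_on_sqrt])
  show "?d y * ?d y \<in> {0<..}" if "y \<in> ?O" for y
   using pos[OF that] j[OF that] by (simp add: zero_less_mult_iff not_less) (metis less_eq_real_def linorder_neqE_linordered_idom mult_neg_neg mult_pos_pos real_sqrt_gt_0_iff mult_eq_0_iff)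
 qed auto
 then show *: "smooth_on ?O (%y. jac kap kap' (point kap' y))"
  by (rule smooth_on_cong[OF O]) (simp add: j)
 show "smooth_on ?O (%y. sqrt (jac kap kap' (point kap' y)))"
  by (rule smooth_on_compose[OF O _ * smooth_on_sqrt]) (use pos in auto)
qed

text \<open>The support, transported to the manifold, is compact and therefore closed, the manifold
  being Hausdorff. Hence every point outside the chart has a neighbourhood on which the half-density
  is 0, and inside the chart it is a transformed test function.\<close>

lemma from_chart_smooth:
 fixes f :: "real^'n::finite => complex^'m::finite" and atl :: "('p::t2_space, 'n) chart set"
 assumes atl: "smooth_structure atl" and kap: "kap \<in> atl" and f: "test_function (coords kap) f"
 shows "smooth_half_density atl (from_chart atl kap f)"
 unfolding smooth_half_density_def half_density_def
proof (intro conjI ballI allI impI)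
 note ch = smooth_structure_chart[OF atl]
 fix kap' kap'' p assume k: "kap' \<in> atl" "kap'' \<in> atl" "p \<in> fst kap' \<inter> fst kap''"
 show "from_chart atl kap f kap'' p = sqrt (jac kap' kap'' p) *\<^sub>R from_chart atl kap f kap' p"
  using k jac_chain[OF atl kap k(1,2), of p] by (auto simp: from_chart_def real_sqrt_mult mult.commute)
next
 fix kap' p assume "kap' \<notin> atl \<or> p \<notin> fst kap'"
 then show "from_chart atl kap f kap' p = 0" by (auto simp: from_chart_def)
next
 note ch = smooth_structure_chart[OF atl]
 fix kap' assume k: "kap' \<in> atl"
 let ?u = "from_chart atl kap f kap' \<circ> point kap'"
 let ?O = "overlap kap kap'"
 let ?C = "point kap ` supp f"
 have O: "open ?O" by (rule open_overlap[OF ch[OF kap] ch[OF k]])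
 have "compact ?C"
  using f by (intro compact_continuous_image continuous_on_subset[OF point_continuous[OF ch[OF kap]]]) (auto simp: test_function_def)
 then have C: "closed ?C" by (rule compact_imp_closed)
 show "smooth_on (coords kap') ?u"
 proof (rule smooth_on_local)
  fix y assume y: "y \<in> coords kap'"
  show "\<exists>T. open T \<and> y \<in> T \<and> smooth_on T ?u"
  proof (cases "point kap' y \<in> fst kap")
   case True
   then have yO: "y \<in> ?O" using coord_point[OF ch[OF k] y] point_in[OF ch[OF k] y] by (force simp: image_iff)
   have "smooth_on ?O (%y. sqrt (jac kap kap' (point kap' y)) *\<^sub>R f (transition kap kap' y))"
    by (intro smooth_on_scaleR O jac_smooth(2)[OF atl kap k]
      smooth_on_compose[OF O open_UNIV transition_smooth[OF atl kap k] test_function_smooth[OF f]]) auto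
   then have "smooth_on ?O ?u"
    by (rule smooth_on_cong[OF O]) (auto simp: from_chart_def kap k transition_def point_coord[OF ch[OF k]])
   then show ?thesis using O yO by blast
  next
   case False
   let ?N = "snd kap' ` (fst kap' - ?C)"
   have N: "open ?N" using chart_open_domain[OF ch[OF k]] C by (intro open_chart_image[OF ch[OF k]] open_Diff) auto
   have "?C \<subseteq> fst kap" using f point_in[OF ch[OF kap]] by (auto simp: test_function_def)
   then have yN: "y \<in> ?N" using False coord_point[OF ch[OF k] y] point_in[OF ch[OF k] y] by (force simp: image_iff)
   have "f (snd kap q) = 0" if "q \<in> fst kap" "q \<notin> ?C" for q
    using that point_coord[OF ch[OF kap] that(1)] zero_outside_supp[of "snd kap q" f] by force
   then have "smooth_on ?N ?u"
    by (intro smooth_on_cong[OF N smooth_on_const[OF N, of 0]]) (auto simp: from_chart_def point_coord[OF ch[OF k]])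
   then show ?thesis using N yN by blast
  qed
 qed
qed

subsection \<open>The principal symbol of a formally self-adjoint operator is Hermitian\<close>

abbreviation wave :: "real^'n::finite => (real^'n => real) => complex^'m::finite => real^'n => complex^'m" where
 "wave eta h c \<equiv> %y. cis (y \<bullet> eta) *s (complex_of_real (h y) *s c)"

lemma test_function_wave:
 assumes "test_function U h" shows "test_function U (wave eta h c)"
proof (rule test_functionI[where K = "supp h"])
 show "smooth_on UNIV (wave eta h c)"
  by (rule smooth_on_vec) (auto intro!: smooth_on_mult smooth_on_cis_inner smooth_on_const
    smooth_on_bounded_linear[OF bounded_linear_of_real] test_function_smooth[OF assms])
qed (use assms in \<open>auto simp: test_function_def zero_outside_supp vec_eq_iff\<close>)

text \<open>Cutting both the Taylor expansion and the symbol expansion at N = 1 leaves an error of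
  order 0, bounded uniformly over the support of \<open>h\<close>. This is enough, since the leading
  term grows linearly in the frequency.\<close>

lemma wave_asymptotics:
 fixes A :: "('p::t2_space, 'n::finite, 'm::finite) column => ('p, 'n, 'm) column"
 assumes atl: "smooth_structure atl" and A: "classical_psido atl A" and kap: "kap \<in> atl"
  and h: "test_function (coords kap) h" "!!x. 0 \<le> h x" "!!x. h x \<le> 1"
 shows "\<exists>C. \<forall>eta x. 1 \<le> norm eta --> x \<in> supp h -->
  norm (A (from_chart atl kap (wave eta h c)) kap (point kap x) - cis (x \<bullet> eta) *s (complex_of_real (h x) *s (principal_symbol atl A kap x eta *v c))) \<le> C"
proof -
 have ch: "is_chart kap" by (rule smooth_structure_chart[OF atl kap])
 have U: "open (coords kap)" by (rule chart_open[OF ch])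
 have hs: "compact (supp h)" "supp h \<subseteq> coords kap" using h(1) by (auto simp: test_function_def)
 obtain \<phi> \<psi> :: "real^'n => complex" and V where \<phi>: "test_function (coords kap) \<phi>" "test_function (coords kap) \<psi>"
  "supp \<phi> \<subseteq> interior {x. \<psi> x = 1}" and V: "open V" "supp h \<subseteq> V" "\<forall>y\<in>V. \<phi> y = 1"
  using cutoffs_exist[OF hs U] by auto
 let ?p = "symbol_component atl A kap"
 let ?ch = "%y. complex_of_real (h y)"
 obtain a where a: "a \<in> symbol_class 1" "!!u. test_function UNIV u ==> localised atl A kap \<phi> \<psi> u = Op a u"
  "\<forall>N. \<exists>C. \<forall>x ksi. 1 \<le> norm ksi --> norm (a x ksi - (\<Sum>k<N. cscale (\<phi> x) (?p k x ksi))) \<le> C * (1 + norm ksi) powr (1 - real N)"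
  using has_full_symbol_cutoff[OF full_symbol_component[OF A kap] \<phi>] by blast
 have cht: "test_function (coords kap) ?ch" by (rule test_function_bounded_linear[OF bounded_linear_of_real h(1)])
 note aij = symb_on_ent[OF open_UNIV subset_UNIV iffD1[OF symbol_class_iff a(1)]]
 have phi1: "\<phi> x = 1" if "x \<in> supp h" for x using that V by auto
 have psi1: "\<psi> x = 1" if "x \<in> supp h" for x
 proof -
  have "x \<in> supp \<phi>" using phi1[OF that] zero_outside_supp[of x \<phi>] by auto
  then show ?thesis using \<phi>(3) interior_subset by blast
 qed
 obtain C2 where C2: "!!x ksi. 1 \<le> norm ksi ==> norm (a x ksi - (\<Sum>k<1. cscale (\<phi> x) (?p k x ksi))) \<le> C2 * (1 + norm ksi) powr (1 - real 1)"
  using a(3) by blast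
 have "\<forall>i j. \<exists>C. \<forall>x eta. norm (T 1 (ent a i j) ?ch x eta - a x eta $ i $ j * ?ch x) \<le> C"
 proof (intro allI)
  fix i j
  obtain C where C: "\<forall>t x ksi. 0 \<le> t --> t \<le> 1 --> norm (Rem 1 t (ent a i j) ?ch x ksi) \<le> C * (1 + norm ksi) powr (1 - real 1)"
   using Rem_bound[OF aij cht] by blast
  have "norm (T 1 (ent a i j) ?ch x eta - a x eta $ i $ j * ?ch x) \<le> C" for x eta
  proof -
   have "(1 + norm eta) powr (1 - real 1) = 1" using add_nonneg_eq_0_iff[of 1 "norm eta"] by simp
   then show ?thesis using C[rule_format, of 1 x eta] by (simp add: Rem_def)
  qed
  then show "\<exists>C. \<forall>x eta. norm (T 1 (ent a i j) ?ch x eta - a x eta $ i $ j * ?ch x) \<le> C" by blast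
 qed
 then obtain C1 where C1: "!!i j x eta. norm (T 1 (ent a i j) ?ch x eta - a x eta $ i $ j * ?ch x) \<le> C1 i j" by metis
 have "norm (A (from_chart atl kap (wave eta h c)) kap (point kap x) - cis (x \<bullet> eta) *s (?ch x *s (principal_symbol atl A kap x eta *v c)))
   \<le> (\<Sum>i\<in>UNIV. \<Sum>j\<in>UNIV. (C1 i j + C2) * norm (c $ j))" if eta: "1 \<le> norm eta" and x: "x \<in> supp h" for eta x
 proof -
  have "(%y. \<psi> y *s wave eta h c y) = wave eta h c"
  proof
   fix y show "\<psi> y *s wave eta h c y = wave eta h c y"
    by (cases "y \<in> supp h") (auto simp: psi1 zero_outside_supp vec_eq_iff)
  qed
  then have "A (from_chart atl kap (wave eta h c)) kap (point kap x) = localised atl A kap \<phi> \<psi> (wave eta h c) x"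
   using x hs(2) phi1[OF x] by (auto simp: localised_def)
  also have "... = Op a (wave eta h c) x" using a(2)[OF test_function_mono[OF test_function_wave[OF h(1)]]] by simp
  also have "... = cis (x \<bullet> eta) *s (\<chi> i. \<Sum>j\<in>UNIV. T 1 (ent a i j) ?ch x eta * c $ j)" by (rule T_axis[OF a(1) cht])
  finally have e: "A (from_chart atl kap (wave eta h c)) kap (point kap x) - cis (x \<bullet> eta) *s (?ch x *s (principal_symbol atl A kap x eta *v c)) =
   (\<chi> i. cis (x \<bullet> eta) * (\<Sum>j\<in>UNIV. (T 1 (ent a i j) ?ch x eta - ?p 0 x eta $ i $ j * ?ch x) * c $ j))"
   by (simp add: vec_eq_iff principal_symbol_def matrix_vector_mult_def left_diff_distrib right_diff_distrib sum_subtractf sum_distrib_left mult_ac)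
  have b: "norm (T 1 (ent a i j) ?ch x eta - ?p 0 x eta $ i $ j * ?ch x) \<le> C1 i j + C2" for i j
  proof -
   have e0: "(1 + norm eta) powr (1 - real 1) = 1" using add_nonneg_eq_0_iff[of 1 "norm eta"] by simp
   have s1: "(\<Sum>k<1. cscale (\<phi> x) (?p k x eta)) = ?p 0 x eta" by (simp add: cscale_def phi1[OF x] vec_eq_iff)
   have n: "norm (a x eta - ?p 0 x eta) \<le> C2" using C2[OF eta, of x] unfolding e0 s1 by simp
   have "norm ((a x eta - ?p 0 x eta) $ i $ j) \<le> C2"
    by (rule order_trans[OF order_trans[OF Finite_Cartesian_Product.norm_nth_le Finite_Cartesian_Product.norm_nth_le] n])
   moreover have "norm ((a x eta $ i $ j - ?p 0 x eta $ i $ j) * ?ch x) \<le> norm (a x eta $ i $ j - ?p 0 x eta $ i $ j)"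
    using h(2,3)[of x] by (simp add: norm_mult mult_right_le_one_le)
   ultimately have "norm ((a x eta $ i $ j - ?p 0 x eta $ i $ j) * ?ch x) \<le> C2" by simp
   moreover have "T 1 (ent a i j) ?ch x eta - ?p 0 x eta $ i $ j * ?ch x =
    (T 1 (ent a i j) ?ch x eta - a x eta $ i $ j * ?ch x) + (a x eta $ i $ j - ?p 0 x eta $ i $ j) * ?ch x" by (simp add: algebra_simps)
   ultimately show ?thesis using norm_triangle_mono[OF C1[of i j x eta]] by metis
  qed
  have "norm (A (from_chart atl kap (wave eta h c)) kap (point kap x) - cis (x \<bullet> eta) *s (?ch x *s (principal_symbol atl A kap x eta *v c)))
    \<le> (\<Sum>i\<in>UNIV. norm (cis (x \<bullet> eta) * (\<Sum>j\<in>UNIV. (T 1 (ent a i j) ?ch x eta - ?p 0 x eta $ i $ j * ?ch x) * c $ j)))"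
   unfolding e norm_vec_def by (rule order_trans[OF L2_set_le_sum]) auto
  also have "... \<le> (\<Sum>i\<in>UNIV. \<Sum>j\<in>UNIV. (C1 i j + C2) * norm (c $ j))"
  proof (rule sum_mono)
   fix i
   have "norm (\<Sum>j\<in>UNIV. (T 1 (ent a i j) ?ch x eta - ?p 0 x eta $ i $ j * ?ch x) * c $ j) \<le> (\<Sum>j\<in>UNIV. (C1 i j + C2) * norm (c $ j))"
    by (rule sum_norm_le) (auto simp: norm_mult intro!: mult_right_mono b)
   then show "norm (cis (x \<bullet> eta) * (\<Sum>j\<in>UNIV. (T 1 (ent a i j) ?ch x eta - ?p 0 x eta $ i $ j * ?ch x) * c $ j)) \<le> (\<Sum>j\<in>UNIV. (C1 i j + C2) * norm (c $ j))"
    by (simp add: norm_mult)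
  qed
  finally show ?thesis .
 qed
 then show ?thesis by blast
qed

lemma cdot_scaleR:
 "cdot (s *\<^sub>R v) w = of_real s * cdot v w" "cdot v (s *\<^sub>R w) = of_real s * cdot v w"
 unfolding bounded_bilinear.scaleR_left[OF bounded_bilinear_cdot] bounded_bilinear.scaleR_right[OF bounded_bilinear_cdot]
 by (simp_all add: scaleR_conv_of_real)

lemma cdot_basic:
 "cdot (a *s v) w = cnj a * cdot v w" "cdot v (a *s w) = a * cdot v w"
 "cdot (v + v') w = cdot v w + cdot v' w" "cdot v (w + w') = cdot v w + cdot v w'"
 "cdot 0 w = 0" "cdot v 0 = 0" "cnj (cdot v w) = cdot w v"
 by (simp_all add: cdot_def sum_distrib_left sum.distrib algebra_simps)

lemmas cdot_simps = cdot_scaleR cdot_basic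

text \<open>For two packets of the same frequency t ksi0 the exponentials cancel, and the two
  pairings differ by t times an integral of h^2 \<open>g\<close> up to a bounded error, where
  \<open>g\<close> measures the failure of symmetry. If \<open>g x0\<close> were not 0, the packets
  could be supported where the real part \<open>r\<close> of the product of cnj(\<open>g x0\<close>)
  with \<open>g\<close> is positive, and large t gives a contradiction. The pairing is computed with
  an unknown cover cut into disjoint pieces, so the support is moved into one piece; it then need
  not contain \<open>x0\<close>.\<close>

lemma principal_symbol_hermitian:
 fixes A :: "('p::t2_space, 'n::finite, 'm::finite) column => ('p, 'n, 'm) column"
 assumes comp: "compact (UNIV :: 'p set)" and atl: "smooth_structure atl" and A: "classical_psido atl A"
  and sa: "formally_self_adjoint atl A" and kap: "kap \<in> atl" and x0: "x0 \<in> coords kap" and ksi0: "ksi0 \<noteq> 0"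
 shows "hconj (principal_symbol atl A kap x0 ksi0) = principal_symbol atl A kap x0 ksi0"
proof -
 let ?A1 = "principal_symbol atl A kap"
 note chart = smooth_structure_chart[OF atl]
 have U: "open (coords kap)" by (rule chart_open[OF chart[OF kap]])
 have key: "cdot d (?A1 x0 ksi0 *v c) - cdot (?A1 x0 ksi0 *v d) c = 0" for c d :: "complex^'m"
 proof (rule ccontr)
  define g where "g x = cdot d (?A1 x ksi0 *v c) - cdot (?A1 x ksi0 *v d) c" for x
  define r where "r x = Re (cnj (g x0) * g x)" for x
  assume "cdot d (?A1 x0 ksi0 *v c) - cdot (?A1 x0 ksi0 *v d) c \<noteq> 0"
  then have g0: "g x0 \<noteq> 0" by (simp add: g_def)
  have rx0: "r x0 > 0"
  proof -
   have "cnj (g x0) * g x0 = of_real ((norm (g x0))\<^sup>2)" by (metis complex_norm_square mult.commute)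
   then show ?thesis using g0 by (simp add: r_def)
  qed
  have Bs: "smooth_on (coords kap) (%x. ?A1 x ksi0)"
  proof -
   have W: "open (coords kap \<times> - {0 :: real^'n})" using U by (intro open_Times) auto
   show ?thesis
    using smooth_on_compose[OF U W smooth_on_Pair[OF U smooth_on_id[OF U] smooth_on_const[OF U, of ksi0]] principal_symbol_smooth[OF A kap]] ksi0
    by simp
  qed
  have vs: "smooth_on (coords kap) (%x. ?A1 x ksi0 *v e)" for e
   by (rule smooth_on_bilinear[OF bounded_bilinear_matrix_vector U Bs smooth_on_const[OF U]])
  have rs: "smooth_on (coords kap) r"
   unfolding r_def g_def
   by (intro smooth_on_bounded_linear[OF bounded_linear_Re] smooth_on_mult smooth_on_diff smooth_on_const U
     smooth_on_bilinear[OF bounded_bilinear_cdot] vs)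
  define U0 where "U0 = coords kap \<inter> r -` {0<..}"
  have U0: "open U0" "U0 \<subseteq> coords kap" "x0 \<in> U0"
   unfolding U0_def using continuous_open_preimage[OF smooth_on_continuous[OF rs] U open_greaterThan] rx0 x0 by auto
  define P0 where "P0 = point kap ` U0"
  have P0: "open P0" "P0 \<noteq> {}" "P0 \<subseteq> fst kap"
   unfolding P0_def using open_point_image[OF chart[OF kap] U0(1,2)] U0 point_in[OF chart[OF kap]] by auto
  define cs where "cs = (SOME cs. set cs \<subseteq> atl \<and> (\<Union>kap\<in>set cs. fst kap) = (UNIV :: 'p set))"
  have "\<exists>cs. set cs \<subseteq> atl \<and> (\<Union>kap\<in>set cs. fst kap) = (UNIV :: 'p set)"
  proof -
   have "UNIV \<subseteq> (\<Union>kap\<in>atl. fst kap)" using atl by (simp add: smooth_structure_def)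
   then obtain F where F: "F \<subseteq> atl" "finite F" "UNIV \<subseteq> (\<Union>kap\<in>F. fst kap)"
    using compactE_image[OF comp, of atl fst] chart_open_domain[OF chart] by metis
   obtain l where "set l = F" using finite_list[OF F(2)] by blast
   then show ?thesis using F by blast
  qed
  then have cs: "set cs \<subseteq> atl" "(\<Union>kap\<in>set cs. fst kap) = (UNIV :: 'p set)"
   unfolding cs_def by (metis (mono_tags, lifting) someI_ex)+
  \<comment> \<open>The first chart domain in the cover that meets \<open>P0\<close>. On its
    intersection \<open>V\<close> with \<open>P0\<close> no earlier domain cuts anything away, so
    \<open>V\<close> lies within one piece of the partition.\<close>
  define i where "i = (LEAST i. i < length cs \<and> fst (cs ! i) \<inter> P0 \<noteq> {})"
  have "\<exists>i. i < length cs \<and> fst (cs ! i) \<inter> P0 \<noteq> {}"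
  proof -
   obtain q where q: "q \<in> P0" using P0 by blast
   then obtain kap' where "kap' \<in> set cs" "q \<in> fst kap'" using cs(2) by blast
   then show ?thesis using q by (metis IntI in_set_conv_nth empty_iff)
  qed
  then have i: "i < length cs" "fst (cs ! i) \<inter> P0 \<noteq> {}" unfolding i_def by (metis (mono_tags, lifting) LeastI_ex)+
  have less: "fst (cs ! j) \<inter> P0 = {}" if "j < i" for j
   using not_less_Least[of j "%i. i < length cs \<and> fst (cs ! i) \<inter> P0 \<noteq> {}"] that i(1) by (auto simp: i_def[symmetric])
  define k where "k = cs ! i"
  have k: "k \<in> atl" using cs(1) i(1) by (auto simp: k_def)
  define V where "V = fst k \<inter> P0"
  have V: "open V" "V \<subseteq> fst kap" "V \<subseteq> fst k"
   using chart_open_domain[OF chart[OF k]] P0 by (auto simp: V_def)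
  obtain p1 where p1: "p1 \<in> V" using i(2) by (auto simp: V_def k_def)
  define Y where "Y = snd kap ` V"
  have Y: "open Y" "Y \<subseteq> U0"
   unfolding Y_def using open_chart_image[OF chart[OF kap] V(1,2)] coord_point[OF chart[OF kap]] U0(2) by (auto simp: V_def P0_def)
  define x1 where "x1 = snd kap p1"
  have x1: "x1 \<in> Y" using p1 by (simp add: x1_def Y_def)
  have "compact {x1}" "{x1} \<subseteq> Y" using x1 by auto
  then obtain h :: "real^'n => real" and V' where hY: "test_function Y h" and h01: "!!x. 0 \<le> h x" "!!x. h x \<le> 1"
   and hV: "{x1} \<subseteq> V'" "!!x. x \<in> V' ==> h x = 1" using plateau_exists[OF _ Y(1)] by metis
  have hx1: "h x1 = 1" using hV by auto
  have h: "test_function (coords kap) h" using test_function_mono[OF hY] Y U0 by auto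
  have hs: "compact (supp h)" "supp h \<subseteq> Y" using hY by (auto simp: test_function_def)
  define u where "u t = from_chart atl kap (wave (t *\<^sub>R ksi0) h c)" for t
  define w where "w t = from_chart atl kap (wave (t *\<^sub>R ksi0) h d)" for t
  have su: "smooth_half_density atl (u t)" and sw: "smooth_half_density atl (w t)" for t
   unfolding u_def w_def by (intro from_chart_smooth[OF atl kap] test_function_wave[OF h])+
  have sAu: "smooth_half_density atl (A (u t))" and sAw: "smooth_half_density atl (A (w t))" for t
   using A su sw by (auto simp: classical_psido_def)
  define Kp where "Kp = point kap ` supp h"
  have KpV: "Kp \<subseteq> V"
  proof
   fix q assume "q \<in> Kp"
   then obtain x where x: "x \<in> supp h" "q = point kap x" by (auto simp: Kp_def)
   then obtain q' where "q' \<in> V" "x = snd kap q'" using hs(2) by (auto simp: Y_def)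
   then show "q \<in> V" using V(2) x point_coord[OF chart[OF kap]] by auto
  qed
  have Kpc: "compact Kp"
   unfolding Kp_def using hs Y U0 by (intro compact_continuous_image continuous_on_subset[OF point_continuous[OF chart[OF kap]]]) auto
  have z: "from_chart atl kap (wave eta h e) kap' q = 0" if "q \<notin> Kp" for eta e kap' q
  proof (cases "q \<in> fst kap")
   case True
   then have "snd kap q \<notin> supp h" using that point_coord[OF chart[OF kap] True] by (force simp: Kp_def)
   then show ?thesis by (auto simp: from_chart_def zero_outside_supp vec_eq_iff)
  qed (auto simp: from_chart_def)
  define K where "K = snd k ` Kp"
  have K: "compact K" "K \<subseteq> overlap kap k" "K \<subseteq> coords k"
   unfolding K_def using Kpc KpV V coord_in[of _ k]
   by (auto intro!: compact_continuous_image continuous_on_subset[OF chart_continuous[OF chart[OF k]]])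
  have notK: "point k y \<notin> Kp" if "y \<in> coords k" "y \<notin> K" for y
   using that coord_point[OF chart[OF k] that(1)] by (force simp: K_def)
  \<comment> \<open>For an integrand that vanishes off \<open>Kp\<close> every piece except that of
    the chart \<open>k\<close> contributes 0, so the integral is an ordinary one in the coordinates
    of \<open>k\<close>.\<close>
  have dens: "integral_density atl f = (\<integral>y. (if y \<in> coords k then f k (point k y) else 0) \<partial>lborel)"
   if f: "!!kap' q. q \<notin> Kp ==> f kap' q = 0" for f
  proof -
   define D where "D j = fst (cs ! j) - (\<Union>l<j. fst (cs ! l))" for j
   have VD: "V \<subseteq> D i" using less by (auto simp: D_def V_def k_def)
   have "(LINT y : snd (cs ! j) ` D j | lborel. f (cs ! j) (point (cs ! j) y)) =
     (if j = i then \<integral>y. (if y \<in> coords k then f k (point k y) else 0) \<partial>lborel else 0)" if j: "j < length cs" for j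
   proof (cases "j = i")
    case True
    have "indicator (snd k ` D i) y *\<^sub>R f k (point k y) = (if y \<in> coords k then f k (point k y) else 0)" for y
    proof (cases "y \<in> snd k ` D i")
     case True
     then show ?thesis using coord_in[of _ k] by (auto simp: D_def k_def)
    next
     case False
     have "f k (point k y) = 0" if "y \<in> coords k"
     proof (rule f)
      show "point k y \<notin> Kp" using False KpV VD coord_point[OF chart[OF k] that] by force
     qed
     then show ?thesis using False by auto
    qed
    then show ?thesis using True by (simp add: set_lebesgue_integral_def k_def)
   next
    case False
    have z0: "indicator (snd (cs ! j) ` D j) y *\<^sub>R f (cs ! j) (point (cs ! j) y) = 0" for y
    proof (cases "y \<in> snd (cs ! j) ` D j")
     case True
     then obtain q where q: "q \<in> D j" "y = snd (cs ! j) q" by blast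
     have "cs ! j \<in> atl" using cs(1) j by auto
     then have pq: "point (cs ! j) y = q" using q point_coord[OF chart] by (auto simp: D_def)
     have "q \<notin> V" using q(1) less[of j] False by (cases "j < i") (auto simp: D_def V_def k_def)
     then have "f (cs ! j) q = 0" using KpV by (intro f) blast
     then show ?thesis by (simp add: pq)
    qed auto
    show ?thesis unfolding set_lebesgue_integral_def z0 using False by simp
   qed
   then show ?thesis
    using i(1) by (simp add: integral_density_def Let_def cs_def[symmetric] D_def[symmetric])
  qed
  define f1 where "f1 t = (%kap' p. cdot (w t kap' p) (A (u t) kap' p))" for t
  define f2 where "f2 t = (%kap' p. cdot (A (w t) kap' p) (u t kap' p))" for t
  have fz: "f1 t kap' q = 0" "f2 t kap' q = 0" if "q \<notin> Kp" for t kap' q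
  proof -
   have "u t kap' q = 0" "w t kap' q = 0" unfolding u_def w_def by (rule z[OF that])+
   then show "f1 t kap' q = 0" "f2 t kap' q = 0" by (simp_all add: f1_def f2_def cdot_simps)
  qed
  define H1 where "H1 t = (%y. if y \<in> coords k then f1 t k (point k y) else 0)" for t
  define H2 where "H2 t = (%y. if y \<in> coords k then f2 t k (point k y) else 0)" for t
  have Ck: "open (coords k)" by (rule chart_open[OF chart[OF k]])
  have Hint: "integrable lborel (H1 t)" "integrable lborel (H2 t)" for t
  proof -
   have s: "smooth_on (coords k) (%y. v k (point k y))" if "smooth_half_density atl v" for v :: "('p, 'n, 'm) column"
    using that k by (auto simp: smooth_half_density_def o_def)
   have "smooth_on (coords k) (%y. f1 t k (point k y))" "smooth_on (coords k) (%y. f2 t k (point k y))"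
    unfolding f1_def f2_def by (intro smooth_on_bilinear[OF bounded_bilinear_cdot Ck] s sw sAu su sAw)+
   note sf = this
   have fz': "f1 t k (point k y) = 0" "f2 t k (point k y) = 0" if "y \<in> coords k" "y \<notin> K" for y
    using fz[OF notK[OF that]] by auto
   have S1: "smooth_on UNIV (H1 t)" unfolding H1_def
    by (rule smooth_on_extend_zero[OF Ck sf(1) compact_imp_closed[OF K(1)] K(3) fz'(1)])
   have S2: "smooth_on UNIV (H2 t)" unfolding H2_def
    by (rule smooth_on_extend_zero[OF Ck sf(2) compact_imp_closed[OF K(1)] K(3) fz'(2)])
   have "H1 t y = 0" "H2 t y = 0" if "y \<notin> K" for y using fz'[OF _ that] by (simp_all add: H1_def H2_def)
   then show "integrable lborel (H1 t)" "integrable lborel (H2 t)"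
    using integrable_compact_support[OF smooth_on_continuous[OF S1] K(1)] integrable_compact_support[OF smooth_on_continuous[OF S2] K(1)] by blast+
  qed
  have "integral_density atl (f1 t) = integral_density atl (f2 t)" for t
   using sa su sw unfolding formally_self_adjoint_def f1_def f2_def by blast
  then have H0: "(\<integral>y. H1 t y - H2 t y \<partial>lborel) = 0" for t
   using dens[of "f1 t"] dens[of "f2 t"] fz Hint by (simp add: H1_def[symmetric] H2_def[symmetric])
  obtain C1 where C1: "!!eta x. 1 \<le> norm eta ==> x \<in> supp h ==>
   norm (A (from_chart atl kap (wave eta h c)) kap (point kap x) - cis (x \<bullet> eta) *s (complex_of_real (h x) *s (?A1 x eta *v c))) \<le> C1"
   using wave_asymptotics[OF atl A kap h h01] by blast
  obtain C2 where C2: "!!eta x. 1 \<le> norm eta ==> x \<in> supp h ==>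
   norm (A (from_chart atl kap (wave eta h d)) kap (point kap x) - cis (x \<bullet> eta) *s (complex_of_real (h x) *s (?A1 x eta *v d))) \<le> C2"
   using wave_asymptotics[OF atl A kap h h01] by blast
  obtain Kc where Kc: "Kc > 0" "!!v w :: complex^'m. norm (cdot v w) \<le> norm v * norm w * Kc"
   using bounded_bilinear.pos_bounded[OF bounded_bilinear_cdot] by blast
  define C0 where "C0 = norm d * C1 * Kc + C2 * norm c * Kc"
  \<comment> \<open>The pairing is computed in \<open>kap\<close>, where the packets are explicit;
    the half-density rule transports the result to \<open>k\<close> later.\<close>
  have F: "norm (f1 t kap (point kap x) - f2 t kap (point kap x) - of_real (t * (h x)\<^sup>2) * g x) \<le> C0"
   if t: "t > 0" "1 \<le> norm (t *\<^sub>R ksi0)" and x: "x \<in> supp h" for t x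
  proof -
   let ?e = "cis (x \<bullet> (t *\<^sub>R ksi0))"
   have xc: "x \<in> coords kap" using x hs Y U0 by auto
   have A1t: "?A1 x (t *\<^sub>R ksi0) *v v = t *\<^sub>R (?A1 x ksi0 *v v)" for v
    unfolding principal_symbol_homogeneous[OF A kap xc ksi0 t(1)] using bounded_bilinear.scaleR_left[OF bounded_bilinear_matrix_vector] .
   have val: "from_chart atl kap (wave (t *\<^sub>R ksi0) h v) kap (point kap x) = ?e *s (complex_of_real (h x) *s v)" for v
    using kap point_in[OF chart[OF kap] xc] by (simp add: from_chart_def jac_self[OF chart[OF kap]] coord_point[OF chart[OF kap] xc])
   have nv: "norm (?e *s (complex_of_real (h x) *s v)) \<le> norm v" for v :: "complex^'m"
   proof -
    have "norm (a *s v) = norm a * norm v" for a :: complex and v :: "complex^'m"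
     by (simp add: norm_vec_def L2_set_def norm_mult power_mult_distrib sum_distrib_left[symmetric] real_sqrt_mult)
    then show ?thesis using h01[of x] by (simp add: norm_mult mult_left_le_one_le)
   qed
   have ee: "cnj ?e * ?e = 1" by (simp add: cis_cnj cis_mult)
   have ee': "cis (t * (x \<bullet> ksi0)) * cnj (cis (t * (x \<bullet> ksi0))) = 1" by (simp add: cis_cnj cis_mult)
   define e1 where "e1 = A (u t) kap (point kap x) - ?e *s (complex_of_real (h x) *s (t *\<^sub>R (?A1 x ksi0 *v c)))"
   define e2 where "e2 = A (w t) kap (point kap x) - ?e *s (complex_of_real (h x) *s (t *\<^sub>R (?A1 x ksi0 *v d)))"
   have e1: "norm e1 \<le> C1" and e2: "norm e2 \<le> C2"
    using C1[OF t(2) x] C2[OF t(2) x] by (simp_all add: e1_def e2_def u_def w_def A1t)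
   have Au: "A (u t) kap (point kap x) = ?e *s (complex_of_real (h x) *s (t *\<^sub>R (?A1 x ksi0 *v c))) + e1"
    and Aw: "A (w t) kap (point kap x) = ?e *s (complex_of_real (h x) *s (t *\<^sub>R (?A1 x ksi0 *v d))) + e2"
    by (simp_all add: e1_def e2_def)
   have cc: "cnj ?e * (hh * (?e * X)) = hh * X" for hh X using ee by (metis mult.assoc mult.left_commute mult_1)
   have cc': "cis (t * (x \<bullet> ksi0)) * (X * (Y * (cnj (cis (t * (x \<bullet> ksi0))) * Z))) = X * (Y * Z)" for X Y Z
    using ee' by (metis mult.assoc mult.left_commute mult_1)
   have "f1 t kap (point kap x) = of_real (t * (h x)\<^sup>2) * cdot d (?A1 x ksi0 *v c) + cdot (?e *s (complex_of_real (h x) *s d)) e1"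
    unfolding f1_def Au w_def val cdot_simps by (simp add: cc ee' power2_eq_square mult_ac)
   moreover have "f2 t kap (point kap x) = of_real (t * (h x)\<^sup>2) * cdot (?A1 x ksi0 *v d) c + cdot e2 (?e *s (complex_of_real (h x) *s c))"
    unfolding f2_def Aw u_def val cdot_simps using ee' by (simp add: power2_eq_square algebra_simps)
   ultimately have "f1 t kap (point kap x) - f2 t kap (point kap x) - of_real (t * (h x)\<^sup>2) * g x =
     cdot (?e *s (complex_of_real (h x) *s d)) e1 - cdot e2 (?e *s (complex_of_real (h x) *s c))"
    by (simp add: g_def right_diff_distrib)
   also have "norm ... \<le> norm d * C1 * Kc + C2 * norm c * Kc"
   proof (rule order_trans[OF norm_triangle_ineq4 add_mono])
    show "norm (cdot (?e *s (complex_of_real (h x) *s d)) e1) \<le> norm d * C1 * Kc"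
     by (rule order_trans[OF Kc(2)]) (intro mult_right_mono mult_mono nv e1, use Kc(1) in auto)
    show "norm (cdot e2 (?e *s (complex_of_real (h x) *s c))) \<le> C2 * norm c * Kc"
     by (rule order_trans[OF Kc(2)]) (intro mult_right_mono mult_mono nv e2 order_trans[OF norm_ge_zero e2], use Kc(1) in auto)
   qed
   finally show ?thesis by (simp add: C0_def)
  qed
  let ?O = "overlap kap k"
  define J where "J y = jac kap k (point k y)" for y
  have O: "open ?O" by (rule open_overlap[OF chart[OF kap] chart[OF k]])
  have Js: "smooth_on ?O J" unfolding J_def by (rule jac_smooth(1)[OF atl kap k])
  \<comment> \<open>The leading term in the coordinates of \<open>k\<close>. Each of the two
    half-densities in a pairing contributes a factor sqrt(J), hence \<open>J\<close>.\<close>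
  define G where "G = (%y. if y \<in> ?O then J y * ((h (transition kap k y))\<^sup>2 * r (transition kap k y)) else 0)"
  have tr: "transition kap k y \<in> coords kap" "transition kap k y = snd kap (point k y)" if "y \<in> ?O" for y
   using that by (auto simp: transition_def point_coord[OF chart[OF k]] coords_def)
  have htr: "h (transition kap k y) = 0" if "y \<in> ?O" "y \<notin> K" for y
  proof -
   have "point k y \<in> fst kap" using that by (auto simp: point_coord[OF chart[OF k]])
   moreover have "point k y \<notin> Kp" by (rule notK) (use that coord_in[of _ k] in auto)
   ultimately have "snd kap (point k y) \<notin> supp h" using point_coord[OF chart[OF kap]] by (force simp: Kp_def)
   then show ?thesis using tr[OF that(1)] zero_outside_supp by simp
  qed
  have ts: "smooth_on ?O (transition kap k)" by (rule transition_smooth[OF atl kap k])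
  have hts: "smooth_on ?O (%y. h (transition kap k y))"
   by (rule smooth_on_compose[OF O open_UNIV ts test_function_smooth[OF h]]) auto
  have "smooth_on ?O (%y. J y * ((h (transition kap k y))\<^sup>2 * r (transition kap k y)))"
   unfolding power2_eq_square by (intro smooth_on_mult O Js hts smooth_on_compose[OF O U ts rs] tr)
  then have Gs: "smooth_on UNIV G"
   unfolding G_def using htr K by (intro smooth_on_extend_zero[OF O _ compact_imp_closed[OF K(1)]]) auto
  have Gz: "G y = 0" if "y \<notin> K" for y using htr that by (auto simp: G_def)
  have Gint: "integrable lborel G" by (rule integrable_compact_support[OF smooth_on_continuous[OF Gs] K(1) Gz])
  have Kx: "point k y \<in> V" "transition kap k y \<in> supp h" "point kap (transition kap k y) = point k y" "y \<in> ?O" "y \<in> coords k" if y: "y \<in> K" for y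
  proof -
   obtain x where x: "x \<in> supp h" "y = snd k (point kap x)" using y by (auto simp: K_def Kp_def)
   have xc: "x \<in> coords kap" using x hs Y U0 by auto
   have pV: "point kap x \<in> V" using KpV x by (auto simp: Kp_def)
   then have e: "point k y = point kap x" using x V point_coord[OF chart[OF k]] by auto
   show "point k y \<in> V" using pV e by simp
   show "y \<in> ?O" "y \<in> coords k" using y K by auto
   then show "transition kap k y \<in> supp h" "point kap (transition kap k y) = point k y"
    using tr(2)[of y] e x coord_point[OF chart[OF kap] xc] by auto
  qed
  have Jpos: "J y > 0" if "y \<in> K" for y
   using jac_pos[OF atl kap k] Kx(1)[OF that] V by (auto simp: J_def)
  have rpos: "r (transition kap k y) > 0" if "y \<in> K" for y
   using Kx(2)[OF that] hs Y by (auto simp: U0_def)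
  have G0: "G y \<ge> 0" for y
   using Jpos[of y] rpos[of y] Gz[of y] by (cases "y \<in> K") (auto simp: G_def)
  obtain Jm where Jm: "!!y. y \<in> K ==> J y \<le> Jm"
  proof -
   have "bounded (J ` K)"
    by (rule compact_imp_bounded[OF compact_continuous_image[OF continuous_on_subset[OF smooth_on_continuous[OF Js] K(2)] K(1)]])
   then obtain B where "\<forall>z\<in>J ` K. norm z \<le> B" unfolding bounded_iff by blast
   then show thesis using that[of B] by force
  qed
  have Ky: "K \<in> sets lborel" "emeasure lborel K < \<infinity>"
   using compact_imp_closed[OF K(1)] emeasure_bounded_finite[OF compact_imp_bounded[OF K(1)]] by auto
  \<comment> \<open>The error bound integrated over \<open>K\<close>: \<open>C0\<close> comes from
    the packets, \<open>Jm\<close> bounds the Jacobian, and nothing depends on the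
    frequency.\<close>
  define C3 where "C3 = norm (g x0) * C0 * Jm * measure lborel K"
  have main: "t * (\<integral>y. G y \<partial>lborel) \<le> C3" if t: "t \<ge> 1 / norm ksi0" for t
  proof -
   have tpos: "t > 0" using t ksi0 by (meson less_le_trans zero_less_divide_1_iff zero_less_norm_iff)
   have t1: "1 \<le> norm (t *\<^sub>R ksi0)" using t ksi0 tpos by (simp add: divide_le_eq)
   have le: "t * G y - (norm (g x0) * C0 * Jm) * indicator K y \<le> Re (cnj (g x0) * (H1 t y - H2 t y))" for y
   proof (cases "y \<in> K")
    case False
    then have "H1 t y = 0" "H2 t y = 0" using fz notK by (auto simp: H1_def H2_def)
    then show ?thesis using False Gz by simp
   next
    case True
    note y = Kx[OF True]
    let ?p = "point k y" and ?x = "transition kap k y"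
    have pp: "?p \<in> fst kap \<inter> fst k" using y(1) V by auto
    have hd: "v k ?p = sqrt (J y) *\<^sub>R v kap ?p" if "smooth_half_density atl v" for v :: "('p, 'n, 'm) column"
     using that pp kap k unfolding smooth_half_density_def half_density_def J_def by blast
    have JJ: "of_real (sqrt (J y)) * (of_real (sqrt (J y)) * X) = of_real (J y) * X" for X :: complex
     using Jpos[OF True] by (simp add: mult.assoc[symmetric] of_real_mult[symmetric] del: of_real_mult)
    have "H1 t y = of_real (J y) * f1 t kap ?p" "H2 t y = of_real (J y) * f2 t kap ?p"
     using y(5) hd[OF sw] hd[OF sAu] hd[OF su] hd[OF sAw] by (simp_all add: H1_def H2_def f1_def f2_def cdot_simps JJ)
    then have "H1 t y - H2 t y = of_real (J y) * (f1 t kap ?p - f2 t kap ?p)" by (simp add: right_diff_distrib)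
    have reJ: "Re (of_real q * Z) = q * Re Z" for q Z by simp
    from \<open>H1 t y - H2 t y = _\<close> have R: "Re (cnj (g x0) * (H1 t y - H2 t y)) = J y * Re (cnj (g x0) * (f1 t kap ?p - f2 t kap ?p))"
     by (simp only: mult.left_commute[of "cnj (g x0)"] reJ)
    let ?E = "f1 t kap ?p - f2 t kap ?p - of_real (t * (h ?x)\<^sup>2) * g ?x"
    have nE: "norm ?E \<le> C0" using F[OF tpos t1 y(2)] by (simp add: y(3))
    have "f1 t kap ?p - f2 t kap ?p = of_real (t * (h ?x)\<^sup>2) * g ?x + ?E" by simp
    then have "Re (cnj (g x0) * (f1 t kap ?p - f2 t kap ?p)) = t * ((h ?x)\<^sup>2 * r ?x) + Re (cnj (g x0) * ?E)"
     by (simp only: ring_distribs mult.left_commute[of "cnj (g x0)"] plus_complex.simps reJ) (simp add: r_def)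
    moreover have "- (norm (g x0) * C0) \<le> Re (cnj (g x0) * ?E)"
    proof -
     have "\<bar>Re (cnj (g x0) * ?E)\<bar> \<le> norm (g x0) * norm ?E" using abs_Re_le_cmod[of "cnj (g x0) * ?E"] by (simp add: norm_mult)
     also have "... \<le> norm (g x0) * C0" by (intro mult_left_mono nE) auto
     finally show ?thesis by linarith
    qed
    ultimately have "t * ((h ?x)\<^sup>2 * r ?x) - norm (g x0) * C0 \<le> Re (cnj (g x0) * (f1 t kap ?p - f2 t kap ?p))" by linarith
    from mult_left_mono[OF this less_imp_le[OF Jpos[OF True]]]
    have "t * G y - J y * (norm (g x0) * C0) \<le> Re (cnj (g x0) * (H1 t y - H2 t y))"
     unfolding R using y(4) by (simp add: G_def algebra_simps)
    moreover have "J y * (norm (g x0) * C0) \<le> Jm * (norm (g x0) * C0)"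
     by (intro mult_right_mono Jm True mult_nonneg_nonneg order_trans[OF norm_ge_zero nE]) auto
    ultimately show ?thesis using True by (simp add: mult_ac)
   qed
   have i1: "integrable lborel (%y. t * G y - (norm (g x0) * C0 * Jm) * indicator K y)"
    using Gint Ky by (intro Bochner_Integration.integrable_diff integrable_mult_right integrable_real_indicator) auto
   have i2: "integrable lborel (%y. cnj (g x0) * (H1 t y - H2 t y))"
    using Hint by (intro integrable_mult_right Bochner_Integration.integrable_diff)
   have "(\<integral>y. t * G y - (norm (g x0) * C0 * Jm) * indicator K y \<partial>lborel) \<le> (\<integral>y. Re (cnj (g x0) * (H1 t y - H2 t y)) \<partial>lborel)"
    by (rule Bochner_Integration.integral_mono[OF i1 integrable_bounded_linear[OF bounded_linear_Re i2]]) (rule le)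
   also have "... = Re (\<integral>y. cnj (g x0) * (H1 t y - H2 t y) \<partial>lborel)"
    by (rule integral_bounded_linear[OF bounded_linear_Re i2])
   also have "... = 0" by (simp only: integral_mult_right_zero H0) simp
   also have "(\<integral>y. t * G y - (norm (g x0) * C0 * Jm) * indicator K y \<partial>lborel) = t * (\<integral>y. G y \<partial>lborel) - C3"
    using Gint Ky by (subst Bochner_Integration.integral_diff) (auto simp: C3_def intro!: integrable_mult_right integrable_real_indicator)
   finally show ?thesis by simp
  qed
  have I0: "(\<integral>y. G y \<partial>lborel) = 0"
  proof (rule ccontr)
   assume "(\<integral>y. G y \<partial>lborel) \<noteq> 0"
   then have I: "(\<integral>y. G y \<partial>lborel) > 0" using G0 by (simp add: less_le)
   define t where "t = max (1 / norm ksi0) ((C3 + 1) / (\<integral>y. G y \<partial>lborel))"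
   have "C3 + 1 \<le> t * (\<integral>y. G y \<partial>lborel)" using I by (simp add: t_def pos_divide_le_eq[symmetric])
   moreover have "t * (\<integral>y. G y \<partial>lborel) \<le> C3" by (rule main) (simp add: t_def)
   ultimately show False by simp
  qed
  \<comment> \<open>A continuous function that vanishes almost everywhere cannot be nonzero on a
    nonempty open set, but \<open>G\<close> is positive at the image of \<open>p1\<close>, where
    \<open>h\<close> takes the value 1.\<close>
  have "AE y in lborel. G y = 0" using integral_nonneg_eq_0_iff_AE[OF Gint] G0 I0 by simp
  then have "AE y in lebesgue. G y = 0" by (rule AE_completion)
  then obtain N where N: "negligible N" "{y. G y \<noteq> 0} \<subseteq> N"
   unfolding eventually_ae_filter_negligible by blast
  have "negligible {y. G y \<noteq> 0}" by (rule negligible_subset[OF N])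
  moreover have "open {y. G y \<noteq> 0}"
   by (rule open_Collect_neq[OF smooth_on_continuous[OF Gs] continuous_on_const])
  moreover have "snd k p1 \<in> {y. G y \<noteq> 0}"
  proof -
   have p: "p1 \<in> fst kap" "p1 \<in> fst k" using p1 V by auto
   then have O1: "snd k p1 \<in> ?O" by auto
   have tx: "transition kap k (snd k p1) = x1" using p by (simp add: x1_def transition_coord[OF chart[OF k]])
   have "x1 \<in> supp h" using hx1 zero_outside_supp[of x1 h] by auto
   moreover have "point kap x1 = p1" using p by (simp add: x1_def point_coord[OF chart[OF kap]])
   ultimately have "snd k p1 \<in> K" by (auto simp: K_def Kp_def image_iff intro!: bexI[of _ x1])
   then show ?thesis using O1 Jpos rpos hx1 tx by (force simp: G_def)
  qed
  ultimately show False using open_not_negligible by blast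
 qed
 show ?thesis
 proof (simp only: vec_eq_iff, intro allI)
  fix i j
  let ?M = "?A1 x0 ksi0"
  have ax: "(?M *v axis j 1) $ i = ?M $ i $ j" for i j
   by (simp add: matrix_vector_mult_def axis_def if_distrib cong: if_cong)
  have "cdot (axis i 1) v = v $ i" "cdot v (axis i 1) = cnj (v $ i)" for v :: "complex^'m" and i
   by (simp_all add: cdot_def axis_def if_distrib if_distribR cong: if_cong)
  then show "hconj ?M $ i $ j = ?M $ i $ j" using key[of "axis i 1" "axis j 1"] by (simp add: ax hconj_def)
 qed
qed

subsection \<open>Spectral decomposition\<close>

lemma poly_det: "poly (det M) x = det (\<chi> i j. poly (M $ i $ j) x)"
 for M :: "complex poly^'m::finite^'m"
 by (simp add: det_def poly_sum poly_prod)

lemma matrix_diff_vector: "(B - C) *v v = B *v v - C *v v" for B C :: "complex^'m::finite^'m"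
 by (simp add: vec_eq_iff matrix_vector_mult_def left_diff_distrib sum_subtractf)

lemma mat_vector: "mat c *v v = c *s v" for v :: "complex^'m::finite"
proof -
 have "(if i = j then c else 0) * v $ j = (if j = i then c * v $ j else 0)" for i j by simp
 then show ?thesis by (simp add: vec_eq_iff matrix_vector_mult_def mat_def)
qed

lemma eigenvalue_iff_root: "is_eigenvalue B h \<longleftrightarrow> poly (charpoly B) h = 0"
proof -
 have "poly (charpoly B) h = det (mat h - B)"
  unfolding charpoly_def poly_det by (rule arg_cong[where f = det]) (auto simp: vec_eq_iff mat_def)
 moreover have "det (mat h - B) = 0 \<longleftrightarrow> (\<exists>v. v \<noteq> 0 \<and> (mat h - B) *v v = 0)"
  using invertible_det_nz[of "mat h - B"] invertible_left_inverse[of "mat h - B"] matrix_left_invertible_ker[of "mat h - B"] by metis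
 moreover have "(mat h - B) *v v = 0 \<longleftrightarrow> B *v v = h *s v" for v
  by (auto simp: matrix_diff_vector mat_vector)
 ultimately show ?thesis by (simp add: is_eigenvalue_def)
qed

text \<open>Only the identity permutation reaches degree \<open>CARD('m)\<close>, with a monic
  product; any other permutation meets an off-diagonal entry, which is constant.\<close>

lemma degree_charpoly: "degree (charpoly B) = CARD('m)" for B :: "complex^'m::finite^'m"
proof -
 let ?M = "(\<chi> i j. (if i = j then [:0, 1:] else 0) - [:B $ i $ j:]) :: complex poly^'m^'m"
 have e: "?M $ i $ i = [:- (B $ i $ i), 1:]" for i by simp
 have d1: "degree (?M $ i $ j) \<le> 1" for i j by simp
 have le: "degree (\<Prod>i\<in>UNIV. ?M $ i $ p i) \<le> CARD('m)" for p
  using degree_prod_sum_le[of UNIV "%i. ?M $ i $ p i"] sum_mono[of UNIV "%i. degree (?M $ i $ p i)" "%i. 1"] d1 by (simp add: o_def)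
 have lt: "degree (\<Prod>i\<in>UNIV. ?M $ i $ p i) < CARD('m)" if "p \<noteq> id" for p
 proof -
  obtain i where i: "p i \<noteq> i" using \<open>p \<noteq> id\<close> by (auto simp: fun_eq_iff)
  then have d0: "degree (?M $ i $ p i) = 0" by auto
  have "(\<Sum>i\<in>UNIV. degree (?M $ i $ p i)) < (\<Sum>i\<in>(UNIV :: 'm set). 1)"
   by (rule sum_strict_mono_ex1) (use d1 d0 i[symmetric] in \<open>auto intro!: exI[of _ i]\<close>)
  then show ?thesis using degree_prod_sum_le[of UNIV "%i. ?M $ i $ p i"] by (simp add: o_def)
 qed
 have sg: "degree (of_int (sign p) * q) \<le> degree q" "coeff (of_int (sign p) * q) n = of_int (sign p) * coeff q n" for p :: "'m => 'm" and q :: "complex poly" and n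
  by (auto simp: of_int_poly intro: degree_smult_le)
 have le': "degree (charpoly B) \<le> CARD('m)"
  unfolding charpoly_def det_def by (intro degree_sum_le order_trans[OF sg(1) le]) auto
 have "coeff (charpoly B) CARD('m) = (\<Sum>p\<in>{p. p permutes UNIV}. of_int (sign p) * coeff (\<Prod>i\<in>UNIV. ?M $ i $ p i) CARD('m))"
  unfolding charpoly_def det_def by (simp only: coeff_sum sg(2))
 also have "... = (\<Sum>p\<in>{p :: 'm => 'm. p permutes UNIV}. if p = id then 1 else 0)"
 proof (rule sum.cong[OF refl])
  fix p :: "'m => 'm"
  show "of_int (sign p) * coeff (\<Prod>i\<in>UNIV. ?M $ i $ p i) CARD('m) = (if p = id then 1 else 0 :: complex)"
  proof (cases "p = id")
   case True
   have "degree (\<Prod>i\<in>UNIV. ?M $ i $ i) = CARD('m)"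
    by (subst degree_prod_eq_sum_degree) (simp_all only: e, simp_all)
   moreover have "lead_coeff (\<Prod>i\<in>UNIV. ?M $ i $ i) = 1" by (simp only: lead_coeff_prod e) simp
   ultimately have "coeff (\<Prod>i\<in>UNIV. ?M $ i $ id i) CARD('m) = 1" by (simp only: id_apply)
   then show ?thesis unfolding True by (simp only: sign_id) simp
  next
   case False
   then show ?thesis using coeff_eq_0[OF lt[OF False]] by simp
  qed
 qed
 also have "... = 1" by (simp add: permutes_id)
 finally have "coeff (charpoly B) CARD('m) \<noteq> 0" by simp
 then show ?thesis using le' le_degree[of "charpoly B" "CARD('m)"] by simp
qed

text \<open>Over the complex numbers the characteristic polynomial splits, so its degree is the sum
  of the orders of its roots, and these are all 1.\<close>

lemma card_eigenvalues:
 fixes B :: "complex^'m::finite^'m"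
 assumes "simple_spectrum B"
 shows "finite {h. is_eigenvalue B h}" "card {h. is_eigenvalue B h} = CARD('m)"
proof -
 let ?p = "charpoly B"
 have p0: "?p \<noteq> 0" using degree_charpoly[of B] by auto
 have E: "{h. is_eigenvalue B h} = {z. poly ?p z = 0}" by (simp add: eigenvalue_iff_root)
 show f: "finite {h. is_eigenvalue B h}" unfolding E using poly_roots_finite[OF p0] .
 have "CARD('m) = degree (smult (lead_coeff ?p) (\<Prod>z|poly ?p z = 0. [:-z, 1:] ^ order z ?p))"
  by (rule trans[OF degree_charpoly[symmetric, of B] arg_cong[where f = degree, OF complex_poly_decompose[symmetric]]])
 also have "... = (\<Sum>z|poly ?p z = 0. degree ([:-z, 1:] ^ order z ?p))"
  using p0 by (simp add: degree_prod_eq_sum_degree)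
 also have "... = (\<Sum>z|poly ?p z = 0. 1)"
  using assms by (intro sum.cong) (auto simp: degree_linear_power simple_spectrum_def eigenvalue_iff_root)
 finally show "card {h. is_eigenvalue B h} = CARD('m)" by (simp add: E)
qed

lemma cdot_hermitian:
 assumes "hconj B = B" shows "cdot v (B *v w) = cdot (B *v v) w"
proof -
 have B: "cnj (B $ i $ j) = B $ j $ i" for i j using arg_cong[OF assms, of "%M. M $ j $ i"] by (simp add: hconj_def)
 have "cdot v (B *v w) = (\<Sum>i\<in>UNIV. \<Sum>j\<in>UNIV. cnj (v $ i) * (B $ i $ j * w $ j))"
  by (simp add: cdot_def matrix_vector_mult_def sum_distrib_left)
 also have "... = (\<Sum>j\<in>UNIV. \<Sum>i\<in>UNIV. cnj (v $ i) * (B $ i $ j * w $ j))" by (rule sum.swap)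
 also have "... = cdot (B *v v) w"
  by (simp add: cdot_def matrix_vector_mult_def sum_distrib_left sum_distrib_right B mult_ac)
 finally show ?thesis .
qed

lemma cdot_self: "cdot v v = of_real ((norm v)\<^sup>2)"
proof -
 have "cdot v v = (\<Sum>i\<in>UNIV. of_real ((norm (v $ i))\<^sup>2))"
  unfolding cdot_def by (intro sum.cong refl) (simp only: complex_norm_square, simp add: mult.commute)
 then show ?thesis by (simp add: norm_vec_def L2_set_def sum_nonneg)
qed

lemma hermitian_eigenvalue_real:
 assumes "hconj B = B" "B *v v = h *s v" "v \<noteq> 0"
 shows "h = of_real (Re h)"
proof -
 have "h * cdot v v = cnj h * cdot v v"
  using cdot_hermitian[OF assms(1), of v v] by (simp add: assms(2) cdot_basic)
 moreover have "cdot v v \<noteq> 0" using assms(3) by (simp add: cdot_self)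
 ultimately have "h = cnj h" by simp
 then show ?thesis by (metis Reals_cnj_iff of_real_Re)
qed

definition herm_simple :: "complex^'m::finite^'m => bool" where
 "herm_simple B \<longleftrightarrow> hconj B = B \<and> simple_spectrum B"

text \<open>The index type is \<open>'m\<close> itself, with no order on the eigenvalues: there are
  as many of them as rows, and the branches are followed individually before any numbering is
  introduced.\<close>

definition eigenbasis :: "complex^'m::finite^'m => ('m => real) => ('m => complex^'m) => bool" where
 "eigenbasis B s e \<longleftrightarrow> inj s \<and> (\<forall>k. B *v e k = of_real (s k) *s e k) \<and> (\<forall>k. norm (e k) = 1) \<and>
  (\<forall>h. is_eigenvalue B h \<longleftrightarrow> (\<exists>k. h = of_real (s k))) \<and>
  (\<forall>k l. k \<noteq> l --> cdot (e k) (e l) = 0) \<and> (\<forall>w. w = (\<Sum>k\<in>UNIV. cdot (e k) w *s e k))"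

lemma eigenbasisD:
 assumes "eigenbasis B s e"
 shows "inj s" "!!k. B *v e k = of_real (s k) *s e k" "!!k. norm (e k) = 1"
  "!!h. is_eigenvalue B h \<longleftrightarrow> (\<exists>k. h = of_real (s k))"
  "!!k l. k \<noteq> l ==> cdot (e k) (e l) = 0"
  "!!w. w = (\<Sum>k\<in>UNIV. cdot (e k) w *s e k)"
proof -
 note d = assms[unfolded eigenbasis_def]
 show "inj s" by (rule d[THEN conjunct1])
 note d = d[THEN conjunct2]
 show "B *v e k = of_real (s k) *s e k" for k by (rule d[THEN conjunct1, THEN spec])
 note d = d[THEN conjunct2]
 show "norm (e k) = 1" for k by (rule d[THEN conjunct1, THEN spec])
 note d = d[THEN conjunct2]
 show "is_eigenvalue B h \<longleftrightarrow> (\<exists>k. h = of_real (s k))" for h by (rule d[THEN conjunct1, THEN spec])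
 note d = d[THEN conjunct2]
 show "cdot (e k) (e l) = 0" if "k \<noteq> l" for k l using that d[THEN conjunct1] by blast
 show "w = (\<Sum>k\<in>UNIV. cdot (e k) w *s e k)" for w by (rule d[THEN conjunct2, THEN spec])
qed

text \<open>Simplicity replaces the usual induction on the dimension: it supplies
  \<open>CARD('m)\<close> distinct eigenvalues, and unit eigenvectors for distinct eigenvalues of a
  Hermitian matrix are orthogonal. Orthonormality says that the square matrix \<open>X\<close> of
  these columns has hconj(X) as left inverse; that this is also a right inverse is the completeness
  relation.\<close>

lemma spectral:
 fixes B :: "complex^'m::finite^'m"
 assumes B: "herm_simple B"
 shows "\<exists>s e. eigenbasis B s e"
proof -
 have H: "hconj B = B" and S: "simple_spectrum B" using B by (auto simp: herm_simple_def)
 let ?E = "{h. is_eigenvalue B h}"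
 obtain f where f: "bij_betw f (UNIV :: 'm set) ?E"
  using card_eigenvalues[OF S] by (metis bij_betw_iff_card finite_class.finite_UNIV)
 define s where "s k = Re (f k)" for k
 have fE: "is_eigenvalue B (f k)" for k using f by (auto simp: bij_betw_def)
 have fs: "f k = of_real (s k)" for k
 proof -
  obtain v where "v \<noteq> 0" "B *v v = f k *s v" using fE[of k] unfolding is_eigenvalue_def by blast
  then show ?thesis unfolding s_def by (intro hermitian_eigenvalue_real[OF H])
 qed
 have "inj f" using f by (simp add: bij_betw_def)
 then have inj: "inj s" by (auto simp: inj_def fs)
 have eig: "is_eigenvalue B h \<longleftrightarrow> (\<exists>k. h = of_real (s k))" for h
  using f by (auto simp: bij_betw_def fs)
 have "\<forall>k. \<exists>v. norm v = 1 \<and> B *v v = of_real (s k) *s v"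
 proof
  fix k
  obtain v where v: "v \<noteq> 0" "B *v v = of_real (s k) *s v" using fE[of k] by (auto simp: is_eigenvalue_def fs)
  let ?v = "inverse (norm v) *\<^sub>R v"
  have "B *v ?v = of_real (s k) *s ?v"
   unfolding bounded_bilinear.scaleR_right[OF bounded_bilinear_matrix_vector] v(2)
   by (simp add: vec_eq_iff)
  then show "\<exists>v. norm v = 1 \<and> B *v v = of_real (s k) *s v" using v(1) by (intro exI[of _ ?v]) simp
 qed
 then obtain e where e: "!!k. norm (e k) = 1" "!!k. B *v e k = of_real (s k) *s e k" by metis
 have orth: "cdot (e k) (e l) = 0" if "k \<noteq> l" for k l
 proof -
  have "of_real (s l) * cdot (e k) (e l) = of_real (s k) * cdot (e k) (e l)"
   using cdot_hermitian[OF H, of "e k" "e l"] by (simp add: e(2) cdot_basic)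
  moreover have "s l \<noteq> s k" using inj that by (auto simp: inj_def)
  ultimately show ?thesis by (simp add: mult_cancel_right)
 qed
 define X :: "complex^'m^'m" where "X = (\<chi> i k. e k $ i)"
 have "(hconj X ** X) $ k $ l = cdot (e k) (e l)" for k l
  by (simp add: X_def hconj_def matrix_matrix_mult_def cdot_def)
 then have "hconj X ** X = mat 1"
  using orth by (auto simp: vec_eq_iff mat_def cdot_self e(1))
 then have XX: "X ** hconj X = mat 1" using matrix_left_right_inverse by blast
 have exp: "w = (\<Sum>k\<in>UNIV. cdot (e k) w *s e k)" for w
 proof -
  have "w = X *v (hconj X *v w)" by (simp add: matrix_vector_mul_assoc XX)
  also have "... = (\<Sum>k\<in>UNIV. cdot (e k) w *s e k)"
   by (simp add: vec_eq_iff X_def hconj_def matrix_vector_mult_def cdot_def mult.commute)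
  finally show ?thesis .
 qed
 have "eigenbasis B s e" unfolding eigenbasis_def by (intro conjI allI impI inj e eig orth exp)
 then show ?thesis by blast
qed

lemma norm_expansion:
 fixes e :: "'m::finite => complex^'m"
 assumes "!!k. norm (e k) = 1" "!!k l. k \<noteq> l ==> cdot (e k) (e l) = 0"
 shows "(norm (\<Sum>k\<in>UNIV. c k *s e k))\<^sup>2 = (\<Sum>k\<in>UNIV. (norm (c k))\<^sup>2)"
proof -
 have sl: "cdot (\<Sum>k\<in>UNIV. f k) w = (\<Sum>k\<in>UNIV. cdot (f k) w)" "cdot w (\<Sum>k\<in>UNIV. f k) = (\<Sum>k\<in>UNIV. cdot w (f k))" for f :: "'m => complex^'m" and w
  using linear_sum[OF bounded_linear.linear[OF bounded_bilinear.bounded_linear_left[OF bounded_bilinear_cdot]], of f UNIV]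
   linear_sum[OF bounded_linear.linear[OF bounded_bilinear.bounded_linear_right[OF bounded_bilinear_cdot]], of w f UNIV] by auto
 have "cdot (\<Sum>k\<in>UNIV. c k *s e k) (\<Sum>k\<in>UNIV. c k *s e k) = (\<Sum>k\<in>UNIV. \<Sum>l\<in>UNIV. cnj (c k) * (c l * cdot (e k) (e l)))"
  by (simp only: sl cdot_basic sum_distrib_left, subst sum.swap, simp add: mult_ac)
 also have "... = (\<Sum>k\<in>UNIV. \<Sum>l\<in>UNIV. if l = k then of_real ((norm (c k))\<^sup>2) else 0)"
 proof (intro sum.cong refl)
  fix k l
  have "cnj (c k) * c k = of_real ((norm (c k))\<^sup>2)" by (metis complex_norm_square mult.commute)
  then show "cnj (c k) * (c l * cdot (e k) (e l)) = (if l = k then of_real ((norm (c k))\<^sup>2) else 0)"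
   using assms by (cases "l = k") (auto simp: cdot_self mult.assoc[symmetric])
 qed
 also have "... = of_real (\<Sum>k\<in>UNIV. (norm (c k))\<^sup>2)" by simp
 finally show ?thesis unfolding cdot_self by (simp only: of_real_eq_iff)
qed

text \<open>In an eigenbasis the residual has squared norm sum |c_k|^2 (s_k - \<mu>)^2, with the
  |c_k|^2 adding up to 1; were every eigenvalue at distance at least \<epsilon> from \<mu>, this
  would be at least \<epsilon>^2. Continuity of the eigenvalues rests on this.\<close>

lemma eigenvalue_near:
 fixes B :: "complex^'m::finite^'m"
 assumes B: "herm_simple B" and v: "norm v = 1" and \<epsilon>: "norm (B *v v - of_real \<mu> *s v) < \<epsilon>"
 shows "\<exists>h. is_eigenvalue B (of_real h) \<and> \<bar>h - \<mu>\<bar> < \<epsilon>"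
proof (rule ccontr)
 assume no: "\<not> ?thesis"
 obtain s e where "eigenbasis B s e" using spectral[OF B] by blast
 note s = eigenbasisD[OF this]
 have far: "\<epsilon> \<le> \<bar>s k - \<mu>\<bar>" for k using no s(4)[of "of_real (s k)"] by (auto simp: not_less)
 have \<epsilon>0: "0 \<le> \<epsilon>" using \<epsilon> norm_ge_zero by (meson less_le_trans less_imp_le order_trans)
 let ?c = "%k. cdot (e k) v"
 have "B *v v = (\<Sum>k\<in>UNIV. ?c k *s (B *v e k))"
  using arg_cong[OF s(6)[of v], of "%w. B *v w"]
   linear_sum[OF bounded_linear.linear[OF bounded_bilinear.bounded_linear_right[OF bounded_bilinear_matrix_vector]], of B "%k. ?c k *s e k" UNIV]
  by (simp add: matrix_vector_mult_def vec_eq_iff sum_distrib_left mult_ac)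
 then have "B *v v - of_real \<mu> *s v = (\<Sum>k\<in>UNIV. (?c k * of_real (s k - \<mu>)) *s e k)"
  using arg_cong[OF s(6)[of v], of "%w. of_real \<mu> *s w"]
  by (simp add: s(2) vec_eq_iff sum_distrib_left sum_subtractf[symmetric] algebra_simps)
 then have "(norm (B *v v - of_real \<mu> *s v))\<^sup>2 = (\<Sum>k\<in>UNIV. (norm (?c k) * \<bar>s k - \<mu>\<bar>)\<^sup>2)"
  by (simp add: norm_expansion[OF s(3,5)] norm_mult del: of_real_diff)
 also have "... \<ge> (\<Sum>k\<in>UNIV. (norm (?c k))\<^sup>2 * \<epsilon>\<^sup>2)"
  unfolding power_mult_distrib by (intro sum_mono mult_left_mono power_mono far \<epsilon>0) auto
 also have "(\<Sum>k\<in>UNIV. (norm (?c k))\<^sup>2 * \<epsilon>\<^sup>2) = \<epsilon>\<^sup>2"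
  using norm_expansion[where e = e and c = ?c, OF s(3,5)] s(6)[of v] v by (simp add: sum_distrib_right[symmetric])
 finally have "\<epsilon>\<^sup>2 \<le> (norm (B *v v - of_real \<mu> *s v))\<^sup>2" .
 then have "\<epsilon> \<le> norm (B *v v - of_real \<mu> *s v)" by (rule power2_le_imp_le) simp
 with \<epsilon> show False by simp
qed

subsection \<open>Smooth eigenvalue branches\<close>

text \<open>Where \<open>g\<close> vanishes, the term with a derivative of \<open>f\<close> drops
  out of the product rule, so continuity of \<open>f\<close> suffices. This permits differentiating
  an eigenvalue before its eigenvector is known to be differentiable.\<close>

lemma has_derivative_bilinear_vanishing:
 fixes f :: "'z::real_normed_vector => 'a::real_normed_vector"
 assumes pr: "bounded_bilinear pr" and f: "isCont f z" and g: "(g has_derivative g') (at z)" and g0: "g z = 0"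
 shows "((%y. pr (f y) (g y)) has_derivative (%v. pr (f z) (g' v))) (at z)"
proof -
 obtain K where K: "K > 0" "!!a b. norm (pr a b) \<le> norm a * norm b * K" using bounded_bilinear.pos_bounded[OF pr] by blast
 obtain L where L: "!!v. norm (g' v) \<le> norm v * L"
  using bounded_linear.bounded[OF has_derivative_bounded_linear[OF g]] by blast
 let ?q = "%y. norm (g y - g z - g' (y - z)) / norm (y - z)"
 have q: "(?q \<longlongrightarrow> 0) (at z)" using g by (simp add: has_derivative_iff_norm)
 have fz: "(f \<longlongrightarrow> f z) (at z)" using f by (simp add: isCont_def)
 have "((%y. norm (f y) * ?q y * K + norm (f y - f z) * \<bar>L\<bar> * K) \<longlongrightarrow> norm (f z) * 0 * K + norm (f z - f z) * \<bar>L\<bar> * K) (at z)"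
  by (intro tendsto_intros fz q)
 then have lim: "((%y. norm (f y) * ?q y * K + norm (f y - f z) * \<bar>L\<bar> * K) \<longlongrightarrow> 0) (at z)" by simp
 have "((%y. norm (pr (f y) (g y) - pr (f z) (g z) - pr (f z) (g' (y - z))) / norm (y - z)) \<longlongrightarrow> 0) (at z)"
 proof (rule Lim_null_comparison[OF _ lim], rule eventually_mono[OF eventually_at_filter[THEN iffD2]])
  show "\<forall>\<^sub>F y in nhds z. y \<noteq> z --> y \<in> UNIV --> y \<noteq> z" by simp
  fix y assume y: "y \<noteq> z"
  have e: "pr (f y) (g y) - pr (f z) (g z) - pr (f z) (g' (y - z)) = pr (f y) (g y - g z - g' (y - z)) + pr (f y - f z) (g' (y - z))"
   using g0 by (simp add: bounded_bilinear.diff_left[OF pr] bounded_bilinear.diff_right[OF pr] bounded_bilinear.zero_right[OF pr])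
  have "norm (pr (f y) (g y) - pr (f z) (g z) - pr (f z) (g' (y - z))) \<le>
    norm (f y) * norm (g y - g z - g' (y - z)) * K + norm (f y - f z) * (norm (y - z) * \<bar>L\<bar>) * K"
   unfolding e
  proof (rule order_trans[OF norm_triangle_ineq add_mono[OF K(2) order_trans[OF K(2)]]])
   have "norm (g' (y - z)) \<le> norm (y - z) * \<bar>L\<bar>" by (rule order_trans[OF L mult_left_mono]) auto
   then show "norm (f y - f z) * norm (g' (y - z)) * K \<le> norm (f y - f z) * (norm (y - z) * \<bar>L\<bar>) * K"
    using K(1) by (intro mult_right_mono mult_left_mono) auto
  qed
  then have "norm (pr (f y) (g y) - pr (f z) (g z) - pr (f z) (g' (y - z))) / norm (y - z) \<le>
    (norm (f y) * norm (g y - g z - g' (y - z)) * K + norm (f y - f z) * (norm (y - z) * \<bar>L\<bar>) * K) / norm (y - z)"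
   by (rule divide_right_mono) simp
  also have "... = norm (f y) * ?q y * K + norm (f y - f z) * \<bar>L\<bar> * K" using y by (simp add: add_divide_distrib)
  finally show "norm (norm (pr (f y) (g y) - pr (f z) (g z) - pr (f z) (g' (y - z))) / norm (y - z)) \<le> norm (f y) * ?q y * K + norm (f y - f z) * \<bar>L\<bar> * K"
   by simp
 qed
 moreover have "bounded_linear (%v. pr (f z) (g' v))"
  by (rule bounded_linear_compose[OF bounded_bilinear.bounded_linear_right[OF pr] has_derivative_bounded_linear[OF g]])
 ultimately show ?thesis by (simp add: has_derivative_iff_norm)
qed

text \<open>Applying the factors \<open>B - h\<close> for all but one eigenvalue projects a vector to the remaining eigenspace.\<close>

definition deflate :: "complex^'m::finite^'m => ('m => real) => 'm list => complex^'m => complex^'m" where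
 "deflate B h ls v = foldr (%l w. B *v w - h l *\<^sub>R w) ls v"

lemma deflate_eigenvector:
 assumes "B *v e = \<mu> *\<^sub>R e"
 shows "deflate B h ls (c *s e) = (\<Prod>l\<leftarrow>ls. \<mu> - h l) *\<^sub>R (c *s e)"
proof (induction ls)
 case (Cons l ls)
 have "B *v (c *s e) = \<mu> *\<^sub>R (c *s e)"
  using assms by (simp add: vec_eq_iff matrix_vector_mult_def sum_distrib_left mult.left_commute) (metis mult_scaleR_right sum_distrib_left)
 then have "B *v (p *\<^sub>R (c *s e)) = (p * \<mu>) *\<^sub>R (c *s e)" for p
  by (simp only: bounded_bilinear.scaleR_right[OF bounded_bilinear_matrix_vector] scaleR_scaleR)
 then show ?case using Cons by (simp add: deflate_def algebra_simps scaleR_left_diff_distrib)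
qed (simp add: deflate_def)

lemma linear_deflate: "linear (deflate B h ls)"
proof (induction ls)
 case (Cons l ls)
 have "linear (%w. B *v w - h l *\<^sub>R w)"
  by (intro linear_compose_sub bounded_linear.linear[OF bounded_bilinear.bounded_linear_right[OF bounded_bilinear_matrix_vector]] linear_scale_self)
 from linear_compose[OF Cons this] show ?case by (simp add: deflate_def o_def)
qed (simp add: deflate_def linear_id[unfolded id_def])

lemma Ck_on_deflate:
 assumes "open N" "Ck_on k N A" "!!l. Ck_on k N (H l)"
 shows "Ck_on k N (%z. deflate (A z) (%l. H l z) ls v)"
proof (induction ls)
 case (Cons l ls)
 have "Ck_on k N (%z. A z *v deflate (A z) (%l. H l z) ls v + (- 1) *\<^sub>R (H l z *\<^sub>R deflate (A z) (%l. H l z) ls v))"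
  by (intro Ck_on_add assms Ck_on_bilinear[OF _ bounded_bilinear_matrix_vector] Ck_on_bounded_linear[OF _ bounded_linear_scaleR_right]
    Ck_on_bilinear[OF _ bounded_bilinear_scaleR] Cons)
 then show ?case by (simp add: deflate_def)
qed (simp add: deflate_def Ck_on_const assms(1))

text \<open>Eigenvectors at \<open>z0\<close> are approximate eigenvectors at nearby
  \<open>z\<close>, so each of the disjoint intervals of radius \<delta> around the
  \<open>s k\<close> contains an eigenvalue of \<open>A z\<close>; there are only
  \<open>CARD('m)\<close> eigenvalues, so each interval holds exactly one. Continuity at another
  point \<open>z1\<close> repeats the argument with eigenvectors there.\<close>

lemma eigenvalue_branches:
 fixes A :: "'z::euclidean_space => complex^'m::finite^'m"
 assumes Z: "open Z" "continuous_on Z A" "!!z. z \<in> Z ==> herm_simple (A z)" and z0: "z0 \<in> Z"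
  and se: "eigenbasis (A z0) s e" and \<delta>: "\<delta> > 0" "!!k l. k \<noteq> l ==> 2 * \<delta> \<le> \<bar>s k - s l\<bar>"
 shows "\<exists>N H. open N \<and> z0 \<in> N \<and> N \<subseteq> Z \<and> (\<forall>k. continuous_on N (H k)) \<and> (\<forall>z\<in>N. \<forall>k. \<bar>H k z - s k\<bar> < \<delta>) \<and>
  (\<forall>z\<in>N. \<forall>\<mu>. is_eigenvalue (A z) \<mu> \<longleftrightarrow> (\<exists>k. \<mu> = of_real (H k z)))"
proof -
 have near: "open {z \<in> Z. norm ((A z - A z1) *v w) < \<epsilon>}" for z1 w \<epsilon>
 proof -
  have "continuous_on Z (%z. norm ((A z - A z1) *v w))"
   by (intro continuous_on_norm bounded_bilinear.continuous_on[OF bounded_bilinear_matrix_vector] continuous_intros Z)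
  from continuous_on_open_vimage[OF Z(1), THEN iffD1, OF this, rule_format, of "{..<\<epsilon>}"]
  show ?thesis by (simp add: vimage_def Int_def conj_commute)
 qed
 define N where "N = (\<Inter>k. {z \<in> Z. norm ((A z - A z0) *v e k) < \<delta>})"
 have N: "open N" "z0 \<in> N" "N \<subseteq> Z"
  unfolding N_def using near z0 \<delta> by (auto simp: matrix_diff_vector)
 note s = eigenbasisD[OF se]
 have ex: "\<exists>h. is_eigenvalue (A z) (of_real h) \<and> \<bar>h - s k\<bar> < \<delta>" if z: "z \<in> N" for z k
 proof -
  have "A z *v e k - of_real (s k) *s e k = (A z - A z0) *v e k" by (simp add: matrix_diff_vector s(2))
  then show ?thesis using z N(3) Z(3) by (intro eigenvalue_near[where v = "e k"] s(3)) (auto simp: N_def)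
 qed
 define H where "H k z = (SOME h. is_eigenvalue (A z) (of_real h) \<and> \<bar>h - s k\<bar> < \<delta>)" for k z
 have H: "is_eigenvalue (A z) (of_real (H k z))" "\<bar>H k z - s k\<bar> < \<delta>" if "z \<in> N" for k z
  using someI_ex[OF ex[OF that]] unfolding H_def by blast+
 have injH: "inj (%k. complex_of_real (H k z))" if z: "z \<in> N" for z
 proof (rule injI)
  fix k l assume "complex_of_real (H k z) = of_real (H l z)"
  then have "H k z = H l z" by simp
  then show "k = l" using H(2)[OF z, of k] H(2)[OF z, of l] \<delta>(2)[of k l] by (cases "k = l") auto
 qed
 have all: "is_eigenvalue (A z) \<mu> \<longleftrightarrow> (\<exists>k. \<mu> = of_real (H k z))" if z: "z \<in> N" for z \<mu>
 proof -
  have S: "simple_spectrum (A z)" using z N(3) Z(3) by (auto simp: herm_simple_def)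
  have "range (%k. complex_of_real (H k z)) = {h. is_eigenvalue (A z) h}"
  proof (rule card_subset_eq[OF card_eigenvalues(1)[OF S]])
   show "range (%k. complex_of_real (H k z)) \<subseteq> {h. is_eigenvalue (A z) h}" using H(1)[OF z] by auto
   show "card (range (%k. complex_of_real (H k z))) = card {h. is_eigenvalue (A z) h}"
    using card_eigenvalues(2)[OF S] card_image[OF injH[OF z]] by simp
  qed
  then show ?thesis by blast
 qed
 have cont: "continuous_on N (H k)" for k
  unfolding continuous_on_eq_continuous_at[OF N(1)]
 proof
  fix z1 assume z1: "z1 \<in> N"
  show "isCont (H k) z1"
   unfolding isCont_def tendsto_iff
  proof (intro allI impI)
   fix \<epsilon> :: real assume "\<epsilon> > 0"
   \<comment> \<open>The second term of the minimum keeps an eigenvalue found near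
     \<open>H k z1\<close> within the interval around \<open>s k\<close>, so that it belongs to the
     same branch.\<close>
   define \<epsilon>' where "\<epsilon>' = min \<epsilon> (\<delta> - \<bar>H k z1 - s k\<bar>)"
   have \<epsilon>': "\<epsilon>' > 0" using \<open>\<epsilon> > 0\<close> H(2)[OF z1, of k] by (simp add: \<epsilon>'_def)
   obtain s' e' where se': "eigenbasis (A z1) s' e'" using spectral Z(3) z1 N(3) by blast
   note s' = eigenbasisD[OF se']
   obtain i where i: "H k z1 = s' i" using H(1)[OF z1, of k] s'(4) by (auto simp: of_real_eq_iff)
   let ?M = "{z \<in> Z. norm ((A z - A z1) *v e' i) < \<epsilon>'} \<inter> N"
   have "open ?M" by (intro open_Int near N)
   moreover have "z1 \<in> ?M" using z1 N(3) \<epsilon>' by (auto simp: matrix_diff_vector)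
   moreover have "dist (H k z) (H k z1) < \<epsilon>" if z: "z \<in> ?M" for z
   proof -
    have "A z *v e' i - of_real (H k z1) *s e' i = (A z - A z1) *v e' i" by (simp add: matrix_diff_vector s'(2) i)
    then have "\<exists>h. is_eigenvalue (A z) (of_real h) \<and> \<bar>h - H k z1\<bar> < \<epsilon>'"
     using z N(3) Z(3) by (intro eigenvalue_near[where v = "e' i"] s'(3)) auto
    then obtain h where h: "is_eigenvalue (A z) (of_real h)" "\<bar>h - H k z1\<bar> < \<epsilon>'" by blast
    have zN: "z \<in> N" using z by simp
    obtain l where l: "h = H l z" using h(1) all[OF zN] by auto
    have "\<bar>h - s k\<bar> < \<delta>" using h(2) abs_triangle_ineq[of "h - H k z1" "H k z1 - s k"] by (simp add: \<epsilon>'_def)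
    then have "l = k" using H(2)[OF zN, of l] \<delta>(2)[of k l] l by (cases "l = k") auto
    then show ?thesis using h(2) l by (simp add: \<epsilon>'_def dist_real_def)
   qed
   ultimately have "\<forall>\<^sub>F z in nhds z1. dist (H k z) (H k z1) < \<epsilon>" unfolding eventually_nhds by blast
   then show "\<forall>\<^sub>F z in at z1. dist (H k z) (H k z1) < \<epsilon>" unfolding eventually_at_filter by (rule eventually_mono) simp
  qed
 qed
 show ?thesis by (intro exI[of _ N] exI[of _ H] conjI ballI allI N H(2) all cont)
qed

text \<open>In an eigenbasis of \<open>B\<close> each component is multiplied by a product of
  differences of eigenvalues, which has a zero factor unless the eigenvalue is
  \<open>H k\<close>.\<close>

lemma deflate_is_eigenvector:
 fixes B :: "complex^'m::finite^'m"
 assumes B: "herm_simple B" and H: "!!\<mu>. is_eigenvalue B \<mu> \<longleftrightarrow> (\<exists>k. \<mu> = of_real (H k))"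
  and ls: "set ls = - {k}"
 shows "B *v deflate B H ls v = of_real (H k) *s deflate B H ls v"
proof -
 obtain s e where se: "eigenbasis B s e" using spectral[OF B] by blast
 note s = eigenbasisD[OF se]
 let ?D = "deflate B H ls"
 define w where "w i = ?D (cdot (e i) v *s e i)" for i
 have Be: "B *v e i = s i *\<^sub>R e i" for i unfolding s(2) vec_eq_iff vector_scaleR_component vector_smult_component by (simp add: scaleR_conv_of_real)
 have wi: "B *v w i = H k *\<^sub>R w i" for i
 proof -
  let ?p = "\<Prod>l\<leftarrow>ls. s i - H l"
  have w: "w i = ?p *\<^sub>R (cdot (e i) v *s e i)" unfolding w_def by (rule deflate_eigenvector[OF Be])
  obtain l where l: "s i = H l" using s(4)[of "of_real (s i)"] H by auto
  show ?thesis
  proof (cases "l = k")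
   case False
   then have "?p = 0" using ls l by (auto simp: prod_list_zero_iff image_iff)
   then show ?thesis unfolding w by simp
  next
   case True
   have "B *v (cdot (e i) v *s e i) = H k *\<^sub>R (cdot (e i) v *s e i)"
    using Be[of i] True l by (simp add: vec_eq_iff matrix_vector_mult_def sum_distrib_left mult.left_commute)
     (metis mult_scaleR_right sum_distrib_left)
   then show ?thesis unfolding w bounded_bilinear.scaleR_right[OF bounded_bilinear_matrix_vector] by simp
  qed
 qed
 have "?D v = (\<Sum>i\<in>UNIV. w i)"
  unfolding w_def linear_sum[OF linear_deflate, symmetric] s(6)[of v, symmetric] ..
 moreover have "B *v (\<Sum>i\<in>UNIV. w i) = (\<Sum>i\<in>UNIV. B *v w i)"
  by (rule linear_sum[OF bounded_linear.linear[OF bounded_bilinear.bounded_linear_right[OF bounded_bilinear_matrix_vector]]])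
 ultimately have "B *v ?D v = H k *\<^sub>R ?D v" by (simp add: wi scaleR_sum_right)
 then show ?thesis unfolding vec_eq_iff vector_scaleR_component vector_smult_component by (simp add: scaleR_conv_of_real)
qed

lemma norm_scale_complex: "norm (a *s v) = norm a * norm v" for a :: complex and v :: "complex^'m::finite"
 by (simp add: norm_vec_def L2_set_def norm_mult power_mult_distrib sum_distrib_left[symmetric] real_sqrt_mult)

text \<open>By Hermitian symmetry H z - H z1 times the inner product of W z and W z1 equals the
  inner product of W z with (A z - A z1) W z1, with no derivative of \<open>W\<close> involved. The
  latter vanishes at \<open>z1\<close>, so continuity of \<open>W\<close> is enough to differentiate
  it; the outcome is the formula of first-order perturbation theory.\<close>

lemma eigenvalue_derivative:
 fixes A :: "'z::euclidean_space => complex^'m::finite^'m"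
 assumes N: "open N" "z1 \<in> N" and A: "!!z. z \<in> N ==> hconj (A z) = A z" "(A has_derivative A') (at z1)"
  and H: "!!z. z \<in> N ==> A z *v W z = of_real (H z) *s W z" and W: "continuous_on N W" "W z1 \<noteq> 0"
 shows "(H has_derivative (%v. Re (inverse (cdot (W z1) (W z1)) * cdot (W z1) (A' v *v W z1)))) (at z1)"
proof -
 let ?c = "%z. cdot (W z) (W z1)" and ?g = "%z. cdot (W z) ((A z - A z1) *v W z1)"
 have cW: "isCont W z1" using W(1) N by (simp add: continuous_on_eq_continuous_at)
 have c: "isCont ?c z1"
  by (rule bounded_linear.continuous[OF bounded_bilinear.bounded_linear_left[OF bounded_bilinear_cdot] cW])
 have c0: "?c z1 \<noteq> 0" using W(2) by (simp add: cdot_self)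
 have dA: "((%z. (A z - A z1) *v W z1) has_derivative (%v. A' v *v W z1)) (at z1)"
  by (rule bounded_linear.has_derivative[OF bounded_bilinear.bounded_linear_left[OF bounded_bilinear_matrix_vector]])
   (auto intro!: derivative_eq_intros A(2))
 have dg: "(?g has_derivative (%v. cdot (W z1) (A' v *v W z1))) (at z1)"
  by (rule has_derivative_bilinear_vanishing[OF bounded_bilinear_cdot cW dA]) (simp add: matrix_vector_mult_def vec_eq_iff)
 have g0: "?g z1 = 0" by (simp add: matrix_vector_mult_def cdot_def)
 have "((%z. inverse (?c z) * ?g z) has_derivative (%v. inverse (?c z1) * cdot (W z1) (A' v *v W z1))) (at z1)"
  by (rule has_derivative_bilinear_vanishing[OF bounded_bilinear_mult _ dg g0]) (intro continuous_at_within_inverse c c0)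
 from has_derivative_add[OF has_derivative_const[of "H z1"] bounded_linear.has_derivative[OF bounded_linear_Re this]]
 have "((%z. H z1 + Re (inverse (?c z) * ?g z)) has_derivative (%v. Re (inverse (cdot (W z1) (W z1)) * cdot (W z1) (A' v *v W z1)))) (at z1)"
  by (simp only: add_0)
 moreover have "open ({z. ?c z \<noteq> 0} \<inter> N)"
 proof -
  have "continuous_on N ?c"
   by (rule bounded_linear.continuous_on[OF bounded_bilinear.bounded_linear_left[OF bounded_bilinear_cdot] W(1)])
  from continuous_on_open_vimage[OF N(1), THEN iffD1, OF this, rule_format, of "- {0}", OF open_Compl[OF closed_singleton]]
  show ?thesis by (simp add: vimage_def Compl_eq)
 qed
 moreover have "z1 \<in> {z. ?c z \<noteq> 0} \<inter> N" using c0 N by simp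
 moreover have "H z1 + Re (inverse (?c z) * ?g z) = H z" if z: "z \<in> {z. ?c z \<noteq> 0} \<inter> N" for z
 proof -
  have "?g z = cdot (A z *v W z) (W z1) - cdot (W z) (A z1 *v W z1)"
   unfolding matrix_diff_vector bounded_bilinear.diff_right[OF bounded_bilinear_cdot] using z by (simp add: cdot_hermitian[OF A(1)])
  also have "... = of_real (H z - H z1) * ?c z" using z N by (simp add: H cdot_basic left_diff_distrib)
  finally have "inverse (?c z) * ?g z = of_real (H z - H z1)" using z by simp
  then show ?thesis by simp
 qed
 ultimately show ?thesis by (rule has_derivative_transform_within_open[where s = "{z. ?c z \<noteq> 0} \<inter> N"])
qed

text \<open>Constancy over \<open>N\<close> of the order and of the signs of the branches is
  recorded because the numbering of positive eigenvalues depends on both.\<close>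

definition smooth_eigensystem :: "('z::euclidean_space => complex^'m::finite^'m) => 'z set => ('m => 'z => real) => ('m => 'z => complex^'m) => bool" where
 "smooth_eigensystem A N H W \<longleftrightarrow> (\<forall>k. smooth_on N (H k) \<and> smooth_on N (W k)) \<and>
  (\<forall>z\<in>N. \<forall>\<mu>. is_eigenvalue (A z) \<mu> \<longleftrightarrow> (\<exists>k::'m. \<mu> = of_real (H k z))) \<and>
  (\<forall>z\<in>N. \<forall>k. norm (W k z) = 1 \<and> A z *v W k z = of_real (H k z) *s W k z) \<and>
  (\<forall>z\<in>N. \<forall>z'\<in>N. \<forall>k l. (H k z < H l z \<longleftrightarrow> H k z' < H l z') \<and> (0 < H k z \<longleftrightarrow> 0 < H k z')) \<and>
  (\<forall>z\<in>N. inj (%k. H k z))"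

text \<open>A bootstrap in place of the implicit function theorem. The eigenvector
  \<open>W k\<close> is polynomial in \<open>A\<close> and the \<open>H l\<close>, so it is C^i if
  they are; the derivative of \<open>H k\<close> is expressed by \<open>W k\<close> and the
  derivative of \<open>A\<close>, hence is C^i again, and \<open>H k\<close> is C^(i+1). The start
  is the continuity of the branches.\<close>

lemma smooth_branches:
 fixes A :: "'z::euclidean_space => complex^'m::finite^'m"
 assumes Z: "open Z" and A: "smooth_on Z A" and hs: "!!z. z \<in> Z ==> herm_simple (A z)" and z0: "z0 \<in> Z"
  and n0: "\<not> is_eigenvalue (A z0) 0"
 shows "\<exists>N H W. open N \<and> z0 \<in> N \<and> N \<subseteq> Z \<and> smooth_eigensystem A N H W"
proof -
 obtain s e where se: "eigenbasis (A z0) s e" using spectral[OF hs[OF z0]] by blast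
 note s = eigenbasisD[OF se]
 \<comment> \<open>Half the gaps keep the branches apart, which preserves their order; the absolute
   values keep them away from 0, which preserves their signs.\<close>
 define D where "D = insert 1 ((%(k, l). \<bar>s k - s l\<bar> / 2) ` {(k, l). k \<noteq> l} \<union> range (%k. \<bar>s k\<bar>))"
 define \<delta> where "\<delta> = Min D"
 have D: "finite D" "D \<noteq> {}" by (auto simp: D_def)
 have s0: "s k \<noteq> 0" for k using n0 s(4)[of 0] by (metis of_real_0)
 have \<delta>: "\<delta> > 0"
  unfolding \<delta>_def Min_gr_iff[OF D] using s(1) s0 by (auto simp: D_def inj_def)
 have gap: "2 * \<delta> \<le> \<bar>s k - s l\<bar>" if "k \<noteq> l" for k l
 proof -
  have "\<bar>s k - s l\<bar> / 2 \<in> D" using that by (auto simp: D_def)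
  then show ?thesis using Min_le[OF D(1)] by (force simp: \<delta>_def)
 qed
 have gap0: "\<delta> \<le> \<bar>s k\<bar>" for k
  unfolding \<delta>_def by (rule Min_le[OF D(1)]) (auto simp: D_def)
 obtain N0 H where N0: "open N0" "z0 \<in> N0" "N0 \<subseteq> Z" and Hc: "!!k. continuous_on N0 (H k)"
  and Hs: "!!z k. z \<in> N0 ==> \<bar>H k z - s k\<bar> < \<delta>" and He: "!!z \<mu>. z \<in> N0 ==> is_eigenvalue (A z) \<mu> \<longleftrightarrow> (\<exists>k. \<mu> = of_real (H k z))"
  using eigenvalue_branches[OF Z smooth_on_continuous[OF A] hs z0 se \<delta> gap] by blast
 have order: "H k z < H l z \<longleftrightarrow> s k < s l" if "z \<in> N0" for k l z
  using Hs[OF that, of k] Hs[OF that, of l] gap[of k l] by (cases "k = l") auto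
 have sign: "0 < H k z \<longleftrightarrow> 0 < s k" if "z \<in> N0" for k z
  using Hs[OF that, of k] gap0[of k] by auto
 have inj: "inj (%k. H k z)" if "z \<in> N0" for z
  using order[OF that] s(1) by (metis (mono_tags, lifting) injI injD linorder_neq_iff)
 have "\<exists>ls. set ls = - {k}" for k :: 'm by (rule finite_list) simp
 then obtain ls where ls: "!!k :: 'm. set (ls k) = - {k}" by metis
 define W where "W k z = deflate (A z) (%l. H l z) (ls k) (e k)" for k z
 have "Ck_on 0 N0 (W k)" for k
  unfolding W_def using Hc smooth_on_continuous[OF A] N0 by (intro Ck_on_deflate) (auto intro: continuous_on_subset)
 then have Wc: "continuous_on N0 (W k)" for k by simp
 have W0: "W k z0 \<noteq> 0" for k
 proof -
  have "A z0 *v e k = s k *\<^sub>R e k" unfolding s(2) vec_eq_iff vector_scaleR_component vector_smult_component by (simp add: scaleR_conv_of_real)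
  from deflate_eigenvector[OF this, of "%l. H l z0" "ls k" 1]
  have "W k z0 = (\<Prod>l\<leftarrow>ls k. s k - H l z0) *\<^sub>R e k" by (simp add: W_def)
  moreover have "s k - H l z0 \<noteq> 0" if "l \<in> set (ls k)" for l
   using Hs[OF N0(2), of l] gap[of k l] that ls \<delta> by auto
  ultimately show ?thesis using s(3)[of k] by (auto simp: prod_list_zero_iff)
 qed
 define N where "N = (\<Inter>k. {z \<in> N0. W k z \<noteq> 0})"
 have "open {z \<in> N0. W k z \<noteq> 0}" for k
  using continuous_on_open_vimage[OF N0(1), THEN iffD1, OF Wc[of k], rule_format, of "- {0}", OF open_Compl[OF closed_singleton]]
  by (simp add: vimage_def Int_def conj_commute Compl_eq)
 then have N: "open N" "z0 \<in> N" "N \<subseteq> N0" using W0 N0 by (auto simp: N_def)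
 have Wn: "W k z \<noteq> 0" if "z \<in> N" for k z using that by (auto simp: N_def)
 have We: "A z *v W k z = of_real (H k z) *s W k z" if "z \<in> N" for z k
  unfolding W_def using that N N0 by (intro deflate_is_eigenvector hs He ls) auto
 have AN: "smooth_on N A" by (rule smooth_on_subset[OF A]) (use N N0 in auto)
 have cW: "cdot (W k z) (W k z) = of_real (Re (cdot (W k z) (W k z)))" "Re (cdot (W k z) (W k z)) = (norm (W k z))\<^sup>2" for k z
  by (simp_all add: cdot_self)
 have pos: "Re (cdot (W k z) (W k z)) > 0" if "z \<in> N" for k z using Wn[OF that] cW(2) by simp
 have pne: "Re (cdot (W k z) (W k z)) \<in> - {0}" if "z \<in> N" for k z
  using pos[OF that, of k] unfolding Compl_iff singleton_iff by (intro notI) simp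
 have HC: "\<forall>k. Ck_on i N (H k)" for i
 proof (induction i)
  case 0
  then show ?case using Hc N(3) by (auto intro: continuous_on_subset)
 next
  case (Suc i)
  have WC: "Ck_on i N (W k)" for k
   unfolding W_def by (intro Ck_on_deflate N smooth_on_Ck[OF AN] Suc[rule_format])
  show ?case
  proof
   fix k
   let ?f = "%z v. inverse (Re (cdot (W k z) (W k z))) *\<^sub>R Re (cdot (W k z) (frechet_derivative A (at z) v *v W k z))"
   show "Ck_on (Suc i) N (H k)"
   proof (rule Ck_on_SucI[OF N(1), where f' = ?f])
    fix z assume z: "z \<in> N"
    have "(H k has_derivative (%v. Re (inverse (cdot (W k z) (W k z)) * cdot (W k z) (frechet_derivative A (at z) v *v W k z)))) (at z)"
     using N N0 hs by (intro eigenvalue_derivative[OF N(1) z _ smooth_on_has_derivative[OF AN z] We]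
      Wn[OF z] continuous_on_subset[OF Wc N(3)]) (auto simp: herm_simple_def)
    moreover have "Re (inverse (cdot (W k z) (W k z)) * c) = inverse (Re (cdot (W k z) (W k z))) *\<^sub>R Re c" for c
     by (subst cW(1)) (simp add: of_real_inverse[symmetric] del: of_real_inverse)
    ultimately show "(H k has_derivative ?f z) (at z)" by simp
   next
    fix v
    have 1: "Ck_on i N (%z. Re (cdot (W k z) (W k z)))"
     by (intro Ck_on_bounded_linear[OF N(1) bounded_linear_Re] Ck_on_bilinear[OF N(1) bounded_bilinear_cdot] WC)
    have "Ck_on i N (%z. inverse (Re (cdot (W k z) (W k z))))"
     by (rule Ck_on_compose[OF N(1) open_Compl[OF closed_singleton] pne 1 smooth_on_Ck[OF smooth_on_inverse]])
    moreover have "Ck_on i N (%z. Re (cdot (W k z) (frechet_derivative A (at z) v *v W k z)))"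
     by (intro Ck_on_bounded_linear[OF N(1) bounded_linear_Re] Ck_on_bilinear[OF N(1) bounded_bilinear_cdot] WC
      Ck_on_bilinear[OF N(1) bounded_bilinear_matrix_vector] smooth_on_Ck[OF smooth_on_derivative[OF AN]])
    ultimately show "Ck_on i N (%z. ?f z v)" by (rule Ck_on_bilinear[OF N(1) bounded_bilinear_scaleR])
   qed
  qed
 qed
 then have Hsm: "smooth_on N (H k)" for k by (simp add: smooth_on_def)
 have Wsm: "smooth_on N (W k)" for k
  unfolding smooth_on_def W_def by (intro allI Ck_on_deflate N smooth_on_Ck[OF AN] HC[rule_format])
 define W' where "W' k z = inverse (sqrt (Re (cdot (W k z) (W k z)))) *\<^sub>R W k z" for k z
 have "smooth_on N (W' k)" for k
 proof -
  have 1: "smooth_on N (%z. Re (cdot (W k z) (W k z)))"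
   by (intro smooth_on_bounded_linear[OF bounded_linear_Re] N smooth_on_bilinear[OF bounded_bilinear_cdot] Wsm)
  have 2: "smooth_on N (%z. sqrt (Re (cdot (W k z) (W k z))))"
   by (rule smooth_on_compose[OF N(1) _ 1 smooth_on_sqrt]) (use pos in auto)
  have "smooth_on N (%z. inverse (sqrt (Re (cdot (W k z) (W k z)))))"
   by (rule smooth_on_compose[OF N(1) open_Compl[OF closed_singleton] 2 smooth_on_inverse])
    (use pne[of _ k] in \<open>simp only: Compl_iff singleton_iff real_sqrt_eq_0_iff, simp\<close>)
  then show ?thesis unfolding W'_def by (intro smooth_on_scaleR N Wsm)
 qed
 moreover have "norm (W' k z) = 1" if "z \<in> N" for k z
  using Wn[OF that] by (simp add: W'_def cW(2))
 moreover have "A z *v W' k z = of_real (H k z) *s W' k z" if "z \<in> N" for k z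
  unfolding W'_def bounded_bilinear.scaleR_right[OF bounded_bilinear_matrix_vector] We[OF that]
  by (simp add: vec_eq_iff)
 ultimately show ?thesis
  unfolding smooth_eigensystem_def using N N0 Hsm He order sign inj
  by (intro exI[of _ N] exI[of _ H] exI[of _ W']) (auto simp: subset_iff)
qed

text \<open>The list \<open>ks\<close> sorts the positive branches at \<open>z0\<close>. Order and
  signs do not change over \<open>N\<close>, so the same list sorts them at every \<open>z\<close>,
  and the j-th positive eigenvalue is one fixed branch.\<close>

lemma local_eigenvectors:
 fixes A :: "'z::euclidean_space => complex^'m::finite^'m"
 assumes Z: "open Z" and A: "smooth_on Z A" and hs: "!!z. z \<in> Z ==> herm_simple (A z)" and z0: "z0 \<in> Z"
  and n0: "\<not> is_eigenvalue (A z0) 0"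
 shows "\<exists>N. open N \<and> z0 \<in> N \<and> N \<subseteq> Z \<and>
  (\<forall>z\<in>N. card (positive_eigenvalues (A z)) = card (positive_eigenvalues (A z0))) \<and>
  (\<forall>j\<in>{1..card (positive_eigenvalues (A z0))}. smooth_on N (%z. eigenvalue_no j (A z)) \<and>
   (\<exists>W. smooth_on N W \<and> (\<forall>z\<in>N. norm (W z) = 1 \<and> A z *v W z = of_real (eigenvalue_no j (A z)) *s W z)))"
proof -
 obtain N H W where N: "open N" "z0 \<in> N" "N \<subseteq> Z" and sys: "smooth_eigensystem A N H W"
  using smooth_branches[OF Z A hs z0 n0] by blast
 note d = sys[unfolded smooth_eigensystem_def]
 have sm: "smooth_on N (H k)" "smooth_on N (W k)" for k using d[THEN conjunct1] by blast+
 note d = d[THEN conjunct2]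
 have He: "is_eigenvalue (A z) \<mu> \<longleftrightarrow> (\<exists>k::'m. \<mu> = of_real (H k z))" if "z \<in> N" for z \<mu>
  by (rule d[THEN conjunct1, THEN bspec, OF that, THEN spec])
 note d = d[THEN conjunct2]
 have W: "norm (W k z) = 1 \<and> A z *v W k z = of_real (H k z) *s W k z" if "z \<in> N" for z k
  by (rule d[THEN conjunct1, THEN bspec, OF that, THEN spec])
 note d = d[THEN conjunct2]
 have ord: "(H k z < H l z \<longleftrightarrow> H k z' < H l z') \<and> (0 < H k z \<longleftrightarrow> 0 < H k z')" if "z \<in> N" "z' \<in> N" for z z' k l
  by (rule d[THEN conjunct1, THEN bspec, OF that(1), THEN bspec, OF that(2), THEN spec, THEN spec])
 have inj: "inj (%k. H k z)" if "z \<in> N" for z by (rule d[THEN conjunct2, THEN bspec, OF that])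
 define P where "P = {k. 0 < H k z0}"
 have pe: "positive_eigenvalues (A z) = (%k. H k z) ` P" if "z \<in> N" for z
  using He[OF that] ord[OF that N(2)] by (auto simp: positive_eigenvalues_def P_def)
 have cd: "card (positive_eigenvalues (A z)) = card P" if "z \<in> N" for z
  unfolding pe[OF that] by (rule card_image) (use inj[OF that] in \<open>auto simp: inj_on_def inj_def\<close>)
 define ks where "ks = map (inv (%k. H k z0)) (sorted_list_of_set ((%k. H k z0) ` P))"
 have ks: "map (%k. H k z0) ks = sorted_list_of_set ((%k. H k z0) ` P)"
  unfolding ks_def map_map o_def by (rule map_idI) (auto intro: f_inv_into_f)
 have ksP: "set ks = P" unfolding ks_def using inj[OF N(2)] by (auto simp: image_iff)
 have len: "length ks = card P" using cd[OF N(2)] pe[OF N(2)] by (simp add: ks_def)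
 have st: "sorted_wrt (%k l. H k z0 < H l z0) ks"
  using strict_sorted_list_of_set[of "(%k. H k z0) ` P"] unfolding ks[symmetric] by (simp add: sorted_wrt_map)
 have list: "sorted_list_of_set (positive_eigenvalues (A z)) = map (%k. H k z) ks" if z: "z \<in> N" for z
 proof -
  have "sorted_wrt (<) (map (%k. H k z) ks)"
   unfolding sorted_wrt_map by (rule sorted_wrt_mono_rel[OF _ st]) (use ord[OF z N(2)] in auto)
  moreover have "set (map (%k. H k z) ks) = positive_eigenvalues (A z)" using ksP pe[OF z] by simp
  ultimately show ?thesis
   using sorted_list_of_set.idem_if_sorted_distinct[of "map (%k. H k z) ks"] by (simp add: strict_sorted_iff)
 qed
 have no: "eigenvalue_no j (A z) = H (ks ! (j - 1)) z" if "z \<in> N" "j \<in> {1..card P}" for z j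
 proof -
  have "j - 1 < length ks" using that(2) len by auto
  then show ?thesis by (simp add: eigenvalue_no_def list[OF that(1)])
 qed
 show ?thesis
 proof (intro exI[of _ N] conjI ballI N)
  fix z assume "z \<in> N" then show "card (positive_eigenvalues (A z)) = card (positive_eigenvalues (A z0))" using cd N by simp
 next
  fix j assume "j \<in> {1..card (positive_eigenvalues (A z0))}"
  then have j: "j \<in> {1..card P}" using cd N by simp
  show "smooth_on N (%z. eigenvalue_no j (A z))"
   by (rule smooth_on_cong[OF N(1) sm(1)[of "ks ! (j - 1)"]]) (rule no[OF _ j, symmetric])
  show "\<exists>W. smooth_on N W \<and> (\<forall>z\<in>N. norm (W z) = 1 \<and> A z *v W z = of_real (eigenvalue_no j (A z)) *s W z)"
   using W by (intro exI[of _ "W (ks ! (j - 1))"]) (simp add: sm no[OF _ j])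
 qed
qed

text \<open>Components along basis vectors of other eigenvalues vanish by Hermitian symmetry, so
  both vectors are multiples of the one basis vector with eigenvalue \<open>h\<close>.\<close>

lemma eigenvector_unique:
 fixes B :: "complex^'m::finite^'m"
 assumes B: "herm_simple B" and v: "norm v = 1" "B *v v = of_real h *s v" and w: "B *v w = of_real h *s w"
 shows "w = cdot v w *s v"
proof -
 obtain s e where se: "eigenbasis B s e" using spectral[OF B] by blast
 note s = eigenbasisD[OF se]
 have co: "cdot (e k) u = 0" if "B *v u = of_real h *s u" "s k \<noteq> h" for k u
 proof -
  have "of_real h * cdot (e k) u = of_real (s k) * cdot (e k) u"
   using cdot_hermitian[of B "e k" u] B that(1) by (simp add: herm_simple_def s(2) cdot_basic)
  then show ?thesis using that(2) by simp
 qed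
 have v0: "v \<noteq> 0" using v by auto
 then obtain k where k: "s k = h" using v(2) s(4)[of "of_real h"] by (auto simp: is_eigenvalue_def)
 have ex: "u = cdot (e k) u *s e k" if "B *v u = of_real h *s u" for u
 proof -
  have "u = (\<Sum>i\<in>UNIV. cdot (e i) u *s e i)" by (rule s(6))
  also have "... = (\<Sum>i\<in>{k}. cdot (e i) u *s e i)"
  proof (rule sum.mono_neutral_right)
   show "\<forall>i\<in>UNIV - {k}. cdot (e i) u *s e i = 0"
    using co[OF that] s(1) k by (auto simp: inj_def)
  qed auto
  finally show ?thesis by simp
 qed
 let ?a = "cdot (e k) v" and ?b = "cdot (e k) w"
 have "norm v = norm ?a * norm (e k)" by (subst ex[OF v(2)]) (rule norm_scale_complex)
 then have "norm ?a = 1" using v(1) s(3) by simp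
 then have a: "cnj ?a * ?a = 1" using complex_norm_square[of ?a] by (simp add: mult.commute)
 have e1: "cdot (e k) (e k) = 1" by (simp add: cdot_self s(3))
 have "cdot v w = cdot (?a *s e k) (?b *s e k)" using ex[OF v(2)] ex[OF w] by (rule arg_cong2)
 then have "cdot v w = cnj ?a * ?b" by (simp add: cdot_basic e1)
 then have "cdot v w *s v = (cnj ?a * ?b) *s (?a *s e k)" using arg_cong[OF ex[OF v(2)], of "%u. (cnj ?a * ?b) *s u"] by simp
 also have "... = (cnj ?a * ?a) *s (?b *s e k)" by (simp add: vec_eq_iff mult_ac)
 also have "... = ?b *s e k" unfolding a by (rule vector_smult_lid)
 also have "... = w" by (rule ex[OF w, symmetric])
 finally show ?thesis by simp
qed

subsection \<open>Change of the brackets under conjugation\<close>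

lemma matrix_vector_simps:
 fixes B C :: "complex^'m::finite^'m"
 shows "B *v (c *s v) = c *s (B *v v)" "B *v (v + w) = B *v v + B *v w" "(B + C) *v v = B *v v + C *v v"
  "cscale c B *v v = c *s (B *v v)" "(B ** C) *v v = B *v (C *v v)"
 by (rule_tac [5] matrix_vector_mul_assoc[symmetric]) (simp_all add: vec_eq_iff matrix_vector_mult_def sum_distrib_left sum.distrib algebra_simps cscale_def)


lemma cdot_hconj: "cdot (B *v v) w = cdot v (hconj B *v w)"
proof -
 have "cdot (B *v v) w = (\<Sum>i\<in>UNIV. \<Sum>j\<in>UNIV. cnj (v $ j) * (cnj (B $ i $ j) * w $ i))"
  by (simp add: cdot_def matrix_vector_mult_def sum_distrib_left sum_distrib_right mult_ac)
 also have "... = (\<Sum>j\<in>UNIV. \<Sum>i\<in>UNIV. cnj (v $ j) * (cnj (B $ i $ j) * w $ i))" by (rule sum.swap)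
 also have "... = cdot v (hconj B *v w)"
  by (simp add: cdot_def matrix_vector_mult_def sum_distrib_left hconj_def)
 finally show ?thesis .
qed

lemma hconj_hconj: "hconj (hconj B) = B"
 by (simp add: hconj_def vec_eq_iff)

text \<open>Pointwise algebra for a single index. \<open>a\<close> is the symbol and
  \<open>b\<close> its covector derivative, \<open>B\<close> the antihermitian matrix hconj(Q) Q_x,
  \<gamma> the phase; \<open>p\<close> and \<open>q\<close> are the derivatives of \<gamma> Q v in
  position and covector with the unitary factor Q stripped off. The assumptions are the eigenvalue
  equation, the normalisations and their first derivatives.\<close>

lemma bracket_terms:
 fixes a b B :: "complex^'m::finite^'m" and v v\<^sub>x v\<^sub>ksi :: "complex^'m" and \<gamma> \<gamma>\<^sub>x \<gamma>\<^sub>ksi :: complex and h h\<^sub>ksi :: real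
 assumes H: "hconj a = a" "hconj b = b" and B: "!!u w. cdot (B *v u) w = - cdot u (B *v w)"
  and v: "a *v v = of_real h *s v" "a *v v\<^sub>ksi + b *v v = of_real h *s v\<^sub>ksi + of_real h\<^sub>ksi *s v" "cdot v v = 1"
  "cdot v\<^sub>x v + cdot v v\<^sub>x = 0" "cdot v\<^sub>ksi v + cdot v v\<^sub>ksi = 0"
  and \<gamma>: "cnj \<gamma> * \<gamma> = 1" "cnj \<gamma>\<^sub>x * \<gamma> + cnj \<gamma> * \<gamma>\<^sub>x = 0" "cnj \<gamma>\<^sub>ksi * \<gamma> + cnj \<gamma> * \<gamma>\<^sub>ksi = 0"
 defines "L \<equiv> a - mat (of_real h)" and "p \<equiv> \<gamma> *s (B *v v + v\<^sub>x) + \<gamma>\<^sub>x *s v" and "q \<equiv> \<gamma>\<^sub>ksi *s v + \<gamma> *s v\<^sub>ksi"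
 shows "cdot p (L *v q) - cdot q (L *v p) = cdot v\<^sub>x (L *v v\<^sub>ksi) - cdot v\<^sub>ksi (L *v v\<^sub>x) +
   (cdot v (B *v (b *v v)) + cdot v (b *v (B *v v))) - 2 * of_real h\<^sub>ksi * cdot v (B *v v)" (is ?g1)
  and "cdot p q - cdot q p = cdot v\<^sub>x v\<^sub>ksi - cdot v\<^sub>ksi v\<^sub>x - (cdot v (B *v v\<^sub>ksi) + cdot v\<^sub>ksi (B *v v))" (is ?g2)
proof -
 have Lw: "L *v w = a *v w - of_real h *s w" for w by (simp add: L_def matrix_diff_vector mat_vector)
 have Lv: "L *v v = 0" by (simp add: Lw v)
 have Lvx: "L *v v\<^sub>ksi = of_real h\<^sub>ksi *s v - b *v v" using v(2)[symmetric] unfolding Lw eq_diff_eq diff_add_eq[symmetric] by (simp add: algebra_simps)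
 have cd: "cdot u (w - w') = cdot u w - cdot u w'" "cdot (w - w') u = cdot w u - cdot w' u" for u w w' :: "complex^'m"
  by (simp_all add: bounded_bilinear.diff_right[OF bounded_bilinear_cdot] bounded_bilinear.diff_left[OF bounded_bilinear_cdot])
 have La: "cdot u (L *v w) = cdot (L *v u) w" for u w
  unfolding Lw cd by (simp add: cdot_hermitian[OF H(1)] cdot_basic)
 have Lq: "L *v q = \<gamma> *s (L *v v\<^sub>ksi)" and Lp: "L *v p = \<gamma> *s (L *v (B *v v + v\<^sub>x))"
  unfolding q_def p_def matrix_vector_simps(1,2) Lv by simp_all
 \<comment> \<open>\<open>L\<close> is symmetric and annihilates \<open>v\<close>, so components
   along \<open>v\<close> drop out of the first identity, and with them the derivatives of the
   phase.\<close>
 have v0: "cdot v (L *v w) = 0" for w unfolding La Lv by (simp add: cdot_basic)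
 have \<gamma>': "cnj \<gamma> * (\<gamma> * c) = c" "\<gamma> * (cnj \<gamma> * c) = c" for c
  using \<gamma>(1) by (metis mult.assoc mult.commute mult_1)+
 have "cdot p (L *v q) = cdot (B *v v + v\<^sub>x) (L *v v\<^sub>ksi)"
  unfolding Lq p_def cdot_basic(2-4,1) v0 by (simp add: \<gamma>')
 moreover have "cdot q (L *v p) = cdot v\<^sub>ksi (L *v (B *v v + v\<^sub>x))"
  unfolding Lp q_def cdot_basic(2-4,1) v0 by (simp add: \<gamma>')
 moreover have "cdot v\<^sub>ksi (L *v (B *v v)) = cdot (of_real h\<^sub>ksi *s v - b *v v) (B *v v)" unfolding La Lvx ..
 ultimately show ?g1
  by (simp add: matrix_vector_simps cdot_basic cd Lvx B cdot_hermitian[OF H(2), symmetric]) (simp add: algebra_simps)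
 let ?k = "cnj \<gamma>"
 \<comment> \<open>As |\<gamma>| = 1, conjugate derivatives of the phase can be eliminated; the
   second identity is then polynomial, and its phase terms cancel.\<close>
 have e: "cnj \<gamma>\<^sub>x = - (?k * ?k * \<gamma>\<^sub>x)" "cnj \<gamma>\<^sub>ksi = - (?k * ?k * \<gamma>\<^sub>ksi)"
  using \<gamma> by algebra+
 have vv: "cdot v\<^sub>x v = - cdot v v\<^sub>x" "cdot v\<^sub>ksi v = - cdot v v\<^sub>ksi" using v(4,5) by (simp_all add: eq_neg_iff_add_eq_0)
 have "cdot p q = ?k * \<gamma>\<^sub>ksi * (- cdot v (B *v v) - cdot v v\<^sub>x) + ?k * \<gamma> * (- cdot v (B *v v\<^sub>ksi) + cdot v\<^sub>x v\<^sub>ksi) +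
   cnj \<gamma>\<^sub>x * \<gamma>\<^sub>ksi + cnj \<gamma>\<^sub>x * \<gamma> * cdot v v\<^sub>ksi"
  unfolding p_def q_def cdot_basic B vv v(3) by (simp add: algebra_simps)
 moreover have "cdot q p = cnj \<gamma>\<^sub>ksi * \<gamma> * (cdot v (B *v v) + cdot v v\<^sub>x) + cnj \<gamma>\<^sub>ksi * \<gamma>\<^sub>x +
   ?k * \<gamma> * (cdot v\<^sub>ksi (B *v v) + cdot v\<^sub>ksi v\<^sub>x) - ?k * \<gamma>\<^sub>x * cdot v v\<^sub>ksi"
  unfolding p_def q_def cdot_basic B vv v(3) by (simp add: algebra_simps)
 ultimately show ?g2 unfolding e using \<gamma>(1) by algebra
qed

lemma smooth2_bilinear:
 "bounded_bilinear pr ==> open W ==> smooth2 W f ==> smooth2 W g ==> smooth2 W (%x ksi. pr (f x ksi) (g x ksi))"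
 using smooth_on_bilinear[of pr W "%(x, ksi). f x ksi" "%(x, ksi). g x ksi"] by (simp add: case_prod_unfold)

text \<open>Complex scaling of vectors is the action of the scalar matrix \<open>mat c\<close>, so
  it inherits bilinearity from the matrix action.\<close>

lemma bounded_bilinear_smult: "bounded_bilinear ((*s) :: complex => complex^'m::finite => complex^'m)"
proof -
 have "bounded_bilinear (%c v. mat c *v (v :: complex^'m))"
  by (rule bounded_bilinear.comp1[OF bounded_bilinear_matrix_vector])
   (rule linear_conv_bounded_linear[THEN iffD1], rule linearI, simp_all add: mat_def vec_eq_iff)
 then show ?thesis by (simp add: mat_vector)
qed

text \<open>\<open>v = \<gamma> Q u\<close> with \<open>|\<gamma>| = 1\<close>, so the choice of eigenvectors on both sides is arbitrary.\<close>

lemma bracket_change: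
 fixes a :: "('n::finite, 'm::finite) symb" and h :: "real^'n => real^'n => real" and v u :: "real^'n => real^'n => complex^'m"
  and Q :: "real^'n => complex^'m^'m" and c :: complex
 assumes W: "open W" "(x, ksi) \<in> W" and sm: "smooth2 W a" "smooth2 W h" "smooth2 W u" "smooth2 W v"
  and U: "open U" "W \<subseteq> U \<times> UNIV" and Q: "smooth_on U Q" "!!y. y \<in> U ==> hconj (Q y) ** Q y = mat 1"
  and hs: "!!y eta. (y, eta) \<in> W ==> herm_simple (a y eta)"
  and u: "!!y eta. (y, eta) \<in> W ==> norm (u y eta) = 1 \<and> a y eta *v u y eta = of_real (h y eta) *s u y eta"
  and v: "!!y eta. (y, eta) \<in> W ==> norm (v y eta) = 1 \<and> (Q y ** a y eta ** hconj (Q y)) *v v y eta = of_real (h y eta) *s v y eta"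
 defines "f \<equiv> %\<alpha> y eta. cdot (u y eta) ((hconj (Q y) ** pd \<alpha> Q y) *v u y eta)"
 defines "I \<equiv> %w P M. cdot (w x ksi) (P *v w x ksi) - \<i> / 2 * bracket3 w (%x ksi. M x ksi - mat (of_real (h x ksi))) w x ksi + c * of_real (h x ksi) * bracket2 w w x ksi"
 shows "I v (Q x ** X ** hconj (Q x) + cscale (\<i> / 2) (\<Sum>\<alpha>\<in>UNIV. pd \<alpha> Q x ** d\<xi> \<alpha> a x ksi ** hconj (Q x) - Q x ** d\<xi> \<alpha> a x ksi ** pd \<alpha> (%y. hconj (Q y)) x))
   (%x ksi. Q x ** a x ksi ** hconj (Q x)) - I u X a =
  (\<Sum>\<alpha>\<in>UNIV. \<i> * of_real (d\<xi> \<alpha> h x ksi) * f \<alpha> x ksi - c * of_real (h x ksi) * d\<xi> \<alpha> (f \<alpha>) x ksi)"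
  and "smooth2 W (f \<alpha>)"
proof -
 have QQ: "hconj (Q y) *v (Q y *v w) = w" "Q y *v (hconj (Q y) *v w) = w" if "y \<in> U" for y w
  using Q(2)[OF that] matrix_left_right_inverse[THEN iffD1, OF Q(2)[OF that]] by (simp_all add: matrix_vector_mul_assoc)
 have WU: "y \<in> U" if "(y, eta) \<in> W" for y eta using that U by auto
 note xU = WU[OF W(2)]
 have dQ: "Q differentiable (at y)" if "y \<in> U" for y using smooth_on_differentiable[OF Q(1) that] .
 have proj: "smooth2 W (%x ksi. g x)" if "smooth_on U g" for g :: "real^'n => complex^'m^'m"
  using smooth_on_compose[OF W(1) U(1) smooth_on_fst[OF W(1)] that] WU by (auto simp: case_prod_unfold)
 have Q2: "smooth2 W (%x ksi. Q x)" by (rule proj[OF Q(1)])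
 have h1: "smooth_on U (%y. hconj (Q y))" by (rule smooth_on_bounded_linear[OF bounded_linear_hconj U(1) Q(1)])
 have h2: "smooth2 W (%x ksi. hconj (Q x))" by (rule proj[OF h1])
 have pQ: "smooth2 W (%x ksi. pd \<alpha> Q x)" for \<alpha> using proj[OF smooth_on_derivative[OF Q(1)]] by (simp add: pd_def)
 define b where "b y \<alpha> = hconj (Q y) ** pd \<alpha> Q y" for y \<alpha>
 have sb: "smooth2 W (%y eta. b y \<alpha>)" for \<alpha>
  unfolding b_def by (rule smooth2_bilinear[OF bounded_bilinear_matrix_mult W(1) h2 pQ])
 have sbu: "smooth2 W (%y eta. b y \<alpha> *v u y eta)" for \<alpha>
  by (rule smooth2_bilinear[OF bounded_bilinear_matrix_vector W(1) sb sm(3)])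
 show fs: "smooth2 W (f \<alpha>)" for \<alpha>
  using smooth2_bilinear[OF bounded_bilinear_cdot W(1) sm(3) sbu] unfolding f_def b_def .
 have df: "d\<xi> \<alpha> (f \<alpha>) x ksi = cdot (d\<xi> \<alpha> u x ksi) (b x \<alpha> *v u x ksi) + cdot (u x ksi) (b x \<alpha> *v d\<xi> \<alpha> u x ksi)" for \<alpha>
  using d\<xi>_bilinear[OF bounded_bilinear_cdot sm(3) sbu W(2), of \<alpha> \<alpha>] d\<xi>_bilinear[OF bounded_bilinear_matrix_vector sb sm(3) W(2), of \<alpha> \<alpha>]
  by (simp add: f_def b_def[symmetric] d\<xi>_const bounded_bilinear.zero_left[OF bounded_bilinear_matrix_vector])
 \<comment> \<open>Simplicity of the eigenvalue makes \<open>v\<close> a multiple of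
   \<open>Q\<close> applied to \<open>u\<close>; written as an inner product, the factor is visibly
   smooth.\<close>
 define \<gamma> where "\<gamma> y eta = cdot (u y eta) (hconj (Q y) *v v y eta)" for y eta
 have shv: "smooth2 W (%y eta. hconj (Q y) *v v y eta)" by (rule smooth2_bilinear[OF bounded_bilinear_matrix_vector W(1) h2 sm(4)])
 have s\<gamma>: "smooth2 W \<gamma>" unfolding \<gamma>_def by (rule smooth2_bilinear[OF bounded_bilinear_cdot W(1) sm(3) shv])
 have vu: "v y eta = Q y *v (\<gamma> y eta *s u y eta)" and \<gamma>1: "cnj (\<gamma> y eta) * \<gamma> y eta = 1" and uu: "cdot (u y eta) (u y eta) = 1" if y: "(y, eta) \<in> W" for y eta
 proof -
  let ?w = "hconj (Q y) *v v y eta"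
  have "a y eta *v ?w = hconj (Q y) *v (Q y *v (a y eta *v ?w))" using QQ(1)[OF WU[OF y]] by simp
  also have "... = of_real (h y eta) *s ?w" using v[OF y] by (simp add: matrix_vector_simps)
  finally have "?w = \<gamma> y eta *s u y eta"
   unfolding \<gamma>_def using u[OF y] by (intro eigenvector_unique[OF hs[OF y], of "u y eta" "h y eta"]) auto
  then show e: "v y eta = Q y *v (\<gamma> y eta *s u y eta)" using QQ(2)[OF WU[OF y], of "v y eta"] by simp
  show uu: "cdot (u y eta) (u y eta) = 1" using u[OF y] by (simp add: cdot_self)
  have "1 = cdot (v y eta) (v y eta)" using v[OF y] by (simp add: cdot_self)
  also have "... = cnj (\<gamma> y eta) * \<gamma> y eta"
   unfolding e by (simp add: cdot_hconj QQ(1)[OF WU[OF y]] cdot_basic uu)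
  finally show "cnj (\<gamma> y eta) * \<gamma> y eta = 1" ..
 qed
 have sgu: "smooth2 W (%y eta. \<gamma> y eta *s u y eta)" by (rule smooth2_bilinear[OF bounded_bilinear_smult W(1) s\<gamma> sm(3)])
 have pdx: "dx \<alpha> (%y eta. Q y) x ksi = Q x ** b x \<alpha>" for \<alpha>
  unfolding b_def dx_of_x[OF dQ[OF xU]] using matrix_left_right_inverse[THEN iffD1, OF Q(2)[OF xU]] by (simp add: matrix_mul_assoc)
 have vx: "dx \<alpha> v x ksi = Q x *v (\<gamma> x ksi *s (b x \<alpha> *v u x ksi + dx \<alpha> u x ksi) + dx \<alpha> \<gamma> x ksi *s u x ksi)" for \<alpha>
 proof -
  have "dx \<alpha> v x ksi = dx \<alpha> (%y eta. Q y *v (\<gamma> y eta *s u y eta)) x ksi" by (rule dx_cong[OF W]) (rule vu)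
  also have "... = (Q x ** b x \<alpha>) *v (\<gamma> x ksi *s u x ksi) + Q x *v (dx \<alpha> \<gamma> x ksi *s u x ksi + \<gamma> x ksi *s dx \<alpha> u x ksi)"
   by (simp only: dx_bilinear[OF bounded_bilinear_matrix_vector Q2 sgu W(2)] dx_bilinear[OF bounded_bilinear_smult s\<gamma> sm(3) W(2)] pdx)
  finally show ?thesis by (simp add: matrix_vector_simps vector_add_ldistrib)
 qed
 have vksi: "d\<xi> \<alpha> v x ksi = Q x *v (d\<xi> \<alpha> \<gamma> x ksi *s u x ksi + \<gamma> x ksi *s d\<xi> \<alpha> u x ksi)" for \<alpha>
 proof -
  have "d\<xi> \<alpha> v x ksi = d\<xi> \<alpha> (%y eta. Q y *v (\<gamma> y eta *s u y eta)) x ksi" by (rule d\<xi>_cong[OF W]) (rule vu)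
  then show ?thesis
   by (simp add: d\<xi>_bilinear[OF bounded_bilinear_matrix_vector Q2 sgu W(2)] d\<xi>_bilinear[OF bounded_bilinear_smult s\<gamma> sm(3) W(2)] d\<xi>_const
    bounded_bilinear.zero_left[OF bounded_bilinear_matrix_vector])
 qed
 define B where "B \<alpha> = b x \<alpha>" for \<alpha>
 \<comment> \<open>The derivative of \<open>hconj (Q y) ** Q y = mat 1\<close>; it makes
   \<open>B \<alpha>\<close> antihermitian.\<close>
 have hB: "pd \<alpha> (%y. hconj (Q y)) x ** Q x = - B \<alpha>" for \<alpha>
 proof -
  have "dx \<alpha> (%y eta. hconj (Q y) ** Q y) x ksi = dx \<alpha> (%y eta. mat 1) x ksi"
   by (rule dx_cong[OF W]) (use Q(2) WU in blast)
  then have "pd \<alpha> (%y. hconj (Q y)) x ** Q x + hconj (Q x) ** pd \<alpha> Q x = 0"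
   by (simp add: dx_bilinear[OF bounded_bilinear_matrix_mult h2 Q2 W(2)] dx_of_x[OF dQ[OF xU]] dx_of_x[OF smooth_on_differentiable[OF h1 xU]] dx_const)
  then show ?thesis by (simp add: B_def b_def eq_neg_iff_add_eq_0)
 qed
 have pdh: "pd \<alpha> (%y. hconj (Q y)) x = hconj (pd \<alpha> Q x)" for \<alpha>
  unfolding pd_def by (subst frechet_derivative_eqI[OF bounded_linear.has_derivative[OF bounded_linear_hconj smooth_on_has_derivative[OF Q(1) xU]]]) simp
 have anti: "cdot (B \<alpha> *v w) z = - cdot w (B \<alpha> *v z)" for \<alpha> w z
 proof -
  have "cdot (B \<alpha> *v w) z = cdot w ((pd \<alpha> (%y. hconj (Q y)) x ** Q x) *v z)"
   by (simp add: B_def b_def matrix_vector_simps cdot_hconj hconj_hconj pdh)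
  then show ?thesis unfolding hB by (simp add: cdot_def matrix_vector_mult_def sum_negf)
 qed
 have z2: "smooth2 W (%y eta. of_real (h y eta) :: complex)"
  using smooth_on_bounded_linear[OF bounded_linear_of_real W(1) sm(2)] by (simp add: case_prod_unfold)
 have dh: "d\<xi> \<alpha> (%y eta. of_real (h y eta) :: complex) x ksi = of_real (d\<xi> \<alpha> h x ksi)" for \<alpha>
  using d\<xi>_bounded_linear[OF bounded_linear_of_real sm(2) W(2)] .
 have da: "a x ksi *v d\<xi> \<alpha> u x ksi + d\<xi> \<alpha> a x ksi *v u x ksi = of_real (h x ksi) *s d\<xi> \<alpha> u x ksi + of_real (d\<xi> \<alpha> h x ksi) *s u x ksi" for \<alpha>
 proof -
  have "d\<xi> \<alpha> (%y eta. a y eta *v u y eta) x ksi = d\<xi> \<alpha> (%y eta. of_real (h y eta) *s u y eta) x ksi"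
   by (rule d\<xi>_cong[OF W]) (use u in blast)
  then show ?thesis
   by (simp add: d\<xi>_bilinear[OF bounded_bilinear_matrix_vector sm(1,3) W(2)] d\<xi>_bilinear[OF bounded_bilinear_smult z2 sm(3) W(2)] dh add.commute)
 qed
 have ha: "hconj (d\<xi> \<alpha> a x ksi) = d\<xi> \<alpha> a x ksi" for \<alpha>
 proof -
  have "d\<xi> \<alpha> (%y eta. hconj (a y eta)) x ksi = d\<xi> \<alpha> a x ksi" by (rule d\<xi>_cong[OF W]) (use hs in \<open>auto simp: herm_simple_def\<close>)
  then show ?thesis using d\<xi>_bounded_linear[OF bounded_linear_hconj sm(1) W(2)] by simp
 qed
 have un: "cdot (dx \<alpha> u x ksi) (u x ksi) + cdot (u x ksi) (dx \<alpha> u x ksi) = 0" "cdot (d\<xi> \<alpha> u x ksi) (u x ksi) + cdot (u x ksi) (d\<xi> \<alpha> u x ksi) = 0" for \<alpha>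
 proof -
  have "dx \<alpha> (%y eta. cdot (u y eta) (u y eta)) x ksi = dx \<alpha> (%y eta. 1) x ksi" "d\<xi> \<alpha> (%y eta. cdot (u y eta) (u y eta)) x ksi = d\<xi> \<alpha> (%y eta. 1) x ksi"
   by (rule dx_cong[OF W] d\<xi>_cong[OF W]; erule uu)+
  then show "cdot (dx \<alpha> u x ksi) (u x ksi) + cdot (u x ksi) (dx \<alpha> u x ksi) = 0" "cdot (d\<xi> \<alpha> u x ksi) (u x ksi) + cdot (u x ksi) (d\<xi> \<alpha> u x ksi) = 0"
   by (simp_all add: dx_bilinear[OF bounded_bilinear_cdot sm(3,3) W(2)] d\<xi>_bilinear[OF bounded_bilinear_cdot sm(3,3) W(2)] d\<xi>_const dx_const)
 qed
 have gn: "cnj (dx \<alpha> \<gamma> x ksi) * \<gamma> x ksi + cnj (\<gamma> x ksi) * dx \<alpha> \<gamma> x ksi = 0" "cnj (d\<xi> \<alpha> \<gamma> x ksi) * \<gamma> x ksi + cnj (\<gamma> x ksi) * d\<xi> \<alpha> \<gamma> x ksi = 0" for \<alpha>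
 proof -
  have bb: "bounded_bilinear (%a b. cnj a * b)" by (rule bounded_bilinear.comp1[OF bounded_bilinear_mult bounded_linear_cnj])
  have "dx \<alpha> (%y eta. cnj (\<gamma> y eta) * \<gamma> y eta) x ksi = dx \<alpha> (%y eta. 1) x ksi" "d\<xi> \<alpha> (%y eta. cnj (\<gamma> y eta) * \<gamma> y eta) x ksi = d\<xi> \<alpha> (%y eta. 1) x ksi"
   by (rule dx_cong[OF W] d\<xi>_cong[OF W]; erule \<gamma>1)+
  then show "cnj (dx \<alpha> \<gamma> x ksi) * \<gamma> x ksi + cnj (\<gamma> x ksi) * dx \<alpha> \<gamma> x ksi = 0" "cnj (d\<xi> \<alpha> \<gamma> x ksi) * \<gamma> x ksi + cnj (\<gamma> x ksi) * d\<xi> \<alpha> \<gamma> x ksi = 0"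
   by (simp_all add: dx_bilinear[OF bb s\<gamma> s\<gamma> W(2)] d\<xi>_bilinear[OF bb s\<gamma> s\<gamma> W(2)] d\<xi>_const dx_const)
 qed
 have H: "hconj (a x ksi) = a x ksi" using hs[OF W(2)] by (simp add: herm_simple_def)
 let ?p = "%\<alpha>. \<gamma> x ksi *s (B \<alpha> *v u x ksi + dx \<alpha> u x ksi) + dx \<alpha> \<gamma> x ksi *s u x ksi"
 let ?q = "%\<alpha>. d\<xi> \<alpha> \<gamma> x ksi *s u x ksi + \<gamma> x ksi *s d\<xi> \<alpha> u x ksi"
 let ?L = "a x ksi - mat (of_real (h x ksi))"
 \<comment> \<open>This expression enters with i/2 through the new subprincipal symbol and with -i/2
   through the triple bracket, so it cancels; what the triple bracket leaves behind is the term i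
   h_xi f.\<close>
 let ?bab = "%\<alpha>. cdot (u x ksi) (B \<alpha> *v (d\<xi> \<alpha> a x ksi *v u x ksi)) + cdot (u x ksi) (d\<xi> \<alpha> a x ksi *v (B \<alpha> *v u x ksi))"
 note bt = bracket_terms[OF H ha anti u[OF W(2), THEN conjunct2] da uu[OF W(2)] un \<gamma>1[OF W(2)] gn]
 have QL: "cdot (Q x *v p) ((Q x ** a x ksi ** hconj (Q x) - mat (of_real (h x ksi))) *v (Q x *v q)) = cdot p (?L *v q)" for p q
  by (simp add: matrix_diff_vector mat_vector matrix_vector_simps QQ[OF xU] cdot_hconj bounded_bilinear.diff_right[OF bounded_bilinear_matrix_vector])
 have Q0: "cdot (Q x *v p) (Q x *v q) = cdot p q" for p q by (simp add: cdot_hconj QQ[OF xU])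
 have b3: "bracket3 v (%x ksi. Q x ** a x ksi ** hconj (Q x) - mat (of_real (h x ksi))) v x ksi =
   bracket3 u (%x ksi. a x ksi - mat (of_real (h x ksi))) u x ksi + (\<Sum>\<alpha>\<in>UNIV. ?bab \<alpha> - 2 * of_real (d\<xi> \<alpha> h x ksi) * f \<alpha> x ksi)"
  unfolding bracket3_def vx vksi QL B_def[symmetric] bt(1) by (simp add: sum.distrib sum_subtractf f_def b_def[symmetric] B_def)
 have b2: "bracket2 v v x ksi = bracket2 u u x ksi - (\<Sum>\<alpha>\<in>UNIV. d\<xi> \<alpha> (f \<alpha>) x ksi)"
  unfolding bracket2_def vx vksi Q0 B_def[symmetric] bt(2) df by (simp add: sum.distrib sum_subtractf B_def add.commute)
 let ?S = "\<Sum>\<alpha>\<in>UNIV. pd \<alpha> Q x ** d\<xi> \<alpha> a x ksi ** hconj (Q x) - Q x ** d\<xi> \<alpha> a x ksi ** pd \<alpha> (%y. hconj (Q y)) x"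
 have "cdot (v x ksi) ((Q x ** X ** hconj (Q x) + cscale (\<i> / 2) ?S) *v v x ksi) = cdot (u x ksi) (X *v u x ksi) + \<i> / 2 * (\<Sum>\<alpha>\<in>UNIV. ?bab \<alpha>)"
 proof -
  let ?g = "\<gamma> x ksi"
  have g: "cdot (?g *s p) (?g *s q) = cdot p q" for p q
  proof -
   have "cdot (?g *s p) (?g *s q) = (cnj ?g * ?g) * cdot p q" by (simp add: cdot_basic(1,2))
   then show ?thesis unfolding \<gamma>1[OF W(2)] by simp
  qed
  have 1: "cdot (v x ksi) ((Q x ** M ** N) *v v x ksi) = cdot (u x ksi) (M *v ((N ** Q x) *v u x ksi))" for M N :: "complex^'m^'m"
   unfolding vu[OF W(2)] by (simp add: matrix_vector_simps cdot_hconj QQ[OF xU] g)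
  have 2: "pd \<alpha> Q x = Q x ** B \<alpha>" for \<alpha> using pdx[of \<alpha>] by (simp add: dx_of_x[OF dQ[OF xU]] B_def)
  have "cdot (v x ksi) (?S *v v x ksi) = (\<Sum>\<alpha>\<in>UNIV. cdot (v x ksi) ((pd \<alpha> Q x ** d\<xi> \<alpha> a x ksi ** hconj (Q x) - Q x ** d\<xi> \<alpha> a x ksi ** pd \<alpha> (%y. hconj (Q y)) x) *v v x ksi))"
   by (simp add: bounded_bilinear.sum_left[OF bounded_bilinear_matrix_vector] bounded_bilinear.sum_right[OF bounded_bilinear_cdot])
  also have "... = (\<Sum>\<alpha>\<in>UNIV. ?bab \<alpha>)"
  proof (rule sum.cong[OF refl])
   fix \<alpha>
   have "Q x ** B \<alpha> ** d\<xi> \<alpha> a x ksi ** hconj (Q x) = Q x ** (B \<alpha> ** d\<xi> \<alpha> a x ksi) ** hconj (Q x)" by (simp add: matrix_mul_assoc)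
   then show "cdot (v x ksi) ((pd \<alpha> Q x ** d\<xi> \<alpha> a x ksi ** hconj (Q x) - Q x ** d\<xi> \<alpha> a x ksi ** pd \<alpha> (%y. hconj (Q y)) x) *v v x ksi) = ?bab \<alpha>"
    by (simp only: matrix_diff_vector bounded_bilinear.diff_right[OF bounded_bilinear_cdot] 1 2 hB Q(2)[OF xU])
     (simp add: matrix_vector_simps bounded_bilinear.minus_left[OF bounded_bilinear_matrix_vector]
      bounded_bilinear.minus_right[OF bounded_bilinear_matrix_vector] bounded_bilinear.minus_right[OF bounded_bilinear_cdot])
  qed
  finally show ?thesis unfolding matrix_vector_simps(3,4) cdot_basic(4,2) 1 Q(2)[OF xU] by simp
 qed
 then show "I v (Q x ** X ** hconj (Q x) + cscale (\<i> / 2) ?S) (%x ksi. Q x ** a x ksi ** hconj (Q x)) - I u X a =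
  (\<Sum>\<alpha>\<in>UNIV. \<i> * of_real (d\<xi> \<alpha> h x ksi) * f \<alpha> x ksi - c * of_real (h x ksi) * d\<xi> \<alpha> (f \<alpha>) x ksi)"
  unfolding I_def b3 b2 by (simp add: sum_subtractf sum_distrib_left algebra_simps)
qed

subsection \<open>Integrals of homogeneous functions\<close>

lemma integrable_bounded_support:
 fixes g :: "'a::euclidean_space => 'b::{banach,second_countable_topology}"
 assumes "g \<in> borel_measurable borel" "!!y. norm (g y) \<le> B" "!!y. norm y > r ==> g y = 0"
 shows "integrable lborel g"
 by (rule integrableI_bounded_set[where A = "cball 0 r" and B = B])
  (use assms emeasure_bounded_finite[OF bounded_cball, of "0::'a" r] in \<open>auto simp: not_le\<close>)

text \<open>Layer cake: 1 - h^k is the integral of k s^(k-1) over s from h to 1. By Fubini and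
  scaling, the region h < s contributes s^n times the integral over h < 1, where n is the dimension,
  and integrating k s^(n+k-1) over [0,1] gives k/(n+k). So a weight h^k merely multiplies the
  integral by n/(n+k).\<close>

lemma homogeneous_moment:
 fixes h :: "'a::euclidean_space => real" and G :: "'a => 'b::{banach,second_countable_topology}"
 assumes hm[measurable]: "h \<in> borel_measurable borel" and Gm[measurable]: "G \<in> borel_measurable borel"
  and h0: "c > 0" "!!y. c * norm y \<le> h y" and hh: "!!t y. t > 0 ==> h (t *\<^sub>R y) = t * h y"
  and Gh: "!!t y. t > 0 ==> G (t *\<^sub>R y) = G y" and M: "!!y. norm (G y) \<le> M"
 shows "integrable lborel (%y. (if h y < 1 then h y ^ k else 0) *\<^sub>R G y)" (is "?I k")
  and "real (DIM('a) + k) *\<^sub>R (\<integral>y. (if h y < 1 then h y ^ k else 0) *\<^sub>R G y \<partial>lborel) =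
   real DIM('a) *\<^sub>R (\<integral>y. (if h y < 1 then 1 else 0) *\<^sub>R G y \<partial>lborel)"
proof -
 have hp: "0 \<le> h y" for y using h0 by (meson mult_nonneg_nonneg norm_ge_zero order_trans less_imp_le)
 have M0: "0 \<le> M" using M norm_ge_zero order_trans by blast
 have far: "\<not> h y < 1" if "norm y > 1 / c" for y
  using that h0(1) h0(2)[of y] by (simp add: pos_divide_less_eq mult.commute)
 show int: "?I k" for k
 proof (rule integrable_bounded_support[where B = M and r = "1 / c"])
  show "norm ((if h y < 1 then h y ^ k else 0) *\<^sub>R G y) \<le> M" for y
   using M[of y] M0 hp[of y] by (auto simp: mult_left_le_one_le power_le_one intro: order_trans[OF mult_left_le_one_le])
 qed (use far in auto)
 let ?w = "\<integral>y. (if h y < 1 then 1 else 0) *\<^sub>R G y \<partial>lborel"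
 have scale: "(\<integral>y. (if h y < s then 1 else 0) *\<^sub>R G y \<partial>lborel) = s ^ DIM('a) *\<^sub>R ?w" if s: "s \<ge> 0" for s
 proof (cases "s = 0")
  case True
  then show ?thesis using hp by (simp add: not_less[THEN iffD2])
 next
  case False
  then have "s > 0" using s by simp
  then show ?thesis
   by (subst lborel_integral_affine[of _ s 0]) (simp_all add: hh Gh mult_less_cancel_left_pos[of s _ 1, simplified])
 qed
 show "real (DIM('a) + k) *\<^sub>R (\<integral>y. (if h y < 1 then h y ^ k else 0) *\<^sub>R G y \<partial>lborel) = real DIM('a) *\<^sub>R ?w"
 proof (cases k)
  case 0 then show ?thesis by (simp cong: if_cong)
 next
  case (Suc j)
  define F where "F s y = (real k * (s ^ j * indicator {0..1} s) * (if h y < s then 1 else 0)) *\<^sub>R G y" for s :: real and y :: 'a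
  have "integrable (lborel \<Otimes>\<^sub>M lborel) (case_prod F)"
  proof (rule integrableI_bounded_set[where A = "{0..1} \<times> cball 0 (1 / c)" and B = "real k * M"])
   show "case_prod F \<in> borel_measurable (lborel \<Otimes>\<^sub>M lborel)" unfolding F_def by measurable
   show "emeasure (lborel \<Otimes>\<^sub>M lborel) ({0..1::real} \<times> cball (0::'a) (1 / c)) < \<infinity>"
    using emeasure_bounded_finite[OF bounded_cball, of "0::'a" "1 / c"]
    by (subst lborel.emeasure_pair_measure_Times) (auto simp: ennreal_mult_less_top)
   show "AE x in lborel \<Otimes>\<^sub>M lborel. x \<in> {0..1} \<times> cball 0 (1 / c) --> norm (case_prod F x) \<le> real k * M"
   proof (rule AE_I2, clarify)
    fix s y assume "s \<in> {0..1::real}"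
    then have "\<bar>real k * (s ^ j * indicator {0..1} s) * (if h y < s then 1 else 0)\<bar> \<le> real k"
     by (auto simp: abs_mult power_le_one mult_left_le)
    then show "norm (F s y) \<le> real k * M" unfolding F_def norm_scaleR by (intro mult_mono M) auto
   qed
   show "AE x in lborel \<Otimes>\<^sub>M lborel. x \<notin> {0..1} \<times> cball 0 (1 / c) --> case_prod F x = 0"
   proof (intro AE_I2 impI)
    fix x :: "real \<times> 'a" assume "x \<notin> {0..1} \<times> cball 0 (1 / c)"
    then show "case_prod F x = 0"
     using far[of "snd x"] by (cases x; cases "fst x \<in> {0..1}"; cases "h (snd x) < fst x") (auto simp: F_def not_le)
   qed
  qed (auto intro!: pair_measureI)
  from lborel_pair.Fubini_integral[OF this]
  have Fub: "(\<integral>y. (\<integral>s. F s y \<partial>lborel) \<partial>lborel) = (\<integral>s. (\<integral>y. F s y \<partial>lborel) \<partial>lborel)" .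
  have pw: "integrable lborel (%s::real. s ^ i * indicator {a..b} s)" for i a b
   by (rule borel_integrable_atLeastAtMost) (auto intro!: continuous_intros)
  have Fy: "(\<integral>y. F s y \<partial>lborel) = (real k * (s ^ (j + DIM('a)) * indicator {0..1} s)) *\<^sub>R ?w" for s
  proof (cases "s \<in> {0..1}")
   case True
   have sc: "(\<integral>y. (if h y < s then 1 else 0) *\<^sub>R G y \<partial>lborel) = s ^ DIM('a) *\<^sub>R ?w" by (rule scale) (use True in simp)
   have "(\<integral>y. F s y \<partial>lborel) = (real k * (s ^ j * indicator {0..1} s)) *\<^sub>R (\<integral>y. (if h y < s then 1 else 0) *\<^sub>R G y \<partial>lborel)"
   proof -
    have e: "F s y = (real k * (s ^ j * indicator {0..1} s)) *\<^sub>R ((if h y < s then 1 else 0) *\<^sub>R G y)" for y by (simp add: F_def)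
    show ?thesis unfolding e by (rule integral_scaleR_right)
   qed
   then show ?thesis unfolding sc scaleR_scaleR by (simp add: power_add mult_ac)
  qed (simp add: F_def)
  have "(\<integral>s. (\<integral>y. F s y \<partial>lborel) \<partial>lborel) = (\<integral>s. real k * (s ^ (j + DIM('a)) * indicator {0..1} s) \<partial>lborel) *\<^sub>R ?w"
   unfolding Fy by (rule integral_scaleR_left) (intro integrable_mult_right pw)
  also have "(\<integral>s. real k * (s ^ (j + DIM('a)) * indicator {0..1} s) \<partial>lborel) = real k / real (DIM('a) + k)"
   by (simp only: integral_mult_right_zero integral_power[OF zero_le_one]) (simp add: Suc add.commute)
  finally have right: "(\<integral>s. (\<integral>y. F s y \<partial>lborel) \<partial>lborel) = (real k / real (DIM('a) + k)) *\<^sub>R ?w" .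
  have left: "(\<integral>s. F s y \<partial>lborel) = (if h y < 1 then 1 else 0) *\<^sub>R G y - (if h y < 1 then h y ^ k else 0) *\<^sub>R G y" for y
  proof (cases "h y < 1")
   case False
   then have "F s y = 0" for s by (auto simp: F_def indicator_def)
   then show ?thesis using False by simp
  next
   case True
   have "(\<integral>s. F s y \<partial>lborel) = (\<integral>s. (real k * (s ^ j * indicator {h y..1} s)) *\<^sub>R G y \<partial>lborel)"
   proof (rule integral_cong_AE)
    \<comment> \<open>\<open>F\<close> has the strict inequality \<open>h y < s\<close>, the power
      integral a closed interval; they differ only at the point \<open>s = h y\<close>.\<close>
    show "AE s in lborel. F s y = (real k * (s ^ j * indicator {h y..1} s)) *\<^sub>R G y"
     by (rule eventually_mono[OF AE_lborel_singleton[of "h y"]]) (use hp[of y] in \<open>auto simp: F_def indicator_def\<close>)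
   qed (simp_all add: F_def)
   also have "... = (\<integral>s. real k * (s ^ j * indicator {h y..1} s) \<partial>lborel) *\<^sub>R G y"
    by (rule integral_scaleR_left, intro integrable_mult_right pw)
   also have "(\<integral>s. real k * (s ^ j * indicator {h y..1} s) \<partial>lborel) = 1 - h y ^ k"
    by (simp only: integral_mult_right_zero integral_power[OF less_imp_le[OF True]]) (simp add: Suc)
   finally show ?thesis using True by (simp add: scaleR_left_diff_distrib)
  qed
  have "(\<integral>y. (\<integral>s. F s y \<partial>lborel) \<partial>lborel) = ?w - (\<integral>y. (if h y < 1 then h y ^ k else 0) *\<^sub>R G y \<partial>lborel)"
   unfolding left using int[of 0] int[of k] by (intro Bochner_Integration.integral_diff) (simp_all cong: if_cong)
  then have e: "(\<integral>y. (if h y < 1 then h y ^ k else 0) *\<^sub>R G y \<partial>lborel) = ?w - (real k / real (DIM('a) + k)) *\<^sub>R ?w"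
   using Fub right by (simp add: algebra_simps)
  have "K *\<^sub>R (w - (r / K) *\<^sub>R w) = (K - r) *\<^sub>R w" if "K \<noteq> 0" for K r :: real and w :: 'b
   using that by (simp add: scaleR_right_diff_distrib scaleR_left_diff_distrib)
  note sol = this[where r = "real k" and w = ?w]
  have "real (DIM('a) + k) \<noteq> 0" using Suc by simp
  from sol[OF this] show ?thesis unfolding e by simp
 qed
qed

text \<open>Squaring removes the corner: at 0 the difference quotient is \<open>max 0 z\<close>
  itself, which is continuous.\<close>

lemma DERIV_positive_part_square: "((%u::real. (max 0 u)\<^sup>2) has_real_derivative 2 * max 0 u) (at u)"
proof -
 consider "u < 0" | "u = 0" | "u > 0" by linarith
 then show ?thesis
 proof cases
  case 1
  have "((%u::real. 0) has_real_derivative 2 * max 0 u) (at u)" using 1 by simp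
  then show ?thesis by (rule has_field_derivative_transform_within_open[where S = "{..<0}"]) (use 1 in auto)
 next
  case 2
  have "isCont (%z::real. max 0 z) 0" by (intro continuous_intros)
  moreover have "(max 0 z)\<^sup>2 - (max 0 0)\<^sup>2 = max 0 z * (z - 0)" for z :: real by (simp add: power2_eq_square max_def)
  ultimately show ?thesis unfolding CARAT_DERIV 2 by (intro exI[of _ "%z. max 0 z"]) simp
 next
  case 3
  have "((%u::real. u\<^sup>2) has_real_derivative 2 * max 0 u) (at u)" using 3 by (auto intro!: derivative_eq_intros)
  then show ?thesis by (rule has_field_derivative_transform_within_open[where S = "{0<..}"]) (use 3 in auto)
 qed
qed

lemma derivative_homogeneous:
 assumes f: "smooth_on (- {0}) f" and hom: "!!y. y \<noteq> 0 ==> f (t *\<^sub>R y) = c *\<^sub>R f y" and t: "t \<noteq> 0" and y: "y \<noteq> 0"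
 shows "t *\<^sub>R frechet_derivative f (at (t *\<^sub>R y)) v = c *\<^sub>R frechet_derivative f (at y) v"
proof -
 let ?D = "%y. frechet_derivative f (at y)"
 have D: "(f has_derivative ?D z) (at z)" if "z \<noteq> 0" for z using smooth_on_has_derivative[OF f] that by simp
 have "((%y. f (t *\<^sub>R y)) has_derivative (%v. ?D (t *\<^sub>R y) (t *\<^sub>R v))) (at y)"
  by (rule has_derivative_compose[OF has_derivative_scaleR_right[OF has_derivative_ident] D]) (use t y in auto)
 moreover have "((%y. f (t *\<^sub>R y)) has_derivative (%v. c *\<^sub>R ?D y v)) (at y)"
  by (rule has_derivative_transform_within_open[where s = "- {0}", OF has_derivative_scaleR_right[OF D[OF y]]]) (use y hom in auto)
 ultimately have "?D (t *\<^sub>R y) (t *\<^sub>R v) = c *\<^sub>R ?D y v" using has_derivative_unique by metis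
 then show ?thesis using linear_scale[OF has_derivative_linear[OF D[of "t *\<^sub>R y"]]] t y by simp
qed

lemma sphere_bound:
 fixes g :: "real^'n::finite => 'b::real_normed_vector"
 assumes "continuous_on (- {0}) g" shows "\<exists>C\<ge>0. \<forall>y. norm y = 1 --> norm (g y) \<le> C"
proof -
 have "bounded (g ` sphere 0 1)"
  by (rule compact_imp_bounded[OF compact_continuous_image[OF continuous_on_subset[OF assms] compact_sphere]]) auto
 then show ?thesis unfolding bounded_iff using order_trans[OF norm_ge_zero] by (metis (no_types) abs_ge_self abs_ge_zero image_eqI mem_sphere_0 order_trans)
qed

lemma derivative_sphere_bound:
 fixes f :: "real^'n::finite => 'b::real_normed_vector"
 assumes f: "smooth_on (- {0}) f"
 shows "\<exists>C\<ge>0. \<forall>y v. norm y = 1 --> norm (frechet_derivative f (at y) v) \<le> C * norm v"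
proof -
 let ?D = "%y. frechet_derivative f (at y)"
 have "\<forall>i. \<exists>C\<ge>0. \<forall>y. norm y = 1 --> norm (?D y (axis i 1)) \<le> C"
  by (intro allI sphere_bound smooth_on_continuous smooth_on_derivative f)
 then obtain C where C: "!!i. C i \<ge> 0" "!!i y. norm y = 1 ==> norm (?D y (axis i 1)) \<le> C i" by metis
 have "norm (?D y v) \<le> (\<Sum>i\<in>UNIV. C i) * norm v" if y: "norm y = 1" for y v
 proof -
  have L: "linear (?D y)" by (rule has_derivative_linear[OF smooth_on_has_derivative[OF f]]) (use y in auto)
  have "?D y v = ?D y (\<Sum>i\<in>UNIV. v $ i *\<^sub>R axis i 1)" using basis_expansion[of v] by (simp add: scalar_mult_eq_scaleR)
  also have "... = (\<Sum>i\<in>UNIV. v $ i *\<^sub>R ?D y (axis i 1))" by (simp only: linear_sum[OF L] linear_scale[OF L])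
  also have "norm ... \<le> (\<Sum>i\<in>UNIV. norm v * C i)"
  proof (rule sum_norm_le)
   fix i show "norm (v $ i *\<^sub>R ?D y (axis i 1)) \<le> norm v * C i"
    using mult_mono[OF component_le_norm_cart C(2)[OF y]] by simp
  qed
  finally show ?thesis by (simp add: sum_distrib_left mult.commute)
 qed
 then show ?thesis using C(1) by (intro exI[of _ "\<Sum>i\<in>UNIV. C i"]) (auto intro: sum_nonneg)
qed

lemma normalized_bound:
 assumes "!!t y. t > 0 ==> y \<noteq> 0 ==> g (t *\<^sub>R y) = (g y :: 'b::real_normed_vector)" "!!y. norm y = 1 ==> norm (g y) \<le> C" "y \<noteq> 0"
 shows "norm (g y) \<le> C"
 using assms(1)[of "inverse (norm y)" y] assms(2)[of "inverse (norm y) *\<^sub>R y"] assms(3) by simp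

text \<open>The divergence theorem for \<open>\<chi>(h) f\<close>, where \<open>\<chi>(r) = (max 0 (r - r\<^sup>2))\<^sup>2\<close> makes the field differentiable at
 \<open>0\<close> and across \<open>h = 1\<close>; the weights in \<open>\<chi>\<close> are then removed by homogeneity.\<close>

lemma homogeneous_divergence:
 fixes h :: "real^'n::finite => real" and f :: "real^'n => complex" and \<alpha> :: 'n
 assumes hs: "smooth_on (- {0}) h" and fs: "smooth_on (- {0}) f" and hp: "!!y. y \<noteq> 0 ==> h y > 0"
  and hh: "!!t y. t > 0 ==> y \<noteq> 0 ==> h (t *\<^sub>R y) = t * h y" and fh: "!!t y. t > 0 ==> y \<noteq> 0 ==> f (t *\<^sub>R y) = f y"
 defines "P \<equiv> %y. indicator {y. y \<noteq> 0 \<and> h y < 1} y *\<^sub>R (frechet_derivative h (at y) (axis \<alpha> 1) *\<^sub>R f y)"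
  and "N \<equiv> %y. indicator {y. y \<noteq> 0 \<and> h y < 1} y *\<^sub>R (h y *\<^sub>R frechet_derivative f (at y) (axis \<alpha> 1))"
 shows "integrable lborel P" "integrable lborel N" "(\<integral>y. N y \<partial>lborel) = real (CARD('n) - 1) *\<^sub>R (\<integral>y. P y \<partial>lborel)"
proof -
 let ?h = "%y. indicator (- {0}) y *\<^sub>R h y"
 let ?Dh = "%y. frechet_derivative h (at y)" and ?Df = "%y. frechet_derivative f (at y)" and ?e = "axis \<alpha> (1::real)"
 define g1 where "g1 y = indicator (- {0}) y *\<^sub>R (?Dh y ?e *\<^sub>R f y)" for y
 define g2 where "g2 y = indicator (- {0}) y *\<^sub>R (h y *\<^sub>R ?Df y ?e)" for y
 have Bo: "- {0 :: real^'n} \<in> sets borel" by simp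
 note ct = smooth_on_continuous[OF hs] smooth_on_continuous[OF fs] smooth_on_continuous[OF smooth_on_derivative[OF hs]] smooth_on_continuous[OF smooth_on_derivative[OF fs]]
 have m: "?h \<in> borel_measurable borel" "g1 \<in> borel_measurable borel" "g2 \<in> borel_measurable borel"
  unfolding g1_def[abs_def] g2_def[abs_def] by (intro borel_measurable_continuous_on_indicator Bo continuous_on_scaleR ct)+
 have Dhh: "?Dh (t *\<^sub>R y) v = ?Dh y v" if "t > 0" "y \<noteq> 0" for t y v
  using derivative_homogeneous[OF hs, of t t y v] hh that by simp
 have Dfh: "t *\<^sub>R ?Df (t *\<^sub>R y) v = ?Df y v" if "t > 0" "y \<noteq> 0" for t y v
  using derivative_homogeneous[OF fs, of t 1 y v] fh that by simp
 have hom: "?h (t *\<^sub>R y) = t * ?h y" "g1 (t *\<^sub>R y) = g1 y" "g2 (t *\<^sub>R y) = g2 y" if "t > 0" for t y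
 proof -
  show "?h (t *\<^sub>R y) = t * ?h y" "g1 (t *\<^sub>R y) = g1 y" using that hh Dhh fh by (auto simp: g1_def indicator_def)
  have "h (t *\<^sub>R y) *\<^sub>R ?Df (t *\<^sub>R y) ?e = h y *\<^sub>R ?Df y ?e" if "y \<noteq> 0"
   using Dfh[OF \<open>t > 0\<close> that, of ?e] hh[OF \<open>t > 0\<close> that] by (metis mult.commute scaleR_scaleR)
  then show "g2 (t *\<^sub>R y) = g2 y" using that by (auto simp: g2_def indicator_def)
 qed
 obtain C1 where C1: "C1 \<ge> 0" "!!y v. norm y = 1 ==> norm (?Dh y v) \<le> C1 * norm v" using derivative_sphere_bound[OF hs] by blast
 obtain C2 where C2: "C2 \<ge> 0" "!!y v. norm y = 1 ==> norm (?Df y v) \<le> C2 * norm v" using derivative_sphere_bound[OF fs] by blast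
 obtain C3 where C3: "C3 \<ge> 0" "!!y. norm y = 1 ==> norm (f y) \<le> C3" using sphere_bound[OF ct(2)] by blast
 obtain C4 where C4: "C4 \<ge> 0" "!!y. norm y = 1 ==> norm (h y) \<le> C4" using sphere_bound[OF ct(1)] by blast
 have "continuous_on (- {0}) (%y. inverse (h y))" using hp by (intro continuous_on_inverse ct) force
 from sphere_bound[OF this] obtain C5 where C5: "C5 \<ge> 0" "!!y. norm y = 1 ==> norm (inverse (h y)) \<le> C5" by blast
 have bDh: "norm (?Dh y v) \<le> C1 * norm v" if "y \<noteq> 0" for y v
  by (rule normalized_bound[where g = "%y. ?Dh y v", OF Dhh C1(2) that])
 have bf: "norm (f y) \<le> C3" if "y \<noteq> 0" for y by (rule normalized_bound[where g = f, OF fh C3(2) that])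
 have bhf: "norm (h y *\<^sub>R ?Df y v) \<le> (C4 * C2) * norm v" if "y \<noteq> 0" for y v
 proof (rule normalized_bound[where g = "%y. h y *\<^sub>R ?Df y v", OF _ _ that])
  show "h (t *\<^sub>R y) *\<^sub>R ?Df (t *\<^sub>R y) v = h y *\<^sub>R ?Df y v" if "t > 0" "y \<noteq> 0" for t y
   using Dfh[OF that, of v] hh[OF that] by (metis mult.commute scaleR_scaleR)
  show "norm (h y *\<^sub>R ?Df y v) \<le> (C4 * C2) * norm v" if "norm y = 1" for y
   using mult_mono[OF C4(2)[OF that] C2(2)[OF that, of v]] C4(1) by (simp add: mult_ac)
 qed
 have hup: "h y \<le> C4 * norm y" and hlo: "inverse (C5 + 1) * norm y \<le> h y" if "y \<noteq> 0" for y
 proof -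
  let ?y = "inverse (norm y) *\<^sub>R y"
  have y1: "norm ?y = 1" and y0: "?y \<noteq> 0" using that by auto
  have e: "h y = norm y * h ?y" using hh[of "norm y" ?y] that by simp
  have "h ?y \<le> C4" using C4(2)[OF y1] by simp
  then show "h y \<le> C4 * norm y"
   unfolding e using mult_left_mono[OF _ norm_ge_zero[of y]] by (simp only: mult.commute[of C4])
  have "inverse (h ?y) \<le> C5 + 1" using C5(2)[OF y1] hp[OF y0] by simp
  then have "inverse (C5 + 1) \<le> h ?y" using le_imp_inverse_le[OF _ positive_imp_inverse_positive[OF hp[OF y0]]] by fastforce
  then show "inverse (C5 + 1) * norm y \<le> h y"
   unfolding e using mult_left_mono[OF _ norm_ge_zero[of y]] by (simp only: mult.commute[of "inverse (C5 + 1)"])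
 qed
 have hlo': "inverse (C5 + 1) * norm y \<le> ?h y" for y using hlo[of y] by (cases "y = 0") auto
 have ci: "inverse (C5 + 1) > 0" using C5(1) by simp
 have B1: "norm (g1 y) \<le> C1 * C3" for y
  using mult_mono[OF bDh[of y ?e] bf[of y]] C1(1) C3(1) by (cases "y = 0") (auto simp: g1_def)
 have B2: "norm (g2 y) \<le> C4 * C2" for y
  using bhf[of y ?e] C4(1) C2(1) by (cases "y = 0") (auto simp: g2_def)
 note m1 = homogeneous_moment[OF m(1,2) ci hlo' hom(1,2) B1] and m2 = homogeneous_moment[OF m(1,3) ci hlo' hom(1,3) B2]
 have PN: "P = (%y. (if ?h y < 1 then 1 else 0) *\<^sub>R g1 y)" "N = (%y. (if ?h y < 1 then 1 else 0) *\<^sub>R g2 y)"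
  by (auto simp: fun_eq_iff P_def N_def g1_def g2_def indicator_def)
 show iP: "integrable lborel P" using m1(1)[of 0] unfolding PN power_0 .
 show iN: "integrable lborel N" using m2(1)[of 0] unfolding PN power_0 .
 define p :: "real => real" where "p r = (max 0 (r - r\<^sup>2))\<^sup>2" for r
 define p' :: "real => real" where "p' r = 2 * max 0 (r - r\<^sup>2) * (1 - 2 * r)" for r
 have dp: "(p has_real_derivative p' r) (at r)" for r
  unfolding p_def[abs_def] p'_def
  by (rule DERIV_chain2[OF DERIV_positive_part_square]) (auto intro!: derivative_eq_intros)
 define F where "F y = p (?h y) *\<^sub>R f y" for y
 define F' where "F' y v = (if y = 0 then 0 else (p' (h y) * ?Dh y v) *\<^sub>R f y + p (h y) *\<^sub>R ?Df y v)" for y v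
 have p_le: "0 \<le> p r" "p r \<le> r\<^sup>2" "p r \<le> r" "\<bar>p' r\<bar> \<le> 2" "r \<ge> 1 ==> p r = 0" "r \<ge> 1 ==> p' r = 0" if "r > 0" for r
 proof -
  have a: "max 0 (r - r\<^sup>2) \<le> r" "max 0 (r - r\<^sup>2) \<le> 1" "0 \<le> max 0 (r - r\<^sup>2)"
   using that sum_power2_ge_zero[of r "r - 1"] by (auto simp: power2_eq_square algebra_simps)
  have z: "max 0 (r - r\<^sup>2) = 0" if "r \<ge> 1" using that self_le_power[of r 2] by simp
  show "0 \<le> p r" "p r \<le> r\<^sup>2" "p r \<le> r" using a that mult_mono[OF a(1) a(2)] power_mono[OF a(1) a(3), of 2]
   by (simp_all add: p_def power2_eq_square)
  show "r \<ge> 1 ==> p r = 0" "r \<ge> 1 ==> p' r = 0" using z by (auto simp: p_def p'_def)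
  show "\<bar>p' r\<bar> \<le> 2"
  proof (cases "r \<ge> 1")
   case True then show ?thesis using z by (simp add: p'_def)
  next
   case False
   then have "\<bar>1 - 2 * r\<bar> \<le> 1" using that by simp
   then show ?thesis using a(2,3) mult_mono[of "max 0 (r - r\<^sup>2)" 1 "\<bar>1 - 2 * r\<bar>" 1] by (simp add: p'_def abs_mult)
  qed
 qed
 have der: "(F has_derivative F' y) (at y)" for y
 proof (cases "y = 0")
  case False
  have "((%y. p (h y)) has_derivative (%v. p' (h y) * ?Dh y v)) (at y)"
   by (rule has_derivative_compose[OF smooth_on_has_derivative[OF hs] dp[unfolded has_field_derivative_def]]) (use False in auto)
  from has_derivative_scaleR[OF this smooth_on_has_derivative[OF fs, of y]]
  have "((%y. p (h y) *\<^sub>R f y) has_derivative F' y) (at y)" using False by (simp add: F'_def[abs_def] add.commute)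
  then show ?thesis by (rule has_derivative_transform_within_open[where s = "- {0}"]) (use False in \<open>auto simp: F_def\<close>)
 next
  case True
  have F0: "F 0 = 0" by (simp add: F_def p_def)
  \<comment> \<open>\<open>f\<close> need not have a limit at 0, but it is bounded and
    \<open>p\<close> has a double zero, so \<open>F\<close> is quadratically small and has
    derivative 0 there.\<close>
  have bF: "norm (F z) \<le> (C4\<^sup>2 * C3) * (norm z)\<^sup>2" for z
  proof (cases "z = 0")
   case False
   have "p (h z) \<le> (C4 * norm z)\<^sup>2" using p_le(2)[OF hp[OF False]] power_mono[OF hup[OF False], of 2] hp[OF False] by simp
   then have "\<bar>p (h z)\<bar> * norm (f z) \<le> (C4 * norm z)\<^sup>2 * C3"
    using p_le(1)[OF hp[OF False]] by (intro mult_mono bf False) auto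
   then show ?thesis using False by (simp add: F_def power_mult_distrib mult_ac)
  qed (simp add: F0)
  have "((%z. norm (F z) / norm z) \<longlongrightarrow> 0) (at 0)"
  proof (rule Lim_null_comparison)
   show "((%z::real^'n. (C4\<^sup>2 * C3) * norm z) \<longlongrightarrow> 0) (at 0)" by (auto intro!: tendsto_eq_intros)
   show "\<forall>\<^sub>F z in at 0. norm (norm (F z) / norm z) \<le> (C4\<^sup>2 * C3) * norm z"
    unfolding eventually_at_filter using bF by (intro always_eventually allI impI) (simp add: divide_le_eq power2_eq_square mult_ac)
  qed
  then show ?thesis unfolding True F'_def[abs_def] by (simp add: has_derivative_iff_norm F0)
 qed
 have bnd: "norm (F' y v) \<le> (2 * C1 * C3 + C4 * C2) * norm v" for y v
 proof (cases "y = 0")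
  case False
  have "norm (F' y v) \<le> \<bar>p' (h y)\<bar> * norm (?Dh y v) * norm (f y) + p (h y) * norm (?Df y v)"
   using False p_le(1)[OF hp[OF False]] by (simp add: F'_def) (rule order_trans[OF norm_triangle_ineq], simp add: abs_mult)
  also have "... \<le> 2 * (C1 * norm v) * C3 + C4 * C2 * norm v"
  proof (rule add_mono)
   show "\<bar>p' (h y)\<bar> * norm (?Dh y v) * norm (f y) \<le> 2 * (C1 * norm v) * C3"
    using C1(1) by (intro mult_mono p_le(4) hp bDh bf False) auto
   have "p (h y) * norm (?Df y v) \<le> h y * norm (?Df y v)" by (intro mult_right_mono p_le(3) hp False) auto
   also have "... \<le> C4 * C2 * norm v" using bhf[OF False, of v] hp[OF False] by simp
   finally show "p (h y) * norm (?Df y v) \<le> C4 * C2 * norm v" .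
  qed
  finally show ?thesis by (simp add: algebra_simps)
 qed (use C1 C2 C3 C4 in \<open>simp add: F'_def\<close>)
 have zero: "F y = 0" if "norm y > C5 + 1" for y
 proof -
  have y: "y \<noteq> 0" using that C5(1) by auto
  have "1 < inverse (C5 + 1) * norm y" using that C5(1) by (simp add: field_simps)
  then show ?thesis using hlo[OF y] p_le(5)[OF hp[OF y]] y by (simp add: F_def)
 qed
 let ?m = "%k y. if ?h y < 1 then ?h y ^ k else 0"
 \<comment> \<open>In front of \<open>g1\<close> stand the coefficients of p'(r) = 2r - 6r^2 + 4r^3;
   in front of \<open>g2\<close>, which has absorbed one factor h, those of p(r)/r = r - 2r^2 +
   r^3.\<close>
 let ?G = "%y. 2 *\<^sub>R (?m 1 y *\<^sub>R g1 y) - 6 *\<^sub>R (?m 2 y *\<^sub>R g1 y) + 4 *\<^sub>R (?m 3 y *\<^sub>R g1 y) +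
   (?m 1 y *\<^sub>R g2 y - 2 *\<^sub>R (?m 2 y *\<^sub>R g2 y) + ?m 3 y *\<^sub>R g2 y)"
 have F'e: "F' y ?e = ?G y" for y
 proof (cases "y = 0 \<or> h y \<ge> 1")
  case True
  then show ?thesis using p_le(5,6)[OF hp[of y]] by (auto simp: F'_def g1_def g2_def)
 next
  case False
  then have r: "0 < h y" "h y < 1" "y \<noteq> 0" using hp by auto
  let ?r = "h y"
  have mx: "max 0 (?r - ?r\<^sup>2) = ?r - ?r\<^sup>2" using r by (simp add: power2_eq_square mult_left_le)
  have pe: "p' ?r = 2 * ?r - 6 * ?r ^ 2 + 4 * ?r ^ 3" "p ?r = (?r - 2 * ?r ^ 2 + ?r ^ 3) * ?r"
   unfolding p'_def p_def mx by (simp_all add: power2_eq_square power3_eq_cube algebra_simps)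
  show ?thesis using r by (simp add: F'_def g1_def g2_def pe scaleR_conv_of_real algebra_simps power2_eq_square power3_eq_cube)
 qed
 have GI: "integrable lborel ?G"
  by (intro Bochner_Integration.integrable_add Bochner_Integration.integrable_diff integrable_scaleR_right m1(1) m2(1))
 have "(\<integral>y. F' y ?e \<partial>lborel) = 0"
  by (rule integral_derivative_eq_0[OF der bnd zero]) (use GI F'e in simp_all)
 then have S: "(\<integral>y. ?G y \<partial>lborel) = 0" by (simp only: F'e)
 define n where "n = real CARD('n)"
 let ?P = "\<integral>y. P y \<partial>lborel" and ?N = "\<integral>y. N y \<partial>lborel"
 have n: "n \<ge> 1" by (simp add: n_def Suc_le_eq)
 have M1: "(\<integral>y. ?m k y *\<^sub>R g1 y \<partial>lborel) = of_real (n / (n + real k)) * ?P" and M2: "(\<integral>y. ?m k y *\<^sub>R g2 y \<partial>lborel) = of_real (n / (n + real k)) * ?N" for k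
 proof -
  have sol: "x = of_real (n / (n + real k)) * w" if "(n + real k) *\<^sub>R x = n *\<^sub>R w" for x w :: complex
  proof -
   have "x = inverse (n + real k) *\<^sub>R ((n + real k) *\<^sub>R x)" using n by simp
   then show ?thesis unfolding that by (simp add: scaleR_conv_of_real divide_inverse mult_ac)
  qed
  show "(\<integral>y. ?m k y *\<^sub>R g1 y \<partial>lborel) = of_real (n / (n + real k)) * ?P" by (rule sol) (use m1(2)[of k] in \<open>simp add: PN n_def\<close>)
  show "(\<integral>y. ?m k y *\<^sub>R g2 y \<partial>lborel) = of_real (n / (n + real k)) * ?N" by (rule sol) (use m2(2)[of k] in \<open>simp add: PN n_def\<close>)
 qed
 \<comment> \<open>With the factors n/(n+k) for the moments k = 1, 2, 3 the two combinations of
   coefficients become -(n-1) q and q, so the nonzero q cancels and the ratio n - 1 remains.\<close>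
 define q where "q = 2 * n / ((n + 1) * (n + 2) * (n + 3))"
 have "(\<integral>y. ?G y \<partial>lborel) = of_real (2 * (n / (n + 1)) - 6 * (n / (n + 2)) + 4 * (n / (n + 3))) * ?P +
   of_real (n / (n + 1) - 2 * (n / (n + 2)) + n / (n + 3)) * ?N"
  using M1[of 1] M1[of 2] M1[of 3] M2[of 1] M2[of 2] M2[of 3]
  by (simp only: Bochner_Integration.integral_add Bochner_Integration.integral_diff integral_scaleR_right
    Bochner_Integration.integrable_add Bochner_Integration.integrable_diff integrable_scaleR_right m1(1) m2(1))
   (simp add: scaleR_conv_of_real algebra_simps)
 also have "2 * (n / (n + 1)) - 6 * (n / (n + 2)) + 4 * (n / (n + 3)) = - (n - 1) * q"
  unfolding q_def using n by (simp add: divide_simps) (simp add: algebra_simps)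
 also have "n / (n + 1) - 2 * (n / (n + 2)) + n / (n + 3) = q"
  unfolding q_def using n by (simp add: divide_simps) (simp add: algebra_simps)
 finally have "of_real q * (?N - of_real (n - 1) * ?P) = 0"
  unfolding S by (simp add: algebra_simps)
 moreover have "q \<noteq> 0" using n by (simp add: q_def)
 ultimately have "?N = of_real (n - 1) * ?P" by (simp only: mult_eq_0_iff of_real_eq_0_iff) simp
 moreover have "real (CARD('n) - 1) = n - 1" using n unfolding n_def by (simp add: of_nat_diff)
 ultimately show "?N = real (CARD('n) - 1) *\<^sub>R ?P" by (simp add: scaleR_conv_of_real)
qed

subsection \<open>Unitary invariance\<close>

lemma is_eigenvalue_conjugate:
 assumes "hconj Q ** Q = mat 1"
 shows "is_eigenvalue (Q ** B ** hconj Q) \<mu> \<longleftrightarrow> is_eigenvalue B \<mu>"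
proof -
 have QQ: "hconj Q *v (Q *v w) = w" "Q *v (hconj Q *v w) = w" for w
  using assms matrix_left_right_inverse[THEN iffD1, OF assms] by (simp_all add: matrix_vector_mul_assoc)
 show ?thesis
 proof
  assume "is_eigenvalue (Q ** B ** hconj Q) \<mu>"
  then obtain v where v: "v \<noteq> 0" "Q *v (B *v (hconj Q *v v)) = \<mu> *s v" by (auto simp: is_eigenvalue_def matrix_vector_simps)
  have "B *v (hconj Q *v v) = \<mu> *s (hconj Q *v v)" using arg_cong[OF v(2), of "%w. hconj Q *v w"] by (simp add: QQ matrix_vector_simps)
  moreover have "hconj Q *v v \<noteq> 0" using v(1) QQ(2)[of v] by auto
  ultimately show "is_eigenvalue B \<mu>" by (auto simp: is_eigenvalue_def)
 next
  assume "is_eigenvalue B \<mu>"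
  then obtain v where v: "v \<noteq> 0" "B *v v = \<mu> *s v" by (auto simp: is_eigenvalue_def)
  have "(Q ** B ** hconj Q) *v (Q *v v) = \<mu> *s (Q *v v)" by (simp add: QQ v(2) matrix_vector_simps)
  moreover have "Q *v v \<noteq> 0" using v(1) QQ(1)[of v] by auto
  ultimately show "is_eigenvalue (Q ** B ** hconj Q) \<mu>" unfolding is_eigenvalue_def by blast
 qed
qed

lemma eigenvalues_conjugate:
 assumes "hconj Q ** Q = mat 1"
 shows "positive_eigenvalues (Q ** B ** hconj Q) = positive_eigenvalues B" "eigenvalue_no j (Q ** B ** hconj Q) = eigenvalue_no j B"
 by (simp_all add: positive_eigenvalues_def eigenvalue_no_def is_eigenvalue_conjugate[OF assms])

lemma finite_positive_eigenvalues:
 assumes "simple_spectrum B" shows "finite (positive_eigenvalues B)"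
 by (rule finite_subset[OF _ finite_imageI[OF card_eigenvalues(1)[OF assms], of Re]]) (force simp: positive_eigenvalues_def image_iff)

lemma eigenvalue_no_mem:
 assumes "simple_spectrum B" "j \<in> {1..card (positive_eigenvalues B)}"
 shows "eigenvalue_no j B \<in> positive_eigenvalues B"
proof -
 have "j - 1 < length (sorted_list_of_set (positive_eigenvalues B))" using assms(2) by auto
 from nth_mem[OF this] show ?thesis using finite_positive_eigenvalues[OF assms(1)] by (simp add: eigenvalue_no_def)
qed

lemma scaled_eigenvector:
 fixes B :: "complex^'m::finite^'m"
 assumes "t \<noteq> 0" shows "(t *\<^sub>R B) *v w = of_real (t * h) *s w \<longleftrightarrow> B *v w = of_real h *s w"
proof -
 have "of_real (t * h) *s w = t *\<^sub>R (of_real h *s w)"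
  unfolding vec_eq_iff vector_scaleR_component vector_smult_component by (simp add: scaleR_conv_of_real)
 then show ?thesis
  using assms by (simp only: bounded_bilinear.scaleR_left[OF bounded_bilinear_matrix_vector] scaleR_cancel_left) simp
qed

lemma eigenvalue_no_scaleR:
 fixes B :: "complex^'m::finite^'m"
 assumes t: "t > 0" and B: "simple_spectrum B" "j \<in> {1..card (positive_eigenvalues B)}"
 shows "eigenvalue_no j (t *\<^sub>R B) = t * eigenvalue_no j B"
proof -
 let ?P = "positive_eigenvalues B"
 have ev: "is_eigenvalue (t *\<^sub>R B) (of_real (t * h)) \<longleftrightarrow> is_eigenvalue B (of_real h)" for h
  unfolding is_eigenvalue_def using scaled_eigenvector[of t B _ h] t by auto
 have pt: "h \<in> positive_eigenvalues (t *\<^sub>R B) \<longleftrightarrow> h / t \<in> ?P" for h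
  using ev[of "h / t"] t by (simp add: positive_eigenvalues_def zero_less_divide_iff)
 have im: "positive_eigenvalues (t *\<^sub>R B) = (%h. t * h) ` ?P"
 proof (intro set_eqI iffI)
  fix h assume "h \<in> positive_eigenvalues (t *\<^sub>R B)"
  then show "h \<in> (%h. t * h) ` ?P" using pt[of h] t by (intro image_eqI[of _ _ "h / t"]) simp_all
 next
  fix h assume "h \<in> (%h. t * h) ` ?P"
  then obtain k where "h = t * k" "k \<in> ?P" by blast
  then show "h \<in> positive_eigenvalues (t *\<^sub>R B)" using pt[of h] t by simp
 qed
 have f: "finite ?P" by (rule finite_positive_eigenvalues[OF B(1)])
 have "sorted_wrt (<) (map (%h. t * h) (sorted_list_of_set ?P))"
  unfolding sorted_wrt_map using strict_sorted_list_of_set[of ?P] t by simp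
 then have "sorted_list_of_set (positive_eigenvalues (t *\<^sub>R B)) = map (%h. t * h) (sorted_list_of_set ?P)"
  using sorted_list_of_set.idem_if_sorted_distinct[of "map (%h. t * h) (sorted_list_of_set ?P)"] f
  by (simp add: strict_sorted_iff im)
 moreover have "j - 1 < length (sorted_list_of_set ?P)" using B(2) by auto
 ultimately show ?thesis by (simp add: eigenvalue_no_def)
qed

lemma d\<xi>_eq_frechet: "k x differentiable (at ksi) ==> d\<xi> \<alpha> k x ksi = frechet_derivative (k x) (at ksi) (axis \<alpha> 1)"
 unfolding d\<xi>_def frechet_derivative_works by (auto dest: has_vector_derivative_line[of _ _ _ "axis \<alpha> 1"] intro: vector_derivative_at)

lemma local_eigenvectors_symbol:
 fixes a :: "('n::finite, 'm::finite) symb"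
 assumes U: "open U" "x \<in> U" "ksi \<noteq> 0" and a: "smooth2 (U \<times> - {0}) a"
  and hs: "\<forall>y\<in>U. \<forall>eta. eta \<noteq> 0 --> herm_simple (a y eta) \<and> \<not> is_eigenvalue (a y eta) 0"
 shows "\<exists>N. open N \<and> (x, ksi) \<in> N \<and> N \<subseteq> U \<times> - {0} \<and>
  (\<forall>z\<in>N. card (positive_eigenvalues (case z of (y, eta) => a y eta)) = card (positive_eigenvalues (a x ksi))) \<and>
  (\<forall>j\<in>{1..card (positive_eigenvalues (a x ksi))}. smooth_on N (%z. eigenvalue_no j (case z of (y, eta) => a y eta)) \<and>
   (\<exists>W. smooth_on N W \<and> (\<forall>z\<in>N. norm (W z) = 1 \<and> (case z of (y, eta) => a y eta) *v W z =
    of_real (eigenvalue_no j (case z of (y, eta) => a y eta)) *s W z)))"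
 by (rule local_eigenvectors[OF _ a, of "(x, ksi)", unfolded prod.case]) (use U hs in \<open>auto intro!: open_Times\<close>)

text \<open>The count is locally constant in the covector, and the complement of 0 is connected for
  \<open>CARD('n) \<ge> 2\<close>. This gives \<open>m_plus\<close>, a definite description, its
  meaning.\<close>

lemma card_positive_eigenvalues:
 fixes a :: "('n::finite, 'm::finite) symb"
 assumes n: "CARD('n) \<ge> 2" and U: "open U" "x \<in> U" and a: "smooth2 (U \<times> - {0}) a"
  and hs: "!!y eta. y \<in> U ==> eta \<noteq> 0 ==> herm_simple (a y eta) \<and> \<not> is_eigenvalue (a y eta) 0" and ksi: "ksi \<noteq> 0"
 shows "card (positive_eigenvalues (a x ksi)) = m_plus a x"
proof -
 let ?c = "%eta. card (positive_eigenvalues (a x eta))"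
 have hs': "\<forall>y\<in>U. \<forall>eta. eta \<noteq> 0 --> herm_simple (a y eta) \<and> \<not> is_eigenvalue (a y eta) 0" using hs by blast
 have "?c eta = ?c \<zeta>" if "eta \<noteq> 0" "\<zeta> \<noteq> 0" for eta \<zeta>
 proof (rule connected_local_const[where A = "- {0}" and f = ?c and a = eta and b = \<zeta>])
  show "connected (- {0 :: real^'n})" by (rule connected_punctured_universe) (use n in simp)
  show "\<forall>eta\<in>- {0}. \<forall>\<^sub>F \<zeta> in at eta within - {0}. ?c eta = ?c \<zeta>"
  proof
   fix eta :: "real^'n" assume "eta \<in> - {0}"
   then have eta: "(x, eta) \<in> U \<times> - {0}" using U by simp
   have "eta \<noteq> 0" using eta by simp
   from local_eigenvectors_symbol[OF U this a hs'] obtain N where N: "open N" "(x, eta) \<in> N"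
    and c: "\<forall>z\<in>N. card (positive_eigenvalues (case z of (y, eta) => a y eta)) = ?c eta"
    by (elim exE conjE) (rule that)
   have "((%\<zeta>. (x, \<zeta>)) \<longlongrightarrow> (x, eta)) (at eta within - {0})" by (intro tendsto_intros)
   from topological_tendstoD[OF this N(1,2)] show "\<forall>\<^sub>F \<zeta> in at eta within - {0}. ?c eta = ?c \<zeta>"
   proof (rule eventually_mono)
    fix \<zeta> assume "(x, \<zeta>) \<in> N"
    from bspec[OF c this] show "?c eta = ?c \<zeta>" by simp
   qed
  qed
 qed (use that in auto)
 note const = this
 have "m_plus a x = ?c ksi"
  unfolding m_plus_def
 proof (rule the_equality)
  show "\<forall>\<zeta>. \<zeta> \<noteq> 0 --> ?c \<zeta> = ?c ksi" by (intro allI impI const ksi)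
  show "k = ?c ksi" if "\<forall>\<zeta>. \<zeta> \<noteq> 0 --> ?c \<zeta> = k" for k using spec[OF that, of ksi] ksi by simp
 qed
 then show ?thesis ..
qed

text \<open>The integrands differ by a sum over \<alpha> of i h_\<alpha> g - (i/(n-1)) h g_\<alpha>,
  with \<open>g\<close> depending on \<alpha> as well, and by \<open>homogeneous_divergence\<close>
  each of these terms has integral 0. The eigenvector fields inside \<open>b_integrand\<close>
  change with the base point; what is integrated by parts is \<open>g\<close>, which sees no
  phase.\<close>

lemma b_integral_conjugate:
 fixes a a' s s' :: "('n::finite, 'm::finite) symb" and Q :: "real^'n => complex^'m^'m"
 assumes n: "CARD('n) \<ge> 2" and U: "open U" "x \<in> U" and a: "smooth2 (U \<times> - {0}) a"
  and hom: "!!t ksi. t > 0 ==> ksi \<noteq> 0 ==> a x (t *\<^sub>R ksi) = t *\<^sub>R a x ksi"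
  and hs: "!!y eta. y \<in> U ==> eta \<noteq> 0 ==> herm_simple (a y eta) \<and> \<not> is_eigenvalue (a y eta) 0"
  and Q: "smooth_on U Q" "!!y. hconj (Q y) ** Q y = mat 1"
  and a': "!!y eta. y \<in> U ==> eta \<noteq> 0 ==> a' y eta = Q y ** a y eta ** hconj (Q y)"
  and s': "!!ksi. ksi \<noteq> 0 ==> s' x ksi = Q x ** s x ksi ** hconj (Q x) + cscale (\<i> / 2)
   (\<Sum>\<alpha>\<in>UNIV. pd \<alpha> Q x ** d\<xi> \<alpha> a x ksi ** hconj (Q x) - Q x ** d\<xi> \<alpha> a x ksi ** pd \<alpha> (%y. hconj (Q y)) x)"
  and j: "j \<in> {1..m_plus a x}"
 shows "(LINT ksi : {ksi. ksi \<noteq> 0 \<and> eigenvalue_no j (a' x ksi) < 1} | lborel. b_integrand a' s' j x ksi / K) =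
  (LINT ksi : {ksi. ksi \<noteq> 0 \<and> eigenvalue_no j (a x ksi) < 1} | lborel. b_integrand a s j x ksi / K)"
proof -
 let ?W = "U \<times> - {0 :: real^'n}" and ?c = "\<i> / of_nat (CARD('n) - 1) :: complex"
 have W: "open ?W" using U by (intro open_Times) auto
 define h where "h y eta = eigenvalue_no j (a y eta)" for y eta
 \<comment> \<open>An eigenvector chosen at each point separately, with no smoothness. It defines
   \<open>g\<close> on the whole fibre at once; smoothness of \<open>g\<close> follows from local
   comparison with smooth eigenvectors.\<close>
 define w where "w y eta = (SOME w. norm w = 1 \<and> a y eta *v w = of_real (h y eta) *s w)" for y eta
 define g where "g \<alpha> y eta = cdot (w y eta) ((hconj (Q y) ** pd \<alpha> Q y) *v w y eta)" for \<alpha> y eta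
 have jc: "j \<in> {1..card (positive_eigenvalues (a x ksi))}" if "ksi \<noteq> 0" for ksi
  using j card_positive_eigenvalues[OF n U a hs that] by simp
 have ss: "simple_spectrum (a x ksi)" if "ksi \<noteq> 0" for ksi using hs[OF U(2) that] by (simp add: herm_simple_def)
 have no': "eigenvalue_no j (a' y eta) = h y eta" if "y \<in> U" "eta \<noteq> 0" for y eta
  using eigenvalues_conjugate(2)[OF Q(2)] that by (simp add: a' h_def)
 have hpos: "h x ksi > 0" if "ksi \<noteq> 0" for ksi
  using eigenvalue_no_mem[OF ss[OF that] jc[OF that]] by (simp add: h_def positive_eigenvalues_def)
 have hh: "h x (t *\<^sub>R ksi) = t * h x ksi" if "t > 0" "ksi \<noteq> 0" for t ksi
  unfolding h_def hom[OF that] by (rule eigenvalue_no_scaleR[OF that(1) ss[OF that(2)] jc[OF that(2)]])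
 have gh: "g \<alpha> x (t *\<^sub>R ksi) = g \<alpha> x ksi" if "t > 0" "ksi \<noteq> 0" for \<alpha> t ksi
 proof -
  \<comment> \<open>The property that defines the choice is the same along a ray, so
    \<open>SOME\<close> picks the same vector.\<close>
  have "w x (t *\<^sub>R ksi) = w x ksi" unfolding w_def hh[OF that] hom[OF that] using that(1) by (subst scaled_eigenvector) auto
  then show ?thesis by (simp add: g_def)
 qed
 have loc: "\<exists>N. open N \<and> (x, ksi) \<in> N \<and> smooth2 N h \<and> (\<forall>\<alpha>. smooth2 N (g \<alpha>)) \<and>
   b_integrand a' s' j x ksi - b_integrand a s j x ksi = (\<Sum>\<alpha>\<in>UNIV. \<i> * of_real (d\<xi> \<alpha> h x ksi) * g \<alpha> x ksi - ?c * of_real (h x ksi) * d\<xi> \<alpha> (g \<alpha>) x ksi)"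
  if ksi: "ksi \<noteq> 0" for ksi
 proof -
  have m: "(x, ksi) \<in> ?W" using U ksi by simp
  have "\<forall>y\<in>U. \<forall>eta. eta \<noteq> 0 --> herm_simple (a y eta) \<and> \<not> is_eigenvalue (a y eta) 0" using hs by blast
  from local_eigenvectors_symbol[OF U ksi a this] obtain N where N: "open N" "(x, ksi) \<in> N" "N \<subseteq> ?W"
   and exA: "\<forall>j\<in>{1..card (positive_eigenvalues (a x ksi))}. smooth_on N (%z. eigenvalue_no j (case z of (y, eta) => a y eta)) \<and>
    (\<exists>W. smooth_on N W \<and> (\<forall>z\<in>N. norm (W z) = 1 \<and> (case z of (y, eta) => a y eta) *v W z = of_real (eigenvalue_no j (case z of (y, eta) => a y eta)) *s W z))"
   by (elim exE conjE) (rule that)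
  note ex2 = bspec[OF exA jc[OF ksi]]
  have hN: "smooth2 N h" using ex2[THEN conjunct1] by (simp add: h_def case_prod_unfold)
  from ex2[THEN conjunct2] obtain E where E1: "smooth_on N E" and E': "\<forall>z\<in>N. norm (E z) = 1 \<and>
    (case z of (y, eta) => a y eta) *v E z = of_real (eigenvalue_no j (case z of (y, eta) => a y eta)) *s E z"
   by (elim exE conjE) (rule that)
  have E: "norm (E (y, eta)) = 1 \<and> a y eta *v E (y, eta) = of_real (h y eta) *s E (y, eta)" if "(y, eta) \<in> N" for y eta
   using bspec[OF E' that] by (simp add: h_def)
  have NU: "y \<in> U" "eta \<noteq> 0" if "(y, eta) \<in> N" for y eta using that N(3) by auto
  have E2: "smooth2 N (%y eta. E (y, eta))" using E1 by (simp add: case_prod_unfold)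
  have "local_eigenvector a j N (%y eta. E (y, eta))" unfolding local_eigenvector_def using E2 E by (auto simp: h_def)
  \<comment> \<open>The witness is what makes the choice in \<open>eigenvector_near\<close> satisfy
    its specification.\<close>
  then have "\<exists>v W. open W \<and> (x, ksi) \<in> W \<and> local_eigenvector a j W v" using N by blast
  from someI_ex[OF this] obtain W1 where W1: "open W1" "(x, ksi) \<in> W1" "local_eigenvector a j W1 (eigenvector_near a j x ksi)"
   unfolding eigenvector_near_def by blast
  have "smooth2 N (%y eta. Q y)"
   using smooth_on_compose[OF N(1) U(1) smooth_on_fst[OF N(1)] Q(1)] NU by (auto simp: case_prod_unfold)
  then have QE: "smooth2 N (%y eta. Q y *v E (y, eta))" by (rule smooth2_bilinear[OF bounded_bilinear_matrix_vector N(1) _ E2])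
  have "norm (Q y *v E (y, eta)) = 1 \<and> a' y eta *v (Q y *v E (y, eta)) = of_real (eigenvalue_no j (a' y eta)) *s (Q y *v E (y, eta))" if "(y, eta) \<in> N" for y eta
  proof -
   have QQ: "hconj (Q y) *v (Q y *v u) = u" for u using Q(2)[of y] by (simp add: matrix_vector_mul_assoc)
   let ?e = "E (y, eta)"
   have "cdot (Q y *v ?e) (Q y *v ?e) = cdot ?e ?e" by (simp only: cdot_hconj QQ)
   then have "(norm (Q y *v ?e))\<^sup>2 = (norm ?e)\<^sup>2" unfolding cdot_self by (simp only: of_real_eq_iff)
   then have "norm (Q y *v ?e) = norm ?e" by (rule power2_eq_imp_eq) auto
   moreover have "a' y eta *v (Q y *v ?e) = of_real (h y eta) *s (Q y *v ?e)"
    unfolding a'[OF NU[OF that]] matrix_vector_simps(5) QQ using E[OF that] by (simp add: matrix_vector_simps(1))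
   ultimately show ?thesis using E[OF that] by (simp add: no'[OF NU[OF that]])
  qed
  then have "local_eigenvector a' j N (%y eta. Q y *v E (y, eta))" unfolding local_eigenvector_def using QE by auto
  then have "\<exists>v W. open W \<and> (x, ksi) \<in> W \<and> local_eigenvector a' j W v" using N by blast
  from someI_ex[OF this] obtain W2 where W2: "open W2" "(x, ksi) \<in> W2" "local_eigenvector a' j W2 (eigenvector_near a' j x ksi)"
   unfolding eigenvector_near_def by blast
  define V where "V = N \<inter> W1 \<inter> W2"
  define u where "u = eigenvector_near a j x ksi"
  define v where "v = eigenvector_near a' j x ksi"
  have V: "open V" "(x, ksi) \<in> V" "V \<subseteq> ?W" "V \<subseteq> N" using N W1 W2 by (auto simp: V_def)
  have VU: "y \<in> U" "eta \<noteq> 0" if "(y, eta) \<in> V" for y eta using that V(3) by auto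
  have su: "smooth2 V u" "smooth2 V v"
   using W1(3) W2(3) unfolding local_eigenvector_def u_def v_def by (auto intro: smooth_on_subset simp: V_def)
  have un: "norm (u y eta) = 1 \<and> a y eta *v u y eta = of_real (h y eta) *s u y eta" if "(y, eta) \<in> V" for y eta
   using W1(3) that unfolding local_eigenvector_def u_def h_def V_def by blast
  have vn: "norm (v y eta) = 1 \<and> (Q y ** a y eta ** hconj (Q y)) *v v y eta = of_real (h y eta) *s v y eta" if "(y, eta) \<in> V" for y eta
   using W2(3) that no'[OF VU[OF that]] a'[OF VU[OF that]] unfolding local_eigenvector_def v_def V_def by fastforce
  have hsV: "herm_simple (a y eta)" if "(y, eta) \<in> V" for y eta using hs[OF VU[OF that]] by blast
  let ?f = "%\<alpha> y eta. cdot (u y eta) ((hconj (Q y) ** pd \<alpha> Q y) *v u y eta)"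
  have VU': "V \<subseteq> U \<times> UNIV" using V(3) by auto
  note bc = bracket_change[OF V(1,2) smooth_on_subset[OF a V(3)] smooth_on_subset[OF hN V(4)] su U(1) VU' Q(1) Q(2) hsV un vn]
  \<comment> \<open>Eigenvectors of norm 1 for a simple eigenvalue differ by a factor of modulus 1,
    which does not alter the quadratic form.\<close>
  have gf: "g \<alpha> y eta = ?f \<alpha> y eta" if "(y, eta) \<in> V" for \<alpha> y eta
  proof -
   have "norm (w y eta) = 1 \<and> a y eta *v w y eta = of_real (h y eta) *s w y eta"
    unfolding w_def by (rule someI_ex) (use un[OF that] in blast)
   then have nw: "norm (w y eta) = 1" and e: "w y eta = cdot (u y eta) (w y eta) *s u y eta"
    using eigenvector_unique[OF hsV[OF that]] un[OF that] by blast+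
   let ?k = "cdot (u y eta) (w y eta)"
   have "norm (w y eta) = norm ?k * norm (u y eta)" by (subst e) (rule norm_scale_complex)
   then have "norm ?k = 1" using nw un[OF that] by simp
   then have k: "cnj ?k * ?k = 1" using complex_norm_square[of ?k] by (simp add: mult.commute)
   have "g \<alpha> y eta = (cnj ?k * ?k) * ?f \<alpha> y eta"
    unfolding g_def by (subst (1 2) e) (simp add: matrix_vector_simps(1) cdot_basic(1,2))
   then show ?thesis unfolding k by simp
  qed
  have sg: "smooth2 V (g \<alpha>)" for \<alpha>
   by (rule smooth_on_cong[OF V(1) bc(2)]) (auto simp: gf)
  have dg: "d\<xi> \<alpha> (g \<alpha>) x ksi = d\<xi> \<alpha> (?f \<alpha>) x ksi" for \<alpha> by (rule d\<xi>_cong[OF V(1,2)]) (rule gf)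
  have b3: "bracket3 v (%x ksi. a' x ksi - mat (complex_of_real (eigenvalue_no j (a' x ksi)))) v x ksi =
    bracket3 v (%x ksi. Q x ** a x ksi ** hconj (Q x) - mat (of_real (h x ksi))) v x ksi"
   using a'[OF U(2) ksi] no'[OF U(2) ksi] by (simp add: bracket3_def)
  have "b_integrand a' s' j x ksi - b_integrand a s j x ksi = (\<Sum>\<alpha>\<in>UNIV. \<i> * of_real (d\<xi> \<alpha> h x ksi) * ?f \<alpha> x ksi - ?c * of_real (h x ksi) * d\<xi> \<alpha> (?f \<alpha>) x ksi)"
   unfolding b_integrand_def Let_def u_def[symmetric] v_def[symmetric] b3 s'[OF ksi] no'[OF U(2) ksi] h_def[symmetric] by (rule bc(1))
  then show ?thesis
   using V(1,2) smooth_on_subset[OF hN V(4)] sg by (intro exI[of _ V] conjI allI) (simp_all add: dg gf[OF V(2)])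
 qed
 have slice: "smooth_on (- {0}) (k x)" if k: "!!ksi. ksi \<noteq> 0 ==> \<exists>N. open N \<and> (x, ksi) \<in> N \<and> smooth2 N k" for k :: "real^'n => real^'n => 'b::real_normed_vector"
 proof (rule smooth_on_local)
  fix ksi :: "real^'n" assume "ksi \<in> - {0}"
  then obtain N where N: "open N" "(x, ksi) \<in> N" "smooth2 N k" using k by auto
  let ?T = "(%eta. (x, eta)) -` N"
  have T: "open ?T" by (rule open_vimage[OF N(1)]) (intro continuous_intros)
  have "smooth_on ?T (%eta. (%(y, eta). k y eta) (x, eta))"
   by (rule smooth_on_compose[OF T N(1) smooth_on_Pair[OF T smooth_on_const[OF T] smooth_on_id[OF T]] N(3)]) simp
  then show "\<exists>T. open T \<and> ksi \<in> T \<and> smooth_on T (k x)" using T N(2) by (intro exI[of _ ?T]) simp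
 qed
 have sh: "smooth_on (- {0}) (h x)" by (rule slice) (use loc in blast)
 have sg: "smooth_on (- {0}) (g \<alpha> x)" for \<alpha> by (rule slice) (use loc in blast)
 let ?D = "{ksi. ksi \<noteq> 0 \<and> h x ksi < 1}"
 define P where "P \<alpha> ksi = indicator ?D ksi *\<^sub>R (frechet_derivative (h x) (at ksi) (axis \<alpha> 1) *\<^sub>R g \<alpha> x ksi)" for \<alpha> ksi
 define R where "R \<alpha> ksi = indicator ?D ksi *\<^sub>R (h x ksi *\<^sub>R frechet_derivative (g \<alpha> x) (at ksi) (axis \<alpha> 1))" for \<alpha> ksi
 have PR: "integrable lborel (P \<alpha>)" "integrable lborel (R \<alpha>)" "(\<integral>ksi. R \<alpha> ksi \<partial>lborel) = real (CARD('n) - 1) *\<^sub>R (\<integral>ksi. P \<alpha> ksi \<partial>lborel)" for \<alpha>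
  unfolding P_def[abs_def] R_def[abs_def] using homogeneous_divergence[OF sh sg hpos hh gh, of \<alpha> \<alpha>] by simp_all
 define D where "D ksi = (\<Sum>\<alpha>\<in>UNIV. \<i> * P \<alpha> ksi - ?c * R \<alpha> ksi) / K" for ksi
 have iD: "integrable lborel D"
  unfolding D_def[abs_def] by (intro integrable_divide Bochner_Integration.integrable_sum Bochner_Integration.integrable_diff integrable_mult_right PR)
 have "(\<integral>ksi. D ksi \<partial>lborel) = (\<Sum>\<alpha>\<in>UNIV. \<i> * (\<integral>ksi. P \<alpha> ksi \<partial>lborel) - ?c * (\<integral>ksi. R \<alpha> ksi \<partial>lborel)) / K"
  unfolding D_def using PR(1,2) by (simp add: Bochner_Integration.integral_sum)
 also have "... = 0" using n by (simp add: PR(3) scaleR_conv_of_real)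
 finally have I0: "(\<integral>ksi. D ksi \<partial>lborel) = 0" .
 let ?X = "%ksi. indicat_real ?D ksi *\<^sub>R (b_integrand a s j x ksi / K)"
 have eq: "indicat_real ?D ksi *\<^sub>R (b_integrand a' s' j x ksi / K) = ?X ksi + D ksi" for ksi
 proof (cases "ksi \<in> ?D")
  case True
  then have ksi: "ksi \<noteq> 0" by simp
  have "d\<xi> \<alpha> h x ksi = frechet_derivative (h x) (at ksi) (axis \<alpha> 1)" "d\<xi> \<alpha> (g \<alpha>) x ksi = frechet_derivative (g \<alpha> x) (at ksi) (axis \<alpha> 1)" for \<alpha>
   using smooth_on_differentiable[OF sh, of ksi] smooth_on_differentiable[OF sg, of ksi \<alpha>] ksi by (simp_all add: d\<xi>_eq_frechet)
  then have "(\<Sum>\<alpha>\<in>UNIV. \<i> * of_real (d\<xi> \<alpha> h x ksi) * g \<alpha> x ksi - ?c * of_real (h x ksi) * d\<xi> \<alpha> (g \<alpha>) x ksi) = (\<Sum>\<alpha>\<in>UNIV. \<i> * P \<alpha> ksi - ?c * R \<alpha> ksi)"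
   using True by (simp add: P_def R_def scaleR_conv_of_real mult.assoc)
  then have "b_integrand a' s' j x ksi = b_integrand a s j x ksi + (\<Sum>\<alpha>\<in>UNIV. \<i> * P \<alpha> ksi - ?c * R \<alpha> ksi)"
   using loc[OF ksi] by (metis add.commute diff_add_cancel)
  then show ?thesis using True by (simp add: D_def add_divide_distrib)
 qed (simp add: D_def P_def R_def)
 have set': "{ksi. ksi \<noteq> 0 \<and> eigenvalue_no j (a' x ksi) < 1} = ?D" using no'[OF U(2)] by auto
 \<comment> \<open>If the integrand is not integrable, neither is its sum with the integrable
   \<open>D\<close>, and both integrals are 0 by convention.\<close>
 have "(\<integral>ksi. ?X ksi + D ksi \<partial>lborel) = (\<integral>ksi. ?X ksi \<partial>lborel)"
 proof (cases "integrable lborel ?X")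
  case True
  then show ?thesis using iD I0 by simp
 next
  case False
  then have n: "\<not> integrable lborel (%ksi. ?X ksi + D ksi)"
   using Bochner_Integration.integrable_diff[OF _ iD, of "%ksi. ?X ksi + D ksi"] by auto
  show ?thesis by (simp only: not_integrable_integral_eq[OF n] not_integrable_integral_eq[OF False])
 qed
 then show ?thesis unfolding set_lebesgue_integral_def set' eq by (simp add: h_def)
qed


theorem mainTheorem5:
  fixes atl :: "('p::t2_space, 'n::finite) chart set"
    and A :: "('p, 'n, 'm::finite) column \<Rightarrow> ('p, 'n, 'm) column"
    and R :: "'p \<Rightarrow> complex^'m^'m"
  assumes "compact (UNIV :: 'p set)" and "connected (UNIV :: 'p set)"
    and "smooth_structure atl"
    and "CARD('n) \<ge> 2" and "CARD('m) \<ge> 2"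
    and "classical_psido atl A" and "elliptic atl A" and "formally_self_adjoint atl A"
    and "\<And>\<kappa> x \<xi>. \<kappa> \<in> atl \<Longrightarrow> x \<in> coords \<kappa> \<Longrightarrow> \<xi> \<noteq> 0 \<Longrightarrow>
           \<not> is_eigenvalue (principal_symbol atl A \<kappa> x \<xi>) 0 \<and>
           simple_spectrum (principal_symbol atl A \<kappa> x \<xi>) \<and>
           positive_eigenvalues (principal_symbol atl A \<kappa> x \<xi>) \<noteq> {}"
    and "smooth_on_manifold atl R"
    and "\<And>p. hconj (R p) ** R p = mat 1"
  shows "\<forall>\<kappa>\<in>atl. \<forall>p\<in>fst \<kappa>.
           density_a atl (conjugated R A) \<kappa> p = density_a atl A \<kappa> p \<and>
           density_b atl (conjugated R A) \<kappa> p = density_b atl A \<kappa> p"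
proof (intro ballI)
 fix kap p assume kap: "kap \<in> atl" and p: "p \<in> fst kap"
 let ?a = "principal_symbol atl A kap" and ?a' = "principal_symbol atl (conjugated R A) kap" and ?x = "snd kap p"
 let ?s = "subprincipal_symbol atl A kap" and ?s' = "subprincipal_symbol atl (conjugated R A) kap" and ?Q = "R \<circ> point kap"
 have x: "?x \<in> coords kap" using p by (simp add: coords_def)
 have U: "open (coords kap)" by (rule chart_open[OF smooth_structure_chart[OF assms(3) kap]])
 have Q: "smooth_on (coords kap) ?Q" "\<And>y. hconj (?Q y) ** ?Q y = mat 1"
  using assms(10,11) kap by (simp_all add: smooth_on_manifold_def)
 have hs: "herm_simple (?a y eta) \<and> \<not> is_eigenvalue (?a y eta) 0" if "y \<in> coords kap" "eta \<noteq> 0" for y eta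
  using principal_symbol_hermitian[OF assms(1,3,6,8) kap that] assms(9)[OF kap that] by (simp add: herm_simple_def)
 have hom: "?a ?x (t *\<^sub>R ksi) = t *\<^sub>R ?a ?x ksi" if "t > 0" "ksi \<noteq> 0" for t ksi
  by (rule principal_symbol_homogeneous[OF assms(6) kap x that(2,1)])
 note a' = conjugated_symbols(1)[OF assms(3,6,10) kap] and s' = conjugated_symbols(2)[OF assms(3,6,10) kap x]
 have pe: "positive_eigenvalues (?a' ?x ksi) = positive_eigenvalues (?a ?x ksi)" if "ksi \<noteq> 0" for ksi
  unfolding a'[OF x that] by (rule eigenvalues_conjugate(1)[OF Q(2)])
 \<comment> \<open>Only eigenvalues at nonzero covectors enter \<open>m_plus\<close>, and there they
   are the same for both operators.\<close>
 have mp: "m_plus ?a' ?x = m_plus ?a ?x" unfolding m_plus_def by (simp add: pe cong: imp_cong)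
 have set: "{ksi. ksi \<noteq> 0 \<and> eigenvalue_no j (?a' ?x ksi) < 1} = {ksi. ksi \<noteq> 0 \<and> eigenvalue_no j (?a ?x ksi) < 1}" for j
  using pe by (auto simp: eigenvalue_no_def)
 have "density_a atl (conjugated R A) kap p = density_a atl A kap p"
  by (simp add: density_a_def Let_def mp set)
 moreover have "density_b atl (conjugated R A) kap p = density_b atl A kap p"
  unfolding density_b_def Let_def mp
  by (intro arg_cong[where f = "%z. - of_nat CARD('n) * z"] sum.cong refl
    b_integral_conjugate[where U = "coords kap" and x = ?x and a = ?a and a' = ?a' and s = ?s and s' = ?s' and Q = ?Q,
     OF assms(4) U x principal_symbol_smooth[OF assms(6) kap] hom hs Q a' s'])
 ultimately show "density_a atl (conjugated R A) kap p = density_a atl A kap p \<and> density_b atl (conjugated R A) kap p = density_b atl A kap p" ..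
qed

end
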